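(* Let $d\ge 1$ and let $n:\mathbb{R}^d\times\mathbb{R}^d\to(0,\infty)$ (Borel measurable) and $\alpha:\mathbb{R}^d\to(0,2)$ satisfy: (a) for all $x,h\in\mathbb{R}^d$, $n(x,h)=n(x,-h)$ and $0<\kappa_1\le n(x,h)\le\kappa_2<\infty$, where $\kappa_1,\kappa_2$ are constants; (b) $\int_0^1 r^{-1}\psi(r)\,\mathrm{d}r<\infty$, where $\psi(r):=\sup_{h\in\mathbb{R}^d,\,|x-y|\le r}|n(x,h)-n(y,h)|$; (c) for all $x\in\mathbb{R}^d$, $0<\underline{\alpha}\le\alpha(x)\le\overline{\alpha}<2$, where $\underline{\alpha},\overline{\alpha}$ are constants; (d) $\beta(r)=o(|\ln r|^{-1})$ as $r\to0$ and $\int_0^1 r^{-1}|\ln r|\beta(r)\,\mathrm{d}r<\infty$, where $\beta(r):=\sup_{|x-y|\le r}|\alpha(x)-\alpha(y)|$. Define $$\mathcal{A}f(x)=\int_{\mathbb{R}^d\setminus\{0\}}\left[f(x+h)-f(x)-\mathbf{1}_{\{|h|\le1\}}h\cdot\nabla f(x)\right]\frac{n(x,h)}{|h|^{d+\alpha(x)}}\,\mathrm{d}h .$$ Then for each $x\in\mathbb{R}^d$, the martingale problem for the operator $\mathcal{A}$ starting from $x$ has at most one solution.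
   Context: Let $D=D([0,\infty);\mathbb{R}^d)$ be the set of right-continuous paths with left limits in $\mathbb{R}^d$, endowed with the Skorokhod topology. Set $X_t(\omega)=\omega(t)$ for $\omega\in D$, $\mathcal{D}=\sigma(X_t:0\le t<\infty)$ and $\mathcal{F}_t=\sigma(X_r:0\le r\le t)$. A probability measure $\mathbf{P}$ on $(D,\mathcal{D})$ is a solution to the martingale problem for $\mathcal{A}$ starting from $x\in\mathbb{R}^d$ if $\mathbf{P}(X_0=x)=1$ and, under $\mathbf{P}$, the process $f(X_t)-\int_0^t\mathcal{A}f(X_u)\,\mathrm{d}u$, $t\ge0$, is an $(\mathcal{F}_t)$-martingale for every $f\in C_b^2(\mathbb{R}^d)$ (functions that are bounded and continuous together with their partial derivatives up to order two). *)

theory Defs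
  imports "HOL-Probability.Probability" "HOL-Library.Landau_Symbols"
begin

definition partial_deriv :: "'a::euclidean_space \<Rightarrow> ('a \<Rightarrow> real) \<Rightarrow> 'a \<Rightarrow> real" where
  "partial_deriv b f x = deriv (\<lambda>t. f (x + t *\<^sub>R b)) 0"

definition has_partial_deriv :: "'a::euclidean_space \<Rightarrow> ('a \<Rightarrow> real) \<Rightarrow> bool" where
  "has_partial_deriv b f \<longleftrightarrow> (\<forall>x. (\<lambda>t. f (x + t *\<^sub>R b)) differentiable (at 0))"

definition gradient :: "('a::euclidean_space \<Rightarrow> real) \<Rightarrow> 'a \<Rightarrow> 'a" where
  "gradient f x = (\<Sum>b\<in>Basis. partial_deriv b f x *\<^sub>R b)"

text \<open>\<open>Cb k f\<close>: \<open>f\<close> is bounded and continuous together with its partial derivatives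
  up to order \<open>k\<close>.\<close>

primrec Cb :: "nat \<Rightarrow> ('a::euclidean_space \<Rightarrow> real) \<Rightarrow> bool" where
  "Cb 0 f \<longleftrightarrow> continuous_on UNIV f \<and> bounded (range f)"
| "Cb (Suc k) f \<longleftrightarrow> continuous_on UNIV f \<and> bounded (range f) \<and>
     (\<forall>b\<in>Basis. has_partial_deriv b f \<and> Cb k (partial_deriv b f))"

text \<open>Paths have time domain \<open>[0,\<infinity>)\<close>. They are represented as functions on all of \<open>real\<close>
  that take the value \<open>undefined\<close> at negative times, so that two paths are equal as soon as
  they agree on \<open>[0,\<infinity>)\<close>.\<close>

definition cadlag_paths :: "(real \<Rightarrow> 'a::euclidean_space) set" where
  "cadlag_paths = {\<omega> \<in> extensional {0..}.
     (\<forall>t\<ge>0. (\<omega> \<longlongrightarrow> \<omega> t) (at_right t)) \<and> (\<forall>t>0. \<exists>l. (\<omega> \<longlongrightarrow> l) (at_left t))}"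

text \<open>\<open>coord_algebra T\<close> is \<open>\<sigma>(X\<^sub>r : r \<in> T)\<close> for the coordinate process \<open>X\<^sub>r(\<omega>) = \<omega>(r)\<close>.
  Only the measurable space matters; the measure carried by \<open>sigma\<close> is zero.\<close>

definition coord_algebra :: "real set \<Rightarrow> (real \<Rightarrow> 'a::euclidean_space) measure" where
  "coord_algebra T = sigma cadlag_paths
     (\<Union>r\<in>T. {(\<lambda>\<omega>. \<omega> r) -` B \<inter> cadlag_paths |B. B \<in> sets borel})"

definition path_algebra :: "(real \<Rightarrow> 'a::euclidean_space) measure" where
  "path_algebra = coord_algebra {0..}"

definition path_filtration :: "real \<Rightarrow> (real \<Rightarrow> 'a::euclidean_space) measure" where
  "path_filtration t = coord_algebra {0..t}"

definition martingale ::
    "'w measure \<Rightarrow> (real \<Rightarrow> 'w measure) \<Rightarrow> (real \<Rightarrow> 'w \<Rightarrow> real) \<Rightarrow> bool" where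
  "martingale P F M \<longleftrightarrow>
     (\<forall>t\<ge>0. subalgebra P (F t) \<and> M t \<in> borel_measurable (F t) \<and> integrable P (M t)) \<and>
     (\<forall>s t. 0 \<le> s \<and> s \<le> t \<longrightarrow> (AE \<omega> in P. real_cond_exp P (F s) (M t) \<omega> = M s \<omega>))"

definition solves_martingale_problem ::
    "(('a::euclidean_space \<Rightarrow> real) \<Rightarrow> 'a \<Rightarrow> real) \<Rightarrow> 'a \<Rightarrow> (real \<Rightarrow> 'a) measure \<Rightarrow> bool" where
  "solves_martingale_problem A x P \<longleftrightarrow>
     prob_space P \<and> sets P = sets path_algebra \<and>
     measure P {\<omega> \<in> space P. \<omega> 0 = x} = 1 \<and>
     (\<forall>f. Cb 2 f \<longrightarrow>
        martingale P path_filtration (\<lambda>t \<omega>. f (\<omega> t) - (LINT u:{0..t}|lborel. A f (\<omega> u))))"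

definition stable_like_operator ::
    "('a::euclidean_space \<Rightarrow> 'a \<Rightarrow> real) \<Rightarrow> ('a \<Rightarrow> real) \<Rightarrow> ('a \<Rightarrow> real) \<Rightarrow> 'a \<Rightarrow> real" where
  "stable_like_operator n \<alpha> f x =
     (LINT h:-{0}|lborel.
        (f (x + h) - f x - indicator {h. norm h \<le> 1} h * (h \<bullet> gradient f x))
          * (n x h / norm h powr (real DIM('a) + \<alpha> x)))"

text \<open>The suprema below are taken in \<open>real\<close> and are meaningful for \<open>r \<ge> 0\<close> and bounded
  \<open>n\<close> and \<open>\<alpha>\<close>.\<close>

definition modulus_kernel :: "('a::euclidean_space \<Rightarrow> 'a \<Rightarrow> real) \<Rightarrow> real \<Rightarrow> real" where
  "modulus_kernel n r = (SUP (x, y, h)\<in>{(x, y, h). norm (x - y) \<le> r}. \<bar>n x h - n y h\<bar>)"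

definition modulus_index :: "('a::euclidean_space \<Rightarrow> real) \<Rightarrow> real \<Rightarrow> real" where
  "modulus_index \<alpha> r = (SUP (x, y)\<in>{(x, y). norm (x - y) \<le> r}. \<bar>\<alpha> x - \<alpha> y\<bar>)"

end

theory Submission
  imports Defs
begin

text \<open>Freezing the coefficients at a point \<open>z\<close> turns \<open>A\<close> into a convolution operator \<open>B z\<close>, and all these
  operators commute. Since \<open>n \<ge> \<kappa>1\<close>, the semigroup \<open>P z t = exp (t B z)\<close> regularises differences at the scale
  \<open>t\<^sup>1\<^sup>/\<^sup>\<alpha>\<close> in the supremum norm, with constants that do not depend on \<open>z\<close>; this needs neither the Fourier transform
  nor a heat kernel. Commutativity and Duhamel's formula then bound \<open>P z t - P x t\<close>, for \<open>|x - z|\<close> of order \<open>2\<^sup>-\<^sup>k\<close> and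
  \<open>t\<close> of order \<open>4\<^sup>-\<^sup>k\<close>, by a sequence that is summable by the Dini conditions.

  For such \<open>t\<close> the average of \<open>P z t g x\<close> over the \<open>z\<close> at distance \<open>2\<^sup>-\<^sup>k\<close> from \<open>x\<close> solves \<open>\<partial>f/\<partial>t = A f\<close> up to an
  error whose integral over the block is the \<open>k\<close>th term of a convergent series, and passing from one block to the next
  costs another such term. If \<open>L\<close> is the difference of two finite measures with \<open>L (lam f - A f) = 0\<close>, then
  \<open>exp (- lam t) L f\<close> is nearly constant in \<open>t\<close>, and for large \<open>lam\<close> this yields \<open>|L g| \<le> \<parallel>L\<parallel> \<parallel>g\<parallel> / 2\<close>, so \<open>L = 0\<close>.

  For two solutions one takes the laws of \<open>X (s + T)\<close> weighted by a product of functions of the path up to time \<open>s\<close>,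
  where \<open>T\<close> is exponentially distributed. Inverting the Laplace transform extends the equality of the
  finite-dimensional distributions by one time point.\<close>

text \<open>The obstacle is that \<open>n x h\<close> has no regularity in \<open>h\<close> and only
  Dini regularity in \<open>x\<close>. Because of the first, kernels are never differentiated in the
  jump variable: the lower bound is used only to fit rescaled bumps under the jump kernel, and the
  remaining jumps act as a commuting contraction. Because of the second, the point of evaluation
  cannot itself serve as freezing point: increments in the freezing point are controlled only by the
  Dini moduli and cannot be integrated against a singular jump kernel. Averaging turns this
  dependence into that of a smooth weight. Radius \<open>2^-k\<close> goes with time
  \<open>4^-k\<close> because every index is below 2: the smoothing scale, of order
  \<open>t^(1/\<alpha>)\<close>, is then smaller than the radius by a factor geometric in
  \<open>k\<close>. Cutting off jumps below \<open>2^-J\<close> keeps all generators bounded. The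
  errors of a block do not depend on \<open>J\<close>; constants that deteriorate as the number of
  blocks grows are harmless because \<open>J\<close> tends to infinity before that number
  does.\<close>

text \<open>The type of bounded linear operators carries no algebra structure; the copy below is a Banach algebra,
  so that \<open>exp\<close> is available.\<close>

typedef (overloaded) ('a::euclidean_space) cop = "UNIV :: (('a \<Rightarrow>\<^sub>C real) \<Rightarrow>\<^sub>L ('a \<Rightarrow>\<^sub>C real)) set"
  morphisms cop_blinfun Cop by simp

setup_lifting type_definition_cop

definition cop_apply :: "'a::euclidean_space cop \<Rightarrow> ('a \<Rightarrow>\<^sub>C real) \<Rightarrow> ('a \<Rightarrow>\<^sub>C real)" (infixr \<open>\<bullet>\<^sub>o\<close> 75)
  where "cop_apply A g = blinfun_apply (cop_blinfun A) g"

lemma norm_id_blinfun_bcontfun: "norm (id_blinfun :: ('a::euclidean_space \<Rightarrow>\<^sub>C real) \<Rightarrow>\<^sub>L ('a \<Rightarrow>\<^sub>C real)) = 1"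
proof (rule antisym)
  show "norm (id_blinfun :: ('a \<Rightarrow>\<^sub>C real) \<Rightarrow>\<^sub>L ('a \<Rightarrow>\<^sub>C real)) \<le> 1"
    by (rule norm_blinfun_bound) auto
  let ?c = "const_bcontfun 1 :: 'a \<Rightarrow>\<^sub>C real"
  have c: "norm ?c > 0"
    using norm_bounded[of ?c 0] by (simp only: const_bcontfun.rep_eq norm_one)
  have "norm ?c \<le> norm (id_blinfun :: ('a \<Rightarrow>\<^sub>C real) \<Rightarrow>\<^sub>L _) * norm ?c"
    using norm_blinfun[of id_blinfun ?c] by simp
  then show "1 \<le> norm (id_blinfun :: ('a \<Rightarrow>\<^sub>C real) \<Rightarrow>\<^sub>L ('a \<Rightarrow>\<^sub>C real))"
    using c by (simp add: mult_le_cancel_right1)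
qed

instantiation cop :: (euclidean_space) real_vector
begin
lift_definition zero_cop :: "'a cop" is 0 .
lift_definition plus_cop :: "'a cop \<Rightarrow> 'a cop \<Rightarrow> 'a cop" is "(+)" .
lift_definition minus_cop :: "'a cop \<Rightarrow> 'a cop \<Rightarrow> 'a cop" is "(-)" .
lift_definition uminus_cop :: "'a cop \<Rightarrow> 'a cop" is "uminus" .
lift_definition scaleR_cop :: "real \<Rightarrow> 'a cop \<Rightarrow> 'a cop" is "(*\<^sub>R)" .
instance
  by standard (transfer, simp add: algebra_simps)+
end

instantiation cop :: (euclidean_space) real_normed_algebra_1
begin
lift_definition one_cop :: "'a cop" is id_blinfun .
lift_definition times_cop :: "'a cop \<Rightarrow> 'a cop \<Rightarrow> 'a cop" is "(o\<^sub>L)" .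
lift_definition norm_cop :: "'a cop \<Rightarrow> real" is norm .
lift_definition dist_cop :: "'a cop \<Rightarrow> 'a cop \<Rightarrow> real" is dist .
definition sgn_cop :: "'a cop \<Rightarrow> 'a cop" where "sgn_cop x = x /\<^sub>R norm x"
definition uniformity_cop :: "('a cop \<times> 'a cop) filter"
  where "uniformity_cop = (INF e\<in>{0 <..}. principal {(x, y). dist x y < e})"
definition open_cop :: "'a cop set \<Rightarrow> bool"
  where "open_cop S = (\<forall>x\<in>S. \<forall>\<^sub>F (x', y) in uniformity. x' = x \<longrightarrow> y \<in> S)"
instance
proof
  fix a b c :: "'a cop" and r s :: real
  show "a * b * c = a * (b * c)" by transfer (rule blinfun_eqI, simp)
  show "(a + b) * c = a * c + b * c" by transfer (rule blinfun_eqI, simp add: blinfun.bilinear_simps)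
  show "a * (b + c) = a * b + a * c" by transfer (rule blinfun_eqI, simp add: blinfun.bilinear_simps)
  show "1 * a = a" by transfer (rule blinfun_eqI, simp)
  show "a * 1 = a" by transfer (rule blinfun_eqI, simp)
  show "r *\<^sub>R a * b = r *\<^sub>R (a * b)" by transfer (rule blinfun_eqI, simp add: blinfun.bilinear_simps)
  show "a * r *\<^sub>R b = r *\<^sub>R (a * b)" by transfer (rule blinfun_eqI, simp add: blinfun.bilinear_simps)
  show "dist a b = norm (a - b)" by transfer (rule dist_norm)
  show "norm a = 0 \<longleftrightarrow> a = 0" by transfer simp
  show "norm (a + b) \<le> norm a + norm b" by transfer (rule norm_triangle_ineq)
  show "norm (r *\<^sub>R a) = \<bar>r\<bar> * norm a" by transfer simp
  show "norm (a * b) \<le> norm a * norm b" by transfer (rule norm_blinfun_compose)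
  show "norm (1 :: 'a cop) = 1" by transfer (rule norm_id_blinfun_bcontfun)
  show "(0 :: 'a cop) \<noteq> 1"
  proof
    assume "(0 :: 'a cop) = 1"
    then have "(0 :: ('a \<Rightarrow>\<^sub>C real) \<Rightarrow>\<^sub>L ('a \<Rightarrow>\<^sub>C real)) = id_blinfun" by transfer
    then show False using norm_id_blinfun_bcontfun[where 'a='a] by simp
  qed
qed (rule sgn_cop_def uniformity_cop_def open_cop_def)+
end

instance bcontfun :: (metric_space, banach) banach ..

instance cop :: (euclidean_space) banach
proof
  fix X :: "nat \<Rightarrow> 'a cop" assume "Cauchy X"
  then have "Cauchy (\<lambda>n. cop_blinfun (X n))"
    by (auto simp: Cauchy_def dist_cop.rep_eq)
  then obtain l where "(\<lambda>n. cop_blinfun (X n)) \<longlonglongrightarrow> l"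
    using Cauchy_convergent convergent_def by blast
  then have "X \<longlonglongrightarrow> Cop l"
    by (simp add: tendsto_iff dist_cop.rep_eq Cop_inverse)
  then show "convergent X" by (rule convergentI)
qed

lemma cop_eqI: "(\<And>g. A \<bullet>\<^sub>o g = B \<bullet>\<^sub>o g) \<Longrightarrow> A = B"
  unfolding cop_apply_def by (metis blinfun_eqI cop_blinfun_inject)

lemma cop_simps [simp]:
  "(A * B) \<bullet>\<^sub>o g = A \<bullet>\<^sub>o B \<bullet>\<^sub>o g" "1 \<bullet>\<^sub>o g = g"
  by (simp_all add: cop_apply_def times_cop.rep_eq one_cop.rep_eq)

lemma norm_cop_apply: "norm (A \<bullet>\<^sub>o g) \<le> norm A * norm g"
  by (simp add: cop_apply_def norm_cop.rep_eq norm_blinfun)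

lemma norm_cop_bound: "(\<And>g. norm (A \<bullet>\<^sub>o g) \<le> c * norm g) \<Longrightarrow> 0 \<le> c \<Longrightarrow> norm A \<le> c"
  by (simp add: cop_apply_def norm_cop.rep_eq norm_blinfun_bound)

lemma bounded_bilinear_cop_apply: "bounded_bilinear cop_apply"
proof (rule bounded_bilinear.intro)
  fix a a' :: "'a cop" and b b' :: "'a \<Rightarrow>\<^sub>C real" and r :: real
  show "(a + a') \<bullet>\<^sub>o b = a \<bullet>\<^sub>o b + a' \<bullet>\<^sub>o b"
    unfolding cop_apply_def plus_cop.rep_eq by (rule blinfun.add_left)
  show "a \<bullet>\<^sub>o (b + b') = a \<bullet>\<^sub>o b + a \<bullet>\<^sub>o b'"
    unfolding cop_apply_def by (rule blinfun.add_right)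
  show "(r *\<^sub>R a) \<bullet>\<^sub>o b = r *\<^sub>R (a \<bullet>\<^sub>o b)"
    unfolding cop_apply_def scaleR_cop.rep_eq by (rule blinfun.scaleR_left)
  show "a \<bullet>\<^sub>o (r *\<^sub>R b) = r *\<^sub>R (a \<bullet>\<^sub>o b)"
    unfolding cop_apply_def by (rule blinfun.scaleR_right)
next
  have "norm ((a :: 'a cop) \<bullet>\<^sub>o b) \<le> norm a * norm b * 1" for a b
    using norm_cop_apply[of a b] by simp
  then show "\<exists>K. \<forall>a b. norm ((a :: 'a cop) \<bullet>\<^sub>o b) \<le> norm a * norm b * K"
    by blast
qed

interpretation cop_apply: bounded_bilinear cop_apply
  by (rule bounded_bilinear_cop_apply)

definition cop_of :: "(('a::euclidean_space \<Rightarrow>\<^sub>C real) \<Rightarrow> ('a \<Rightarrow>\<^sub>C real)) \<Rightarrow> 'a cop"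
  where "cop_of T = Cop (Blinfun T)"

lemma cop_of_apply: "bounded_linear T \<Longrightarrow> cop_of T \<bullet>\<^sub>o g = T g"
  by (simp add: cop_of_def cop_apply_def Cop_inverse bounded_linear_Blinfun_apply)

section \<open>Convolution and translation operators on bounded continuous functions\<close>

lemma lborel_distr_reflect_shift:
  fixes t :: "'a::euclidean_space"
  assumes "c = 1 \<or> c = -1"
  shows "distr lborel borel (\<lambda>x. t + c *\<^sub>R x) = lborel"
  using lborel_affine[of c t] assms by (auto simp: density_1)

lemma
  fixes f :: "'a::euclidean_space \<Rightarrow> real"
  assumes f: "f \<in> borel_measurable borel" and c: "c = 1 \<or> c = -1"
  shows integral_lborel_reflect_shift: "(\<integral>x. f (t + c *\<^sub>R x) \<partial>lborel) = (\<integral>x. f x \<partial>lborel)"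
    and integrable_lborel_reflect_shift: "integrable lborel f \<Longrightarrow> integrable lborel (\<lambda>x. f (t + c *\<^sub>R x))"
proof -
  have T: "(\<lambda>x. t + c *\<^sub>R x) \<in> measurable lborel borel" by measurable
  show "(\<integral>x. f (t + c *\<^sub>R x) \<partial>lborel) = (\<integral>x. f x \<partial>lborel)"
    using integral_distr[OF T f] by (simp add: lborel_distr_reflect_shift[OF c])
  show "integrable lborel f \<Longrightarrow> integrable lborel (\<lambda>x. f (t + c *\<^sub>R x))"
    using integrable_distr_eq[OF T f] by (simp add: lborel_distr_reflect_shift[OF c])
qed

lemma integrable_lborel_measurable: "integrable lborel f \<Longrightarrow> f \<in> borel_measurable borel"
  using borel_measurable_integrable by fastforce

lemma measurable_bcontfun [measurable]:
  "apply_bcontfun (g :: 'a::euclidean_space \<Rightarrow>\<^sub>C real) \<in> borel_measurable borel"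
  by (intro borel_measurable_continuous_onI) simp

lemma abs_bcontfun_le: "\<bar>apply_bcontfun g x\<bar> \<le> norm g" for g :: "'a::topological_space \<Rightarrow>\<^sub>C real"
  using norm_bounded[of g x] by simp

lemma tendsto_bcontfun: "(f \<longlongrightarrow> l) F \<Longrightarrow> ((\<lambda>i. apply_bcontfun g (f i)) \<longlongrightarrow> apply_bcontfun g l) F"
  by (rule continuous_on_tendsto_compose[OF continuous_on_apply_bcontfun[of UNIV g]]) auto

lemma integrable_bcontfun_mult:
  fixes g :: "'a::euclidean_space \<Rightarrow>\<^sub>C real"
  assumes [measurable]: "T \<in> borel_measurable borel" and q: "integrable lborel q"
  shows "integrable lborel (\<lambda>h. apply_bcontfun g (T h) * q h)"
proof (rule Bochner_Integration.integrable_bound[where f="\<lambda>h. norm g * \<bar>q h\<bar>"])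
  show "integrable lborel (\<lambda>h. norm g * \<bar>q h\<bar>)" using q by simp
  show "(\<lambda>h. apply_bcontfun g (T h) * q h) \<in> borel_measurable lborel"
    using borel_measurable_integrable[OF q] by measurable
qed (auto simp: abs_mult intro!: mult_right_mono abs_bcontfun_le)

text \<open>This is convolution with the reflection of \<open>q\<close>: in the application
  \<open>q\<close> is a density of jumps \<open>h\<close>, and the operator averages over the
  endpoint \<open>x + h\<close>.\<close>

definition conv_fun :: "('a::euclidean_space \<Rightarrow> real) \<Rightarrow> ('a \<Rightarrow>\<^sub>C real) \<Rightarrow> 'a \<Rightarrow> real"
  where "conv_fun q g x = (\<integral>h. g (x + h) * q h \<partial>lborel)"

definition conv :: "('a::euclidean_space \<Rightarrow> real) \<Rightarrow> 'a cop"
  where "conv q = cop_of (\<lambda>g. Bcontfun (conv_fun q g))"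

definition shift :: "'a::euclidean_space \<Rightarrow> 'a cop"
  where "shift a = cop_of (\<lambda>g. Bcontfun (\<lambda>x. g (x + a)))"

lemma abs_conv_fun_le:
  assumes q: "integrable lborel q"
  shows "\<bar>conv_fun q g x\<bar> \<le> (\<integral>h. \<bar>q h\<bar> \<partial>lborel) * norm g"
proof -
  have "\<bar>conv_fun q g x\<bar> \<le> (\<integral>h. \<bar>g (x + h) * q h\<bar> \<partial>lborel)"
    unfolding conv_fun_def by (rule integral_abs_bound)
  also have "\<dots> \<le> (\<integral>h. norm g * \<bar>q h\<bar> \<partial>lborel)"
    using q by (intro integral_mono integrable_abs integrable_bcontfun_mult)
      (auto simp: abs_mult intro!: mult_right_mono abs_bcontfun_le)
  finally show ?thesis by (simp add: mult.commute)
qed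

lemma conv_fun_bcontfun:
  assumes q: "integrable lborel q"
  shows "conv_fun q g \<in> bcontfun"
proof (rule bcontfun_normI)
  show "norm (conv_fun q g x) \<le> (\<integral>h. \<bar>q h\<bar> \<partial>lborel) * norm g" for x
    using abs_conv_fun_le[OF q] by simp
  show "continuous_on UNIV (conv_fun q g)"
    unfolding continuous_on_sequentially
  proof (safe, unfold comp_def)
    fix u :: "nat \<Rightarrow> 'a" and a assume "u \<longlonglongrightarrow> a"
    then show "(\<lambda>n. conv_fun q g (u n)) \<longlonglongrightarrow> conv_fun q g a"
      unfolding conv_fun_def using q borel_measurable_integrable[OF q]
      by (intro integral_dominated_convergence[where w="\<lambda>h. norm g * \<bar>q h\<bar>"] AE_I2)
        (auto simp: abs_mult intro!: mult_right_mono abs_bcontfun_le tendsto_intros tendsto_bcontfun)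
  qed
qed

lemma conv_apply:
  assumes q: "integrable lborel q"
  shows "apply_bcontfun (conv q \<bullet>\<^sub>o g) x = (\<integral>h. g (x + h) * q h \<partial>lborel)"
proof -
  have B: "apply_bcontfun (Bcontfun (conv_fun q g)) = conv_fun q g" for g
    using conv_fun_bcontfun[OF q] by (rule Bcontfun_inverse)
  have int: "integrable lborel (\<lambda>h. apply_bcontfun g (x + h) * q h)" for x g
    using q by (intro integrable_bcontfun_mult) auto
  have "bounded_linear (\<lambda>g. Bcontfun (conv_fun q g))"
  proof (rule bounded_linear_intro[where K="\<integral>h. \<bar>q h\<bar> \<partial>lborel"])
    show "norm (Bcontfun (conv_fun q g)) \<le> norm g * (\<integral>h. \<bar>q h\<bar> \<partial>lborel)" for g
      using abs_conv_fun_le[OF q] by (intro norm_bound) (simp add: B mult.commute)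
  qed (auto intro!: bcontfun_eqI simp: B conv_fun_def int distrib_right mult.assoc)
  then show ?thesis
    by (simp add: conv_def cop_of_apply B conv_fun_def)
qed

lemma shift_apply [simp]: "apply_bcontfun (shift a \<bullet>\<^sub>o g) x = g (x + a)"
proof -
  have c: "(\<lambda>x. apply_bcontfun g (x + a)) \<in> bcontfun" for g :: "'a \<Rightarrow>\<^sub>C real"
  proof (rule bcontfun_normI)
    show "continuous_on UNIV (\<lambda>x. g (x + a))"
      by (rule continuous_on_compose2[OF continuous_on_apply_bcontfun[of UNIV]])
        (auto intro!: continuous_on_add continuous_on_id continuous_on_const)
  qed (rule norm_bounded)
  have B: "apply_bcontfun (Bcontfun (\<lambda>x. apply_bcontfun g (x + a))) y = g (y + a)"
    for g :: "'a \<Rightarrow>\<^sub>C real" and y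
    using Bcontfun_inverse[OF c[of g]] by simp
  have "bounded_linear (\<lambda>g :: 'a \<Rightarrow>\<^sub>C real. Bcontfun (\<lambda>x. apply_bcontfun g (x + a)))"
  proof (rule bounded_linear_intro[where K=1])
    show "norm (Bcontfun (\<lambda>x. apply_bcontfun g (x + a))) \<le> norm g * 1"
      for g :: "'a \<Rightarrow>\<^sub>C real"
      by (rule norm_bound) (simp add: B abs_bcontfun_le)
    show "Bcontfun (\<lambda>x. (g + g') (x + a)) = Bcontfun (\<lambda>x. g (x + a)) + Bcontfun (\<lambda>x. g' (x + a))"
      for g g' :: "'a \<Rightarrow>\<^sub>C real"
      by (rule bcontfun_eqI) (simp only: B, simp only: plus_bcontfun.rep_eq B)
    show "Bcontfun (\<lambda>x. (r *\<^sub>R g) (x + a)) = r *\<^sub>R Bcontfun (\<lambda>x. g (x + a))"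
      for g :: "'a \<Rightarrow>\<^sub>C real" and r
      by (rule bcontfun_eqI) (simp only: B, simp only: scaleR_bcontfun.rep_eq B)
  qed
  then show ?thesis
    by (simp only: shift_def cop_of_apply B)
qed

lemma norm_shift: "norm (shift a) \<le> 1"
  by (rule norm_cop_bound) (auto intro!: norm_bound simp: abs_bcontfun_le)

lemma shift_mult: "shift a * shift b = shift (a + b)"
  by (rule cop_eqI, rule bcontfun_eqI) (simp add: add_ac)

lemma shift_0: "shift 0 = 1"
  by (rule cop_eqI, rule bcontfun_eqI) simp

lemma norm_conv:
  assumes q: "integrable lborel q"
  shows "norm (conv q) \<le> (\<integral>h. \<bar>q h\<bar> \<partial>lborel)"
  using abs_conv_fun_le[OF q]
  by (intro norm_cop_bound norm_bound) (auto simp: conv_apply[OF q] conv_fun_def)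

lemma conv_shift_commute:
  assumes q: "integrable lborel q"
  shows "conv q * shift a = shift a * conv q"
  by (rule cop_eqI, rule bcontfun_eqI) (simp add: conv_apply[OF q] add_ac)

lemma conv_add:
  assumes "integrable lborel p" "integrable lborel q"
  shows "conv (\<lambda>h. p h + q h) = conv p + conv q"
  using assms
  by (intro cop_eqI bcontfun_eqI)
    (simp add: conv_apply cop_apply.add_left distrib_left integrable_bcontfun_mult)

lemma conv_diff:
  assumes "integrable lborel p" "integrable lborel q"
  shows "conv (\<lambda>h. p h - q h) = conv p - conv q"
  using assms
  by (intro cop_eqI bcontfun_eqI)
    (simp add: conv_apply cop_apply.diff_left right_diff_distrib integrable_bcontfun_mult)

lemma conv_cmult:
  assumes "integrable lborel p"
  shows "conv (\<lambda>h. c * p h) = c *\<^sub>R conv p"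
  using assms
  by (intro cop_eqI bcontfun_eqI)
    (simp add: conv_apply cop_apply.scaleR_left mult.left_commute[of _ c])

lemma integrable_pair_mult:
  fixes p :: "'a::euclidean_space \<Rightarrow> real" and q :: "'b::euclidean_space \<Rightarrow> real"
  assumes p: "integrable lborel p" and q: "integrable lborel q"
  shows "integrable (lborel \<Otimes>\<^sub>M lborel) (\<lambda>(x, y). p x * q y)"
proof (rule lborel_pair.Fubini_integrable)
  have [measurable]: "p \<in> borel_measurable borel" "q \<in> borel_measurable borel"
    using p q by (auto dest: integrable_lborel_measurable)
  show "(\<lambda>(x, y). p x * q y) \<in> borel_measurable (lborel \<Otimes>\<^sub>M lborel)"
    by measurable
  show "integrable lborel (\<lambda>x. \<integral>y. norm (case (x, y) of (x, y) \<Rightarrow> p x * q y) \<partial>lborel)"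
    using p by (simp add: abs_mult)
  show "AE x in lborel. integrable lborel (\<lambda>y. case (x, y) of (x, y) \<Rightarrow> p x * q y)"
    using q by simp
qed

text \<open>Fubini: both orders integrate \<open>g (x + h + k)\<close> against the product of the
  two densities. The comparison of different freezing points rests on this.\<close>

lemma conv_commute:
  fixes p q :: "'a::euclidean_space \<Rightarrow> real"
  assumes p: "integrable lborel p" and q: "integrable lborel q"
  shows "conv p * conv q = conv q * conv p"
proof (intro cop_eqI bcontfun_eqI)
  fix g :: "'a \<Rightarrow>\<^sub>C real" and x
  have [measurable]: "p \<in> borel_measurable borel" "q \<in> borel_measurable borel"
    using p q by (auto dest: integrable_lborel_measurable)
  have "integrable (lborel \<Otimes>\<^sub>M lborel) (\<lambda>z. norm g * (case z of (h, k) \<Rightarrow> p h * q k))"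
    by (intro integrable_mult_right integrable_pair_mult p q)
  then have I: "integrable (lborel \<Otimes>\<^sub>M lborel) (\<lambda>(h, k). g (x + h + k) * q k * p h)"
  proof (rule Bochner_Integration.integrable_bound)
    show "(\<lambda>(h, k). g (x + h + k) * q k * p h) \<in> borel_measurable (lborel \<Otimes>\<^sub>M lborel)"
      by measurable
    show "AE z in lborel \<Otimes>\<^sub>M lborel. norm (case z of (h, k) \<Rightarrow> g (x + h + k) * q k * p h)
        \<le> norm (norm g * (case z of (h, k) \<Rightarrow> p h * q k))"
    proof (rule AE_I2, clarify)
      fix h k :: 'a
      show "norm (g (x + h + k) * q k * p h) \<le> norm (norm g * (p h * q k))"
        using mult_right_mono[OF abs_bcontfun_le[of g "x + h + k"], of "\<bar>q k\<bar> * \<bar>p h\<bar>"]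
        by (simp add: abs_mult mult_ac)
    qed
  qed
  have "((conv p * conv q) \<bullet>\<^sub>o g) x = (\<integral>h. (\<integral>k. g (x + h + k) * q k * p h \<partial>lborel) \<partial>lborel)"
    by (simp add: conv_apply p q)
  also have "\<dots> = (\<integral>k. (\<integral>h. g (x + h + k) * q k * p h \<partial>lborel) \<partial>lborel)"
    using I by (intro lborel_pair.Fubini_integral[symmetric]) simp
  also have "\<dots> = ((conv q * conv p) \<bullet>\<^sub>o g) x"
  proof -
    have "(\<integral>h. g (x + h + k) * q k * p h \<partial>lborel) = (\<integral>h. g (x + k + h) * p h \<partial>lborel) * q k" for k
      by (subst integral_mult_left_zero[symmetric], rule Bochner_Integration.integral_cong)
        (simp_all add: mult_ac add_ac)
    then show ?thesis by (simp add: conv_apply p q)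
  qed
  finally show "((conv p * conv q) \<bullet>\<^sub>o g) x = ((conv q * conv p) \<bullet>\<^sub>o g) x" .
qed

section \<open>Exponentials in a Banach algebra\<close>

lemma exp_commute:
  fixes A B :: "'b::{real_normed_algebra_1,banach}"
  assumes "A * B = B * A"
  shows "exp A * B = B * exp A"
proof -
  have "A ^ n * B = B * A ^ n" for n
    using power_commuting_commutes[OF assms] by simp
  then show ?thesis
    unfolding exp_def
    by (subst suminf_mult[symmetric, OF summable_exp_generic], subst suminf_mult2[OF summable_exp_generic]) simp
qed

lemma exp_diff_scaleR_1:
  fixes A :: "'b::{real_normed_algebra_1,banach}"
  shows "exp (A - s *\<^sub>R 1) = exp (- s) *\<^sub>R exp A"
proof -
  have "exp (A + (- s) *\<^sub>R 1) = exp A * exp ((- s) *\<^sub>R 1)"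
    by (rule exp_add_commuting) simp
  also have "exp ((- s) *\<^sub>R (1::'b)) = exp (- s) *\<^sub>R 1"
    using exp_of_real[of "-s", where 'a='b] by (simp add: of_real_def)
  finally show ?thesis by simp
qed

text \<open>With \<open>T\<close> the jump part of a generator and \<open>L\<close> its total jump
  rate, this is the contraction property of a jump semigroup, obtained from norms alone: the scalar
  part gains exactly what the exponential series of \<open>T\<close> can lose.\<close>

lemma norm_exp_contraction:
  fixes T :: "'b::{real_normed_algebra_1,banach}"
  assumes "norm T \<le> L" "0 \<le> t"
  shows "norm (exp (t *\<^sub>R (T - L *\<^sub>R 1))) \<le> 1"
proof -
  have "norm (exp (t *\<^sub>R (T - L *\<^sub>R 1))) = exp (- (t * L)) * norm (exp (t *\<^sub>R T))"
    by (simp add: scaleR_diff_right exp_diff_scaleR_1)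
  also have "\<dots> \<le> exp (- (t * L)) * exp (t * norm T)"
    using norm_exp[of "t *\<^sub>R T"] assms by simp
  also have "\<dots> \<le> 1"
    using assms by (simp add: mult_left_mono flip: exp_add)
  finally show ?thesis .
qed

lemma norm_mult_le_1:
  fixes a b :: "'b::real_normed_algebra_1"
  assumes "norm a \<le> 1" "norm b \<le> c" shows "norm (a * b) \<le> c"
proof -
  have "norm (a * b) \<le> norm a * norm b" by (rule norm_mult_ineq)
  also have "\<dots> \<le> 1 * c" using assms by (intro mult_mono) (auto intro: order_trans[OF norm_ge_zero])
  finally show ?thesis by simp
qed

lemma norm_mult_le_1':
  fixes a b :: "'b::real_normed_algebra_1"
  assumes "norm a \<le> c" "norm b \<le> 1" shows "norm (a * b) \<le> c"
proof -
  have "norm (a * b) \<le> norm a * norm b" by (rule norm_mult_ineq)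
  also have "\<dots> \<le> c * 1" using assms by (intro mult_mono) (auto intro: order_trans[OF norm_ge_zero])
  finally show ?thesis by simp
qed

text \<open>The first jump of the compound Poisson semigroup \<open>exp (s (N - 1))\<close> regularises with \<open>N\<close>.\<close>

lemma norm_exp_first_jump:
  fixes D N X :: "'b::{real_normed_algebra_1,banach}"
  assumes N: "norm N \<le> 1" and X: "norm X \<le> 1" and s: "0 \<le> s"
  shows "norm (D * exp (s *\<^sub>R (N - 1)) * X) \<le> exp (- s) * norm (D * X) + (1 - exp (- s)) * norm (D * N)"
proof -
  \<comment> \<open>Every term of the exponential series beyond the zeroth contains a factor
    \<open>N\<close>, which can be placed next to \<open>D\<close>. Bounding the derivative in
    \<open>u\<close> collects these terms at once.\<close>
  have "norm (D * exp (s *\<^sub>R N) - D * exp (0 *\<^sub>R N)) \<le> norm (D * N) * exp s - norm (D * N) * exp 0"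
  proof (cases "s = 0")
    case False
    show ?thesis
    proof (rule differentiable_bound_general[where f'="\<lambda>u. D * (N * exp (u *\<^sub>R N))" and \<phi>'="\<lambda>u. norm (D * N) * exp u"])
      fix u :: real assume u: "0 < u" "u < s"
      show "((\<lambda>u. D * exp (u *\<^sub>R N)) has_vector_derivative D * (N * exp (u *\<^sub>R N))) (at u)"
        by (intro has_vector_derivative_mult_right exp_scaleR_has_vector_derivative_left)
      show "((\<lambda>u. norm (D * N) * exp u) has_vector_derivative norm (D * N) * exp u) (at u)"
        by (auto intro!: derivative_eq_intros simp flip: has_real_derivative_iff_has_vector_derivative)
      have "norm (D * (N * exp (u *\<^sub>R N))) \<le> norm (D * N) * norm (exp (u *\<^sub>R N))"
        by (simp add: norm_mult_ineq flip: mult.assoc)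
      also have "norm (exp (u *\<^sub>R N)) \<le> exp u"
        using norm_exp[of "u *\<^sub>R N"] u N by (intro order_trans[OF norm_exp]) (simp add: mult_left_le)
      finally show "norm (D * (N * exp (u *\<^sub>R N))) \<le> norm (D * N) * exp u"
        by (simp add: mult_left_mono)
    next
      have "continuous_on UNIV (\<lambda>u. D * exp (u *\<^sub>R N))"
        by (intro continuous_at_imp_continuous_on ballI has_vector_derivative_continuous[OF
            has_vector_derivative_mult_right[OF exp_scaleR_has_vector_derivative_left]])
      then show "continuous_on {0..s} (\<lambda>u. D * exp (u *\<^sub>R N))"
        by (rule continuous_on_subset) simp
    qed (use False s in \<open>auto intro!: continuous_intros\<close>)
  qed simp
  then have 1: "norm (D * exp (s *\<^sub>R N) - D) \<le> norm (D * N) * (exp s - 1)"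
    by (simp add: algebra_simps)
  have eq: "D * exp (s *\<^sub>R (N - 1)) * X
      = exp (- s) *\<^sub>R (D * X) + exp (- s) *\<^sub>R ((D * exp (s *\<^sub>R N) - D) * X)"
    by (simp add: scaleR_diff_right exp_diff_scaleR_1 algebra_simps)
  have "norm (D * exp (s *\<^sub>R (N - 1)) * X)
      \<le> exp (- s) * norm (D * X) + exp (- s) * norm ((D * exp (s *\<^sub>R N) - D) * X)"
    unfolding eq by (rule order_trans[OF norm_triangle_ineq]) simp
  also have "norm ((D * exp (s *\<^sub>R N) - D) * X) \<le> norm (D * N) * (exp s - 1)"
    using norm_mult_le_1'[OF 1 X] .
  finally show ?thesis
    by (simp add: eq right_diff_distrib left_diff_distrib mult_left_mono exp_minus field_simps)
qed

text \<open>Duhamel's formula in differential form: for commuting generators the path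
  \<open>\<phi>\<close> from one semigroup to the other has derivative
  \<open>t (A - B) \<phi>\<close>. The hypothesis keeps both semigroups and \<open>Y\<close> in the
  product, so that the smoothing of whichever semigroup has run longer can be used.\<close>

lemma norm_exp_diff_commuting:
  fixes A B Y :: "'b::{real_normed_algebra_1,banach}"
  assumes AB: "A * B = B * A" and t: "0 \<le> t"
    and bound: "\<And>\<theta>. 0 < \<theta> \<Longrightarrow> \<theta> < 1 \<Longrightarrow>
      norm ((A - B) * (exp ((t * \<theta>) *\<^sub>R A) * exp ((t * (1 - \<theta>)) *\<^sub>R B) * Y)) \<le> c"
  shows "norm (exp (t *\<^sub>R A) * Y - exp (t *\<^sub>R B) * Y) \<le> t * c"
proof -
  define \<phi> where "\<phi> \<theta> = exp (\<theta> *\<^sub>R (t *\<^sub>R (A - B))) * (exp (t *\<^sub>R B) * Y)" for \<theta>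
  have \<phi>: "\<phi> \<theta> = exp ((t * \<theta>) *\<^sub>R A) * exp ((t * (1 - \<theta>)) *\<^sub>R B) * Y" for \<theta>
  proof -
    have "exp (\<theta> *\<^sub>R (t *\<^sub>R (A - B))) * exp (t *\<^sub>R B) = exp (\<theta> *\<^sub>R (t *\<^sub>R (A - B)) + t *\<^sub>R B)"
      by (rule exp_add_commuting[symmetric]) (simp add: algebra_simps AB)
    also have "\<theta> *\<^sub>R (t *\<^sub>R (A - B)) + t *\<^sub>R B = (t * \<theta>) *\<^sub>R A + (t * (1 - \<theta>)) *\<^sub>R B"
      by (simp add: algebra_simps)
    also have "exp \<dots> = exp ((t * \<theta>) *\<^sub>R A) * exp ((t * (1 - \<theta>)) *\<^sub>R B)"
      by (rule exp_add_commuting) (simp add: AB)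
    finally show ?thesis by (simp add: \<phi>_def mult.assoc[symmetric])
  qed
  have d: "(\<phi> has_vector_derivative t *\<^sub>R ((A - B) * \<phi> \<theta>)) (at \<theta>)" for \<theta>
    using has_vector_derivative_mult_left[OF exp_scaleR_has_vector_derivative_left[of "t *\<^sub>R (A - B)" \<theta>],
        of "exp (t *\<^sub>R B) * Y"]
    by (simp add: \<phi>_def[abs_def] mult.assoc)
  have "norm (\<phi> 1 - \<phi> 0) \<le> (t * c) * 1 - (t * c) * 0"
  proof (rule differentiable_bound_general[where \<phi>'="\<lambda>_. t * c", OF zero_less_one _ _ d])
    show "continuous_on {0..1} \<phi>"
      by (intro continuous_at_imp_continuous_on ballI has_vector_derivative_continuous[OF d])
    show "norm (t *\<^sub>R ((A - B) * \<phi> \<theta>)) \<le> t * c" if "0 < \<theta>" "\<theta> < 1" for \<theta>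
      using bound[OF that] t by (simp add: \<phi> mult_left_mono)
    show "((*) (t * c) has_vector_derivative t * c) (at \<theta>)" for \<theta>
      by (auto intro!: derivative_eq_intros simp flip: has_real_derivative_iff_has_vector_derivative)
  qed (auto intro!: continuous_intros)
  then show ?thesis by (simp add: \<phi>)
qed

text \<open>Serves to differentiate in time uniformly in the freezing point. The constant
  deteriorates with the norm of the generator, but the remainder is quadratic and only the
  derivative survives.\<close>

lemma norm_exp_taylor:
  fixes B :: "'b::{real_normed_algebra_1,banach}"
  assumes c: "\<And>u. 0 \<le> u \<Longrightarrow> norm (exp (u *\<^sub>R B)) \<le> 1" and B: "norm B \<le> L" and t: "0 \<le> t" "0 \<le> s"
  shows "norm (exp (s *\<^sub>R B) - exp (t *\<^sub>R B) - (s - t) *\<^sub>R (B * exp (t *\<^sub>R B))) \<le> L\<^sup>2 * (s - t)\<^sup>2"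
proof -
  have L: "0 \<le> L" using B norm_ge_zero order_trans by blast
  have d: "((\<lambda>u. exp (u *\<^sub>R B)) has_vector_derivative B * exp (u *\<^sub>R B)) (at u within S)" for u S
    by (rule has_vector_derivative_at_within[OF exp_scaleR_has_vector_derivative_left])
  have bd: "norm (B * exp (u *\<^sub>R B)) \<le> L" if "0 \<le> u" for u
    by (rule norm_mult_le_1'[OF B c[OF that]])
  have lip: "norm (exp (u *\<^sub>R B) - exp (v *\<^sub>R B)) \<le> L * norm (u - v)" if "0 \<le> u" "0 \<le> v" for u v
  proof (rule differentiable_bound[where S="{0..}" and f'="\<lambda>u h. h *\<^sub>R (B * exp (u *\<^sub>R B))"])
    show "onorm (\<lambda>h. h *\<^sub>R (B * exp (u *\<^sub>R B))) \<le> L" if "u \<in> {0..}" for u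
    proof (rule onorm_le)
      fix h :: real
      have "\<bar>h\<bar> * norm (B * exp (u *\<^sub>R B)) \<le> \<bar>h\<bar> * L"
        using that by (intro mult_left_mono bd) auto
      then show "norm (h *\<^sub>R (B * exp (u *\<^sub>R B))) \<le> L * norm h"
        by (simp add: mult.commute)
    qed
  qed (use that d in \<open>auto simp: has_vector_derivative_def\<close>)
  have "norm (exp (s *\<^sub>R B) - exp (t *\<^sub>R B) - (s - t) *\<^sub>R (B * exp (t *\<^sub>R B))) \<le> norm (s - t) * (L * (L * norm (s - t)))"
  proof (rule vector_differentiable_bound_linearization[where S="closed_segment t s", OF d])
    fix u assume u: "u \<in> closed_segment t s"
    then have u': "0 \<le> u" "norm (u - t) \<le> norm (s - t)"
      using t by (auto simp: closed_segment_eq_real_ivl split: if_splits)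
    have "norm (B * exp (u *\<^sub>R B) - B * exp (t *\<^sub>R B)) \<le> norm B * norm (exp (u *\<^sub>R B) - exp (t *\<^sub>R B))"
      by (simp add: norm_mult_ineq flip: right_diff_distrib)
    also have "\<dots> \<le> L * (L * norm (s - t))"
      using B L order_trans[OF lip[OF u'(1) t(1)] mult_left_mono[OF u'(2) L]] by (intro mult_mono) auto
    finally show "norm (B * exp (u *\<^sub>R B) - B * exp (t *\<^sub>R B)) \<le> L * (L * norm (s - t))" .
  qed auto
  then show ?thesis by (simp add: power2_eq_square mult_ac)
qed

section \<open>The bump kernel\<close>

definition pospow :: "nat \<Rightarrow> real \<Rightarrow> real" where "pospow k s = (max 0 s) ^ k"

lemma DERIV_pospow:
  "(pospow (Suc (Suc k)) has_real_derivative real (Suc (Suc k)) * pospow (Suc k) s) (at s)"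
proof -
  consider "s < 0" | "s = 0" | "s > 0" by linarith
  then show ?thesis
  proof cases
    case 1
    have "((\<lambda>_. 0) has_real_derivative 0) (at s)" by simp
    moreover have "eventually (\<lambda>u. 0 = pospow (Suc (Suc k)) u) (nhds s)"
      using order_tendstoD(2)[OF filterlim_ident[of "nhds s"] 1]
      by eventually_elim (auto simp: pospow_def max_def)
    ultimately have "(pospow (Suc (Suc k)) has_real_derivative 0) (at s)"
      by (subst DERIV_cong_ev[OF refl _ refl, symmetric])
    then show ?thesis using 1 by (simp add: pospow_def max_def)
  next
    case 2
    have "pospow (Suc k) \<midarrow>0\<rightarrow> 0"
    proof (rule Lim_null_comparison)
      show "\<forall>\<^sub>F u in at 0. norm (pospow (Suc k) u) \<le> \<bar>u\<bar>"
        unfolding eventually_at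
        by (rule exI[of _ 1]) (auto simp: pospow_def abs_mult power_le_one max_def mult_left_le)
      show "(\<lambda>u. \<bar>u\<bar>) \<midarrow>0\<rightarrow> (0::real)" using tendsto_rabs_zero[OF tendsto_ident_at] .
    qed
    moreover have "(pospow (Suc (Suc k)) (0 + u) - pospow (Suc (Suc k)) 0) / u = pospow (Suc k) u" if "u \<noteq> 0" for u
      using that by (auto simp: pospow_def max_def)
    ultimately have "(\<lambda>u. (pospow (Suc (Suc k)) (0 + u) - pospow (Suc (Suc k)) 0) / u) \<midarrow>0\<rightarrow> 0"
      by (subst tendsto_cong[of _ "pospow (Suc k)"]) (auto simp: eventually_at_filter)
    then show ?thesis using 2 by (simp add: DERIV_def pospow_def)
  next
    case 3
    have "((\<lambda>u. u ^ Suc (Suc k)) has_real_derivative real (Suc (Suc k)) * s ^ Suc k) (at s)"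
      using DERIV_pow[of "Suc (Suc k)" s] by simp
    moreover have "eventually (\<lambda>u. u ^ Suc (Suc k) = pospow (Suc (Suc k)) u) (nhds s)"
      using order_tendstoD(1)[OF filterlim_ident[of "nhds s"] 3]
      by eventually_elim (auto simp: pospow_def max_def)
    ultimately have "(pospow (Suc (Suc k)) has_real_derivative real (Suc (Suc k)) * s ^ Suc k) (at s)"
      by (subst DERIV_cong_ev[OF refl _ refl, symmetric])
    then show ?thesis using 3 by (simp add: pospow_def max_def)
  qed
qed

lemma DERIV_pospow2 [derivative_intros]:
  assumes "(f has_real_derivative f') (at t)"
  shows "((\<lambda>t. pospow 2 (f t)) has_real_derivative 2 * pospow 1 (f t) * f') (at t)"
    and "((\<lambda>t. pospow 3 (f t)) has_real_derivative 3 * pospow 2 (f t) * f') (at t)"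
    and "((\<lambda>t. pospow 4 (f t)) has_real_derivative 4 * pospow 3 (f t) * f') (at t)"
  using DERIV_chain2[OF DERIV_pospow[of 0] assms] DERIV_chain2[OF DERIV_pospow[of 1] assms]
    DERIV_chain2[OF DERIV_pospow[of 2] assms]
  by (simp_all add: eval_nat_numeral)

lemma continuous_on_pospow [continuous_intros]:
  "continuous_on S f \<Longrightarrow> continuous_on S (\<lambda>x. pospow k (f x))"
  unfolding pospow_def by (intro continuous_intros)

lemma pospow_nonneg [simp]: "0 \<le> pospow k s" by (simp add: pospow_def)

lemma pospow_le_1: "s \<le> 1 \<Longrightarrow> pospow k s \<le> 1" by (simp add: pospow_def power_le_one max_def)

lemma pospow_0: "s \<le> 0 \<Longrightarrow> 0 < k \<Longrightarrow> pospow k s = 0" by (simp add: pospow_def max_def)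

text \<open>The fourth power is chosen so that third derivatives exist and are bounded, which allows
  a Taylor expansion of the first derivatives with quadratic remainder. Compact support makes the
  averages local and lets dyadic bumps be fitted under a singular kernel.\<close>

definition bump0 :: "'a::euclidean_space \<Rightarrow> real" where "bump0 y = pospow 4 (1 - y \<bullet> y)"
definition dbump0 :: "'a::euclidean_space \<Rightarrow> 'a \<Rightarrow> real"
  where "dbump0 h y = - 8 * pospow 3 (1 - y \<bullet> y) * (y \<bullet> h)"
definition ddbump0 :: "'a::euclidean_space \<Rightarrow> 'a \<Rightarrow> 'a \<Rightarrow> real"
  where "ddbump0 b c y = 48 * pospow 2 (1 - y \<bullet> y) * (y \<bullet> b) * (y \<bullet> c) - 8 * pospow 3 (1 - y \<bullet> y) * (b \<bullet> c)"
definition dddbump0 :: "'a::euclidean_space \<Rightarrow> 'a \<Rightarrow> 'a \<Rightarrow> real"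
  where "dddbump0 b c y = - 192 * pospow 1 (1 - y \<bullet> y) * (y \<bullet> c) * (y \<bullet> b) * (y \<bullet> c)
    + 48 * pospow 2 (1 - y \<bullet> y) * ((c \<bullet> b) * (y \<bullet> c) + (y \<bullet> b) * (c \<bullet> c) + (y \<bullet> c) * (b \<bullet> c))"

lemma DERIV_bump0:
  fixes x h b c :: "'a::euclidean_space"
  shows "((\<lambda>t. bump0 (x + t *\<^sub>R h)) has_real_derivative dbump0 h (x + t *\<^sub>R h)) (at t)"
    and "((\<lambda>t. dbump0 b (x + t *\<^sub>R c)) has_real_derivative ddbump0 b c (x + t *\<^sub>R c)) (at t)"
    and "((\<lambda>t. ddbump0 b c (x + t *\<^sub>R c)) has_real_derivative dddbump0 b c (x + t *\<^sub>R c)) (at t)"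
proof -
  have d1: "((\<lambda>t. (x + t *\<^sub>R c) \<bullet> b) has_real_derivative c \<bullet> b) (at t)" for b c :: 'a
    unfolding inner_add_left inner_scaleR_left by (auto intro!: derivative_eq_intros)
  have d2: "((\<lambda>t. 1 - (x + t *\<^sub>R c) \<bullet> (x + t *\<^sub>R c)) has_real_derivative - 2 * ((x + t *\<^sub>R c) \<bullet> c)) (at t)" for c :: 'a
    unfolding inner_add_left inner_add_right inner_scaleR_left inner_scaleR_right
    by (auto intro!: derivative_eq_intros simp: inner_commute)
  show "((\<lambda>t. bump0 (x + t *\<^sub>R h)) has_real_derivative dbump0 h (x + t *\<^sub>R h)) (at t)"
    unfolding bump0_def dbump0_def
    by (rule DERIV_cong, rule DERIV_pospow2(3)[OF d2]) simp
  show "((\<lambda>t. dbump0 b (x + t *\<^sub>R c)) has_real_derivative ddbump0 b c (x + t *\<^sub>R c)) (at t)"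
    unfolding dbump0_def ddbump0_def
    by (rule DERIV_cong, rule DERIV_mult[OF DERIV_cmult[OF DERIV_pospow2(2)[OF d2]] d1])
      (simp add: inner_commute algebra_simps)
  show "((\<lambda>t. ddbump0 b c (x + t *\<^sub>R c)) has_real_derivative dddbump0 b c (x + t *\<^sub>R c)) (at t)"
    unfolding ddbump0_def dddbump0_def
    by (rule DERIV_cong, rule DERIV_diff[OF DERIV_mult[OF DERIV_mult[OF DERIV_cmult[OF DERIV_pospow2(1)[OF d2]] d1] d1]
      DERIV_mult[OF DERIV_cmult[OF DERIV_pospow2(2)[OF d2]] DERIV_const]])
      (simp add: inner_commute algebra_simps)
qed

lemma bump0_eq_0:
  assumes "1 \<le> norm y"
  shows "bump0 y = 0" "dbump0 h y = 0" "ddbump0 b c y = 0" "dddbump0 b c y = 0"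
proof -
  have "1 - y \<bullet> y \<le> 0"
    using assms one_le_power[of "norm y" 2] by (simp add: power2_norm_eq_inner)
  then show "bump0 y = 0" "dbump0 h y = 0" "ddbump0 b c y = 0" "dddbump0 b c y = 0"
    by (simp_all add: bump0_def dbump0_def ddbump0_def dddbump0_def pospow_0)
qed

lemma abs_pospow_le: "\<bar>pospow k (1 - y \<bullet> y)\<bar> \<le> 1" for y :: "'a::euclidean_space"
  by (simp add: pospow_le_1)

lemma abs_bump0_le: "\<bar>bump0 y\<bar> \<le> 1"
  using abs_pospow_le[of 4 y] by (simp add: bump0_def)

lemma abs_dbump0_le: "\<bar>dbump0 h y\<bar> \<le> 8 * norm h"
proof (cases "norm y < 1")
  case True
  have "\<bar>y \<bullet> h\<bar> \<le> 1 * norm h"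
    using Cauchy_Schwarz_ineq2[of y h] True by (meson less_imp_le mult_right_mono norm_ge_zero order_trans)
  then have "\<bar>pospow 3 (1 - y \<bullet> y)\<bar> * \<bar>y \<bullet> h\<bar> \<le> 1 * (1 * norm h)"
    by (intro mult_mono abs_pospow_le) auto
  then show ?thesis by (simp add: dbump0_def abs_mult)
qed (simp add: bump0_eq_0)

lemma abs_ddbump0_le: "\<bar>ddbump0 b c y\<bar> \<le> 56 * norm b * norm c"
proof (cases "norm y < 1")
  case True
  have I: "\<bar>y \<bullet> h\<bar> \<le> norm h" for h
    using Cauchy_Schwarz_ineq2[of y h] True by (meson less_imp_le mult_left_le_one_le norm_ge_zero order_trans)
  have 1: "\<bar>pospow 2 (1 - y \<bullet> y)\<bar> * \<bar>y \<bullet> b\<bar> * \<bar>y \<bullet> c\<bar> \<le> 1 * norm b * norm c"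
    by (intro mult_mono abs_pospow_le I) auto
  have 2: "\<bar>pospow 3 (1 - y \<bullet> y)\<bar> * \<bar>b \<bullet> c\<bar> \<le> 1 * (norm b * norm c)"
    by (intro mult_mono abs_pospow_le Cauchy_Schwarz_ineq2) auto
  show ?thesis
    unfolding ddbump0_def
    by (rule order_trans[OF abs_triangle_ineq4]) (use 1 2 in \<open>simp add: abs_mult\<close>)
qed (simp add: bump0_eq_0)

lemma abs_dddbump0_le:
  assumes b: "norm b = 1" and c: "norm c = 1"
  shows "\<bar>dddbump0 b c y\<bar> \<le> 336"
proof (cases "norm y < 1")
  case True
  have I: "\<bar>y \<bullet> h\<bar> \<le> 1" if "norm h = 1" for h
    using Cauchy_Schwarz_ineq2[of y h] True that by simp
  have J: "\<bar>h \<bullet> k\<bar> \<le> 1" if "norm h = 1" "norm k = 1" for h k :: 'a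
    using Cauchy_Schwarz_ineq2[of h k] that by simp
  have P: "\<bar>a * d\<bar> \<le> 1" if "\<bar>a\<bar> \<le> 1" "\<bar>d\<bar> \<le> 1" for a d :: real
    using mult_mono[OF that] by (simp add: abs_mult)
  have 1: "\<bar>pospow 1 (1 - y \<bullet> y) * (y \<bullet> c) * (y \<bullet> b) * (y \<bullet> c)\<bar> \<le> 1"
    by (intro P I b c abs_pospow_le)
  have 2: "\<bar>pospow 2 (1 - y \<bullet> y) * ((c \<bullet> b) * (y \<bullet> c))\<bar> \<le> 1"
    "\<bar>pospow 2 (1 - y \<bullet> y) * ((y \<bullet> b) * (c \<bullet> c))\<bar> \<le> 1"
    "\<bar>pospow 2 (1 - y \<bullet> y) * ((y \<bullet> c) * (b \<bullet> c))\<bar> \<le> 1"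
    by (intro P I J b c abs_pospow_le)+
  have eq: "dddbump0 b c y = - 192 * (pospow 1 (1 - y \<bullet> y) * (y \<bullet> c) * (y \<bullet> b) * (y \<bullet> c))
    + 48 * (pospow 2 (1 - y \<bullet> y) * ((c \<bullet> b) * (y \<bullet> c))) + 48 * (pospow 2 (1 - y \<bullet> y) * ((y \<bullet> b) * (c \<bullet> c)))
    + 48 * (pospow 2 (1 - y \<bullet> y) * ((y \<bullet> c) * (b \<bullet> c)))"
    by (simp add: dddbump0_def algebra_simps)
  show ?thesis using 1 2 unfolding eq by linarith
qed (simp add: bump0_eq_0)

lemma abs_taylor1_le:
  fixes f :: "real \<Rightarrow> real"
  assumes f: "\<And>t. (f has_real_derivative f' t) (at t)" and K: "\<And>t. \<bar>f' t\<bar> \<le> K"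
  shows "\<bar>f 1 - f 0\<bar> \<le> K"
proof -
  obtain z where "f 1 - f 0 = (1 - 0) * f' z" using MVT2[of 0 1 f f'] f by auto
  then show ?thesis using K by simp
qed

lemma abs_taylor2_le:
  fixes f :: "real \<Rightarrow> real"
  assumes f: "\<And>t. (f has_real_derivative f' t) (at t)" and f': "\<And>t. (f' has_real_derivative f'' t) (at t)"
    and K: "\<And>t. \<bar>f'' t\<bar> \<le> K"
  shows "\<bar>f 1 - f 0 - f' 0\<bar> \<le> K"
proof -
  obtain z where z: "0 < z" "z < 1" "f 1 - f 0 = (1 - 0) * f' z" using MVT2[of 0 1 f f'] f by auto
  obtain w where w: "f' z - f' 0 = (z - 0) * f'' w" using MVT2[of 0 z f' f''] f' z by auto
  have "\<bar>z * f'' w\<bar> \<le> 1 * K" unfolding abs_mult using z K by (intro mult_mono) auto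
  then show ?thesis using z w by simp
qed

lemma abs_bump0_diff_le: "\<bar>bump0 (x + h) - bump0 x\<bar> \<le> 8 * norm h"
  using abs_taylor1_le[of "\<lambda>t. bump0 (x + t *\<^sub>R h)", OF DERIV_bump0(1) abs_dbump0_le] by simp

lemma abs_bump0_taylor_le: "\<bar>bump0 (x + h) - bump0 x - dbump0 h x\<bar> \<le> 56 * (norm h)\<^sup>2"
  using abs_taylor2_le[of "\<lambda>t. bump0 (x + t *\<^sub>R h)", OF DERIV_bump0(1) DERIV_bump0(2) abs_ddbump0_le]
  by (simp add: power2_eq_square)

lemma dbump0_scaleR: "dbump0 (t *\<^sub>R h) x = t * dbump0 h x"
  by (simp add: dbump0_def)

lemma abs_dbump0_taylor_le:
  assumes "norm b = 1" "norm c = 1"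
  shows "\<bar>dbump0 b (x + t *\<^sub>R c) - dbump0 b x - t * ddbump0 b c x\<bar> \<le> 336 * t\<^sup>2"
proof -
  have c: "((\<lambda>u. t * u) has_real_derivative t) (at u)" for u
    using DERIV_cmult_Id[of t] .
  have 1: "((\<lambda>u. dbump0 b (x + (t * u) *\<^sub>R c)) has_real_derivative ddbump0 b c (x + (t * u) *\<^sub>R c) * t) (at u)" for u
    using DERIV_chain2[OF DERIV_bump0(2) c] .
  have 2: "((\<lambda>u. ddbump0 b c (x + (t * u) *\<^sub>R c) * t) has_real_derivative dddbump0 b c (x + (t * u) *\<^sub>R c) * t * t) (at u)" for u
    using DERIV_cmult_right[OF DERIV_chain2[OF DERIV_bump0(3) c]] .
  have "\<bar>dddbump0 b c (x + (t * u) *\<^sub>R c) * t * t\<bar> \<le> 336 * t\<^sup>2" for u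
    using mult_right_mono[OF abs_dddbump0_le[OF assms, of "x + (t * u) *\<^sub>R c"], of "t\<^sup>2"]
    by (simp add: abs_mult power2_eq_square)
  from abs_taylor2_le[OF 1 2 this] show ?thesis by (simp add: mult.commute)
qed

lemma continuous_on_bump0 [continuous_intros]:
  fixes f :: "'b::topological_space \<Rightarrow> 'a::euclidean_space"
  assumes "continuous_on S f"
  shows "continuous_on S (\<lambda>x. bump0 (f x))" "continuous_on S (\<lambda>x. dbump0 h (f x))" "continuous_on S (\<lambda>x. ddbump0 b c (f x))"
  unfolding bump0_def dbump0_def ddbump0_def by (intro continuous_intros assms)+

text \<open>A difference of translates of one bump lives on a few balls with the radius of the bump,
  however large the shift; \<open>F\<close> collects their centres. Sup bounds thus give
  \<open>L^1\<close> bounds that do not grow with the shift.\<close>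

lemma
  fixes f :: "'a::euclidean_space \<Rightarrow> real"
  assumes f: "f \<in> borel_measurable borel" and K: "\<And>x. \<bar>f x\<bar> \<le> K" and F: "finite F" and s: "0 \<le> s"
    and supp: "\<And>x. f x \<noteq> 0 \<Longrightarrow> \<exists>a\<in>F. norm (x - a) < s"
  shows integrable_compact_support: "integrable lborel f"
    and integral_compact_support_le: "(\<integral>x. \<bar>f x\<bar> \<partial>lborel) \<le> real (card F) * (K * s ^ DIM('a) * measure lborel (ball (0::'a) 1))"
proof -
  have K0: "0 \<le> K" using K[of 0] by simp
  let ?g = "\<lambda>x. \<Sum>a\<in>F. K * indicator (ball a s) x :: real"
  have ig: "integrable lborel (\<lambda>x. K * indicator (ball a s) x :: real)" for a
    by (intro integrable_mult_right integrable_real_indicator) (use emeasure_lborel_ball_finite[of a s] in auto)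
  then have g: "integrable lborel ?g" by (rule Bochner_Integration.integrable_sum)
  have le: "\<bar>f x\<bar> \<le> ?g x" for x
  proof (cases "f x = 0")
    case False
    then obtain a where a: "a \<in> F" "norm (x - a) < s" using supp by blast
    have "\<bar>f x\<bar> \<le> K * indicator (ball a s) x" using K a by (simp add: dist_norm norm_minus_commute)
    also have "\<dots> \<le> ?g x" using a F K0 by (intro member_le_sum) auto
    finally show ?thesis .
  qed (use K0 in \<open>auto intro!: sum_nonneg\<close>)
  show f': "integrable lborel f"
    by (rule Bochner_Integration.integrable_bound[OF g]) (use f le in \<open>auto intro!: AE_I2 order_trans[OF le]\<close>)
  have "(\<integral>x. \<bar>f x\<bar> \<partial>lborel) \<le> (\<integral>x. ?g x \<partial>lborel)"
    using f' g le by (intro integral_mono) auto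
  also have "\<dots> = (\<Sum>a\<in>F. K * measure lborel (ball a s))"
    using ig by (subst Bochner_Integration.integral_sum) auto
  also have "\<dots> = real (card F) * (K * s ^ DIM('a) * measure lborel (ball (0::'a) 1))"
    by (subst content_ball_conv_unit_ball[OF s]) (simp add: mult_ac)
  finally show "(\<integral>x. \<bar>f x\<bar> \<partial>lborel) \<le> real (card F) * (K * s ^ DIM('a) * measure lborel (ball (0::'a) 1))" .
qed

abbreviation unit_vol :: "'a::euclidean_space itself \<Rightarrow> real"
  where "unit_vol _ \<equiv> measure lborel (ball (0::'a) 1)"

definition bump_mass :: "'a::euclidean_space itself \<Rightarrow> real"
  where "bump_mass _ = (\<integral>y. bump0 (y::'a) \<partial>lborel)"

definition bump :: "real \<Rightarrow> 'a::euclidean_space \<Rightarrow> real"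
  where "bump s y = bump0 (y /\<^sub>R s) / (s ^ DIM('a) * bump_mass TYPE('a))"

lemma measurable_bump0 [measurable]:
  "bump0 \<in> borel_measurable borel" "dbump0 h \<in> borel_measurable borel" "ddbump0 b c \<in> borel_measurable borel"
  by (intro borel_measurable_continuous_onI continuous_intros)+

lemma bump0_nonneg: "0 \<le> bump0 y" by (simp add: bump0_def)

lemma integrable_bump0: "integrable lborel (bump0 :: 'a::euclidean_space \<Rightarrow> real)"
  by (rule integrable_compact_support[where F="{0}" and s=1, OF _ abs_bump0_le])
    (use bump0_eq_0(1) not_le in auto)

lemma bump_mass_pos: "0 < bump_mass TYPE('a::euclidean_space)"
proof -
  have nn: "0 \<le> bump_mass TYPE('a)" unfolding bump_mass_def by (intro integral_nonneg_AE) (simp add: bump0_nonneg)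
  have "bump_mass TYPE('a) \<noteq> 0"
  proof
    assume "bump_mass TYPE('a) = 0"
    then have "AE y in lborel. bump0 (y::'a) = 0"
      unfolding bump_mass_def
      by (subst (asm) integral_nonneg_eq_0_iff_AE) (auto simp: integrable_bump0 bump0_nonneg)
    then have "emeasure lborel {y::'a. bump0 y \<noteq> 0} = 0"
      by (subst (asm) AE_iff_measurable[OF _ refl]) auto
    moreover have "ball (0::'a) 1 \<subseteq> {y. bump0 y \<noteq> 0}"
    proof safe
      fix y :: 'a assume "y \<in> ball 0 1" "bump0 y = 0"
      moreover from this have "y \<bullet> y < 1"
        using power_strict_mono[of "norm y" 1 2] by (simp add: power2_norm_eq_inner)
      ultimately show False by (simp add: bump0_def pospow_def max_def split: if_splits)
    qed
    ultimately have "emeasure lborel (ball (0::'a) 1) = 0"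
      using emeasure_mono[of "ball (0::'a) 1" "{y. bump0 y \<noteq> 0}" lborel] by simp
    then have "measure lborel (ball (0::'a) 1) = 0" by (simp add: measure_def)
    then show False using content_ball_pos[of 1 "0::'a"] by simp
  qed
  with nn show ?thesis by simp
qed

lemma bump_nonneg: "0 < s \<Longrightarrow> 0 \<le> bump s (y::'a::euclidean_space)"
  using bump_mass_pos[where 'a='a] by (auto simp: bump_def bump0_nonneg intro!: divide_nonneg_pos mult_nonneg_nonneg)

lemma bump_eq_0: "0 < s \<Longrightarrow> s \<le> norm y \<Longrightarrow> bump s y = 0"
  by (simp add: bump_def bump0_eq_0 field_simps)

lemma bump_minus: "bump s (- y) = bump s y"
  by (simp add: bump_def bump0_def)

lemma bump_le: "0 < s \<Longrightarrow> bump s (y::'a::euclidean_space) \<le> 1 / (s ^ DIM('a) * bump_mass TYPE('a))"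
  using bump_mass_pos[where 'a='a] abs_bump0_le[of "y /\<^sub>R s"]
  by (auto simp: bump_def intro!: divide_right_mono)

lemma continuous_on_bump [continuous_intros]: "continuous_on S f \<Longrightarrow> continuous_on S (\<lambda>x. bump s (f x))"
  unfolding bump_def divide_inverse by (intro continuous_intros)

lemma measurable_bump [measurable]: "bump s \<in> borel_measurable borel"
  by (intro borel_measurable_continuous_onI continuous_intros)

lemma
  assumes s: "0 < s"
  shows integrable_bump: "integrable lborel (bump s :: 'a::euclidean_space \<Rightarrow> real)"
    and integral_bump: "(\<integral>y. bump s (y::'a) \<partial>lborel) = 1"
proof -
  show i: "integrable lborel (bump s :: 'a::euclidean_space \<Rightarrow> real)"
  proof (rule integrable_compact_support[where F="{0}" and s=s and K="1 / (s ^ DIM('a) * bump_mass TYPE('a))"])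
    show "\<bar>bump s x\<bar> \<le> 1 / (s ^ DIM('a) * bump_mass TYPE('a))" for x :: 'a
      using bump_le[OF s, of x] bump_nonneg[OF s, of x] by simp
    show "\<exists>a\<in>{0}. norm (x - a) < s" if "bump s x \<noteq> 0" for x :: 'a
      using that bump_eq_0[OF s, of x] by force
  qed (use s in auto)
  have "lborel = density (distr lborel borel (\<lambda>x::'a. 0 + s *\<^sub>R x)) (\<lambda>_. ennreal (s ^ DIM('a)))"
    using lborel_affine[of s "0::'a"] s by simp
  then have "(\<integral>y. bump s (y::'a) \<partial>lborel)
      = (\<integral>y. bump s (y::'a) \<partial>density (distr lborel borel (\<lambda>x::'a. 0 + s *\<^sub>R x)) (\<lambda>_. ennreal (s ^ DIM('a))))"
    by simp
  also have "\<dots> = (\<integral>y. s ^ DIM('a) * bump s (y::'a) \<partial>distr lborel borel (\<lambda>x::'a. 0 + s *\<^sub>R x))"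
    using s by (subst integral_density) auto
  also have "\<dots> = (\<integral>y. s ^ DIM('a) * bump s (s *\<^sub>R y) \<partial>(lborel :: 'a measure))"
    by (subst integral_distr) auto
  also have "\<dots> = (\<integral>y. bump0 (y::'a) / bump_mass TYPE('a) \<partial>lborel)"
    using s by (simp add: bump_def)
  also have "\<dots> = 1"
    using bump_mass_pos[where 'a='a] by (simp add: bump_mass_def)
  finally show "(\<integral>y. bump s (y::'a) \<partial>lborel) = 1" .
qed

text \<open>A constant for the \<open>L\<^sup>1\<close> norms of the first and second differences of all \<open>bump s\<close>.\<close>

definition bump_const :: "'a::euclidean_space itself \<Rightarrow> real"
  where "bump_const _ = 336 * unit_vol TYPE('a) / bump_mass TYPE('a)"

lemma bump_const_pos: "0 < bump_const TYPE('a::euclidean_space)"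
  using bump_mass_pos[where 'a='a] content_ball_pos[of 1 "0::'a"] by (simp add: bump_const_def)

lemma integral_bump_diff_le:
  assumes s: "0 < s"
  shows "(\<integral>y. \<bar>bump s (y + h) - bump s (y::'a::euclidean_space)\<bar> \<partial>lborel) \<le> bump_const TYPE('a) * norm h / s"
proof -
  let ?m = "bump_mass TYPE('a)" and ?K = "8 * norm h / s / (s ^ DIM('a) * bump_mass TYPE('a))"
  note m = bump_mass_pos[where 'a='a]
  have eq: "bump s (y + h) - bump s y = (bump0 (y /\<^sub>R s + h /\<^sub>R s) - bump0 (y /\<^sub>R s)) / (s ^ DIM('a) * ?m)" for y
    by (simp add: bump_def scaleR_add_right diff_divide_distrib)
  have "(\<integral>y. \<bar>bump s (y + h) - bump s (y::'a)\<bar> \<partial>lborel) \<le> real (card {0, - h}) * (?K * s ^ DIM('a) * unit_vol TYPE('a))"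
  proof (rule integral_compact_support_le)
    fix y :: 'a
    show "\<bar>bump s (y + h) - bump s y\<bar> \<le> ?K"
      using abs_bump0_diff_le[of "y /\<^sub>R s" "h /\<^sub>R s"] s m
      by (simp add: eq abs_mult divide_right_mono divide_inverse mult_ac)
    assume "bump s (y + h) - bump s y \<noteq> 0"
    then have "\<not> (s \<le> norm y \<and> s \<le> norm (y + h))" by (auto simp: bump_eq_0[OF s])
    then show "\<exists>a\<in>{0, - h}. norm (y - a) < s" by auto
  qed (use s in auto)
  also have "\<dots> \<le> 2 * (?K * s ^ DIM('a) * unit_vol TYPE('a))"
    using s m by (intro mult_right_mono) (auto simp: card_insert_if intro!: mult_nonneg_nonneg divide_nonneg_nonneg)
  also have "\<dots> = (16 * unit_vol TYPE('a) / ?m) * (norm h / s)"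
    using s m by (simp add: field_simps)
  also have "\<dots> \<le> bump_const TYPE('a) * (norm h / s)"
    using s m by (intro mult_right_mono) (auto simp: bump_const_def divide_right_mono)
  finally show ?thesis by simp
qed

lemma integral_bump_diff2_le:
  assumes s: "0 < s"
  shows "(\<integral>y. \<bar>bump s (y + h) + bump s (y - h) - 2 * bump s (y::'a::euclidean_space)\<bar> \<partial>lborel)
    \<le> bump_const TYPE('a) * (norm h / s)\<^sup>2"
proof -
  let ?m = "bump_mass TYPE('a)" and ?K = "112 * (norm h / s)\<^sup>2 / (s ^ DIM('a) * bump_mass TYPE('a))"
  note m = bump_mass_pos[where 'a='a]
  have eq: "bump s (y + h) + bump s (y - h) - 2 * bump s y
      = ((bump0 (y /\<^sub>R s + h /\<^sub>R s) - bump0 (y /\<^sub>R s) - dbump0 (h /\<^sub>R s) (y /\<^sub>R s))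
        + (bump0 (y /\<^sub>R s + (- h /\<^sub>R s)) - bump0 (y /\<^sub>R s) - dbump0 (- h /\<^sub>R s) (y /\<^sub>R s))) / (s ^ DIM('a) * ?m)" for y
    by (simp add: bump_def scaleR_add_right scaleR_diff_right diff_divide_distrib add_divide_distrib dbump0_def)
  have "(\<integral>y. \<bar>bump s (y + h) + bump s (y - h) - 2 * bump s (y::'a)\<bar> \<partial>lborel)
      \<le> real (card {0, - h, h}) * (?K * s ^ DIM('a) * unit_vol TYPE('a))"
  proof (rule integral_compact_support_le)
    fix y :: 'a
    have "\<bar>(bump0 (y /\<^sub>R s + h /\<^sub>R s) - bump0 (y /\<^sub>R s) - dbump0 (h /\<^sub>R s) (y /\<^sub>R s))
        + (bump0 (y /\<^sub>R s + (- h /\<^sub>R s)) - bump0 (y /\<^sub>R s) - dbump0 (- h /\<^sub>R s) (y /\<^sub>R s))\<bar> \<le> 112 * (norm h / s)\<^sup>2"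
      using abs_bump0_taylor_le[of "y /\<^sub>R s" "h /\<^sub>R s"] abs_bump0_taylor_le[of "y /\<^sub>R s" "- h /\<^sub>R s"] s
      by (simp add: divide_inverse mult.commute)
    then show "\<bar>bump s (y + h) + bump s (y - h) - 2 * bump s y\<bar> \<le> ?K"
      unfolding eq using s m by (simp add: divide_right_mono)
    assume "bump s (y + h) + bump s (y - h) - 2 * bump s y \<noteq> 0"
    then have "\<not> (s \<le> norm y \<and> s \<le> norm (y + h) \<and> s \<le> norm (y - h))" by (auto simp: bump_eq_0[OF s])
    then show "\<exists>a\<in>{0, - h, h}. norm (y - a) < s" by auto
  qed (use s in auto)
  \<comment> \<open>Three balls, each with the bound 112, which is twice the 56 of the Taylor
    remainder: this is the 336 in \<open>bump_const\<close>.\<close>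
  also have "\<dots> \<le> 3 * (?K * s ^ DIM('a) * unit_vol TYPE('a))"
    using s m by (intro mult_right_mono) (auto simp: card_insert_if intro!: mult_nonneg_nonneg divide_nonneg_nonneg)
  also have "\<dots> = bump_const TYPE('a) * (norm h / s)\<^sup>2"
    using s m by (simp add: field_simps bump_const_def)
  finally show ?thesis by simp
qed

section \<open>Mollification\<close>

definition dbump :: "real \<Rightarrow> 'a::euclidean_space \<Rightarrow> 'a \<Rightarrow> real"
  where "dbump s h y = dbump0 h (y /\<^sub>R s) / s / (s ^ DIM('a) * bump_mass TYPE('a))"
definition ddbump :: "real \<Rightarrow> 'a::euclidean_space \<Rightarrow> 'a \<Rightarrow> 'a \<Rightarrow> real"
  where "ddbump s b c y = ddbump0 b c (y /\<^sub>R s) / s\<^sup>2 / (s ^ DIM('a) * bump_mass TYPE('a))"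

lemma measurable_dbump [measurable]:
  "dbump s h \<in> borel_measurable borel" "ddbump s b c \<in> borel_measurable borel"
  unfolding dbump_def[abs_def] ddbump_def[abs_def] by measurable

lemma dbump_eq_0:
  assumes "0 < s" "s \<le> norm y"
  shows "dbump s h y = 0" "ddbump s b c y = 0"
  using assms by (simp_all add: dbump_def ddbump_def bump0_eq_0 field_simps)

lemma integrable_dbump:
  assumes s: "0 < s"
  shows "integrable lborel (dbump s (h::'a::euclidean_space))" "integrable lborel (ddbump s b (c::'a))"
proof -
  note m = bump_mass_pos[where 'a='a]
  show "integrable lborel (dbump s h)"
  proof (rule integrable_compact_support[where F="{0}" and s=s])
    show "\<bar>dbump s h x\<bar> \<le> 8 * norm h / s / (s ^ DIM('a) * bump_mass TYPE('a))" for x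
      using s m by (auto simp: dbump_def abs_mult intro!: divide_right_mono abs_dbump0_le)
    show "\<exists>a\<in>{0}. norm (x - a) < s" if "dbump s h x \<noteq> 0" for x
      using that dbump_eq_0(1)[OF s, of x] by force
  qed (use s in auto)
  show "integrable lborel (ddbump s b c)"
  proof (rule integrable_compact_support[where F="{0}" and s=s])
    show "\<bar>ddbump s b c x\<bar> \<le> 56 * norm b * norm c / s\<^sup>2 / (s ^ DIM('a) * bump_mass TYPE('a))" for x
      using s m by (auto simp: ddbump_def abs_mult intro!: divide_right_mono abs_ddbump0_le)
    show "\<exists>a\<in>{0}. norm (x - a) < s" if "ddbump s b c x \<noteq> 0" for x
      using that dbump_eq_0(2)[OF s, of x] by force
  qed (use s in auto)
qed

text \<open>Derivatives of a mollified function fall on the kernel, so this expansion in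
  \<open>L^1\<close> is all that differentiability requires. It is used for fixed \<open>s\<close>,
  hence the dependence of \<open>C\<close> on \<open>s\<close> is harmless.\<close>

lemma integral_bump_taylor_le:
  assumes s: "0 < s"
  shows "\<exists>C\<ge>0. \<forall>h. (\<integral>y. \<bar>bump s (y - h) - bump s y + dbump s h (y::'a::euclidean_space)\<bar> \<partial>lborel) \<le> C * (norm h)\<^sup>2"
proof (intro exI conjI allI)
  let ?m = "bump_mass TYPE('a)"
  let ?K = "\<lambda>h::'a. 56 * (norm h)\<^sup>2 / s\<^sup>2 / (s ^ DIM('a) * bump_mass TYPE('a))"
  let ?C = "2 * (56 / s\<^sup>2 / (s ^ DIM('a) * ?m)) * s ^ DIM('a) * unit_vol TYPE('a)"
  note m = bump_mass_pos[where 'a='a]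
  show "0 \<le> ?C" using s m by simp
  fix h :: 'a
  have eq: "bump s (y - h) - bump s y + dbump s h y
      = (bump0 (y /\<^sub>R s + (- h /\<^sub>R s)) - bump0 (y /\<^sub>R s) - dbump0 (- h /\<^sub>R s) (y /\<^sub>R s)) / (s ^ DIM('a) * ?m)" for y
    by (simp add: bump_def dbump_def scaleR_diff_right diff_divide_distrib add_divide_distrib dbump0_def divide_inverse algebra_simps)
  have "(\<integral>y. \<bar>bump s (y - h) - bump s y + dbump s h y\<bar> \<partial>lborel) \<le> real (card {0, h}) * (?K h * s ^ DIM('a) * unit_vol TYPE('a))"
  proof (rule integral_compact_support_le)
    fix y :: 'a
    have "\<bar>bump s (y - h) - bump s y + dbump s h y\<bar>
        = \<bar>bump0 (y /\<^sub>R s + (- h /\<^sub>R s)) - bump0 (y /\<^sub>R s) - dbump0 (- h /\<^sub>R s) (y /\<^sub>R s)\<bar> / (s ^ DIM('a) * ?m)"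
      unfolding eq using s m by simp
    also have "\<dots> \<le> 56 * (norm (- h /\<^sub>R s))\<^sup>2 / (s ^ DIM('a) * ?m)"
      using s m by (intro divide_right_mono abs_bump0_taylor_le) auto
    also have "\<dots> = ?K h" using s by (simp add: power_mult_distrib divide_inverse power_inverse)
    finally show "\<bar>bump s (y - h) - bump s y + dbump s h y\<bar> \<le> ?K h" .
    assume "bump s (y - h) - bump s y + dbump s h y \<noteq> 0"
    then have "\<not> (s \<le> norm y \<and> s \<le> norm (y - h))" by (auto simp: bump_eq_0[OF s] dbump_eq_0[OF s])
    then show "\<exists>a\<in>{0, h}. norm (y - a) < s" by auto
  qed (use s in auto)
  also have "\<dots> \<le> 2 * (?K h * s ^ DIM('a) * unit_vol TYPE('a))"
    using s m by (intro mult_right_mono) (auto simp: card_insert_if intro!: mult_nonneg_nonneg divide_nonneg_nonneg)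
  also have "\<dots> = ?C * (norm h)\<^sup>2" by simp
  finally show "(\<integral>y. \<bar>bump s (y - h) - bump s y + dbump s h y\<bar> \<partial>lborel) \<le> ?C * (norm h)\<^sup>2" .
qed

lemma integral_dbump_taylor_le:
  assumes s: "0 < s" and b: "b \<in> Basis" and c: "c \<in> Basis"
  shows "\<exists>C\<ge>0. \<forall>t. (\<integral>y. \<bar>dbump s b (y - t *\<^sub>R c) - dbump s b y + t * ddbump s b c (y::'a::euclidean_space)\<bar> \<partial>lborel) \<le> C * t\<^sup>2"
proof (intro exI conjI allI)
  let ?m = "bump_mass TYPE('a)"
  let ?K = "\<lambda>t. 336 * t\<^sup>2 / s\<^sup>2 / s / (s ^ DIM('a) * bump_mass TYPE('a))"
  let ?C = "2 * (336 / s\<^sup>2 / s / (s ^ DIM('a) * ?m)) * s ^ DIM('a) * unit_vol TYPE('a)"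
  note m = bump_mass_pos[where 'a='a]
  show "0 \<le> ?C" using s m by simp
  fix t :: real
  have eq: "dbump s b (y - t *\<^sub>R c) - dbump s b y + t * ddbump s b c y
      = (dbump0 b (y /\<^sub>R s + (- t / s) *\<^sub>R c) - dbump0 b (y /\<^sub>R s) - (- t / s) * ddbump0 b c (y /\<^sub>R s)) / s / (s ^ DIM('a) * ?m)" for y
    using s by (simp add: dbump_def ddbump_def scaleR_diff_right diff_divide_distrib add_divide_distrib power2_eq_square divide_inverse algebra_simps)
  have "(\<integral>y. \<bar>dbump s b (y - t *\<^sub>R c) - dbump s b y + t * ddbump s b c y\<bar> \<partial>lborel)
      \<le> real (card {0, t *\<^sub>R c}) * (?K t * s ^ DIM('a) * unit_vol TYPE('a))"
  proof (rule integral_compact_support_le)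
    fix y :: 'a
    have "\<bar>dbump s b (y - t *\<^sub>R c) - dbump s b y + t * ddbump s b c y\<bar>
        = \<bar>dbump0 b (y /\<^sub>R s + (- t / s) *\<^sub>R c) - dbump0 b (y /\<^sub>R s) - (- t / s) * ddbump0 b c (y /\<^sub>R s)\<bar> / s / (s ^ DIM('a) * ?m)"
      unfolding eq using s m by simp
    also have "\<dots> \<le> (336 * (- t / s)\<^sup>2) / s / (s ^ DIM('a) * ?m)"
      using s m b c by (intro divide_right_mono abs_dbump0_taylor_le) auto
    finally show "\<bar>dbump s b (y - t *\<^sub>R c) - dbump s b y + t * ddbump s b c y\<bar> \<le> ?K t"
      by (simp add: power_divide)
    assume "dbump s b (y - t *\<^sub>R c) - dbump s b y + t * ddbump s b c y \<noteq> 0"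
    then have "\<not> (s \<le> norm y \<and> s \<le> norm (y - t *\<^sub>R c))" by (auto simp: dbump_eq_0[OF s])
    then show "\<exists>a\<in>{0, t *\<^sub>R c}. norm (y - a) < s" by auto
  qed (use s in auto)
  also have "\<dots> \<le> 2 * (?K t * s ^ DIM('a) * unit_vol TYPE('a))"
    using s m by (intro mult_right_mono) (auto simp: card_insert_if intro!: mult_nonneg_nonneg divide_nonneg_nonneg)
  also have "\<dots> = ?C * t\<^sup>2" by simp
  finally show "(\<integral>y. \<bar>dbump s b (y - t *\<^sub>R c) - dbump s b y + t * ddbump s b c y\<bar> \<partial>lborel) \<le> ?C * t\<^sup>2" .
qed

text \<open>A change of variables moves the translation by \<open>h\<close> from the function to the
  kernel, as \<open>p (y - h)\<close>. This is also why the derivative of the mollified function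
  carries a minus sign.\<close>

lemma conv_taylor:
  fixes p p' :: "'a::euclidean_space \<Rightarrow> real"
  assumes p: "integrable lborel p" and p': "integrable lborel p'"
  shows "\<bar>(conv p \<bullet>\<^sub>o u) (x + h) - (conv p \<bullet>\<^sub>o u) x + (conv p' \<bullet>\<^sub>o u) x\<bar>
    \<le> norm u * (\<integral>y. \<bar>p (y - h) - p y + p' y\<bar> \<partial>lborel)"
proof -
  have [measurable]: "p \<in> borel_measurable borel" using p by (rule integrable_lborel_measurable)
  have ph: "integrable lborel (\<lambda>y. p (y - h))"
    using integrable_lborel_reflect_shift[of p 1 "- h"] p by simp
  have "(conv p \<bullet>\<^sub>o u) (x + h) = (\<integral>y. u (x + y) * p (y - h) \<partial>lborel)"
    using integral_lborel_reflect_shift[of "\<lambda>y. u (x + y) * p (y - h)" 1 h]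
    by (simp add: conv_apply[OF p] add.assoc)
  then have "(conv p \<bullet>\<^sub>o u) (x + h) - (conv p \<bullet>\<^sub>o u) x + (conv p' \<bullet>\<^sub>o u) x
      = (\<integral>y. u (x + y) * (p (y - h) - p y + p' y) \<partial>lborel)"
    using integrable_bcontfun_mult[OF _ p, of "\<lambda>y. x + y" u] integrable_bcontfun_mult[OF _ p', of "\<lambda>y. x + y" u]
      integrable_bcontfun_mult[OF _ ph, of "\<lambda>y. x + y" u]
    by (simp add: conv_apply[OF p] conv_apply[OF p'] distrib_left right_diff_distrib)
  also have "\<bar>\<dots>\<bar> \<le> (\<integral>y. \<bar>p (y - h) - p y + p' y\<bar> \<partial>lborel) * norm u"
    using abs_conv_fun_le[of "\<lambda>y. p (y - h) - p y + p' y" u x] p p' ph by (simp add: conv_fun_def)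
  finally show ?thesis by (simp add: mult.commute)
qed

lemma DERIV_conv:
  fixes p p' :: "'a::euclidean_space \<Rightarrow> real"
  assumes p: "integrable lborel p" and p': "integrable lborel p'"
    and C: "\<And>t. (\<integral>y. \<bar>p (y - t *\<^sub>R b) - p y + t * p' y\<bar> \<partial>lborel) \<le> C * t\<^sup>2"
  shows "((\<lambda>t. (conv p \<bullet>\<^sub>o u) (x + t *\<^sub>R b)) has_real_derivative - (conv p' \<bullet>\<^sub>o u) x) (at 0)"
  unfolding DERIV_def
proof (rule LIM_zero_cancel, rule Lim_null_comparison)
  show "(\<lambda>t. \<bar>t\<bar> * (norm u * C)) \<midarrow>0\<rightarrow> 0"
    by (rule tendsto_mult_left_zero) (use tendsto_rabs_zero[OF tendsto_ident_at] in simp)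
  have "norm (((conv p \<bullet>\<^sub>o u) (x + (0 + t) *\<^sub>R b) - (conv p \<bullet>\<^sub>o u) (x + 0 *\<^sub>R b)) / t - - (conv p' \<bullet>\<^sub>o u) x)
      \<le> \<bar>t\<bar> * (norm u * C)" if "t \<noteq> 0" for t :: real
  proof -
    have tp: "integrable lborel (\<lambda>y. t * p' y)" using p' by simp
    have "\<bar>(conv p \<bullet>\<^sub>o u) (x + t *\<^sub>R b) - (conv p \<bullet>\<^sub>o u) x + t * (conv p' \<bullet>\<^sub>o u) x\<bar> \<le> norm u * (C * t\<^sup>2)"
      using conv_taylor[OF p tp, of u x "t *\<^sub>R b"] mult_left_mono[OF C[of t], of "norm u"]
      by (simp add: conv_cmult[OF p'] cop_apply.scaleR_left)
    then have "\<bar>(conv p \<bullet>\<^sub>o u) (x + t *\<^sub>R b) - (conv p \<bullet>\<^sub>o u) x + t * (conv p' \<bullet>\<^sub>o u) x\<bar> / \<bar>t\<bar> \<le> norm u * (C * t\<^sup>2) / \<bar>t\<bar>"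
      by (intro divide_right_mono) auto
    also have "\<bar>(conv p \<bullet>\<^sub>o u) (x + t *\<^sub>R b) - (conv p \<bullet>\<^sub>o u) x + t * (conv p' \<bullet>\<^sub>o u) x\<bar> / \<bar>t\<bar>
        = \<bar>((conv p \<bullet>\<^sub>o u) (x + t *\<^sub>R b) - (conv p \<bullet>\<^sub>o u) x) / t + (conv p' \<bullet>\<^sub>o u) x\<bar>"
      using that by (simp add: abs_divide[symmetric] add_divide_distrib)
    also have "norm u * (C * t\<^sup>2) / \<bar>t\<bar> = \<bar>t\<bar> * (norm u * C)"
      using that by (simp add: field_simps power2_eq_square)
    finally show ?thesis by simp
  qed
  then show "\<forall>\<^sub>F t in at 0. norm (((conv p \<bullet>\<^sub>o u) (x + (0 + t) *\<^sub>R b) - (conv p \<bullet>\<^sub>o u) (x + 0 *\<^sub>R b)) / t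
      - - (conv p' \<bullet>\<^sub>o u) x) \<le> \<bar>t\<bar> * (norm u * C)"
    by (auto simp: eventually_at_filter)
qed

lemma DERIV_conv_bump:
  fixes u :: "'a::euclidean_space \<Rightarrow>\<^sub>C real"
  assumes s: "0 < s" and b: "b \<in> Basis"
  shows "((\<lambda>t. (conv (bump s) \<bullet>\<^sub>o u) (x + t *\<^sub>R b)) has_real_derivative - (conv (dbump s b) \<bullet>\<^sub>o u) x) (at 0)"
proof -
  obtain C where "\<forall>h. (\<integral>y. \<bar>bump s (y - h) - bump s y + dbump s h (y::'a)\<bar> \<partial>lborel) \<le> C * (norm h)\<^sup>2"
    using integral_bump_taylor_le[OF s] by blast
  then have "(\<integral>y. \<bar>bump s (y - t *\<^sub>R b) - bump s y + t * dbump s b y\<bar> \<partial>lborel) \<le> C * t\<^sup>2" for t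
    using b by (auto dest!: spec[of _ "t *\<^sub>R b"] simp: dbump_def dbump0_scaleR)
  then show ?thesis by (rule DERIV_conv[OF integrable_bump[OF s] integrable_dbump(1)[OF s]])
qed

lemma DERIV_conv_dbump:
  fixes u :: "'a::euclidean_space \<Rightarrow>\<^sub>C real"
  assumes s: "0 < s" and b: "b \<in> Basis" "c \<in> Basis"
  shows "((\<lambda>t. (conv (dbump s b) \<bullet>\<^sub>o u) (x + t *\<^sub>R c)) has_real_derivative - (conv (ddbump s b c) \<bullet>\<^sub>o u) x) (at 0)"
  using DERIV_conv[OF integrable_dbump(1)[OF s] integrable_dbump(2)[OF s]] integral_dbump_taylor_le[OF s b] by blast

lemma partial_deriv_conv_bump:
  assumes "0 < s" "b \<in> Basis"
  shows "partial_deriv b (apply_bcontfun (conv (bump s) \<bullet>\<^sub>o u)) x = - (conv (dbump s b) \<bullet>\<^sub>o u) x"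
  unfolding partial_deriv_def by (rule DERIV_imp_deriv[OF DERIV_conv_bump[OF assms]])

text \<open>The resolvent equation is given for test functions in \<open>Cb 2\<close>; mollified
  functions are the ones to which it gets applied.\<close>

lemma Cb_2_conv_bump:
  fixes u :: "'a::euclidean_space \<Rightarrow>\<^sub>C real"
  assumes s: "0 < s"
  shows "Cb 2 (apply_bcontfun (conv (bump s) \<bullet>\<^sub>o u))"
proof -
  have 0: "Cb 0 (\<lambda>x. apply_bcontfun g x)" "Cb 0 (\<lambda>x. - apply_bcontfun g x)" for g :: "'a \<Rightarrow>\<^sub>C real"
    using bounded_apply_bcontfun[of g] bounded_apply_bcontfun[of "- g"]
    by (auto intro!: continuous_on_minus simp: uminus_bcontfun.rep_eq)
  have d1: "partial_deriv b (apply_bcontfun (conv (bump s) \<bullet>\<^sub>o u)) = (\<lambda>x. - (conv (dbump s b) \<bullet>\<^sub>o u) x)" if "b \<in> Basis" for b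
    using partial_deriv_conv_bump[OF s that] by blast
  have D2: "((\<lambda>t. - (conv (dbump s b) \<bullet>\<^sub>o u) (x + t *\<^sub>R c)) has_real_derivative (conv (ddbump s b c) \<bullet>\<^sub>o u) x) (at 0)"
    if "b \<in> Basis" "c \<in> Basis" for b c x
    using DERIV_minus[OF DERIV_conv_dbump[OF s that]] by simp
  have d2: "partial_deriv c (\<lambda>x. - (conv (dbump s b) \<bullet>\<^sub>o u) x) = (\<lambda>x. (conv (ddbump s b c) \<bullet>\<^sub>o u) x)"
    if "b \<in> Basis" "c \<in> Basis" for b c
    unfolding partial_deriv_def using DERIV_imp_deriv[OF D2[OF that]] by blast
  have "has_partial_deriv b (apply_bcontfun (conv (bump s) \<bullet>\<^sub>o u))" if "b \<in> Basis" for b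
    unfolding has_partial_deriv_def using DERIV_conv_bump[OF s that] real_differentiable_def by blast
  moreover have "has_partial_deriv c (\<lambda>x. - (conv (dbump s b) \<bullet>\<^sub>o u) x)" if "b \<in> Basis" "c \<in> Basis" for b c
    unfolding has_partial_deriv_def using D2[OF that] real_differentiable_def by blast
  ultimately show ?thesis
    using 0 by (simp add: numeral_2_eq_2 d1 d2)
qed

lemma gradient_conv_bump:
  fixes u :: "'a::euclidean_space \<Rightarrow>\<^sub>C real"
  assumes s: "0 < s"
  shows "h \<bullet> gradient (apply_bcontfun (conv (bump s) \<bullet>\<^sub>o u)) x = - (conv (dbump s h) \<bullet>\<^sub>o u) x"
proof -
  have I: "integrable lborel (\<lambda>y. u (x + y) * dbump s b y)" for b
    by (intro integrable_bcontfun_mult integrable_dbump s) auto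
  have lin: "(\<Sum>b\<in>Basis. (h \<bullet> b) * dbump s b y) = dbump s h y" for y
    using euclidean_inner[of h y]
    by (simp add: dbump_def dbump0_def sum_distrib_left sum_distrib_right sum_divide_distrib inner_commute sum_negf mult_ac)
  have eq: "u (x + y) * dbump s h y = (\<Sum>b\<in>Basis. (h \<bullet> b) * (u (x + y) * dbump s b y))" for y
    by (subst lin[symmetric]) (simp add: sum_distrib_left mult_ac)
  have "h \<bullet> gradient (apply_bcontfun (conv (bump s) \<bullet>\<^sub>o u)) x = (\<Sum>b\<in>Basis. (h \<bullet> b) * - (conv (dbump s b) \<bullet>\<^sub>o u) x)"
    unfolding gradient_def inner_sum_right
    by (intro sum.cong refl) (simp add: partial_deriv_conv_bump[OF s] mult.commute)
  also have "\<dots> = - (\<integral>y. u (x + y) * dbump s h y \<partial>lborel)"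
    unfolding eq using I by (simp add: conv_apply integrable_dbump[OF s] sum_negf)
  finally show ?thesis by (simp add: conv_apply integrable_dbump[OF s])
qed

lemma conv_bump_taylor:
  fixes u :: "'a::euclidean_space \<Rightarrow>\<^sub>C real"
  assumes s: "0 < s"
  obtains C where "0 \<le> C" "\<And>x h. \<bar>(conv (bump s) \<bullet>\<^sub>o u) (x + h) - (conv (bump s) \<bullet>\<^sub>o u) x
      - h \<bullet> gradient (apply_bcontfun (conv (bump s) \<bullet>\<^sub>o u)) x\<bar> \<le> C * (norm h)\<^sup>2"
proof -
  obtain C where C: "0 \<le> C" "\<And>h. (\<integral>y. \<bar>bump s (y - h) - bump s y + dbump s h (y::'a)\<bar> \<partial>lborel) \<le> C * (norm h)\<^sup>2"
    using integral_bump_taylor_le[OF s] by blast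
  have "\<bar>(conv (bump s) \<bullet>\<^sub>o u) (x + h) - (conv (bump s) \<bullet>\<^sub>o u) x
      - h \<bullet> gradient (apply_bcontfun (conv (bump s) \<bullet>\<^sub>o u)) x\<bar> \<le> (norm u * C) * (norm h)\<^sup>2" for x h
    using conv_taylor[OF integrable_bump[OF s] integrable_dbump(1)[OF s], of u x h h] mult_left_mono[OF C(2)[of h], of "norm u"]
    by (simp add: gradient_conv_bump[OF s])
  then show thesis using C(1) that[of "norm u * C"] by simp
qed

section \<open>Integrals of stable kernels\<close>

text \<open>Split at \<open>\<delta>\<close>: below it the square leaves
  \<open>r powr (1 - a)\<close>, integrable at 0 because \<open>a < 2\<close>; above it
  \<open>r powr (- 1 - a)\<close> is integrable at infinity because \<open>0 < a\<close>.\<close>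

lemma nn_integral_min_powr_le:
  fixes a \<delta> :: real
  assumes a: "0 < a" "a < 2" and \<delta>: "0 < \<delta>"
  shows "(\<integral>\<^sup>+r. ennreal (min 1 ((r / \<delta>)\<^sup>2) * r powr (- 1 - a)) * indicator {0<..} r \<partial>lborel)
    \<le> ennreal ((1 / a + 1 / (2 - a)) * \<delta> powr (- a))"
proof -
  have 1: "((\<lambda>r. r powr (1 - a)) has_integral (\<delta> powr (2 - a) / (2 - a))) {0..\<delta>}"
    using has_integral_powr_from_0[of "1 - a" \<delta>] a \<delta> by simp
  have 2: "((\<lambda>r. r powr (- 1 - a)) has_integral (\<delta> powr (- a) / a)) {\<delta>..}"
    using has_integral_powr_to_inf[of "- 1 - a" \<delta>] a \<delta> by simp
  have I1: "(\<integral>\<^sup>+r. ennreal (r powr (1 - a)) * indicator {0..\<delta>} r \<partial>lborel) = ennreal (\<delta> powr (2 - a) / (2 - a))"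
    by (rule nn_integral_has_integral_lebesgue'[OF _ 1]) auto
  have I2: "(\<integral>\<^sup>+r. ennreal (r powr (- 1 - a)) * indicator {\<delta>..} r \<partial>lborel) = ennreal (\<delta> powr (- a) / a)"
    by (rule nn_integral_has_integral_lebesgue'[OF _ 2]) auto
  have "(\<integral>\<^sup>+r. ennreal (min 1 ((r / \<delta>)\<^sup>2) * r powr (- 1 - a)) * indicator {0<..} r \<partial>lborel)
      \<le> (\<integral>\<^sup>+r. ennreal (1 / \<delta>\<^sup>2) * (ennreal (r powr (1 - a)) * indicator {0..\<delta>} r)
           + ennreal (r powr (- 1 - a)) * indicator {\<delta>..} r \<partial>lborel)"
  proof (rule nn_integral_mono)
    fix r :: real
    consider "r \<le> 0" | "0 < r" "r \<le> \<delta>" | "\<delta> < r" by linarith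
    then show "ennreal (min 1 ((r / \<delta>)\<^sup>2) * r powr (- 1 - a)) * indicator {0<..} r
      \<le> ennreal (1 / \<delta>\<^sup>2) * (ennreal (r powr (1 - a)) * indicator {0..\<delta>} r)
           + ennreal (r powr (- 1 - a)) * indicator {\<delta>..} r" (is "?L \<le> ?R1 + ?R2")
    proof cases
      case 2
      have "r\<^sup>2 * r powr (- 1 - a) = r powr (1 - a)"
        using 2 powr_add[of r 2 "- 1 - a"] by simp
      then have "min 1 ((r / \<delta>)\<^sup>2) * r powr (- 1 - a) \<le> 1 / \<delta>\<^sup>2 * r powr (1 - a)"
        using mult_right_mono[of "min 1 ((r / \<delta>)\<^sup>2)" "(r / \<delta>)\<^sup>2" "r powr (- 1 - a)"]
        by (simp add: power_divide)
      then have "?L \<le> ennreal (1 / \<delta>\<^sup>2 * r powr (1 - a))"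
        using 2 by (simp add: ennreal_leI)
      also have "\<dots> = ?R1" using 2 by (simp add: ennreal_mult[symmetric])
      also have "\<dots> \<le> ?R1 + ?R2" by simp
      finally show ?thesis .
    next
      case 3
      have "min 1 ((r / \<delta>)\<^sup>2) * r powr (- 1 - a) \<le> 1 * r powr (- 1 - a)"
        by (intro mult_right_mono) auto
      then have "?L \<le> ennreal (r powr (- 1 - a))"
        using 3 \<delta> by (simp add: ennreal_leI)
      also have "\<dots> = ?R2" using 3 by simp
      also have "\<dots> \<le> ?R1 + ?R2" by simp
      finally show ?thesis .
    qed simp
  qed
  also have "\<dots> = ennreal (1 / \<delta>\<^sup>2) * ennreal (\<delta> powr (2 - a) / (2 - a)) + ennreal (\<delta> powr (- a) / a)"
    by (simp add: nn_integral_add nn_integral_cmult I1 I2)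
  also have "\<dots> = ennreal (1 / \<delta>\<^sup>2 * (\<delta> powr (2 - a) / (2 - a)) + \<delta> powr (- a) / a)"
    using a by (subst ennreal_mult[symmetric]) (auto intro!: ennreal_plus[symmetric])
  also have "1 / \<delta>\<^sup>2 * (\<delta> powr (2 - a) / (2 - a)) = \<delta> powr (- a) / (2 - a)"
    using \<delta> by (simp add: powr_diff powr_minus field_simps)
  finally show ?thesis by (simp add: algebra_simps)
qed

text \<open>The power of 2 bounds \<open>2 powr (DIM('a) + 1 + a)\<close> for \<open>a < 2\<close>,
  the loss from comparing a radius with one up to twice as large; the volume comes from integrating
  the indicator of a ball.\<close>

definition stable_const :: "'a::euclidean_space itself \<Rightarrow> real"
  where "stable_const _ = 2 ^ (DIM('a) + 3) * unit_ball_vol (real DIM('a))"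

lemma stable_const_nonneg: "0 \<le> stable_const TYPE('a::euclidean_space)"
  by (simp add: stable_const_def)

definition stable_kernel :: "real \<Rightarrow> 'a::euclidean_space \<Rightarrow> real"
  where "stable_kernel a h = norm h powr - (real DIM('a) + a)"

lemma measurable_stable_kernel [measurable]: "stable_kernel a \<in> borel_measurable borel"
  unfolding stable_kernel_def[abs_def] by measurable

lemma stable_kernel_nonneg [simp]: "0 \<le> stable_kernel a h" by (simp add: stable_kernel_def)

text \<open>Fubini for the representation of the radial integrand as a superposition of indicators of balls.\<close>

lemma nn_integral_stable_kernel_le:
  fixes a \<delta> :: real
  assumes a: "0 < a" "a < 2" and \<delta>: "0 < \<delta>"
  shows "(\<integral>\<^sup>+h. ennreal (min 1 ((norm h / \<delta>)\<^sup>2) * stable_kernel a (h::'a::euclidean_space)) \<partial>lborel)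
    \<le> ennreal (stable_const TYPE('a) * (1 / a + 1 / (2 - a)) * \<delta> powr (- a))"
proof -
  let ?d = "real DIM('a)"
  let ?g = "\<lambda>r. min 1 ((r / \<delta>)\<^sup>2) * r powr (- (?d + 1 + a))"
  let ?G = "\<lambda>(h::'a, r). ennreal (2 ^ (DIM('a) + 3) * ?g r) * indicator {(h, r). 0 < r \<and> norm h \<le> r} (h, r)"
  have "{z \<in> space (borel \<Otimes>\<^sub>M borel). 0 < snd z \<and> norm (fst z :: 'a) \<le> (snd z :: real)} \<in> sets (borel \<Otimes>\<^sub>M borel)"
    by measurable
  also have "{z \<in> space (borel \<Otimes>\<^sub>M borel). 0 < snd z \<and> norm (fst z :: 'a) \<le> (snd z :: real)} = {(h::'a, r::real). 0 < r \<and> norm h \<le> r}"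
    by (auto simp: space_pair_measure)
  finally have [measurable]: "{(h::'a, r::real). 0 < r \<and> norm h \<le> r} \<in> sets (borel \<Otimes>\<^sub>M borel)" .
  have [measurable]: "?G \<in> borel_measurable (borel \<Otimes>\<^sub>M borel)"
    by measurable
  \<comment> \<open>Radii between \<open>norm h\<close> and its double already recover the
    integrand, since an interval of length \<open>norm h\<close> makes up for the extra power of
    \<open>r\<close> in \<open>?g\<close>. After the exchange of integrals the indicator contributes
    only the volume of a ball, so no polar coordinates enter.\<close>
  have le: "ennreal (min 1 ((norm h / \<delta>)\<^sup>2) * stable_kernel a h) \<le> (\<integral>\<^sup>+r. ?G (h, r) \<partial>lborel)" for h :: 'a
  proof (cases "h = 0")
    case False
    define s where "s = norm h"
    have s: "0 < s" using False by (simp add: s_def)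
    let ?c = "min 1 ((s / \<delta>)\<^sup>2) * (2 * s) powr (- (?d + 1 + a))"
    have p: "2 powr (?d + 1 + a) \<le> 2 ^ (DIM('a) + 3)"
      using a powr_mono[of "?d + 1 + a" "real (DIM('a) + 3)" 2] by (subst powr_realpow[symmetric]) auto
    have "min 1 ((norm h / \<delta>)\<^sup>2) * stable_kernel a h = 2 powr (?d + 1 + a) * (?c * s)"
    proof -
      have "s powr - (?d + 1 + a) * s = s powr - (?d + a)"
        using s powr_add[of s "- (?d + 1 + a)" 1] by simp
      moreover have "2 powr (?d + 1 + a) * 2 powr - (?d + 1 + a) = (1::real)"
        by (subst powr_add[symmetric]) simp
      then have "2 powr (?d + 1 + a) * (?c * s) = min 1 ((s / \<delta>)\<^sup>2) * (s powr - (?d + 1 + a) * s)"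
        using s by (subst powr_mult) (auto simp: mult_ac)
      ultimately show ?thesis by (simp only: stable_kernel_def s_def[symmetric])
    qed
    also have "\<dots> \<le> 2 ^ (DIM('a) + 3) * (?c * s)"
      using s by (intro mult_right_mono p) auto
    finally have "ennreal (min 1 ((norm h / \<delta>)\<^sup>2) * stable_kernel a h) \<le> ennreal (2 ^ (DIM('a) + 3) * ?c * s)"
      by (intro ennreal_leI) (simp add: mult_ac)
    also have "\<dots> = (\<integral>\<^sup>+r. ennreal (2 ^ (DIM('a) + 3) * ?c) * indicator {s..2 * s} r \<partial>lborel)"
      using s by (simp add: nn_integral_cmult ennreal_mult'')
    also have "\<dots> \<le> (\<integral>\<^sup>+r. ?G (h, r) \<partial>lborel)"
    proof (rule nn_integral_mono)
      fix r :: real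
      have "?c \<le> ?g r" if "s \<le> r" "r \<le> 2 * s"
      proof (intro mult_mono)
        show "min 1 ((s / \<delta>)\<^sup>2) \<le> min 1 ((r / \<delta>)\<^sup>2)"
          using that s \<delta> by (intro min.mono power_mono divide_right_mono) auto
        show "(2 * s) powr - (?d + 1 + a) \<le> r powr - (?d + 1 + a)"
          using that s a by (intro powr_mono2') auto
      qed auto
      note c = this
      show "ennreal (2 ^ (DIM('a) + 3) * ?c) * indicator {s..2 * s} r \<le> ?G (h, r)"
      proof (cases "s \<le> r \<and> r \<le> 2 * s")
        case True
        then have "?G (h, r) = ennreal (2 ^ (DIM('a) + 3) * ?g r)"
          using s less_le_trans[OF s, of r] by (simp add: s_def)
        then show ?thesis using True c by (auto intro!: ennreal_leI mult_left_mono)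
      qed simp
    qed
    finally show ?thesis .
  qed (simp add: stable_kernel_def)
  have "(\<integral>\<^sup>+h. ennreal (min 1 ((norm h / \<delta>)\<^sup>2) * stable_kernel a (h::'a)) \<partial>lborel)
      \<le> (\<integral>\<^sup>+h. \<integral>\<^sup>+r. ?G (h, r) \<partial>lborel \<partial>lborel)"
    by (rule nn_integral_mono) (rule le)
  also have "\<dots> = (\<integral>\<^sup>+r. \<integral>\<^sup>+h. ?G (h, r) \<partial>lborel \<partial>lborel)"
    by (rule lborel_pair.Fubini'[symmetric]) simp
  also have "\<dots> = (\<integral>\<^sup>+r. ennreal (stable_const TYPE('a)) * (ennreal (min 1 ((r / \<delta>)\<^sup>2) * r powr (- 1 - a)) * indicator {0<..} r) \<partial>lborel)"
  proof (rule nn_integral_cong)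
    fix r :: real
    show "(\<integral>\<^sup>+h. ?G (h, r) \<partial>lborel)
      = ennreal (stable_const TYPE('a)) * (ennreal (min 1 ((r / \<delta>)\<^sup>2) * r powr (- 1 - a)) * indicator {0<..} r)"
    proof (cases "0 < r")
      case True
      have "(\<integral>\<^sup>+h. ?G (h, r) \<partial>lborel) = (\<integral>\<^sup>+h. ennreal (2 ^ (DIM('a) + 3) * ?g r) * indicator (cball (0::'a) r) h \<partial>lborel)"
        using True by (intro nn_integral_cong) (auto simp: indicator_def)
      also have "\<dots> = ennreal (2 ^ (DIM('a) + 3) * ?g r) * ennreal (unit_ball_vol ?d * r ^ DIM('a))"
        using True by (subst nn_integral_cmult_indicator) (auto simp: emeasure_cball)
      also have "\<dots> = ennreal (2 ^ (DIM('a) + 3) * ?g r * (unit_ball_vol ?d * r ^ DIM('a)))"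
        using True by (intro ennreal_mult''[symmetric]) auto
      also have "r powr (- (?d + 1 + a)) * r ^ DIM('a) = r powr (- 1 - a)"
        using True powr_add[of r "- (?d + 1 + a)" ?d] by (simp add: powr_realpow)
      then have "2 ^ (DIM('a) + 3) * ?g r * (unit_ball_vol ?d * r ^ DIM('a))
          = stable_const TYPE('a) * (min 1 ((r / \<delta>)\<^sup>2) * r powr (- 1 - a))"
        by (simp add: stable_const_def mult_ac)
      finally show ?thesis
        using True by (simp add: ennreal_mult' stable_const_nonneg)
    qed simp
  qed
  also have "\<dots> = ennreal (stable_const TYPE('a)) *
      (\<integral>\<^sup>+r. ennreal (min 1 ((r / \<delta>)\<^sup>2) * r powr (- 1 - a)) * indicator {0<..} r \<partial>lborel)"
    by (rule nn_integral_cmult) measurable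
  also have "\<dots> \<le> ennreal (stable_const TYPE('a)) * ennreal ((1 / a + 1 / (2 - a)) * \<delta> powr (- a))"
    by (intro mult_left_mono nn_integral_min_powr_le assms) simp
  also have "\<dots> = ennreal (stable_const TYPE('a) * (1 / a + 1 / (2 - a)) * \<delta> powr (- a))"
    using a by (subst ennreal_mult[symmetric]) (auto simp: stable_const_nonneg mult.assoc)
  finally show ?thesis .
qed

lemma
  fixes a \<delta> :: real
  assumes a: "a0 \<le> a" "a \<le> a1" "0 < a0" "a1 < 2" and \<delta>: "0 < \<delta>"
  shows integrable_stable_kernel: "integrable lborel (\<lambda>h::'a::euclidean_space. min 1 ((norm h / \<delta>)\<^sup>2) * stable_kernel a h)"
    and integral_stable_kernel_le: "(\<integral>h. min 1 ((norm h / \<delta>)\<^sup>2) * stable_kernel a (h::'a) \<partial>lborel)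
      \<le> stable_const TYPE('a) * (1 / a0 + 1 / (2 - a1)) * \<delta> powr (- a)"
proof -
  have a': "0 < a" "a < 2" using a by auto
  have nn: "(\<integral>\<^sup>+h. ennreal (min 1 ((norm h / \<delta>)\<^sup>2) * stable_kernel a (h::'a)) \<partial>lborel)
      \<le> ennreal (stable_const TYPE('a) * (1 / a0 + 1 / (2 - a1)) * \<delta> powr (- a))"
    using a stable_const_nonneg[where 'a='a]
    by (intro order_trans[OF nn_integral_stable_kernel_le[OF a' \<delta>]] ennreal_leI mult_right_mono mult_left_mono add_mono divide_left_mono) auto
  show i: "integrable lborel (\<lambda>h::'a. min 1 ((norm h / \<delta>)\<^sup>2) * stable_kernel a h)"
    by (rule integrableI_bounded) (use order_le_less_trans[OF nn] in \<open>auto\<close>)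
  show "(\<integral>h. min 1 ((norm h / \<delta>)\<^sup>2) * stable_kernel a (h::'a) \<partial>lborel)
      \<le> stable_const TYPE('a) * (1 / a0 + 1 / (2 - a1)) * \<delta> powr (- a)"
    using a stable_const_nonneg[where 'a='a] by (intro integral_real_bounded nn) auto
qed

section \<open>Generators of symmetric jump processes\<close>

definition diff2 :: "'a::euclidean_space \<Rightarrow> 'a cop"
  where "diff2 h = shift h + shift (- h) - 2 *\<^sub>R 1"

definition gen :: "('a::euclidean_space \<Rightarrow> real) \<Rightarrow> 'a cop"
  where "gen q = conv q - (\<integral>h. q h \<partial>lborel) *\<^sub>R 1"

lemma cop_apply_simps:
  "apply_bcontfun ((A - B) \<bullet>\<^sub>o u) x = (A \<bullet>\<^sub>o u) x - (B \<bullet>\<^sub>o u) x"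
  "apply_bcontfun ((A + B) \<bullet>\<^sub>o u) x = (A \<bullet>\<^sub>o u) x + (B \<bullet>\<^sub>o u) x"
  "apply_bcontfun ((c *\<^sub>R A) \<bullet>\<^sub>o u) x = c * (A \<bullet>\<^sub>o u) x"
  by (simp_all add: cop_apply.diff_left cop_apply.add_left cop_apply.scaleR_left)

lemma diff2_apply: "apply_bcontfun (diff2 h \<bullet>\<^sub>o u) x = u (x + h) + u (x - h) - 2 * u x"
  by (simp add: diff2_def cop_apply_simps)

text \<open>With this factorisation each half of a semigroup can absorb one first
  difference.\<close>

lemma diff2_eq: "diff2 h = (shift h - 1) * (1 - shift (- h))"
  by (simp add: diff2_def algebra_simps shift_mult shift_0 scaleR_2)

lemma norm_diff2: "norm (diff2 h :: 'a::euclidean_space cop) \<le> 4"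
proof -
  have "norm (shift h + shift (- h) - 2 *\<^sub>R 1 :: 'a cop) \<le> norm (shift h + shift (- h) :: 'a cop) + 2"
    by (rule order_trans[OF norm_triangle_ineq4]) simp
  also have "\<dots> \<le> 1 + 1 + 2"
    using norm_shift[of h] norm_shift[of "- h"] norm_triangle_ineq[of "shift h" "shift (- h)"] by simp
  finally show ?thesis by (simp add: diff2_def)
qed

lemma gen_apply:
  assumes q: "integrable lborel q"
  shows "apply_bcontfun (gen q \<bullet>\<^sub>o u) x = (\<integral>h. (u (x + h) - u x) * q h \<partial>lborel)"
  using q integrable_bcontfun_mult[OF _ q, of "\<lambda>h. x + h" u]
  by (simp add: gen_def cop_apply_simps conv_apply left_diff_distrib)

text \<open>Averaging over \<open>h\<close> and \<open>- h\<close> turns first differences into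
  second ones, which are quadratically small in \<open>h\<close>. Evenness of the kernel thus takes
  over the role of the gradient term.\<close>

lemma gen_apply_diff2:
  assumes q: "integrable lborel q" and even: "\<And>h. q (- h) = q h"
  shows "apply_bcontfun (gen q \<bullet>\<^sub>o u) x = (\<integral>h. (diff2 h \<bullet>\<^sub>o u) x * q h \<partial>lborel) / 2"
proof -
  have [measurable]: "q \<in> borel_measurable borel" using q by (rule integrable_lborel_measurable)
  have i: "integrable lborel (\<lambda>h. (u (x + h) - u x) * q h)" "integrable lborel (\<lambda>h. (u (x - h) - u x) * q h)"
    using q integrable_bcontfun_mult[OF _ q, of "\<lambda>h. x + h" u] integrable_bcontfun_mult[OF _ q, of "\<lambda>h. x - h" u]
    by (auto simp: left_diff_distrib)
  have "(\<integral>h. (u (x + h) - u x) * q h \<partial>lborel) = (\<integral>h. (u (x - h) - u x) * q h \<partial>lborel)"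
    using integral_lborel_reflect_shift[of "\<lambda>h. (u (x + h) - u x) * q h" "-1" 0] by (simp add: even)
  then have "2 * (gen q \<bullet>\<^sub>o u) x = (\<integral>h. (u (x + h) - u x) * q h + (u (x - h) - u x) * q h \<partial>lborel)"
    using i by (simp add: gen_apply[OF q])
  also have "\<dots> = (\<integral>h. (diff2 h \<bullet>\<^sub>o u) x * q h \<partial>lborel)"
    by (simp add: diff2_apply algebra_simps)
  finally show ?thesis by simp
qed

text \<open>The density \<open>q\<close> may change sign and enters through a majorant
  \<open>r\<close>: in the main application it is the difference of two jump kernels.\<close>

lemma norm_gen_apply_le:
  assumes q: "integrable lborel q" and even: "\<And>h. q (- h) = q h"
    and K: "\<And>h. norm (diff2 h \<bullet>\<^sub>o u) \<le> K h" and qK: "integrable lborel (\<lambda>h. K h * r h)" and qr: "\<And>h. \<bar>q h\<bar> \<le> r h"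
  shows "norm (gen q \<bullet>\<^sub>o u) \<le> (\<integral>h. K h * r h \<partial>lborel) / 2"
proof (rule norm_bound)
  fix x
  have [measurable]: "q \<in> borel_measurable borel" using q by (rule integrable_lborel_measurable)
  have le: "\<bar>(diff2 h \<bullet>\<^sub>o u) x * q h\<bar> \<le> K h * r h" for h
    unfolding abs_mult using order_trans[OF abs_bcontfun_le K, of h x] qr[of h]
    by (intro mult_mono) (auto intro: order_trans[OF norm_ge_zero K])
  have m: "(\<lambda>h. (diff2 h \<bullet>\<^sub>o u) x * q h) \<in> borel_measurable borel"
    unfolding diff2_apply by measurable
  have i: "integrable lborel (\<lambda>h. (diff2 h \<bullet>\<^sub>o u) x * q h)"
    by (rule Bochner_Integration.integrable_bound[OF qK]) (use m le in \<open>auto intro!: AE_I2 intro: order_trans[OF le]\<close>)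
  have "\<bar>\<integral>h. (diff2 h \<bullet>\<^sub>o u) x * q h \<partial>lborel\<bar> \<le> (\<integral>h. \<bar>(diff2 h \<bullet>\<^sub>o u) x * q h\<bar> \<partial>lborel)"
    by (rule integral_abs_bound)
  also have "\<dots> \<le> (\<integral>h. K h * r h \<partial>lborel)"
    by (intro integral_mono integrable_abs i qK le)
  finally show "norm ((gen q \<bullet>\<^sub>o u) x) \<le> (\<integral>h. K h * r h \<partial>lborel) / 2"
    by (simp add: gen_apply_diff2[OF q even])
qed

lemma gen_commute:
  assumes "integrable lborel p" "integrable lborel q"
  shows "gen p * gen q = gen q * gen p"
  using conv_commute[OF assms] by (simp add: gen_def algebra_simps)

lemma gen_conv_commute:
  assumes "integrable lborel p" "integrable lborel q"
  shows "gen p * conv q = conv q * gen p"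
  using conv_commute[OF assms] by (simp add: gen_def algebra_simps)

lemma gen_shift_commute:
  assumes "integrable lborel p"
  shows "gen p * shift h = shift h * gen p"
  using conv_shift_commute[OF assms] by (simp add: gen_def algebra_simps)

lemma gen_add:
  assumes "integrable lborel p" "integrable lborel q"
  shows "gen (\<lambda>h. p h + q h) = gen p + gen q"
  using assms by (simp add: gen_def conv_add scaleR_add_left)

lemma gen_diff:
  assumes "integrable lborel p" "integrable lborel q"
  shows "gen (\<lambda>h. p h - q h) = gen p - gen q"
  using assms by (simp add: gen_def conv_diff scaleR_diff_left)

lemma gen_cmult:
  assumes "integrable lborel p"
  shows "gen (\<lambda>h. c * p h) = c *\<^sub>R gen p"
  using assms by (simp add: gen_def conv_cmult scaleR_diff_right)

lemma norm_gen_le: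
  assumes q: "integrable lborel q"
  shows "norm (gen q) \<le> 2 * (\<integral>h. \<bar>q h\<bar> \<partial>lborel)"
proof -
  have "norm (gen q) \<le> norm (conv q) + \<bar>\<integral>h. q h \<partial>lborel\<bar>"
    unfolding gen_def by (rule order_trans[OF norm_triangle_ineq4]) simp
  then show ?thesis
    using norm_conv[OF q] integral_abs_bound[of lborel q] by linarith
qed

lemma norm_exp_gen_le:
  assumes q: "integrable lborel q" and nn: "\<And>h. 0 \<le> q h" and t: "0 \<le> t"
  shows "norm (exp (t *\<^sub>R gen q)) \<le> 1"
  unfolding gen_def using norm_conv[OF q] nn by (intro norm_exp_contraction t) simp

lemma norm_conv_bump: "0 < s \<Longrightarrow> norm (conv (bump s) :: 'a::euclidean_space cop) \<le> 1"
  using norm_conv[OF integrable_bump[of s, where 'a='a]] integral_bump[of s, where 'a='a]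
  by (simp add: bump_nonneg)

lemma gen_bump: "0 < s \<Longrightarrow> gen (bump s) = conv (bump s) - 1"
  by (simp add: gen_def integral_bump)

lemma norm_shift_conv_bump:
  assumes s: "0 < s"
  shows "norm ((shift h - 1) * conv (bump s :: 'a::euclidean_space \<Rightarrow> real)) \<le> bump_const TYPE('a) * norm h / s"
proof -
  note i = integrable_bump[OF s, where 'a='a]
  have ih: "integrable lborel (\<lambda>y. bump s (y - h))"
    using integrable_lborel_reflect_shift[of "bump s" 1 "- h"] i by simp
  have "shift h * conv (bump s) = conv (\<lambda>y. bump s (y - h))"
  proof (intro cop_eqI bcontfun_eqI)
    fix g :: "'a \<Rightarrow>\<^sub>C real" and x
    show "((shift h * conv (bump s)) \<bullet>\<^sub>o g) x = (conv (\<lambda>y. bump s (y - h)) \<bullet>\<^sub>o g) x"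
      using integral_lborel_reflect_shift[of "\<lambda>y. g (x + y) * bump s (y - h)" 1 h]
      by (simp add: conv_apply[OF i] conv_apply[OF ih] add.assoc)
  qed
  then have "(shift h - 1) * conv (bump s) = conv (\<lambda>y. bump s (y - h) - bump s y)"
    by (simp add: conv_diff[OF ih i] left_diff_distrib)
  then have "norm ((shift h - 1) * conv (bump s)) \<le> (\<integral>y. \<bar>bump s (y + (- h)) - bump s y\<bar> \<partial>lborel)"
    using norm_conv[of "\<lambda>y. bump s (y - h) - bump s y"] i ih by simp
  also have "\<dots> \<le> bump_const TYPE('a) * norm h / s"
    using integral_bump_diff_le[OF s, of "- h"] by simp
  finally show ?thesis .
qed

section \<open>The frozen semigroups\<close>

lemma sum_powers_le:
  fixes q :: real
  assumes q: "2 \<le> q"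
  shows "(\<Sum>j\<le>m. q ^ j) \<le> 2 * q ^ m"
proof (induction m)
  case (Suc m)
  have "2 * q ^ m \<le> q * q ^ m" using q by (intro mult_right_mono) auto
  then show ?case using Suc by simp
qed simp

text \<open>In the application \<open>b j\<close> bounds the derivative of the semigroup restricted to jumps of
  size at most \<open>2\<^sup>-\<^sup>j\<close>; the smoothing scale \<open>t\<^sup>-\<^sup>1\<^sup>/\<^sup>a\<close> is where jumps start to be frequent.\<close>

lemma smoothing_recursion:
  fixes b :: "nat \<Rightarrow> real"
  assumes t: "0 < t" "t \<le> 1" and a: "a0 \<le> a" "0 < a0" and M: "1 \<le> M" "2 \<le> c * M powr a0" "0 < c"
    and top: "b (Suc J) \<le> 2 ^ J"
    and rec: "\<And>j. j \<le> J \<Longrightarrow> b j \<le> exp (- (t * (c * (2 ^ j) powr a))) * b (Suc j)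
      + (1 - exp (- (t * (c * (2 ^ j) powr a)))) * 2 ^ j"
  shows "b 0 \<le> 4 * M * t powr (- 1 / a)"
proof -
  let ?T = "t powr (- 1 / a)"
  have a': "0 < a" using a by simp
  have T: "1 \<le> ?T" using t a' powr_mono2'[of "- 1 / a" t 1] by simp
  \<comment> \<open>Downward induction from the finest level. The bound halves from level to level
    with \<open>2 ^ j\<close> until it reaches a plateau of the order of \<open>?T\<close>, which it
    then keeps.\<close>
  have "b j \<le> 2 * max (2 ^ j) (2 * M * ?T)" if "j \<le> Suc J" for j
    using that
  proof (induction j rule: inc_induct)
    case base
    have "(2::real) ^ J \<le> 2 * 2 ^ Suc J" by simp
    also have "\<dots> \<le> 2 * max (2 ^ Suc J) (2 * M * ?T)" by (intro mult_left_mono) auto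
    finally show ?case using top by linarith
  next
    case (step j)
    define E where "E = exp (- (t * (c * (2 ^ j) powr a)))"
    have E: "0 < E" "E \<le> 1" using t M by (auto simp: E_def)
    have r: "b j \<le> E * b (Suc j) + (1 - E) * 2 ^ j"
      using rec[of j] step.hyps by (simp add: E_def)
    show ?case
    proof (cases "M * ?T \<le> 2 ^ j")
      case True
      have "M powr a0 \<le> M powr a" using M a by (intro powr_mono) auto
      then have "c * M powr a0 \<le> c * M powr a" using M by simp
      also have "\<dots> = t * (c * (M * ?T) powr a)"
      proof -
        have e: "- 1 / a * a = - 1" using a' by simp
        have "?T powr a = 1 / t" unfolding powr_powr e using t(1) by (rule powr_neg_one)
        then show ?thesis using t M by (simp add: powr_mult)
      qed
      also have "\<dots> \<le> t * (c * (2 ^ j) powr a)"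
        using t M a' True T by (intro mult_left_mono powr_mono2) auto
      \<comment> \<open>The expected number of jumps of this size is at least two, so the
        probability \<open>E\<close> of none is at most 1/4. This beats the factor 4 between
        \<open>2 * 2 ^ Suc j\<close> and \<open>2 ^ j\<close>.\<close>
      finally have "2 \<le> t * (c * (2 ^ j) powr a)" using M by linarith
      then have "E \<le> exp (-2)" by (simp add: E_def)
      also have "exp (-2 :: real) \<le> 1 / 4"
      proof -
        have "(2::real) * 2 \<le> exp 1 * exp 1" using exp_ge_add_one_self[of 1] by (intro mult_mono) auto
        then show ?thesis by (simp add: exp_minus field_simps flip: exp_add)
      qed
      finally have E4: "E \<le> 1 / 4" .
      have mx: "max (2 ^ Suc j) (2 * M * ?T) = 2 ^ Suc j" using True by (simp add: max_def)
      have "E * b (Suc j) \<le> E * (2 * 2 ^ Suc j)"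
        using step.IH E unfolding mx by (intro mult_left_mono) auto
      also have "\<dots> \<le> 1 / 4 * (2 * 2 ^ Suc j)" using E4 by (intro mult_right_mono) auto
      finally have 1: "E * b (Suc j) \<le> 2 ^ j" by simp
      have "(1 - E) * 2 ^ j \<le> 1 * 2 ^ j" using E by (intro mult_right_mono) auto
      with r 1 have "b j \<le> 2 * 2 ^ j" by linarith
      also have "\<dots> \<le> 2 * max (2 ^ j) (2 * M * ?T)" by simp
      finally show ?thesis .
    next
      case False
      \<comment> \<open>On the plateau both terms of the convex combination are bounded by the same
        value, so the bound no longer changes.\<close>
      then have mx: "max (2 ^ Suc j) (2 * M * ?T) = 2 * M * ?T" by (simp add: max_def)
      have "E * b (Suc j) \<le> E * (2 * (2 * M * ?T))"
        using step.IH E unfolding mx by (intro mult_left_mono) auto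
      moreover have "(1 - E) * 2 ^ j \<le> (1 - E) * (2 * (2 * M * ?T))"
      proof (intro mult_left_mono)
        show "2 ^ j \<le> 2 * (2 * M * ?T)" 
        proof -
          have "0 \<le> M * ?T" using M T by simp
          then show ?thesis using False by linarith
        qed
      qed (use E in simp)
      ultimately have "b j \<le> 2 * (2 * M * ?T)" using r by (simp add: algebra_simps)
      also have "\<dots> \<le> 2 * max (2 ^ j) (2 * M * ?T)" by simp
      finally show ?thesis .
    qed
  qed
  from this[of 0] have "b 0 \<le> 2 * max 1 (2 * M * ?T)" by simp
  moreover have "1 \<le> M * ?T" using mult_mono[OF M(1) T] M by simp
  ultimately show ?thesis by (simp add: max_def split: if_splits)
qed

text \<open>\<open>\<psi> k\<close> and \<open>\<beta> k\<close> bound the oscillation of \<open>n\<close> and \<open>\<alpha>\<close> at distance \<open>2\<^sup>1\<^sup>-\<^sup>k\<close>;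
  their summability expresses the Dini conditions.\<close>

locale stable_like =
  fixes n :: "'a::euclidean_space \<Rightarrow> 'a \<Rightarrow> real" and \<alpha> :: "'a \<Rightarrow> real"
    and \<kappa>1 \<kappa>2 a0 a1 :: real and \<psi> \<beta> :: "nat \<Rightarrow> real"
  assumes n_meas: "(\<lambda>(x, h). n x h) \<in> borel_measurable (borel \<Otimes>\<^sub>M borel)"
    and n_even: "n x (- h) = n x h"
    and \<kappa>1: "0 < \<kappa>1" and n_ge: "\<kappa>1 \<le> n x h" and n_le: "n x h \<le> \<kappa>2"
    and a0: "0 < a0" and a1: "a1 < 2" and \<alpha>_ge: "a0 \<le> \<alpha> x" and \<alpha>_le: "\<alpha> x \<le> a1"
    and n_osc: "norm (x - z) \<le> 2 * (1/2) ^ k \<Longrightarrow> \<bar>n x h - n z h\<bar> \<le> \<psi> k"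
    and \<alpha>_osc: "norm (x - z) \<le> 2 * (1/2) ^ k \<Longrightarrow> \<bar>\<alpha> x - \<alpha> z\<bar> \<le> \<beta> k"
    and \<psi>_summable: "summable \<psi>" and \<beta>_summable: "summable (\<lambda>k. (1 + real k) * \<beta> k)"
begin

lemma \<alpha>_pos: "0 < \<alpha> x" and \<alpha>_less_2: "\<alpha> x < 2"
  using a0 a1 \<alpha>_ge[of x] \<alpha>_le[of x] by linarith+

lemma a0_le_a1: "a0 \<le> a1" using \<alpha>_ge[of 0] \<alpha>_le[of 0] by linarith

lemma \<kappa>2: "0 < \<kappa>2" using \<kappa>1 n_ge[of 0 0] n_le[of 0 0] by linarith

lemma n_pos: "0 < n x h" using \<kappa>1 n_ge[of x h] by linarith

lemma \<psi>_nonneg: "0 \<le> \<psi> k" using n_osc[of 0 0 k 0] by simp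

lemma \<beta>_nonneg: "0 \<le> \<beta> k" using \<alpha>_osc[of 0 0 k] by simp

lemma measurable_n [measurable]: "n x \<in> borel_measurable borel"
  using measurable_compose[OF measurable_Pair1' n_meas, of x] by simp

text \<open>Terms of a convergent series tend to 0, so the oscillation bounds make the coefficients
  continuous. Continuity, and hence measurability, in the freezing point comes from here.\<close>

lemma osc_tendsto_0:
  assumes "e \<longlonglongrightarrow> (0::real)" "\<And>x z k. norm (x - z) \<le> 2 * (1/2) ^ k \<Longrightarrow> \<bar>f x - f (z::'a)\<bar> \<le> e k"
  shows "isCont f (x::'a)"
  unfolding continuous_at_eps_delta
proof safe
  fix r :: real assume "0 < r"
  then obtain k where k: "e k < r"
    using order_tendstoD(2)[OF assms(1), of r] by (auto simp: eventually_sequentially)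
  show "\<exists>d>0. \<forall>x'. dist x' x < d \<longrightarrow> dist (f x') (f x) < r"
  proof (intro exI[of _ "2 * (1/2) ^ k"] conjI allI impI)
    fix x' assume "dist x' x < 2 * (1/2) ^ k"
    then show "dist (f x') (f x) < r"
      using assms(2)[of x' x k] k by (simp add: dist_norm)
  qed simp
qed

lemma isCont_n: "isCont (\<lambda>x. n x h) x"
  by (rule osc_tendsto_0[OF summable_LIMSEQ_zero[OF \<psi>_summable] n_osc])

lemma isCont_\<alpha>: "isCont \<alpha> x"
proof (rule osc_tendsto_0[OF summable_LIMSEQ_zero[OF \<beta>_summable]])
  fix x z :: 'a and k assume "norm (x - z) \<le> 2 * (1/2) ^ k"
  then have "\<bar>\<alpha> x - \<alpha> z\<bar> \<le> 1 * \<beta> k" using \<alpha>_osc by simp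
  also have "\<dots> \<le> (1 + real k) * \<beta> k" using \<beta>_nonneg by (intro mult_right_mono) auto
  finally show "\<bar>\<alpha> x - \<alpha> z\<bar> \<le> (1 + real k) * \<beta> k" .
qed

lemma measurable_\<alpha> [measurable]: "\<alpha> \<in> borel_measurable borel"
  by (intro borel_measurable_continuous_onI continuous_at_imp_continuous_on ballI isCont_\<alpha>)

text \<open>The singularity is truncated at \<open>2\<^sup>-\<^sup>J\<close> so that the frozen generators are bounded operators.
  All estimates are uniform in \<open>J\<close>.\<close>

definition regk :: "nat \<Rightarrow> real \<Rightarrow> 'a \<Rightarrow> real"
  where "regk J a h = (max (norm h) ((1/2) ^ J)) powr - (real DIM('a) + a)"

lemma measurable_regk [measurable]: "regk J a \<in> borel_measurable borel"
  unfolding regk_def[abs_def] by measurable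

lemma regk_nonneg [simp]: "0 \<le> regk J a h" by (simp add: regk_def)

lemma regk_minus [simp]: "regk J a (- h) = regk J a h" by (simp add: regk_def)

lemma regk_le_stable_kernel: "0 < a \<Longrightarrow> h \<noteq> 0 \<Longrightarrow> regk J a h \<le> stable_kernel a h"
  unfolding regk_def stable_kernel_def by (intro powr_mono2') auto

lemma min_regk_le:
  "0 < a \<Longrightarrow> min 1 ((norm h / \<delta>)\<^sup>2) * regk J a h \<le> min 1 ((norm h / \<delta>)\<^sup>2) * stable_kernel a h"
  by (cases "h = 0") (auto intro!: mult_left_mono regk_le_stable_kernel)

lemma integrable_regk:
  assumes "0 < a" "a < 2"
  shows "integrable lborel (regk J a)"
proof (rule Bochner_Integration.integrable_bound)
  let ?e = "(1/2) ^ J :: real"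
  let ?f = "\<lambda>h. ?e powr - (real DIM('a) + a) * indicator (cball (0::'a) ?e) h + min 1 ((norm h / ?e)\<^sup>2) * stable_kernel a h"
  show "integrable lborel ?f"
    using assms emeasure_lborel_cball_finite[of "0::'a" ?e]
    by (intro Bochner_Integration.integrable_add integrable_mult_right integrable_real_indicator integrable_stable_kernel[of a a a]) auto
  show "AE h in lborel. norm (regk J a h) \<le> norm (?f h)"
  proof (rule AE_I2)
    fix h :: 'a
    have "regk J a h \<le> ?f h"
    proof (cases "norm h \<le> ?e")
      case False
      then have "1 \<le> (norm h / ?e)\<^sup>2" by (intro one_le_power) (simp add: field_simps)
      then show ?thesis using False by (simp add: regk_def stable_kernel_def max_def)
    qed (auto simp: regk_def max_def)
    also have "\<dots> \<le> norm (?f h)" by simp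
    finally show "norm (regk J a h) \<le> norm (?f h)" by simp
  qed
qed simp

definition ker :: "nat \<Rightarrow> 'a \<Rightarrow> 'a \<Rightarrow> real" where "ker J z h = n z h * regk J (\<alpha> z) h"

lemma measurable_ker [measurable]: "ker J z \<in> borel_measurable borel"
  unfolding ker_def[abs_def] by measurable

lemma ker_nonneg [simp]: "0 \<le> ker J z h" using n_pos[of z h] by (simp add: ker_def)

lemma ker_minus [simp]: "ker J z (- h) = ker J z h" by (simp add: ker_def n_even)

text \<open>A majorant of all frozen kernels at once: a power is monotone in its exponent, in
  opposite directions on either side of 1, so one of the two extreme indices always
  dominates.\<close>

definition regk' :: "nat \<Rightarrow> 'a \<Rightarrow> real" where "regk' J h = \<kappa>2 * (regk J a0 h + regk J a1 h)"

lemma ker_le: "ker J z h \<le> regk' J h"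
proof -
  let ?m = "max (norm h) ((1/2) ^ J)"
  have m: "0 < ?m" by (simp add: less_max_iff_disj)
  have "regk J (\<alpha> z) h \<le> regk J a0 h + regk J a1 h"
  proof (cases "?m \<le> 1")
    case True
    have "regk J (\<alpha> z) h \<le> regk J a1 h"
      unfolding regk_def using True m \<alpha>_le[of z] by (intro powr_mono') auto
    then show ?thesis by (simp add: add_increasing)
  next
    case False
    have "regk J (\<alpha> z) h \<le> regk J a0 h"
      unfolding regk_def using False m \<alpha>_ge[of z] by (intro powr_mono) auto
    then show ?thesis by (simp add: add_increasing2)
  qed
  then show ?thesis
    unfolding ker_def regk'_def using n_le[of z h] n_pos[of z h] by (intro mult_mono) auto
qed

lemma integrable_regk': "integrable lborel (regk' J)"
  unfolding regk'_def[abs_def] using a0 a1 a0_le_a1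
  by (intro integrable_mult_right Bochner_Integration.integrable_add integrable_regk) auto

lemma integrable_ker: "integrable lborel (ker J z)"
  by (rule Bochner_Integration.integrable_bound[OF integrable_regk'[of J]])
    (auto intro!: AE_I2 order_trans[OF ker_le abs_ge_self])

definition B :: "nat \<Rightarrow> 'a \<Rightarrow> 'a cop" where "B J z = gen (ker J z)"

definition P :: "nat \<Rightarrow> 'a \<Rightarrow> real \<Rightarrow> 'a cop" where "P J z t = exp (t *\<^sub>R B J z)"

definition moll :: "nat \<Rightarrow> 'a cop" where "moll J = conv (bump ((1/2) ^ J))"

lemma norm_P: "0 \<le> t \<Longrightarrow> norm (P J z t) \<le> 1"
  unfolding P_def B_def by (intro norm_exp_gen_le integrable_ker) auto

lemma norm_moll: "norm (moll J) \<le> 1"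
  unfolding moll_def by (rule norm_conv_bump) simp

text \<open>Not uniform in \<open>J\<close>. It enters only qualitative facts: continuity,
  integrability, and differentiability in time.\<close>

definition LB :: "nat \<Rightarrow> real" where "LB J = 2 * (\<integral>h. regk' J h \<partial>lborel)"

lemma norm_B: "norm (B J z) \<le> LB J"
proof -
  have "norm (B J z) \<le> 2 * (\<integral>h. \<bar>ker J z h\<bar> \<partial>lborel)"
    unfolding B_def by (rule norm_gen_le[OF integrable_ker])
  also have "\<dots> \<le> LB J"
    unfolding LB_def using integrable_ker integrable_regk' by (intro mult_left_mono integral_mono) (auto intro: ker_le)
  finally show ?thesis .
qed

lemma LB_nonneg: "0 \<le> LB J" using norm_B[of J 0] norm_ge_zero order_trans by blast

lemma B_commute: "B J x * B J z = B J z * B J x"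
  unfolding B_def by (intro gen_commute integrable_ker)

lemma B_moll_commute: "B J z * moll K = moll K * B J z"
  unfolding B_def moll_def by (intro gen_conv_commute integrable_ker integrable_bump) simp

lemma B_shift_commute: "B J z * shift h = shift h * B J z"
  unfolding B_def by (intro gen_shift_commute integrable_ker)

lemma P_commute:
  assumes "B J z * A = A * B J z" shows "P J z t * A = A * P J z t"
  unfolding P_def by (rule exp_commute) (simp add: assms)

lemma P_commute_P: "P J x s * P J z t = P J z t * P J x s"
  by (rule P_commute) (simp add: P_def exp_commute[symmetric] B_commute)

lemma P_add: "P J z (s + t) = P J z s * P J z t"
  unfolding P_def scaleR_add_left by (rule exp_add_commuting) simp

text \<open>Dominated convergence in \<open>h\<close> with majorant \<open>regk'\<close> gives
  continuity in the operator norm, so that averages over freezing points are integrals of continuous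
  functions.\<close>

lemma isCont_B: "isCont (B J) z"
  unfolding continuous_at_sequentially
proof (safe, unfold comp_def)
  fix u :: "nat \<Rightarrow> 'a" assume u: "u \<longlonglongrightarrow> z"
  have m: "0 < max (norm h) ((1/2) ^ J)" for h :: 'a by (simp add: less_max_iff_disj)
  have "(\<lambda>i. \<integral>h. \<bar>ker J (u i) h - ker J z h\<bar> \<partial>lborel) \<longlonglongrightarrow> integral\<^sup>L lborel (\<lambda>h::'a. 0)"
  proof (rule integral_dominated_convergence[where w="\<lambda>h. 2 * regk' J h"])
    show "AE h in lborel. (\<lambda>i. \<bar>ker J (u i) h - ker J z h\<bar>) \<longlonglongrightarrow> 0"
    proof (rule AE_I2)
      fix h
      have "(\<lambda>i. ker J (u i) h) \<longlonglongrightarrow> ker J z h"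
        unfolding ker_def regk_def using m[of h]
        by (intro tendsto_intros isCont_tendsto_compose[OF isCont_n u] isCont_tendsto_compose[OF isCont_\<alpha> u]) auto
      then have "(\<lambda>i. \<bar>ker J (u i) h - ker J z h\<bar>) \<longlonglongrightarrow> \<bar>ker J z h - ker J z h\<bar>"
        by (intro tendsto_intros)
      then show "(\<lambda>i. \<bar>ker J (u i) h - ker J z h\<bar>) \<longlonglongrightarrow> 0" by simp
    qed
    show "AE h in lborel. norm \<bar>ker J (u i) h - ker J z h\<bar> \<le> 2 * regk' J h" for i
    proof (rule AE_I2)
      fix h
      show "norm \<bar>ker J (u i) h - ker J z h\<bar> \<le> 2 * regk' J h"
        using ker_le[of J "u i" h] ker_le[of J z h] ker_nonneg[of J "u i" h] ker_nonneg[of J z h]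
        unfolding real_norm_def abs_idempotent by linarith
    qed
  qed (auto intro!: integrable_mult_right integrable_regk')
  then have lim: "(\<lambda>i. 2 * (\<integral>h. \<bar>ker J (u i) h - ker J z h\<bar> \<partial>lborel)) \<longlonglongrightarrow> 0"
    using tendsto_mult_right_zero by fastforce
  show "(\<lambda>i. B J (u i)) \<longlonglongrightarrow> B J z"
  proof (rule LIM_zero_cancel, rule Lim_null_comparison[OF always_eventually lim], rule allI)
    fix i
    show "norm (B J (u i) - B J z) \<le> 2 * (\<integral>h. \<bar>ker J (u i) h - ker J z h\<bar> \<partial>lborel)"
      unfolding B_def gen_diff[OF integrable_ker integrable_ker, symmetric]
      by (intro norm_gen_le Bochner_Integration.integrable_diff integrable_ker)
  qed
qed

lemma norm_P_diff_le:
  assumes "0 \<le> t"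
  shows "norm (P J x t - P J z t) \<le> t * norm (B J x - B J z)"
proof -
  have "norm (exp (t *\<^sub>R B J x) * 1 - exp (t *\<^sub>R B J z) * 1) \<le> t * norm (B J x - B J z)"
  proof (rule norm_exp_diff_commuting[OF B_commute assms])
    fix \<theta> :: real assume "0 < \<theta>" "\<theta> < 1"
    then have "norm (P J x (t * \<theta>) * P J z (t * (1 - \<theta>))) \<le> 1"
      using assms by (intro norm_mult_le_1 norm_P) auto
    then show "norm ((B J x - B J z) * (exp ((t * \<theta>) *\<^sub>R B J x) * exp ((t * (1 - \<theta>)) *\<^sub>R B J z) * 1)) \<le> norm (B J x - B J z)"
      by (intro norm_mult_le_1'[OF order_refl]) (simp add: P_def)
  qed
  then show ?thesis by (simp add: P_def)
qed

lemma isCont_P: "0 \<le> t \<Longrightarrow> isCont (\<lambda>z. P J z t) x"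
  unfolding isCont_def
proof (rule LIM_zero_cancel, rule Lim_null_comparison[OF always_eventually], rule allI, rule norm_P_diff_le)
  have "((\<lambda>z. B J z - B J x) \<longlongrightarrow> 0) (at x)"
    using isCont_B[of x J] by (intro LIM_zero) (simp add: isCont_def)
  then have "((\<lambda>z. t * norm (B J z - B J x)) \<longlongrightarrow> t * norm (0 :: 'a cop)) (at x)"
    by (intro tendsto_intros)
  then show "((\<lambda>z. t * norm (B J z - B J x)) \<longlongrightarrow> 0) (at x)" by simp
qed

definition Ck :: real where "Ck = stable_const TYPE('a) * (1 / a0 + 1 / (2 - a1))"

lemma Ck_nonneg: "0 \<le> Ck"
  using a0 a1 stable_const_nonneg[where 'a='a] by (simp add: Ck_def)

lemma
  assumes "0 < \<delta>"
  shows integrable_min_ker: "integrable lborel (\<lambda>h. min 1 ((norm h / \<delta>)\<^sup>2) * ker J z h)"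
    and integral_min_ker_le: "(\<integral>h. min 1 ((norm h / \<delta>)\<^sup>2) * ker J z h \<partial>lborel) \<le> \<kappa>2 * Ck * \<delta> powr - \<alpha> z"
proof -
  have i: "integrable lborel (\<lambda>h::'a. \<kappa>2 * (min 1 ((norm h / \<delta>)\<^sup>2) * stable_kernel (\<alpha> z) h))"
    by (intro integrable_mult_right integrable_stable_kernel[OF \<alpha>_ge \<alpha>_le a0 a1 assms])
  have le: "min 1 ((norm h / \<delta>)\<^sup>2) * ker J z h \<le> \<kappa>2 * (min 1 ((norm h / \<delta>)\<^sup>2) * stable_kernel (\<alpha> z) h)" for h
  proof -
    have "n z h * (min 1 ((norm h / \<delta>)\<^sup>2) * regk J (\<alpha> z) h) \<le> \<kappa>2 * (min 1 ((norm h / \<delta>)\<^sup>2) * stable_kernel (\<alpha> z) h)"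
      using n_le[of z h] n_pos[of z h] by (intro mult_mono min_regk_le \<alpha>_pos) auto
    then show ?thesis by (simp add: ker_def mult_ac)
  qed
  show i': "integrable lborel (\<lambda>h. min 1 ((norm h / \<delta>)\<^sup>2) * ker J z h)"
    by (rule Bochner_Integration.integrable_bound[OF i]) (auto intro!: AE_I2 intro: order_trans[OF le])
  have "(\<integral>h. min 1 ((norm h / \<delta>)\<^sup>2) * ker J z h \<partial>lborel) \<le> (\<integral>h. \<kappa>2 * (min 1 ((norm h / \<delta>)\<^sup>2) * stable_kernel (\<alpha> z) (h::'a)) \<partial>lborel)"
    by (rule integral_mono[OF i' i le])
  also have "\<dots> \<le> \<kappa>2 * (Ck * \<delta> powr - \<alpha> z)"
    using integral_stable_kernel_le[OF \<alpha>_ge \<alpha>_le a0 a1 assms, where 'a='a] \<kappa>2 by (simp add: Ck_def mult.assoc)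
  finally show "(\<integral>h. min 1 ((norm h / \<delta>)\<^sup>2) * ker J z h \<partial>lborel) \<le> \<kappa>2 * Ck * \<delta> powr - \<alpha> z" by simp
qed

end

lemma le_mult_min_1:
  fixes x c r :: real
  assumes "x \<le> r" "x \<le> c" "1 \<le> c" "0 \<le> r"
  shows "x \<le> c * min 1 r"
proof (cases "1 \<le> r")
  case False
  have "x \<le> 1 * r" using assms by simp
  also have "\<dots> \<le> c * r" using assms by (intro mult_right_mono)
  finally show ?thesis using False by simp
qed (use assms in simp)

context stable_like begin

subsection \<open>Smoothing\<close>

text \<open>The largest multiple for which the dyadic bumps can be shown to fit under the jump
  kernel: \<open>bump_mass\<close> undoes the normalisation of \<open>bump\<close>, and the factor
  1/2 pays for the geometric sum over the overlapping levels.\<close>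

definition c_sm :: real where "c_sm = \<kappa>1 * bump_mass TYPE('a) / 2"

text \<open>Makes the expected number of jumps in the recursion at least 2. As \<open>M_sm\<close>
  is at least 1, its power at the smallest index \<open>a0\<close> is the worst case, and one value
  serves all freezing points.\<close>

definition M_sm :: real where "M_sm = max 1 ((2 / c_sm) powr (1 / a0))"

definition C_sm :: real where "C_sm = max 1 (4 * M_sm * bump_const TYPE('a))"

lemma c_sm: "0 < c_sm" using \<kappa>1 bump_mass_pos[where 'a='a] by (simp add: c_sm_def)

lemma M_sm: "1 \<le> M_sm" "2 \<le> c_sm * M_sm powr a0"
proof -
  show "1 \<le> M_sm" by (simp add: M_sm_def)
  have e: "1 / a0 * a0 = 1" using a0 by simp
  have "2 / c_sm = ((2 / c_sm) powr (1 / a0)) powr a0"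
    unfolding powr_powr e by (rule powr_one[symmetric]) (use c_sm in simp)
  also have "\<dots> \<le> M_sm powr a0"
    using a0 by (intro powr_mono2) (auto simp: M_sm_def)
  finally show "2 \<le> c_sm * M_sm powr a0" using c_sm by (simp add: field_simps)
qed

lemma C_sm: "1 \<le> C_sm" "4 * M_sm * bump_const TYPE('a) \<le> C_sm" by (auto simp: C_sm_def)

lemma power_powr: "0 < x \<Longrightarrow> (x ^ j) powr p = (x powr p) ^ j" for x p :: real
  by (induction j) (simp_all add: powr_mult)

text \<open>At a given \<open>h\<close> only levels with \<open>norm h < (1/2) ^ j\<close>
  contribute. Their bounds grow geometrically with ratio at least 2, so the sum is at most twice the
  bound at the finest such level, where the radius dominates both \<open>norm h\<close> and the
  truncation.\<close>

lemma sum_bump_le_regk: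
  assumes a: "0 < a"
  shows "(\<Sum>j\<le>J. c_sm * (2 ^ j) powr a * bump ((1/2) ^ j) (h::'a)) \<le> \<kappa>1 * regk J a h"
proof -
  define p where "p = real DIM('a) + a"
  define S where "S = {j. j \<le> J \<and> norm h < (1/2) ^ j}"
  note bm = bump_mass_pos[where 'a='a]
  have "1 \<le> real DIM('a)" using DIM_positive[where 'a='a] by (simp add: Suc_leI)
  then have p: "1 \<le> p" using a unfolding p_def by linarith
  then have q: "2 \<le> (2::real) powr p" using powr_mono[of 1 p 2] by simp
  have S: "finite S" "S \<subseteq> {..J}" by (auto simp: S_def)
  have bump: "c_sm * (2 ^ j) powr a * bump ((1/2) ^ j) h \<le> c_sm / bump_mass TYPE('a) * (2 powr p) ^ j" for j
  proof -
    have "((2::real) ^ j) powr real DIM('a) = (2 ^ j) ^ DIM('a)" by (rule powr_realpow) simp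
    then have "bump ((1/2) ^ j) h \<le> (2 ^ j) powr real DIM('a) / bump_mass TYPE('a)"
      using bump_le[of "(1/2) ^ j" h] by (simp add: power_one_over)
    then have "c_sm * (2 ^ j) powr a * bump ((1/2) ^ j) h
        \<le> c_sm * (2 ^ j) powr a * ((2 ^ j) powr real DIM('a) / bump_mass TYPE('a))"
      using c_sm by (intro mult_left_mono) auto
    also have "c_sm * (2 ^ j) powr a * ((2 ^ j) powr real DIM('a) / bump_mass TYPE('a))
        = c_sm / bump_mass TYPE('a) * ((2 ^ j) powr real DIM('a) * (2 ^ j) powr a)"
      by simp
    also have "(2 ^ j) powr real DIM('a) * (2 ^ j) powr a = ((2::real) ^ j) powr p"
      unfolding p_def by (rule powr_add[symmetric])
    also have "\<dots> = (2 powr p) ^ j" by (rule power_powr) simp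
    finally show ?thesis .
  qed
  have zero: "bump ((1/2) ^ j) h = 0" if "j \<le> J" "j \<notin> S" for j
    using that by (intro bump_eq_0) (auto simp: S_def)
  have "(\<Sum>j\<le>J. c_sm * (2 ^ j) powr a * bump ((1/2) ^ j) h) = (\<Sum>j\<in>S. c_sm * (2 ^ j) powr a * bump ((1/2) ^ j) h)"
    using S zero by (intro sum.mono_neutral_right) auto
  also have "\<dots> \<le> (\<Sum>j\<in>S. c_sm / bump_mass TYPE('a) * (2 powr p) ^ j)"
    by (intro sum_mono bump)
  also have "\<dots> \<le> \<kappa>1 * regk J a h"
  proof (cases "S = {}")
    case False
    define m where "m = Max S"
    have m: "m \<in> S" "\<And>j. j \<in> S \<Longrightarrow> j \<le> m" using S False by (auto simp: m_def)
    have "(\<Sum>j\<in>S. (2 powr p) ^ j) \<le> (\<Sum>j\<le>m. (2 powr p) ^ j)"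
      using m(2) S by (intro sum_mono2) auto
    also have "\<dots> \<le> 2 * (2 powr p) ^ m" by (rule sum_powers_le[OF q])
    also have "(2 powr p) ^ m = ((1/2) ^ m) powr - p"
      by (subst power_powr) (auto simp: powr_divide powr_minus)
    also have "\<dots> \<le> regk J a h"
      unfolding regk_def p_def
    proof (rule powr_mono2')
      show "max (norm h) ((1/2) ^ J) \<le> (1/2) ^ m"
        using m(1) by (auto simp: S_def intro!: power_decreasing)
    qed (use a in \<open>auto simp: less_max_iff_disj\<close>)
    finally have "(\<Sum>j\<in>S. (2 powr p) ^ j) \<le> 2 * regk J a h" by simp
    then have "c_sm / bump_mass TYPE('a) * (\<Sum>j\<in>S. (2 powr p) ^ j) \<le> c_sm / bump_mass TYPE('a) * (2 * regk J a h)"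
      using c_sm bm by (intro mult_left_mono) auto
    also have "\<dots> = \<kappa>1 * regk J a h" using bm by (simp add: c_sm_def)
    finally show ?thesis by (simp add: sum_distrib_left)
  qed (use \<kappa>1 in simp)
  finally show ?thesis .
qed

lemma gen_sum:
  assumes "finite F" "\<And>j. j \<in> F \<Longrightarrow> integrable lborel (p j :: 'b::euclidean_space \<Rightarrow> real)"
  shows "gen (\<lambda>h. \<Sum>j\<in>F. p j h) = (\<Sum>j\<in>F. gen (p j))"
  using assms
proof (induction F rule: finite_induct)
  case empty
  have "gen (\<lambda>h::'b. 0 * (0::real)) = 0 *\<^sub>R gen (\<lambda>_. 0)" by (rule gen_cmult) simp
  then show ?case by simp
qed (simp add: gen_add Bochner_Integration.integrable_sum)

text \<open>Only the dyadic bumps under the jump kernel smooth. The rest of the kernel is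
  nonnegative, so its semigroup is a contraction, and it commutes with the difference. Each bump
  acts both as a jump law and as a mollifier: peeling off the levels from the coarsest to the
  finest, either a jump of the current level occurs and mollifies at its scale, or the finer levels
  remain. Beyond the finest level \<open>moll J\<close> provides the starting value.\<close>

lemma norm_first_diff:
  assumes t: "0 < t" "t \<le> 1"
  shows "norm ((shift h - 1) * (P J z t * moll J)) \<le> C_sm * norm h * t powr (- 1 / \<alpha> z)"
proof (cases "h = 0")
  case True then show ?thesis by (simp add: shift_0)
next
  case False
  define \<Lambda> where "\<Lambda> j = c_sm * (2 ^ j) powr \<alpha> z" for j :: nat
  define D where "D = (shift h - 1 :: 'a cop)"
  define S where "S i = (\<Sum>j\<in>{i..J}. \<Lambda> j *\<^sub>R (moll j - 1))" for i
  define q where "q i h = (\<Sum>j\<in>{i..J}. \<Lambda> j * bump ((1/2) ^ j) h)" for i and h :: 'a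
  define rest where "rest h = ker J z h - q 0 h" for h
  define X where "X i = exp (t *\<^sub>R S i) * moll J" for i
  define bc where "bc = bump_const TYPE('a) * norm h"
  have bc: "0 < bc" using False bump_const_pos[where 'a='a] by (simp add: bc_def)
  have \<Lambda>: "0 \<le> \<Lambda> j" for j using c_sm by (simp add: \<Lambda>_def)
  have ib: "integrable lborel (bump ((1/2) ^ j) :: 'a \<Rightarrow> real)" for j by (rule integrable_bump) simp
  have iq: "integrable lborel (q i)" for i
    unfolding q_def[abs_def] by (intro Bochner_Integration.integrable_sum integrable_mult_right ib)
  have q_nn: "0 \<le> q i h" for i h
    unfolding q_def by (intro sum_nonneg mult_nonneg_nonneg \<Lambda> bump_nonneg) simp
  have Sq: "S i = gen (q i)" for i
    unfolding S_def q_def[abs_def] moll_def using ib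
    by (subst gen_sum) (auto simp: gen_cmult gen_bump)
  have rest_nn: "0 \<le> rest h" for h
  proof -
    have "q 0 h \<le> \<kappa>1 * regk J (\<alpha> z) h"
      using sum_bump_le_regk[OF \<alpha>_pos[of z], where J=J and h=h] by (simp add: q_def \<Lambda>_def atMost_atLeast0)
    also have "\<dots> \<le> ker J z h"
      unfolding ker_def by (intro mult_right_mono n_ge) simp
    finally show ?thesis by (simp add: rest_def)
  qed
  have ir: "integrable lborel rest"
    unfolding rest_def[abs_def] by (intro Bochner_Integration.integrable_diff integrable_ker iq)
  have Bz: "t *\<^sub>R B J z = t *\<^sub>R gen rest + t *\<^sub>R S 0"
    using gen_add[OF ir iq, of 0] by (simp add: B_def Sq rest_def scaleR_add_right)
  \<comment> \<open>Translation-invariant generators commute, so the semigroup splits into that of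
    the bumps and that of the remaining jumps.\<close>
  have Pz: "P J z t = exp (t *\<^sub>R gen rest) * exp (t *\<^sub>R S 0)"
    unfolding P_def Bz using gen_commute[OF ir iq] by (intro exp_add_commuting) (simp add: Sq)
  have normX: "norm (X i) \<le> 1" for i
    unfolding X_def Sq using t by (intro norm_mult_le_1 norm_moll norm_exp_gen_le iq q_nn) auto
  have Dm: "norm (D * moll j) \<le> bc * 2 ^ j" for j
    using norm_shift_conv_bump[of "(1/2) ^ j" h] by (simp add: D_def moll_def bc_def power_one_over divide_simps)
  have rec: "norm (D * X i) \<le> exp (- (t * \<Lambda> i)) * norm (D * X (Suc i)) + (1 - exp (- (t * \<Lambda> i))) * norm (D * moll i)"
    if "i \<le> J" for i
  proof -
    have S_eq: "t *\<^sub>R S i = (t * \<Lambda> i) *\<^sub>R (moll i - 1) + t *\<^sub>R S (Suc i)"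
      using sum.atLeast_Suc_atMost[OF that, of "\<lambda>j. \<Lambda> j *\<^sub>R (moll j - 1 :: 'a cop)"] by (simp add: S_def scaleR_add_right)
    have comm: "moll i * S (Suc i) = S (Suc i) * moll i"
      unfolding Sq moll_def using gen_conv_commute[OF iq ib] by simp
    have "X i = exp ((t * \<Lambda> i) *\<^sub>R (moll i - 1)) * X (Suc i)"
      unfolding X_def S_eq by (subst exp_add_commuting) (simp_all add: comm algebra_simps mult.assoc)
    then show ?thesis
      using norm_exp_first_jump[OF norm_moll normX, of "t * \<Lambda> i" D i "Suc i"] \<Lambda>[of i] t by (simp add: mult.assoc)
  qed
  define b where "b i = norm (D * X i) / bc" for i
  have "b 0 \<le> 4 * M_sm * t powr (- 1 / \<alpha> z)"
  proof (rule smoothing_recursion[OF t \<alpha>_ge a0 M_sm c_sm])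
    have "X (Suc J) = moll J" by (simp add: X_def S_def)
    then show "b (Suc J) \<le> 2 ^ J" using Dm[of J] bc by (simp add: b_def divide_le_eq mult.commute)
  next
    fix j assume j: "j \<le> J"
    define E where "E = exp (- (t * \<Lambda> j))"
    have E: "0 \<le> E" "E \<le> 1" using \<Lambda>[of j] t by (auto simp: E_def)
    have "norm (D * X j) \<le> E * norm (D * X (Suc j)) + (1 - E) * (bc * 2 ^ j)"
      using rec[OF j] mult_left_mono[OF Dm[of j], of "1 - E"] E by (simp add: E_def)
    then have "b j \<le> (E * norm (D * X (Suc j)) + (1 - E) * (bc * 2 ^ j)) / bc"
      unfolding b_def using bc by (intro divide_right_mono) auto
    also have "\<dots> = E * b (Suc j) + (1 - E) * 2 ^ j" using bc by (simp add: b_def add_divide_distrib)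
    finally show "b j \<le> exp (- (t * (c_sm * (2 ^ j) powr \<alpha> z))) * b (Suc j) + (1 - exp (- (t * (c_sm * (2 ^ j) powr \<alpha> z)))) * 2 ^ j"
      by (simp add: E_def \<Lambda>_def)
  qed
  then have 1: "norm (D * X 0) \<le> (4 * M_sm * t powr (- 1 / \<alpha> z)) * bc"
    using bc by (simp add: b_def divide_le_eq)
  have "exp (t *\<^sub>R gen rest) * D = D * exp (t *\<^sub>R gen rest)"
    by (rule exp_commute) (simp add: D_def gen_shift_commute[OF ir] algebra_simps)
  then have "D * (P J z t * moll J) = exp (t *\<^sub>R gen rest) * (D * X 0)"
    by (simp add: Pz X_def mult.assoc[symmetric])
  then have "norm (D * (P J z t * moll J)) \<le> (4 * M_sm * t powr (- 1 / \<alpha> z)) * bc"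
    using norm_mult_le_1[OF norm_exp_gen_le[OF ir rest_nn] 1, of t] t by simp
  also have "\<dots> = (4 * M_sm * bump_const TYPE('a)) * (norm h * t powr (- 1 / \<alpha> z))"
    by (simp add: bc_def)
  also have "\<dots> \<le> C_sm * (norm h * t powr (- 1 / \<alpha> z))"
    by (intro mult_right_mono C_sm) auto
  finally show ?thesis by (simp add: D_def)
qed

text \<open>One mollifier for each half of the time interval, because a second difference consumes
  two smoothing factors.\<close>

definition moll2 :: "nat \<Rightarrow> 'a cop" where "moll2 J = moll J * moll J"

lemma norm_moll2: "norm (moll2 J) \<le> 1"
  unfolding moll2_def by (intro norm_mult_le_1 norm_moll)

text \<open>The length below which the smoothed function has small differences. It is taken at
  \<open>t / 2\<close> since each first difference has only half of the time at its
  disposal.\<close>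

definition \<delta> :: "'a \<Rightarrow> real \<Rightarrow> real" where "\<delta> z t = (t / 2) powr (1 / \<alpha> z) / C_sm"

lemma \<delta>_pos: "0 < t \<Longrightarrow> 0 < \<delta> z t" using C_sm by (simp add: \<delta>_def)

lemma P_moll_commute: "P J z t * moll K = moll K * P J z t"
  by (intro P_commute B_moll_commute)

lemma P_shift_commute: "P J z t * shift h = shift h * P J z t"
  by (intro P_commute B_shift_commute)

lemma moll_shift_commute: "moll J * shift h = shift h * moll J"
  unfolding moll_def by (rule conv_shift_commute[OF integrable_bump]) simp

lemma P_moll2_eq: "P J z t * moll2 J = (P J z (t / 2) * moll J) * (P J z (t / 2) * moll J)"
proof -
  have "(P J z (t / 2) * moll J) * (P J z (t / 2) * moll J) = P J z (t / 2) * (moll J * P J z (t / 2)) * moll J"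
    by (simp only: mult.assoc)
  also have "\<dots> = (P J z (t / 2) * P J z (t / 2)) * (moll J * moll J)"
    unfolding P_moll_commute[symmetric] by (simp only: mult.assoc)
  finally show ?thesis using P_add[of J z "t / 2" "t / 2"] by (simp add: moll2_def)
qed

lemma norm_first_diff':
  assumes t: "0 < t" "t \<le> 1"
  shows "norm ((shift h - 1) * (P J z (t / 2) * moll J)) \<le> norm h / \<delta> z t"
proof -
  have "C_sm * norm h * (t / 2) powr (- 1 / \<alpha> z) = norm h / \<delta> z t"
    using C_sm powr_minus_divide[of "t / 2" "1 / \<alpha> z"] unfolding \<delta>_def by simp
  then show ?thesis using norm_first_diff[of "t / 2" h J z] t by simp
qed

lemma norm_first_diff_P:
  assumes t: "0 < t" "t \<le> 1"
  shows "norm ((shift h - 1) * (P J z t * moll2 J)) \<le> 2 * min 1 (norm h / \<delta> z t)"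
proof -
  have a: "norm (P J z s * moll J) \<le> 1" if "0 \<le> s" for s
    using that by (intro norm_mult_le_1 norm_P norm_moll)
  have "norm ((shift h - 1) * (P J z t * moll2 J)) \<le> norm h / \<delta> z t"
    unfolding P_moll2_eq mult.assoc[symmetric]
    using norm_mult_le_1'[OF norm_first_diff'[OF t, of h J z] a[of "t / 2"]] t by (simp add: mult.assoc)
  moreover have "norm ((shift h - 1) * (P J z t * moll2 J)) \<le> 2"
  proof (rule norm_mult_le_1')
    show "norm (shift h - 1 :: 'a cop) \<le> 2"
      using norm_triangle_ineq4[of "shift h" "1 :: 'a cop"] norm_shift[of h] by simp
    show "norm (P J z t * moll2 J) \<le> 1" using t by (intro norm_mult_le_1 norm_P norm_moll2) auto
  qed
  moreover have "0 \<le> norm h / \<delta> z t" using \<delta>_pos[OF t(1), of z] by simp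
  ultimately show ?thesis by (intro le_mult_min_1) auto
qed

text \<open>The square of the first-order estimate: the second difference factorises, and
  translation invariance lets one first difference be attached to each half of the semigroup. The
  value 1 in the minimum is the trivial bound.\<close>

lemma norm_diff2_P:
  assumes t: "0 < t" "t \<le> 1"
  shows "norm (diff2 h * (P J z t * moll2 J)) \<le> 4 * min 1 ((norm h / \<delta> z t)\<^sup>2)"
proof -
  define Y where "Y = P J z (t / 2) * moll J"
  have Ysh: "Y * shift h = shift h * Y" for h
  proof -
    have "Y * shift h = P J z (t / 2) * (moll J * shift h)" by (simp only: Y_def mult.assoc)
    also have "\<dots> = (P J z (t / 2) * shift h) * moll J" unfolding moll_shift_commute by (simp only: mult.assoc)
    also have "\<dots> = shift h * Y" unfolding P_shift_commute by (simp only: Y_def mult.assoc)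
    finally show ?thesis .
  qed
  have Ysh': "Y * (shift (- h) - 1) = (shift (- h) - 1) * Y" by (simp add: algebra_simps Ysh)
  have "((shift h - 1) * Y) * - ((shift (- h) - 1) * Y) = - ((shift h - 1) * (Y * (shift (- h) - 1)) * Y)"
    by (simp only: mult.assoc mult_minus_right)
  also have "\<dots> = diff2 h * (Y * Y)"
    unfolding Ysh' diff2_eq minus_diff_eq[symmetric, of 1] by (simp only: mult.assoc mult_minus_right mult_minus_left minus_minus)
  finally have "diff2 h * (Y * Y) = ((shift h - 1) * Y) * - ((shift (- h) - 1) * Y)" by simp
  then have "norm (diff2 h * (Y * Y)) \<le> norm ((shift h - 1) * Y) * norm ((shift (- h) - 1) * Y)"
    using norm_mult_ineq[of "(shift h - 1) * Y" "- ((shift (- h) - 1) * Y)"] by simp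
  also have "\<dots> \<le> (norm h / \<delta> z t) * (norm h / \<delta> z t)"
    using norm_first_diff'[OF t, of h J z] norm_first_diff'[OF t, of "- h" J z] \<delta>_pos[OF t(1), of z]
    by (intro mult_mono) (auto simp: Y_def)
  finally have "norm (diff2 h * (P J z t * moll2 J)) \<le> (norm h / \<delta> z t)\<^sup>2"
    by (simp add: P_moll2_eq Y_def power2_eq_square)
  moreover have "norm (diff2 h * (P J z t * moll2 J)) \<le> 4"
    using t by (intro norm_mult_le_1' norm_diff2 norm_mult_le_1 norm_P norm_moll2) auto
  ultimately show ?thesis by (intro le_mult_min_1) auto
qed

end

text \<open>Mean value theorem in the exponent. The larger of the two end powers depends on whether
  \<open>m\<close> exceeds 1; their sum covers both cases.\<close>

lemma abs_powr_diff_le: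
  fixes m p q :: real
  assumes m: "0 < m"
  shows "\<bar>m powr p - m powr q\<bar> \<le> \<bar>p - q\<bar> * \<bar>ln m\<bar> * (m powr p + m powr q)"
proof -
  have main: "\<bar>m powr p - m powr q\<bar> \<le> \<bar>p - q\<bar> * \<bar>ln m\<bar> * (m powr p + m powr q)" if pq: "p < q" for p q
  proof -
    have d: "((\<lambda>s. m powr s) has_real_derivative m powr s * ln m) (at s)" for s
      using m by (auto intro!: derivative_eq_intros)
    obtain s where s: "p < s" "s < q" "m powr q - m powr p = (q - p) * (m powr s * ln m)"
      using MVT2[OF pq, of "\<lambda>s. m powr s" "\<lambda>s. m powr s * ln m"] d by auto
    have "m powr s \<le> m powr p + m powr q"
    proof (cases "1 \<le> m")
      case True
      then have "m powr s \<le> m powr q" using s by (intro powr_mono) auto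
      then show ?thesis by (simp add: add_increasing)
    next
      case False
      then have "m powr s \<le> m powr p" using s m by (intro powr_mono') auto
      then show ?thesis by (simp add: add_increasing2)
    qed
    then have "\<bar>q - p\<bar> * \<bar>ln m\<bar> * (m powr s) \<le> \<bar>q - p\<bar> * \<bar>ln m\<bar> * (m powr p + m powr q)"
      by (intro mult_left_mono) auto
    moreover have "\<bar>m powr p - m powr q\<bar> = \<bar>q - p\<bar> * \<bar>ln m\<bar> * (m powr s)"
      by (subst abs_minus_commute, subst s(3)) (simp add: abs_mult mult_ac)
    ultimately show ?thesis by (simp add: abs_minus_commute)
  qed
  consider "p < q" | "q < p" | "p = q" by linarith
  then show ?thesis
  proof cases
    case 2
    then show ?thesis using main[of q p] by (simp add: abs_minus_commute add.commute)
  qed (use main in auto)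
qed

lemma abs_ln_le_powr:
  fixes s e :: real
  assumes s: "0 < s" and e: "0 < e"
  shows "\<bar>ln s\<bar> \<le> (s powr e + s powr - e) / e"
proof -
  have "e * ln s \<le> s powr e" using ln_le_minus_one[of "s powr e"] s by (simp add: ln_powr)
  moreover have "- e * ln s \<le> s powr - e" using ln_le_minus_one[of "s powr - e"] s by (simp add: ln_powr)
  moreover have "0 \<le> s powr e" "0 \<le> s powr - e" by auto
  ultimately have "\<bar>e * ln s\<bar> \<le> s powr e + s powr - e" by linarith
  then show ?thesis using e by (simp add: abs_mult pos_le_divide_eq mult.commute)
qed

lemma divide_powr: "0 < x \<Longrightarrow> 0 < y \<Longrightarrow> (x / y) powr e = x powr e * y powr - e" for x y e :: real
  by (simp add: powr_divide powr_minus_divide)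

context stable_like begin

subsection \<open>Comparison of frozen generators\<close>

text \<open>The logarithm in the difference of two kernels is absorbed by changing the index by \<open>\<eta>\<close>.\<close>

definition \<eta> :: real where "\<eta> = min a0 (2 - a1) / 2"

lemma \<eta>: "0 < \<eta>" "0 < a0 - \<eta>" "a1 + \<eta> < 2"
  using a0 a1 by (auto simp: \<eta>_def min_def field_simps)

definition Ck' :: real where "Ck' = stable_const TYPE('a) * (1 / (a0 - \<eta>) + 1 / (2 - (a1 + \<eta>)))"

lemma Ck'_nonneg: "0 \<le> Ck'"
  using \<eta> stable_const_nonneg[where 'a='a] by (simp add: Ck'_def)

lemma
  assumes v: "a0 - \<eta> \<le> v" "v \<le> a1 + \<eta>" and d: "0 < d"
  shows integrable_min_regk: "integrable lborel (\<lambda>h. min 1 ((norm h / d)\<^sup>2) * regk J v h)"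
    and integral_min_regk_le: "(\<integral>h. min 1 ((norm h / d)\<^sup>2) * regk J v h \<partial>lborel) \<le> Ck' * d powr - v"
proof -
  have i: "integrable lborel (\<lambda>h::'a. min 1 ((norm h / d)\<^sup>2) * stable_kernel v h)"
    by (rule integrable_stable_kernel[OF v \<eta>(2,3) d])
  have v0: "0 < v" using v \<eta> by linarith
  show i': "integrable lborel (\<lambda>h. min 1 ((norm h / d)\<^sup>2) * regk J v h)"
    by (rule Bochner_Integration.integrable_bound[OF i]) (use min_regk_le[OF v0] in \<open>auto intro!: AE_I2 simp: abs_mult\<close>)
  have "(\<integral>h. min 1 ((norm h / d)\<^sup>2) * regk J v h \<partial>lborel) \<le> (\<integral>h. min 1 ((norm h / d)\<^sup>2) * stable_kernel v (h::'a) \<partial>lborel)"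
    by (rule integral_mono[OF i' i min_regk_le[OF v0]])
  also have "\<dots> \<le> Ck' * d powr - v"
    unfolding Ck'_def by (rule integral_stable_kernel_le[OF v \<eta>(2,3) d])
  finally show "(\<integral>h. min 1 ((norm h / d)\<^sup>2) * regk J v h \<partial>lborel) \<le> Ck' * d powr - v" .
qed

definition \<Gamma> :: real where "\<Gamma> = (\<Sum>k. (1 + real k) * \<beta> k)"

lemma \<beta>_le_\<Gamma>: "(1 + real k) * \<beta> k \<le> \<Gamma>" and \<Gamma>_nonneg: "0 \<le> \<Gamma>" and \<beta>_le_\<Gamma>': "\<beta> k \<le> \<Gamma>"
proof -
  show 1: "(1 + real k) * \<beta> k \<le> \<Gamma>"
    using sum_le_suminf[OF \<beta>_summable, of "{k}"] \<beta>_nonneg by (simp add: \<Gamma>_def)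
  have 2: "1 * \<beta> k \<le> (1 + real k) * \<beta> k" using \<beta>_nonneg by (intro mult_right_mono) auto
  show "\<beta> k \<le> \<Gamma>" using 1 2 by simp
  then show "0 \<le> \<Gamma>" using \<beta>_nonneg[of k] by linarith
qed

text \<open>At the smoothing scale for \<open>t\<close> of order \<open>4\<^sup>-\<^sup>k\<close> that logarithm is of order \<open>1 + k\<close>, whence the weight of \<open>\<beta>\<close>.\<close>

definition \<Omega> :: "nat \<Rightarrow> real" where "\<Omega> k = \<psi> k + (1 + real k) * \<beta> k"

lemma \<Omega>_nonneg: "0 \<le> \<Omega> k" using \<psi>_nonneg[of k] \<beta>_nonneg[of k] by (simp add: \<Omega>_def)

lemma summable_\<Omega>: "summable \<Omega>"
  unfolding \<Omega>_def[abs_def] by (intro summable_add \<psi>_summable \<beta>_summable)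

text \<open>Collects the cost of raising the scale \<open>\<delta> z t\<close> to an index that is
  off by \<open>\<beta> k\<close>. The main factor is \<open>2 / t\<close>, at most
  \<open>64 * 4 ^ k\<close>; the deviation contributes the last factor.\<close>

definition D0 :: real where "D0 = C_sm powr (2 + \<Gamma>) * 64 * 4 powr (3 * \<Gamma> / a0)"

definition D1 :: real where "D1 = ln C_sm + 3 * ln 4 / a0"

lemma D0_pos: "0 < D0" using C_sm by (simp add: D0_def)

lemma D1_nonneg: "0 \<le> D1" using C_sm a0 by (simp add: D1_def)

lemma two_div_le:
  fixes t :: real
  assumes t: "0 < t" "(1/4) ^ (k + 2) \<le> t"
  shows "2 / t \<le> 4 ^ (k + 3)"
proof -
  have "2 / t \<le> 2 / (1/4) ^ (k + 2)" using t by (intro divide_left_mono) auto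
  also have "\<dots> \<le> 4 ^ (k + 3)" by (simp add: power_one_over power_add)
  finally show ?thesis .
qed

text \<open>A change of index by a multiple of \<open>\<beta> k\<close> at times of order
  \<open>4^-k\<close> costs a bounded factor, because \<open>(1 + k) * \<beta> k\<close> is a term
  of a convergent series with nonnegative terms and so stays below its sum
  \<open>\<Gamma>\<close>.\<close>

lemma four_powr_le:
  assumes "0 \<le> y"
  shows "(4 ^ (k + 3)) powr (\<beta> k * y) \<le> 4 powr (3 * \<Gamma> * y)"
proof -
  have "real (k + 3) * \<beta> k \<le> 3 * ((1 + real k) * \<beta> k)"
    using \<beta>_nonneg[of k] by (simp add: algebra_simps)
  also have "\<dots> \<le> 3 * \<Gamma>" using \<beta>_le_\<Gamma>[of k] by simp
  finally have e: "real (k + 3) * \<beta> k * y \<le> 3 * \<Gamma> * y" using assms by (rule mult_right_mono)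
  have "(4 ^ (k + 3)) powr (\<beta> k * y) = (4 powr real (k + 3)) powr (\<beta> k * y)"
    by (subst powr_realpow) auto
  also have "\<dots> = 4 powr (real (k + 3) * \<beta> k * y)" by (simp only: powr_powr mult.assoc)
  also have "\<dots> \<le> 4 powr (3 * \<Gamma> * y)" using e by (intro powr_mono) auto
  finally show ?thesis .
qed

lemma \<delta>_powr_le:
  assumes t: "0 < t" "t \<le> 1" "(1/4) ^ (k + 2) \<le> t" and v: "0 \<le> v" "v \<le> \<alpha> z + \<beta> k"
  shows "\<delta> z t powr - v \<le> D0 * 4 ^ k"
proof -
  define y where "y = (2 / t) powr (1 / \<alpha> z)"
  have a: "0 < \<alpha> z" by (rule \<alpha>_pos)
  have "1 powr (1 / \<alpha> z) \<le> y" unfolding y_def using t a by (intro powr_mono2) auto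
  then have y1: "1 \<le> y" by simp
  then have Cy: "1 \<le> C_sm * y" using mult_mono[OF C_sm(1) y1] C_sm by simp
  have inv: "\<delta> z t = inverse (C_sm * y)"
    using t by (simp add: \<delta>_def y_def powr_divide field_simps)
  have "\<delta> z t powr - v = (C_sm * y) powr v"
    unfolding inv using Cy by (subst powr_minus, subst inverse_powr) auto
  also have "\<dots> \<le> (C_sm * y) powr (\<alpha> z + \<beta> k)" using Cy v by (intro powr_mono) auto
  also have "\<dots> = C_sm powr (\<alpha> z + \<beta> k) * y powr (\<alpha> z + \<beta> k)" by (rule powr_mult)
  also have "\<dots> \<le> C_sm powr (2 + \<Gamma>) * (4 ^ (k + 3) * 4 powr (3 * \<Gamma> / a0))"
  proof (intro mult_mono)
    show "C_sm powr (\<alpha> z + \<beta> k) \<le> C_sm powr (2 + \<Gamma>)"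
      using C_sm \<alpha>_less_2[of z] \<beta>_le_\<Gamma>'[of k] by (intro powr_mono) auto
    have "y powr (\<alpha> z + \<beta> k) = (2 / t) powr (1 + \<beta> k / \<alpha> z)"
      unfolding y_def powr_powr using a by (simp add: field_simps)
    also have "\<dots> \<le> (4 ^ (k + 3)) powr (1 + \<beta> k / \<alpha> z)"
      using two_div_le[OF t(1,3)] t a \<beta>_nonneg[of k] by (intro powr_mono2) auto
    also have "\<dots> = 4 ^ (k + 3) * (4 ^ (k + 3)) powr (\<beta> k * (1 / \<alpha> z))"
      by (simp add: powr_add)
    also have "\<dots> \<le> 4 ^ (k + 3) * 4 powr (3 * \<Gamma> * (1 / \<alpha> z))"
      using a by (intro mult_left_mono four_powr_le) auto
    also have "\<dots> \<le> 4 ^ (k + 3) * 4 powr (3 * \<Gamma> / a0)"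
      using \<alpha>_ge[of z] a0 \<Gamma>_nonneg by (intro mult_left_mono powr_mono) (auto intro!: divide_left_mono)
    finally show "y powr (\<alpha> z + \<beta> k) \<le> 4 ^ (k + 3) * 4 powr (3 * \<Gamma> / a0)" .
  qed auto
  also have "\<dots> = D0 * 4 ^ k" by (simp add: D0_def power_add)
  finally show ?thesis .
qed

lemma abs_ln_\<delta>_le:
  assumes t: "0 < t" "t \<le> 1" "(1/4) ^ (k + 2) \<le> t"
  shows "\<bar>ln (\<delta> z t)\<bar> \<le> D1 * (1 + real k)"
proof -
  have a: "0 < \<alpha> z" by (rule \<alpha>_pos)
  have l: "ln (\<delta> z t) = - (ln (2 / t) / \<alpha> z + ln C_sm)"
    using t C_sm by (simp add: \<delta>_def ln_div ln_powr diff_divide_distrib)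
  have l0: "0 \<le> ln (2 / t)" "0 \<le> ln C_sm" using t C_sm by auto
  have "ln (2 / t) \<le> ln (4 ^ (k + 3))" using two_div_le[OF t(1,3)] t by (subst ln_le_cancel_iff) auto
  also have "\<dots> = real (k + 3) * ln 4" by (rule ln_realpow)
  also have "\<dots> \<le> 3 * (1 + real k) * ln 4" by (intro mult_right_mono) auto
  finally have "ln (2 / t) / \<alpha> z \<le> 3 * (1 + real k) * ln 4 / a0"
    using \<alpha>_ge[of z] a0 l0 by (intro frac_le) auto
  moreover have "ln C_sm \<le> ln C_sm * (1 + real k)" using l0 by (simp add: algebra_simps)
  moreover have "0 \<le> ln (2 / t) / \<alpha> z" using l0 a by simp
  moreover have "D1 * (1 + real k) = ln C_sm * (1 + real k) + 3 * (1 + real k) * ln 4 / a0"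
    by (simp add: D1_def algebra_simps add_divide_distrib)
  ultimately show ?thesis using l0(2) unfolding l abs_minus_cancel by linarith
qed

lemma abs_ker_diff_le:
  assumes xz: "norm (x - z) \<le> 2 * (1/2) ^ k"
  shows "\<bar>ker J x h - ker J z h\<bar> \<le> \<psi> k * regk J (\<alpha> x) h
    + \<kappa>2 * \<beta> k * \<bar>ln (max (norm h) ((1/2) ^ J))\<bar> * (regk J (\<alpha> x) h + regk J (\<alpha> z) h)"
proof -
  let ?m = "max (norm h) ((1/2) ^ J)"
  let ?L = "\<beta> k * \<bar>ln ?m\<bar> * (regk J (\<alpha> x) h + regk J (\<alpha> z) h)"
  have m: "0 < ?m" by (simp add: less_max_iff_disj)
  have "\<bar>(- (real DIM('a) + \<alpha> x)) - (- (real DIM('a) + \<alpha> z))\<bar> = \<bar>\<alpha> x - \<alpha> z\<bar>" by simp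
  then have "\<bar>regk J (\<alpha> x) h - regk J (\<alpha> z) h\<bar> \<le> \<bar>\<alpha> x - \<alpha> z\<bar> * \<bar>ln ?m\<bar> * (regk J (\<alpha> x) h + regk J (\<alpha> z) h)"
    using abs_powr_diff_le[OF m, of "- (real DIM('a) + \<alpha> x)" "- (real DIM('a) + \<alpha> z)"] by (simp only: regk_def)
  also have "\<dots> \<le> ?L"
    using \<alpha>_osc[OF xz] by (intro mult_right_mono) auto
  finally have 1: "\<bar>regk J (\<alpha> x) h - regk J (\<alpha> z) h\<bar> \<le> ?L" .
  have "ker J x h - ker J z h = (n x h - n z h) * regk J (\<alpha> x) h + n z h * (regk J (\<alpha> x) h - regk J (\<alpha> z) h)"
    by (simp add: ker_def algebra_simps)
  then have "\<bar>ker J x h - ker J z h\<bar> \<le> \<bar>n x h - n z h\<bar> * regk J (\<alpha> x) h + \<bar>n z h\<bar> * \<bar>regk J (\<alpha> x) h - regk J (\<alpha> z) h\<bar>"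
    using abs_triangle_ineq[of "(n x h - n z h) * regk J (\<alpha> x) h" "n z h * (regk J (\<alpha> x) h - regk J (\<alpha> z) h)"]
    by (simp add: abs_mult)
  also have "\<dots> \<le> \<psi> k * regk J (\<alpha> x) h + \<kappa>2 * ?L"
    using n_osc[OF xz, of h] n_le[of z h] n_pos[of z h] 1 by (intro add_mono mult_mono) auto
  finally show ?thesis by (simp add: mult.assoc)
qed

text \<open>A majorant of the logarithm times the kernel that consists of pure powers. The logarithm
  is centred at \<open>d\<close>, and that of the ratio to \<open>d\<close> is bounded by the powers
  \<open>\<eta>\<close> and \<open>- \<eta>\<close> of the ratio. With the prefactors in
  \<open>d\<close>, all three terms integrate to multiples of \<open>d powr - v\<close>.\<close>

definition lnk :: "nat \<Rightarrow> real \<Rightarrow> real \<Rightarrow> 'a \<Rightarrow> real"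
  where "lnk J d v h = \<bar>ln d\<bar> * regk J v h + (d powr - \<eta> * regk J (v - \<eta>) h + d powr \<eta> * regk J (v + \<eta>) h) / \<eta>"

lemma ln_regk_le:
  assumes d: "0 < d"
  shows "\<bar>ln (max (norm h) ((1/2) ^ J))\<bar> * regk J v h \<le> lnk J d v h"
proof -
  let ?m = "max (norm h) ((1/2) ^ J)"
  have m: "0 < ?m" by (simp add: less_max_iff_disj)
  have "\<bar>ln ?m\<bar> \<le> \<bar>ln d\<bar> + \<bar>ln (?m / d)\<bar>" using m d by (simp add: ln_div)
  also have "\<bar>ln (?m / d)\<bar> \<le> ((?m / d) powr \<eta> + (?m / d) powr - \<eta>) / \<eta>"
    using m d \<eta> by (intro abs_ln_le_powr) auto
  finally have "\<bar>ln ?m\<bar> * regk J v h \<le> (\<bar>ln d\<bar> + ((?m / d) powr \<eta> + (?m / d) powr - \<eta>) / \<eta>) * regk J v h"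
    by (intro mult_right_mono) auto
  moreover have "(?m / d) powr e * regk J v h = d powr - e * regk J (v - e) h" for e
  proof -
    have "(?m / d) powr e * regk J v h = d powr - e * (?m powr e * ?m powr - (real DIM('a) + v))"
      unfolding regk_def divide_powr[OF m d] by (simp only: mult_ac)
    also have "?m powr e * ?m powr - (real DIM('a) + v) = ?m powr - (real DIM('a) + (v - e))"
      unfolding powr_add[symmetric] by (simp add: algebra_simps)
    finally show ?thesis by (simp only: regk_def)
  qed
  from this[of \<eta>] this[of "- \<eta>"]
  have "(?m / d) powr \<eta> * regk J v h = d powr - \<eta> * regk J (v - \<eta>) h"
    "(?m / d) powr - \<eta> * regk J v h = d powr \<eta> * regk J (v + \<eta>) h"
    by simp_all
  ultimately show ?thesis by (simp add: lnk_def distrib_right)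
qed

lemma
  assumes v: "a0 \<le> v" "v \<le> a1" and d: "0 < d"
  shows integrable_min_lnk: "integrable lborel (\<lambda>h. min 1 ((norm h / d)\<^sup>2) * lnk J d v h)"
    and integral_min_lnk_le: "(\<integral>h. min 1 ((norm h / d)\<^sup>2) * lnk J d v h \<partial>lborel) \<le> Ck' * (\<bar>ln d\<bar> + 2 / \<eta>) * d powr - v"
proof -
  let ?w = "\<lambda>h::'a. min 1 ((norm h / d)\<^sup>2)"
  have i: "integrable lborel (\<lambda>h. ?w h * regk J v h)" "integrable lborel (\<lambda>h. ?w h * regk J (v - \<eta>) h)"
    "integrable lborel (\<lambda>h. ?w h * regk J (v + \<eta>) h)"
    using v \<eta> d by (auto intro!: integrable_min_regk)
  have eq: "?w h * lnk J d v h = \<bar>ln d\<bar> * (?w h * regk J v h)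
      + (d powr - \<eta> * (?w h * regk J (v - \<eta>) h) + d powr \<eta> * (?w h * regk J (v + \<eta>) h)) / \<eta>" for h
    by (simp add: lnk_def algebra_simps add_divide_distrib)
  show "integrable lborel (\<lambda>h. ?w h * lnk J d v h)"
    unfolding eq using i by simp
  have "(\<integral>h. ?w h * lnk J d v h \<partial>lborel) = \<bar>ln d\<bar> * (\<integral>h. ?w h * regk J v h \<partial>lborel)
      + (d powr - \<eta> * (\<integral>h. ?w h * regk J (v - \<eta>) h \<partial>lborel) + d powr \<eta> * (\<integral>h. ?w h * regk J (v + \<eta>) h \<partial>lborel)) / \<eta>"
    unfolding eq using i by simp
  also have "\<dots> \<le> \<bar>ln d\<bar> * (Ck' * d powr - v) + (d powr - \<eta> * (Ck' * d powr - (v - \<eta>)) + d powr \<eta> * (Ck' * d powr - (v + \<eta>))) / \<eta>"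
    using v \<eta> d by (intro add_mono mult_left_mono divide_right_mono integral_min_regk_le) auto
  also have "d powr - \<eta> * (Ck' * d powr - (v - \<eta>)) = Ck' * d powr - v"
    using powr_add[of d "- \<eta>" "- (v - \<eta>)"] by simp
  also have "d powr \<eta> * (Ck' * d powr - (v + \<eta>)) = Ck' * d powr - v"
    using powr_add[of d "\<eta>" "- (v + \<eta>)"] by simp
  also have "\<bar>ln d\<bar> * (Ck' * d powr - v) + (Ck' * d powr - v + Ck' * d powr - v) / \<eta> = Ck' * (\<bar>ln d\<bar> + 2 / \<eta>) * d powr - v"
    by (simp add: algebra_simps add_divide_distrib)
  finally show "(\<integral>h. ?w h * lnk J d v h \<partial>lborel) \<le> Ck' * (\<bar>ln d\<bar> + 2 / \<eta>) * d powr - v" .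
qed

definition CE :: real where "CE = 2 * Ck' * D0 * (1 + 2 * \<kappa>2 * (D1 + 2 / \<eta>))"

lemma CE_nonneg: "0 \<le> CE"
  using Ck'_nonneg D0_pos \<kappa>2 D1_nonneg \<eta> by (simp add: CE_def)

text \<open>Second differences of the smoothed function are governed by
  \<open>norm h / \<delta> z t\<close>. Integrated against one of the kernels they give the scale to
  the power of minus the index, which is of order \<open>1 / t\<close>, that is
  \<open>4 ^ k\<close>; the difference of the kernels contributes the oscillation
  \<open>\<Omega> k\<close>. Integrated over times of order \<open>4^-k\<close> this leaves
  \<open>\<Omega> k\<close>.\<close>

lemma norm_B_diff_P:
  assumes t: "0 < t" "t \<le> 1" "(1/4) ^ (k + 2) \<le> t" and xz: "norm (x - z) \<le> 2 * (1/2) ^ k"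
  shows "norm ((B J x - B J z) * (P J z t * moll2 J)) \<le> CE * 4 ^ k * \<Omega> k"
proof (rule norm_cop_bound)
  show "0 \<le> CE * 4 ^ k * \<Omega> k" using CE_nonneg \<Omega>_nonneg by simp
  fix g :: "'a \<Rightarrow>\<^sub>C real"
  define d where "d = \<delta> z t"
  have d: "0 < d" using \<delta>_pos[OF t(1)] by (simp add: d_def)
  let ?w = "\<lambda>h::'a. min 1 ((norm h / d)\<^sup>2)"
  define q where "q h = ker J x h - ker J z h" for h
  define r where "r h = \<psi> k * regk J (\<alpha> x) h + \<kappa>2 * \<beta> k * (lnk J d (\<alpha> x) h + lnk J d (\<alpha> z) h)" for h
  have iq: "integrable lborel q" unfolding q_def[abs_def] by (intro Bochner_Integration.integrable_diff integrable_ker)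
  have qr: "\<bar>q h\<bar> \<le> r h" for h
  proof -
    have "\<kappa>2 * \<beta> k * (\<bar>ln (max (norm h) ((1/2) ^ J))\<bar> * regk J (\<alpha> x) h + \<bar>ln (max (norm h) ((1/2) ^ J))\<bar> * regk J (\<alpha> z) h)
       \<le> \<kappa>2 * \<beta> k * (lnk J d (\<alpha> x) h + lnk J d (\<alpha> z) h)"
      using \<kappa>2 \<beta>_nonneg[of k] by (intro mult_left_mono add_mono ln_regk_le d) auto
    then show ?thesis using abs_ker_diff_le[OF xz, of J h] by (simp add: q_def r_def algebra_simps)
  qed
  have i: "integrable lborel (\<lambda>h. ?w h * regk J (\<alpha> x) h)" "integrable lborel (\<lambda>h. ?w h * lnk J d (\<alpha> x) h)"
    "integrable lborel (\<lambda>h. ?w h * lnk J d (\<alpha> z) h)"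
    using \<eta> \<alpha>_ge \<alpha>_le d by (auto intro!: integrable_min_regk integrable_min_lnk intro: order_trans[OF _ \<alpha>_ge] order_trans[OF \<alpha>_le])
  have eq: "4 * norm g * ?w h * r h = 4 * norm g * (\<psi> k * (?w h * regk J (\<alpha> x) h)
      + \<kappa>2 * \<beta> k * (?w h * lnk J d (\<alpha> x) h + ?w h * lnk J d (\<alpha> z) h))" for h
    by (simp add: r_def algebra_simps)
  \<comment> \<open>The index \<open>\<alpha> x\<close> meets a scale that belongs to
    \<open>z\<close>; the power estimate for \<open>\<delta>\<close> allows for exactly this
    mismatch.\<close>
  have vx: "\<alpha> x \<le> \<alpha> z + \<beta> k" using \<alpha>_osc[OF xz] by simp
  have dx: "d powr - \<alpha> x \<le> D0 * 4 ^ k" "d powr - \<alpha> z \<le> D0 * 4 ^ k"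
    using \<delta>_powr_le[OF t _ vx] \<delta>_powr_le[OF t, of "\<alpha> z" z] \<alpha>_pos[of x] \<alpha>_pos[of z] \<beta>_nonneg[of k] by (auto simp: d_def)
  have lnd: "\<bar>ln d\<bar> + 2 / \<eta> \<le> (D1 + 2 / \<eta>) * (1 + real k)"
  proof -
    have "2 / \<eta> * 1 \<le> 2 / \<eta> * (1 + real k)" using \<eta> by (intro mult_left_mono) auto
    then show ?thesis using abs_ln_\<delta>_le[OF t, of z] unfolding d_def distrib_right[of D1] by linarith
  qed
  have I1: "(\<integral>h. ?w h * regk J (\<alpha> x) h \<partial>lborel) \<le> Ck' * (D0 * 4 ^ k)"
    using integral_min_regk_le[of "\<alpha> x" d J] d \<eta> \<alpha>_ge[of x] \<alpha>_le[of x] mult_left_mono[OF dx(1) Ck'_nonneg] by simp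
  have I2: "(\<integral>h. ?w h * lnk J d v h \<partial>lborel) \<le> Ck' * ((D1 + 2 / \<eta>) * (1 + real k)) * (D0 * 4 ^ k)"
    if "v = \<alpha> x \<or> v = \<alpha> z" for v
  proof -
    have "(\<integral>h. ?w h * lnk J d v h \<partial>lborel) \<le> Ck' * (\<bar>ln d\<bar> + 2 / \<eta>) * d powr - v"
      using that \<alpha>_ge \<alpha>_le by (intro integral_min_lnk_le d) auto
    also have "\<dots> \<le> Ck' * ((D1 + 2 / \<eta>) * (1 + real k)) * (D0 * 4 ^ k)"
      using that dx lnd Ck'_nonneg D1_nonneg \<eta> by (intro mult_mono mult_left_mono) auto
    finally show ?thesis .
  qed
  have "norm (gen q \<bullet>\<^sub>o (P J z t * moll2 J) \<bullet>\<^sub>o g) \<le> (\<integral>h. 4 * norm g * ?w h * r h \<partial>lborel) / 2"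
  proof (rule norm_gen_apply_le[OF iq])
    show "q (- h) = q h" for h by (simp add: q_def)
    show "norm (diff2 h \<bullet>\<^sub>o (P J z t * moll2 J) \<bullet>\<^sub>o g) \<le> 4 * norm g * ?w h" for h
      using order_trans[OF norm_cop_apply[of "diff2 h * (P J z t * moll2 J)" g]
          mult_right_mono[OF norm_diff2_P[OF t(1,2), of h J z] norm_ge_zero]]
      by (simp add: d_def mult_ac)
    show "integrable lborel (\<lambda>h. 4 * norm g * ?w h * r h)"
      unfolding eq using i by simp
  qed (rule qr)
  also have "(\<integral>h. 4 * norm g * ?w h * r h \<partial>lborel) = 4 * norm g * (\<psi> k * (\<integral>h. ?w h * regk J (\<alpha> x) h \<partial>lborel)
      + \<kappa>2 * \<beta> k * ((\<integral>h. ?w h * lnk J d (\<alpha> x) h \<partial>lborel) + (\<integral>h. ?w h * lnk J d (\<alpha> z) h \<partial>lborel)))"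
    unfolding eq using i by simp
  also have "\<dots> / 2 \<le> 4 * norm g * (\<psi> k * (Ck' * (D0 * 4 ^ k)) + \<kappa>2 * \<beta> k *
      (Ck' * ((D1 + 2 / \<eta>) * (1 + real k)) * (D0 * 4 ^ k) + Ck' * ((D1 + 2 / \<eta>) * (1 + real k)) * (D0 * 4 ^ k))) / 2"
    using \<psi>_nonneg[of k] \<beta>_nonneg[of k] \<kappa>2 by (intro divide_right_mono mult_left_mono add_mono I1 I2) auto
  also have "\<dots> = norm g * (2 * Ck' * D0 * 4 ^ k) * (\<psi> k + 2 * \<kappa>2 * (D1 + 2 / \<eta>) * ((1 + real k) * \<beta> k))"
    by (simp add: algebra_simps)
  also have "\<dots> \<le> norm g * (2 * Ck' * D0 * 4 ^ k) * ((1 + 2 * \<kappa>2 * (D1 + 2 / \<eta>)) * \<Omega> k)"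
  proof (rule mult_left_mono)
    define X where "X = 2 * \<kappa>2 * (D1 + 2 / \<eta>)"
    have "0 \<le> X" using \<kappa>2 D1_nonneg \<eta> by (simp add: X_def)
    moreover have "0 \<le> (1 + real k) * \<beta> k" using \<beta>_nonneg[of k] by simp
    ultimately have "0 \<le> (1 + real k) * \<beta> k + X * \<psi> k" using \<psi>_nonneg[of k] by simp
    then show "\<psi> k + 2 * \<kappa>2 * (D1 + 2 / \<eta>) * ((1 + real k) * \<beta> k) \<le> (1 + 2 * \<kappa>2 * (D1 + 2 / \<eta>)) * \<Omega> k"
      unfolding \<Omega>_def X_def[symmetric] by (simp add: algebra_simps)
  qed (use Ck'_nonneg D0_pos in simp)
  also have "\<dots> = CE * 4 ^ k * \<Omega> k * norm g" by (simp add: CE_def)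
  finally show "norm (((B J x - B J z) * (P J z t * moll2 J)) \<bullet>\<^sub>o g) \<le> CE * 4 ^ k * \<Omega> k * norm g"
    using gen_diff[OF integrable_ker[of J x] integrable_ker[of J z]] by (simp add: B_def q_def[abs_def])
qed

text \<open>In Duhamel's formula one of the two semigroups has run for at least
  \<open>t / 2\<close>. It does the smoothing while the other is a contraction. Therefore the
  estimate of the generators has to reach down to \<open>(1/4) ^ (k + 2)\<close>, although blocks
  end at \<open>(1/4) ^ (k + 1)\<close>.\<close>

lemma norm_P_moll2_diff:
  assumes t: "0 < t" "t \<le> 1" "(1/4) ^ (k + 1) \<le> t" and xz: "norm (x - z) \<le> 2 * (1/2) ^ k"
  shows "norm (P J x t * moll2 J - P J z t * moll2 J) \<le> t * (CE * 4 ^ k * \<Omega> k)"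
  unfolding P_def
proof (rule norm_exp_diff_commuting[OF B_commute])
  show "0 \<le> t" using t by simp
  fix \<theta> :: real assume \<theta>: "0 < \<theta>" "\<theta> < 1"
  have half: "(1/4) ^ (k + 2) \<le> t * s" "t * s \<le> 1" if "1/2 \<le> s" "s \<le> 1" for s
  proof -
    have "(1/4::real) ^ (k + 2) \<le> (1/4) ^ (k + 1) * (1/2)" by simp
    also have "\<dots> \<le> t * s" using t that by (intro mult_mono) auto
    finally show "(1/4) ^ (k + 2) \<le> t * s" .
    show "t * s \<le> 1" using mult_mono[of t 1 s 1] t that by simp
  qed
  have c1: "norm (P J v s * A) \<le> c" if "norm A \<le> c" "0 \<le> s" for v s A c
    using that by (intro norm_mult_le_1 norm_P)
  have comm: "P J v s * (B J x - B J z) = (B J x - B J z) * P J v s" for v s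
    by (simp add: P_commute B_commute algebra_simps)
  have zx: "norm (z - x) \<le> 2 * (1/2) ^ k" using xz by (simp add: norm_minus_commute)
  have "norm ((B J x - B J z) * (P J x (t * \<theta>) * P J z (t * (1 - \<theta>)) * moll2 J)) \<le> CE * 4 ^ k * \<Omega> k"
  proof (cases "1/2 \<le> \<theta>")
    case True
    have "(B J x - B J z) * (P J x (t * \<theta>) * P J z (t * (1 - \<theta>)) * moll2 J)
        = (B J x - B J z) * P J z (t * (1 - \<theta>)) * P J x (t * \<theta>) * moll2 J"
      unfolding P_commute_P[of J x] by (simp only: mult.assoc)
    also have "\<dots> = P J z (t * (1 - \<theta>)) * ((B J x - B J z) * (P J x (t * \<theta>) * moll2 J))"
      unfolding comm[symmetric] by (simp only: mult.assoc)
    finally have "norm ((B J x - B J z) * (P J x (t * \<theta>) * P J z (t * (1 - \<theta>)) * moll2 J))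
        \<le> norm ((B J x - B J z) * (P J x (t * \<theta>) * moll2 J))"
      using c1[OF order_refl, of "t * (1 - \<theta>)" z] \<theta> t by simp
    also have "(B J x - B J z) * (P J x (t * \<theta>) * moll2 J) = - ((B J z - B J x) * (P J x (t * \<theta>) * moll2 J))"
      by (subst mult_minus_left[symmetric]) (simp only: minus_diff_eq)
    also have "norm \<dots> \<le> CE * 4 ^ k * \<Omega> k"
      unfolding norm_minus_cancel using half(2)[of \<theta>] True \<theta> t by (intro norm_B_diff_P zx half(1)) auto
    finally show ?thesis .
  next
    case False
    have "(B J x - B J z) * (P J x (t * \<theta>) * P J z (t * (1 - \<theta>)) * moll2 J)
        = (B J x - B J z) * P J x (t * \<theta>) * P J z (t * (1 - \<theta>)) * moll2 J"
      by (simp only: mult.assoc)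
    also have "\<dots> = P J x (t * \<theta>) * ((B J x - B J z) * (P J z (t * (1 - \<theta>)) * moll2 J))"
      unfolding comm[symmetric] by (simp only: mult.assoc)
    finally show ?thesis
      using c1[OF norm_B_diff_P[OF _ _ half(1) xz, of "1 - \<theta>" J], of "t * \<theta>" x] half(2)[of "1 - \<theta>"] False \<theta> t by simp
  qed
  then show "norm ((B J x - B J z) * (exp ((t * \<theta>) *\<^sub>R B J x) * exp ((t * (1 - \<theta>)) *\<^sub>R B J z) * moll2 J)) \<le> CE * 4 ^ k * \<Omega> k"
    by (simp add: P_def)
qed

end

section \<open>Averaged frozen semigroups\<close>

lemma tendsto_bcontfun2:
  fixes U :: "'i \<Rightarrow> 'a::euclidean_space \<Rightarrow>\<^sub>C real"
  assumes U: "(U \<longlongrightarrow> l) F" and y: "(y \<longlongrightarrow> x) F"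
  shows "((\<lambda>i. U i (y i)) \<longlongrightarrow> l x) F"
proof -
  have "((\<lambda>i. apply_bcontfun (U i - l) (y i)) \<longlongrightarrow> 0) F"
  proof (rule Lim_null_comparison)
    show "\<forall>\<^sub>F i in F. norm (apply_bcontfun (U i - l) (y i)) \<le> norm (U i - l)"
      by (intro always_eventually allI norm_bounded)
    show "((\<lambda>i. norm (U i - l)) \<longlongrightarrow> 0) F"
      using tendsto_norm[OF LIM_zero[OF U]] by simp
  qed
  from tendsto_add[OF this tendsto_bcontfun[OF y, of l]] show ?thesis by simp
qed

lemma continuous_on_bcontfun2:
  fixes U :: "'b::topological_space \<Rightarrow> 'a::euclidean_space \<Rightarrow>\<^sub>C real"
  assumes "continuous_on UNIV U" "continuous_on S f" "continuous_on S g"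
  shows "continuous_on S (\<lambda>p. U (f p) (g p))"
  using continuous_on_compose2[OF assms(1,2)] assms(3)
  by (auto simp: continuous_on_def intro!: tendsto_bcontfun2)

lemma measurable_bcontfun2:
  fixes U :: "'b::euclidean_space \<Rightarrow> 'a::euclidean_space \<Rightarrow>\<^sub>C real"
  assumes U: "continuous_on UNIV U" and f: "f \<in> borel_measurable M" and g: "g \<in> borel_measurable M"
  shows "(\<lambda>p. U (f p) (g p)) \<in> borel_measurable M"
proof -
  have "(\<lambda>p. U (fst p) (snd p)) \<in> borel_measurable borel"
    by (intro borel_measurable_continuous_onI continuous_on_bcontfun2[OF U] continuous_intros)
  from measurable_compose[OF borel_measurable_Pair[OF f g] this] show ?thesis by simp
qed

text \<open>The point \<open>x\<close> enters twice, through the weight and as argument, so this is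
  not a convolution.\<close>

definition avg :: "real \<Rightarrow> ('a::euclidean_space \<Rightarrow> 'a \<Rightarrow>\<^sub>C real) \<Rightarrow> ('a \<Rightarrow>\<^sub>C real)"
  where "avg l U = Bcontfun (\<lambda>x. \<integral>z. bump l (x - z) * U z x \<partial>lborel)"

lemma bump_reflect:
  fixes x :: "'a::euclidean_space"
  assumes l: "0 < l"
  shows integrable_bump_reflect: "integrable lborel (\<lambda>z. bump l (x - z))"
    and integral_bump_reflect: "(\<integral>z. bump l (x - z) \<partial>lborel) = 1"
  using integrable_lborel_reflect_shift[of "bump l :: 'a \<Rightarrow> real" "-1" x]
    integral_lborel_reflect_shift[of "bump l :: 'a \<Rightarrow> real" "-1" x] integrable_bump[OF l] integral_bump[OF l]
  by simp_all

lemma integrable_weighted: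
  fixes w f :: "'a::euclidean_space \<Rightarrow> real"
  assumes w: "integrable lborel w" and f: "f \<in> borel_measurable borel" and C: "\<And>z. \<bar>f z\<bar> \<le> C"
  shows "integrable lborel (\<lambda>z. w z * f z)"
proof (rule Bochner_Integration.integrable_bound)
  show "integrable lborel (\<lambda>z. C * w z)" using w by simp
  show "(\<lambda>z. w z * f z) \<in> borel_measurable lborel"
    using f integrable_lborel_measurable[OF w] by measurable
  show "AE z in lborel. norm (w z * f z) \<le> norm (C * w z)"
  proof (rule AE_I2)
    fix z
    have "\<bar>w z\<bar> * \<bar>f z\<bar> \<le> \<bar>w z\<bar> * \<bar>C\<bar>" using C[of z] by (intro mult_left_mono) auto
    then show "norm (w z * f z) \<le> norm (C * w z)" by (simp add: abs_mult mult.commute)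
  qed
qed

lemma abs_integral_weighted_le:
  fixes w f :: "'a::euclidean_space \<Rightarrow> real"
  assumes w: "integrable lborel w" and f: "f \<in> borel_measurable borel" and C: "\<And>z. w z \<noteq> 0 \<Longrightarrow> \<bar>f z\<bar> \<le> C"
  shows "\<bar>\<integral>z. w z * f z \<partial>lborel\<bar> \<le> C * (\<integral>z. \<bar>w z\<bar> \<partial>lborel)"
proof -
  have le: "\<bar>w z * f z\<bar> \<le> C * \<bar>w z\<bar>" for z
    using C[of z] by (cases "w z = 0") (auto simp: abs_mult mult.commute intro!: mult_right_mono)
  have i: "integrable lborel (\<lambda>z. w z * f z)"
  proof (rule Bochner_Integration.integrable_bound)
    show "integrable lborel (\<lambda>z. C * \<bar>w z\<bar>)" using w by simp
    show "(\<lambda>z. w z * f z) \<in> borel_measurable lborel"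
      using f integrable_lborel_measurable[OF w] by measurable
  qed (use le in \<open>auto intro!: AE_I2 intro: order_trans[OF le]\<close>)
  have "\<bar>\<integral>z. w z * f z \<partial>lborel\<bar> \<le> (\<integral>z. \<bar>w z * f z\<bar> \<partial>lborel)" by (rule integral_abs_bound)
  also have "\<dots> \<le> (\<integral>z. C * \<bar>w z\<bar> \<partial>lborel)" using i w le by (intro integral_mono) auto
  finally show ?thesis by simp
qed

context
  fixes U :: "'a::euclidean_space \<Rightarrow> 'a \<Rightarrow>\<^sub>C real" and C l :: real
  assumes U: "continuous_on UNIV U" and C: "\<And>z. norm (U z) \<le> C" and l: "0 < l"
begin

lemma measurable_avg [measurable]: "(\<lambda>z. U z x) \<in> borel_measurable borel"
  by (rule measurable_bcontfun2[OF U]) auto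

lemma abs_U_le: "\<bar>U z x\<bar> \<le> C" using order_trans[OF abs_bcontfun_le C] .

lemma integrable_avg:
  assumes "integrable lborel w" shows "integrable lborel (\<lambda>z. w z * U z x)"
  by (rule integrable_weighted[OF assms measurable_avg abs_U_le])

lemma avg_apply: "avg l U x = (\<integral>z. bump l (x - z) * U z x \<partial>lborel)"
proof -
  have "(\<lambda>x. \<integral>z. bump l (x - z) * U z x \<partial>lborel) \<in> bcontfun"
  proof (rule bcontfun_normI)
    fix x
    show "norm (\<integral>z. bump l (x - z) * U z x \<partial>lborel) \<le> C"
      using abs_integral_weighted_le[OF integrable_bump_reflect[OF l] measurable_avg abs_U_le, of x x]
      by (simp add: bump_nonneg[OF l] integral_bump_reflect[OF l])
  next
    \<comment> \<open>Substituting \<open>y = x - z\<close> moves \<open>x\<close> from the weight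
      into the continuous \<open>U\<close>, and the dominating function no longer depends on
      \<open>x\<close>.\<close>
    have eq: "(\<integral>z. bump l (x - z) * U z x \<partial>lborel) = (\<integral>y. bump l y * U (x - y) x \<partial>lborel)" for x
      using integral_lborel_reflect_shift[of "\<lambda>z. bump l (x - z) * U z x" "-1" x] by simp
    show "continuous_on UNIV (\<lambda>x. \<integral>z. bump l (x - z) * U z x \<partial>lborel)"
      unfolding continuous_on_sequentially eq
    proof (safe, unfold comp_def)
      fix u :: "nat \<Rightarrow> 'a" and a assume u: "u \<longlonglongrightarrow> a"
      show "(\<lambda>i. \<integral>y. bump l y * U (u i - y) (u i) \<partial>lborel) \<longlonglongrightarrow> (\<integral>y. bump l y * U (a - y) a \<partial>lborel)"
      proof (rule integral_dominated_convergence[where w="\<lambda>y. C * bump l y"])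
        show "(\<lambda>y. bump l y * U (a - y) a) \<in> borel_measurable lborel"
          "(\<lambda>y. bump l y * U (u i - y) (u i)) \<in> borel_measurable lborel" for i
          by (auto intro!: borel_measurable_times measurable_bcontfun2[OF U])
        show "integrable lborel (\<lambda>y. C * bump l (y::'a))"
          by (rule integrable_mult_right[OF integrable_bump[OF l]])
        show "AE y in lborel. (\<lambda>i. bump l y * U (u i - y) (u i)) \<longlonglongrightarrow> bump l y * U (a - y) a"
        proof (intro AE_I2 tendsto_intros tendsto_bcontfun2 u)
          fix y
          have "(\<lambda>i. u i - y) \<longlonglongrightarrow> a - y" by (intro tendsto_intros u)
          then show "(\<lambda>i. U (u i - y)) \<longlonglongrightarrow> U (a - y)"
            using continuous_on_tendsto_compose[OF U] by simp
        qed
        show "AE y in lborel. norm (bump l y * U (u i - y) (u i)) \<le> C * bump l y" for i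
          by (rule AE_I2) (use mult_right_mono[OF abs_U_le bump_nonneg[OF l]] in \<open>simp add: abs_mult bump_nonneg[OF l] mult.commute\<close>)
      qed
    qed
  qed
  then show ?thesis by (simp add: avg_def Bcontfun_inverse)
qed

lemma abs_avg_diff_le:
  assumes K: "\<And>z. norm (x - z) < l \<Longrightarrow> \<bar>U z x - c\<bar> \<le> K"
  shows "\<bar>avg l U x - c\<bar> \<le> K"
proof -
  have i: "integrable lborel (\<lambda>z. bump l (x - z))" by (rule integrable_bump_reflect[OF l])
  have "avg l U x - c = (\<integral>z. bump l (x - z) * (U z x - c) \<partial>lborel)"
    using i integrable_avg[OF i] by (simp add: avg_apply right_diff_distrib integral_bump_reflect[OF l])
  moreover have "\<bar>\<integral>z. bump l (x - z) * (U z x - c) \<partial>lborel\<bar> \<le> K * (\<integral>z. \<bar>bump l (x - z)\<bar> \<partial>lborel)"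
  proof (rule abs_integral_weighted_le[OF i])
    show "\<bar>U z x - c\<bar> \<le> K" if "bump l (x - z) \<noteq> 0" for z
      using that bump_eq_0[OF l, of "x - z"] K[of z] by force
  qed measurable
  ultimately show ?thesis by (simp add: bump_nonneg[OF l] integral_bump_reflect[OF l])
qed

end

section \<open>The averaged semigroup: bounds, change of radius, derivative in time\<close>

context stable_like begin

definition u :: "nat \<Rightarrow> real \<Rightarrow> ('a \<Rightarrow>\<^sub>C real) \<Rightarrow> 'a \<Rightarrow> ('a \<Rightarrow>\<^sub>C real)"
  where "u J t g z = (P J z t * moll2 J) \<bullet>\<^sub>o g"

definition Bu :: "nat \<Rightarrow> real \<Rightarrow> ('a \<Rightarrow>\<^sub>C real) \<Rightarrow> 'a \<Rightarrow> ('a \<Rightarrow>\<^sub>C real)"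
  where "Bu J t g z = B J z \<bullet>\<^sub>o u J t g z"

lemma continuous_P: "0 \<le> t \<Longrightarrow> continuous_on UNIV (\<lambda>z. P J z t)"
  by (intro continuous_at_imp_continuous_on ballI isCont_P)

lemma continuous_B: "continuous_on UNIV (B J)"
  by (intro continuous_at_imp_continuous_on ballI isCont_B)

lemma continuous_u: "0 \<le> t \<Longrightarrow> continuous_on UNIV (u J t g)"
  unfolding u_def[abs_def]
  by (intro cop_apply.continuous_on continuous_intros continuous_P)

lemma continuous_Bu: "0 \<le> t \<Longrightarrow> continuous_on UNIV (Bu J t g)"
  unfolding Bu_def[abs_def]
  by (intro cop_apply.continuous_on continuous_B continuous_u)

lemma norm_u: "0 \<le> t \<Longrightarrow> norm (u J t g z) \<le> norm g"
  unfolding u_def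
  using order_trans[OF norm_cop_apply[of "P J z t * moll2 J" g]
      mult_right_mono[OF norm_mult_le_1[OF norm_P[of t J z] norm_moll2] norm_ge_zero]] by simp

lemma norm_Bu: "0 \<le> t \<Longrightarrow> norm (Bu J t g z) \<le> LB J * norm g"
  unfolding Bu_def by (rule order_trans[OF norm_cop_apply]) (intro mult_mono norm_B norm_u LB_nonneg norm_ge_zero)

lemma u_shift_le:
  assumes t: "0 < t" "t \<le> 1"
  shows "\<bar>u J t g z (x + h) - u J t g z x\<bar> \<le> 2 * min 1 (norm h / \<delta> z t) * norm g"
proof -
  have "u J t g z (x + h) - u J t g z x = (((shift h - 1) * (P J z t * moll2 J)) \<bullet>\<^sub>o g) x"
    by (simp add: u_def cop_apply_simps)
  also have "\<bar>\<dots>\<bar> \<le> norm (((shift h - 1) * (P J z t * moll2 J)) \<bullet>\<^sub>o g)" by (rule abs_bcontfun_le)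
  also have "\<dots> \<le> norm ((shift h - 1) * (P J z t * moll2 J)) * norm g" by (rule norm_cop_apply)
  also have "\<dots> \<le> 2 * min 1 (norm h / \<delta> z t) * norm g"
    by (intro mult_right_mono norm_first_diff_P t) auto
  finally show ?thesis .
qed

lemma u_diff2_le:
  assumes t: "0 < t" "t \<le> 1"
  shows "\<bar>(diff2 h \<bullet>\<^sub>o u J t g z) x\<bar> \<le> 4 * min 1 ((norm h / \<delta> z t)\<^sup>2) * norm g"
proof -
  have "\<bar>(diff2 h \<bullet>\<^sub>o u J t g z) x\<bar> \<le> norm ((diff2 h * (P J z t * moll2 J)) \<bullet>\<^sub>o g)"
    unfolding u_def using abs_bcontfun_le[of "(diff2 h * (P J z t * moll2 J)) \<bullet>\<^sub>o g" x] by simp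
  also have "\<dots> \<le> norm (diff2 h * (P J z t * moll2 J)) * norm g" by (rule norm_cop_apply)
  also have "\<dots> \<le> 4 * min 1 ((norm h / \<delta> z t)\<^sup>2) * norm g"
    by (intro mult_right_mono norm_diff2_P t) auto
  finally show ?thesis .
qed

text \<open>The generator \<open>B J x\<close> acts on both occurrences of \<open>x\<close> in \<open>f\<close>. On the block of times of order \<open>4\<^sup>-\<^sup>k\<close> the weight
  \<open>bump (2\<^sup>-\<^sup>k)\<close> varies on a scale much larger than the smoothing scale, so its increments only contribute
  lower order terms.\<close>

definition f :: "nat \<Rightarrow> nat \<Rightarrow> ('a \<Rightarrow>\<^sub>C real) \<Rightarrow> real \<Rightarrow> ('a \<Rightarrow>\<^sub>C real)"
  where "f J k g t = avg ((1/2) ^ k) (u J t g)"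

definition f' :: "nat \<Rightarrow> nat \<Rightarrow> ('a \<Rightarrow>\<^sub>C real) \<Rightarrow> real \<Rightarrow> ('a \<Rightarrow>\<^sub>C real)"
  where "f' J k g t = avg ((1/2) ^ k) (Bu J t g)"

lemma f_apply: "0 \<le> t \<Longrightarrow> f J k g t x = (\<integral>z. bump ((1/2) ^ k) (x - z) * u J t g z x \<partial>lborel)"
  unfolding f_def by (rule avg_apply[OF continuous_u norm_u]) auto

lemma f'_apply: "0 \<le> t \<Longrightarrow> f' J k g t x = (\<integral>z. bump ((1/2) ^ k) (x - z) * Bu J t g z x \<partial>lborel)"
  unfolding f'_def by (rule avg_apply[OF continuous_Bu norm_Bu]) auto

lemma norm_f: "0 \<le> t \<Longrightarrow> norm (f J k g t) \<le> norm g"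
proof (rule norm_bound)
  fix x assume t: "0 \<le> t"
  have "\<bar>f J k g t x - 0\<bar> \<le> norm g"
    unfolding f_def
    by (rule abs_avg_diff_le[OF continuous_u[OF t] norm_u[OF t]]) (use order_trans[OF abs_bcontfun_le norm_u[OF t]] in auto)
  then show "norm (f J k g t x) \<le> norm g" by simp
qed

lemma half_power_le: "a < (1/2) ^ k \<Longrightarrow> a \<le> 2 * (1/2) ^ k" for a :: real
  using zero_less_power[of "1/2 :: real" k] by linarith

lemma half_power_Suc_le: "a < (1/2) ^ Suc k \<Longrightarrow> a \<le> 2 * (1/2) ^ k" for a :: real
  using zero_less_power[of "1/2 :: real" k] unfolding power_Suc by linarith

text \<open>Both averages are compared with the semigroup frozen at the point of evaluation. The
  oscillation bound of level \<open>k\<close> covers the radius of level \<open>k + 1\<close> as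
  well.\<close>

lemma norm_f_switch:
  "norm (f J k g ((1/4) ^ (k + 1)) - f J (Suc k) g ((1/4) ^ (k + 1))) \<le> CE * \<Omega> k * norm g"
proof (rule norm_bound)
  fix x
  define t :: real where "t = (1/4) ^ (k + 1)"
  have t: "0 < t" "t \<le> 1" "(1/4) ^ (k + 1) \<le> t"
    using power_le_one[of "1/4 :: real" "k + 1"] by (simp_all add: t_def)
  have u: "\<bar>u J t g z x - u J t g x x\<bar> \<le> CE / 4 * \<Omega> k * norm g" if "norm (x - z) \<le> 2 * (1/2) ^ k" for z
  proof -
    have "u J t g z x - u J t g x x = ((P J z t * moll2 J - P J x t * moll2 J) \<bullet>\<^sub>o g) x"
      by (simp add: u_def cop_apply_simps)
    also have "\<bar>\<dots>\<bar> \<le> norm (P J z t * moll2 J - P J x t * moll2 J) * norm g"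
      by (rule order_trans[OF abs_bcontfun_le norm_cop_apply])
    also have "\<dots> \<le> (t * (CE * 4 ^ k * \<Omega> k)) * norm g"
      using that by (intro mult_right_mono norm_P_moll2_diff t) (auto simp: norm_minus_commute)
    also have "t * (CE * 4 ^ k * \<Omega> k) = CE / 4 * \<Omega> k"
      by (simp add: t_def power_one_over)
    finally show ?thesis .
  qed
  have 1: "\<bar>f J k g t x - u J t g x x\<bar> \<le> CE / 4 * \<Omega> k * norm g"
    unfolding f_def using t by (intro abs_avg_diff_le[OF continuous_u norm_u] u half_power_le) auto
  have 2: "\<bar>f J (Suc k) g t x - u J t g x x\<bar> \<le> CE / 4 * \<Omega> k * norm g"
    unfolding f_def using t by (intro abs_avg_diff_le[OF continuous_u norm_u] u half_power_Suc_le) auto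
  have "CE / 4 * \<Omega> k * norm g + CE / 4 * \<Omega> k * norm g \<le> CE * \<Omega> k * norm g"
    using CE_nonneg \<Omega>_nonneg[of k] by (simp add: field_simps)
  then show "norm ((f J k g ((1/4) ^ (k + 1)) - f J (Suc k) g ((1/4) ^ (k + 1))) x) \<le> CE * \<Omega> k * norm g"
    using 1 2 unfolding minus_bcontfun.rep_eq real_norm_def t_def[symmetric] by linarith
qed

lemma norm_f_taylor:
  assumes t: "0 \<le> t" "0 \<le> s"
  shows "norm (f J k g s - f J k g t - (s - t) *\<^sub>R f' J k g t) \<le> (LB J)\<^sup>2 * norm g * (s - t)\<^sup>2"
proof (rule norm_bound)
  fix x :: 'a
  let ?w = "\<lambda>z. bump ((1/2) ^ k) (x - z) :: real"
  have l: "0 < ((1/2) ^ k :: real)" by simp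
  have i: "integrable lborel ?w" by (rule integrable_bump_reflect[OF l])
  note m = measurable_avg[OF continuous_u norm_u l] measurable_avg[OF continuous_Bu norm_Bu l]
  note iu = integrable_avg[OF continuous_u norm_u l i] integrable_avg[OF continuous_Bu norm_Bu l i]
  let ?r = "\<lambda>z. u J s g z x - u J t g z x - (s - t) * Bu J t g z x"
  have eq: "(f J k g s - f J k g t - (s - t) *\<^sub>R f' J k g t) x = (\<integral>z. ?w z * ?r z \<partial>lborel)"
    using t iu by (simp add: f_apply f'_apply right_diff_distrib mult.left_commute[of _ "s - t"])
  have "\<bar>?r z\<bar> \<le> (LB J)\<^sup>2 * norm g * (s - t)\<^sup>2" for z
  proof -
    let ?E = "exp (s *\<^sub>R B J z) - exp (t *\<^sub>R B J z) - (s - t) *\<^sub>R (B J z * exp (t *\<^sub>R B J z))"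
    have "?r z = ((?E * moll2 J) \<bullet>\<^sub>o g) x"
      by (simp add: u_def Bu_def P_def cop_apply_simps left_diff_distrib)
    also have "\<bar>\<dots>\<bar> \<le> norm (?E * moll2 J) * norm g"
      by (rule order_trans[OF abs_bcontfun_le norm_cop_apply])
    also have "\<dots> \<le> ((LB J)\<^sup>2 * (s - t)\<^sup>2) * norm g"
      using norm_P[of _ J z] t
      by (intro mult_right_mono norm_mult_le_1' norm_exp_taylor norm_B norm_moll2) (auto simp: P_def)
    finally show ?thesis by (simp add: mult_ac)
  qed
  then have "\<bar>\<integral>z. ?w z * ?r z \<partial>lborel\<bar> \<le> ((LB J)\<^sup>2 * norm g * (s - t)\<^sup>2) * (\<integral>z. \<bar>?w z\<bar> \<partial>lborel)"
    using t m by (intro abs_integral_weighted_le[OF i]) auto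
  then show "norm ((f J k g s - f J k g t - (s - t) *\<^sub>R f' J k g t) x) \<le> (LB J)\<^sup>2 * norm g * (s - t)\<^sup>2"
    unfolding eq by (simp add: bump_nonneg[OF l] integral_bump_reflect[OF l])
qed

subsection \<open>The commutator\<close>

definition D2 :: real where "D2 = C_sm * 4 powr (3 * \<Gamma> * (1 / a0\<^sup>2))"

lemma D2_pos: "0 < D2" using C_sm by (simp add: D2_def)

text \<open>Replaces the index of \<open>z\<close> by that of \<open>x\<close>, so that one scale
  serves all \<open>z\<close> in the average. Reciprocals of indices differ by at most
  \<open>\<beta> k / a0^2\<close>, which costs a bounded factor at these times.\<close>

lemma inverse_\<delta>_le:
  assumes t: "0 < t" "t \<le> 1" "(1/4) ^ (k + 2) \<le> t" and xz: "norm (x - z) \<le> 2 * (1/2) ^ k"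
  shows "1 / \<delta> z t \<le> D2 * (2 / t) powr (1 / \<alpha> x)"
proof -
  have p: "0 < \<alpha> x" "0 < \<alpha> z" by (rule \<alpha>_pos)+
  have "1 / \<alpha> z - 1 / \<alpha> x = (\<alpha> x - \<alpha> z) / (\<alpha> z * \<alpha> x)" using p by (simp add: field_simps)
  also have "\<dots> \<le> \<beta> k / (a0 * a0)"
  proof (rule frac_le)
    show "a0 * a0 \<le> \<alpha> z * \<alpha> x" using a0 \<alpha>_ge p by (intro mult_mono) auto
  qed (use \<alpha>_osc[OF xz] \<beta>_nonneg[of k] a0 in auto)
  finally have "1 / \<alpha> z \<le> 1 / \<alpha> x + \<beta> k * (1 / a0\<^sup>2)" by (simp add: power2_eq_square)
  then have "(2 / t) powr (1 / \<alpha> z) \<le> (2 / t) powr (1 / \<alpha> x + \<beta> k * (1 / a0\<^sup>2))"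
    using t by (intro powr_mono) auto
  also have "\<dots> = (2 / t) powr (1 / \<alpha> x) * (2 / t) powr (\<beta> k * (1 / a0\<^sup>2))" by (rule powr_add)
  also have "\<dots> \<le> (2 / t) powr (1 / \<alpha> x) * 4 powr (3 * \<Gamma> * (1 / a0\<^sup>2))"
  proof (rule mult_left_mono)
    have "(2 / t) powr (\<beta> k * (1 / a0\<^sup>2)) \<le> (4 ^ (k + 3)) powr (\<beta> k * (1 / a0\<^sup>2))"
      using two_div_le[OF t(1,3)] t \<beta>_nonneg[of k] by (intro powr_mono2) auto
    also have "\<dots> \<le> 4 powr (3 * \<Gamma> * (1 / a0\<^sup>2))" by (rule four_powr_le) simp
    finally show "(2 / t) powr (\<beta> k * (1 / a0\<^sup>2)) \<le> 4 powr (3 * \<Gamma> * (1 / a0\<^sup>2))" .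
  qed simp
  finally have "C_sm * (2 / t) powr (1 / \<alpha> z) \<le> C_sm * ((2 / t) powr (1 / \<alpha> x) * 4 powr (3 * \<Gamma> * (1 / a0\<^sup>2)))"
    using C_sm by (intro mult_left_mono) auto
  moreover have "1 / \<delta> z t = C_sm * (2 / t) powr (1 / \<alpha> z)"
    using t by (simp add: \<delta>_def powr_divide)
  ultimately show ?thesis by (simp add: D2_def mult_ac)
qed

text \<open>The gain per block from the slow variation of the weight. The mixed term in the product
  rule is of order \<open>2 powr (k * (a1 / 2 + 1))\<close>, which is
  \<open>4 ^ k * \<rho> ^ k\<close>; after integration over a block \<open>\<rho> ^ k\<close>
  remains.\<close>

definition \<rho> :: real where "\<rho> = 2 powr (a1 / 2 - 1)"

lemma \<rho>: "0 < \<rho>" "\<rho> < 1" using a1 by (simp_all add: \<rho>_def powr_less_one)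

definition CC :: real where "CC = \<kappa>2 * Ck * ((4 + bump_const TYPE('a)) + 8 * (4 + bump_const TYPE('a) * D2))"

lemma CC_nonneg: "0 \<le> CC"
  using \<kappa>2 Ck_nonneg bump_const_pos[where 'a='a] D2_pos by (simp add: CC_def)

lemma integral_bump_Dw_le:
  fixes x h :: 'a
  assumes l: "0 < l"
  shows "(\<integral>z. \<bar>bump l (x + h - z) - bump l (x - z)\<bar> \<partial>lborel) \<le> bump_const TYPE('a) * norm h / l"
    and "(\<integral>z. \<bar>bump l (x + h - z) - bump l (x - z)\<bar> \<partial>lborel) \<le> 2"
    and "(\<integral>z. \<bar>bump l (x + h - z) + bump l (x - h - z) - 2 * bump l (x - z)\<bar> \<partial>lborel) \<le> (4 + bump_const TYPE('a)) * min 1 ((norm h / l)\<^sup>2)"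
proof -
  have eq1: "(\<integral>z. \<bar>bump l (x + h - z) - bump l (x - z)\<bar> \<partial>lborel) = (\<integral>y. \<bar>bump l (y + h) - bump l (y::'a)\<bar> \<partial>lborel)"
    using integral_lborel_reflect_shift[of "\<lambda>y. \<bar>bump l (y + h) - bump l (y::'a)\<bar>" "-1" x] by (simp add: algebra_simps)
  have eq2: "(\<integral>z. \<bar>bump l (x + h - z) + bump l (x - h - z) - 2 * bump l (x - z)\<bar> \<partial>lborel)
      = (\<integral>y. \<bar>bump l (y + h) + bump l (y - h) - 2 * bump l (y::'a)\<bar> \<partial>lborel)"
    using integral_lborel_reflect_shift[of "\<lambda>y. \<bar>bump l (y + h) + bump l (y - h) - 2 * bump l (y::'a)\<bar>" "-1" x]
    by (simp add: algebra_simps)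
  note i = integrable_bump_reflect[OF l, of "x + h"] integrable_bump_reflect[OF l, of "x - h"] integrable_bump_reflect[OF l, of x]
  have int: "(\<integral>z. \<bar>bump l (v - z)\<bar> \<partial>lborel) = 1" for v :: 'a
    by (simp add: bump_nonneg[OF l] integral_bump_reflect[OF l])
  show "(\<integral>z. \<bar>bump l (x + h - z) - bump l (x - z)\<bar> \<partial>lborel) \<le> bump_const TYPE('a) * norm h / l"
    unfolding eq1 by (rule integral_bump_diff_le[OF l])
  have "(\<integral>z. \<bar>bump l (x + h - z) - bump l (x - z)\<bar> \<partial>lborel) \<le> (\<integral>z. \<bar>bump l (x + h - z)\<bar> + \<bar>bump l (x - z)\<bar> \<partial>lborel)"
    using i by (intro integral_mono) auto
  then show "(\<integral>z. \<bar>bump l (x + h - z) - bump l (x - z)\<bar> \<partial>lborel) \<le> 2" using i int by simp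
  have "(\<integral>z. \<bar>bump l (x + h - z) + bump l (x - h - z) - 2 * bump l (x - z)\<bar> \<partial>lborel)
      \<le> (\<integral>z. \<bar>bump l (x + h - z)\<bar> + \<bar>bump l (x - h - z)\<bar> + 2 * \<bar>bump l (x - z)\<bar> \<partial>lborel)"
    using i by (intro integral_mono) auto
  also have "\<dots> = 4" using i int by simp
  finally have 4: "(\<integral>z. \<bar>bump l (x + h - z) + bump l (x - h - z) - 2 * bump l (x - z)\<bar> \<partial>lborel) \<le> 4" .
  have b: "(\<integral>z. \<bar>bump l (x + h - z) + bump l (x - h - z) - 2 * bump l (x - z)\<bar> \<partial>lborel) \<le> bump_const TYPE('a) * (norm h / l)\<^sup>2"
    unfolding eq2 by (rule integral_bump_diff2_le[OF l])
  show "(\<integral>z. \<bar>bump l (x + h - z) + bump l (x - h - z) - 2 * bump l (x - z)\<bar> \<partial>lborel) \<le> (4 + bump_const TYPE('a)) * min 1 ((norm h / l)\<^sup>2)"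
  proof (cases "1 \<le> (norm h / l)\<^sup>2")
    case True then show ?thesis using 4 bump_const_pos[where 'a='a] by simp
  next
    case False
    have "bump_const TYPE('a) * (norm h / l)\<^sup>2 \<le> (4 + bump_const TYPE('a)) * (norm h / l)\<^sup>2" by (intro mult_right_mono) auto
    then show ?thesis using b False by simp
  qed
qed

lemma commutator:
  assumes t: "0 < t" "t \<le> (1/4) ^ k" "(1/4) ^ (k + 1) \<le> t"
  shows "\<bar>f' J k g t x - (B J x \<bullet>\<^sub>o f J k g t) x\<bar> \<le> (CE * 4 ^ k * \<Omega> k + CC * (4 ^ k * \<rho> ^ k)) * norm g"
proof -
  define l :: real where "l = (1/2) ^ k"
  have l: "0 < l" "l \<le> 1" by (simp_all add: l_def power_le_one)
  have t1: "t \<le> 1" using t(2) power_le_one[of "1/4::real" k] by linarith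
  have t2: "(1/4) ^ (k + 2) \<le> t" using t(3) power_decreasing[of "k + 1" "k + 2" "1/4::real"] by linarith
  have t0: "0 \<le> t" using t by simp
  define v where "v = u J t g"
  define F where "F = f J k g t"
  have cv: "continuous_on UNIV v" unfolding v_def by (rule continuous_u[OF t0])
  have nv: "\<bar>v z y\<bar> \<le> norm g" for z y
    unfolding v_def by (rule order_trans[OF abs_bcontfun_le norm_u[OF t0]])
  have nv2: "\<bar>v z y - v z y'\<bar> \<le> 2 * norm g" for z y y'
    using nv[of z y] nv[of z y'] by linarith
  have mv [measurable]: "(\<lambda>z. v z y) \<in> borel_measurable borel" for y
    by (rule measurable_bcontfun2[OF cv]) auto
  have mv2 [measurable]: "(\<lambda>p. v (snd p) (x + fst p)) \<in> borel_measurable (lborel \<Otimes>\<^sub>M lborel)"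
    "(\<lambda>p. v (snd p) x) \<in> borel_measurable (lborel \<Otimes>\<^sub>M lborel)"
    by (auto intro!: measurable_bcontfun2[OF cv])
  let ?w = "\<lambda>z. bump l (x - z)"
  let ?D = "\<lambda>h z. bump l (x + h - z) - bump l (x - z)"
  have iw: "integrable lborel (\<lambda>z. bump l (y - z))" for y :: 'a by (rule integrable_bump_reflect[OF l(1)])
  have int_w: "(\<integral>z. \<bar>bump l (y - z)\<bar> \<partial>lborel) = 1" for y :: 'a
    by (simp add: bump_nonneg[OF l(1)] integral_bump_reflect[OF l(1)])
  \<comment> \<open>The increment of \<open>F\<close> by the product rule: increment of \<open>v\<close>, increment of the weight, and both.\<close>
  define I1 where "I1 h = (\<integral>z. ?w z * (v z (x + h) - v z x) \<partial>lborel)" for h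
  define I2 where "I2 h = (\<integral>z. ?D h z * v z x \<partial>lborel)" for h
  define I3 where "I3 h = (\<integral>z. ?D h z * (v z (x + h) - v z x) \<partial>lborel)" for h
  have iD: "integrable lborel (?D h)" for h using iw by simp
  have m [measurable]: "I1 \<in> borel_measurable borel" "I2 \<in> borel_measurable borel" "I3 \<in> borel_measurable borel"
    unfolding I1_def[abs_def] I2_def[abs_def] I3_def[abs_def]
    using lborel.borel_measurable_lebesgue_integral[of "\<lambda>h z. ?w z * (v z (x + h) - v z x)" lborel]
      lborel.borel_measurable_lebesgue_integral[of "\<lambda>h z. ?D h z * v z x" lborel]
      lborel.borel_measurable_lebesgue_integral[of "\<lambda>h z. ?D h z * (v z (x + h) - v z x)" lborel]
    by (simp_all add: split_beta)
  have b1: "\<bar>I1 h\<bar> \<le> 2 * norm g" for h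
    using abs_integral_weighted_le[OF iw, of "\<lambda>z. v z (x + h) - v z x" x "2 * norm g"] nv2 int_w by (simp add: I1_def)
  have b2: "\<bar>I2 h\<bar> \<le> norm g * 2" for h
    using abs_integral_weighted_le[OF iD[of h] mv[of x] nv] mult_left_mono[OF integral_bump_Dw_le(2)[OF l(1), of x h], of "norm g"]
    by (simp add: I2_def)
  have b3: "\<bar>I3 h\<bar> \<le> 2 * norm g * 2" for h
    using abs_integral_weighted_le[OF iD[of h], of "\<lambda>z. v z (x + h) - v z x" "2 * norm g"] nv2
      mult_left_mono[OF integral_bump_Dw_le(2)[OF l(1), of x h], of "2 * norm g"] by (simp add: I3_def)
  have ik: "integrable lborel (\<lambda>h. ker J x h * G h)" if "G \<in> borel_measurable borel" "\<And>h. \<bar>G h\<bar> \<le> C" for G C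
    by (rule integrable_weighted[OF integrable_ker that])
  have split: "F (x + h) - F x = I1 h + I2 h + I3 h" for h
  proof -
    have i: "integrable lborel (\<lambda>z. ?w z * (v z (x + h) - v z x))" "integrable lborel (\<lambda>z. ?D h z * v z x)"
      "integrable lborel (\<lambda>z. ?D h z * (v z (x + h) - v z x))"
      by (rule integrable_weighted[OF iw _ nv2] integrable_weighted[OF iD _ nv] integrable_weighted[OF iD _ nv2]; measurable)+
    have i': "integrable lborel (\<lambda>z. bump l (y - z) * v z y)" for y
      by (rule integrable_weighted[OF iw _ nv]) measurable
    have Fa: "F y = (\<integral>z. bump l (y - z) * v z y \<partial>lborel)" for y
      unfolding F_def f_def v_def l_def by (rule avg_apply[OF continuous_u[OF t0] norm_u[OF t0]]) simp
    have "F (x + h) - F x = (\<integral>z. bump l (x + h - z) * v z (x + h) - bump l (x - z) * v z x \<partial>lborel)"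
      unfolding Fa by (rule Bochner_Integration.integral_diff[symmetric, OF i' i'])
    also have "\<dots> = (\<integral>z. ?w z * (v z (x + h) - v z x) + ?D h z * v z x + ?D h z * (v z (x + h) - v z x) \<partial>lborel)"
      by (rule Bochner_Integration.integral_cong) (simp_all add: algebra_simps)
    also have "\<dots> = I1 h + I2 h + I3 h" using i by (simp add: I1_def I2_def I3_def)
    finally show ?thesis .
  qed
  have "(B J x \<bullet>\<^sub>o F) x = (\<integral>h. ker J x h * I1 h + ker J x h * I2 h + ker J x h * I3 h \<partial>lborel)"
    unfolding B_def gen_apply[OF integrable_ker] split by (simp add: algebra_simps)
  also have "\<dots> = (\<integral>h. ker J x h * I1 h \<partial>lborel) + (\<integral>h. ker J x h * I2 h \<partial>lborel) + (\<integral>h. ker J x h * I3 h \<partial>lborel)"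
    using ik[OF m(1) b1] ik[OF m(2) b2] ik[OF m(3) b3] by simp
  finally have BF: "(B J x \<bullet>\<^sub>o F) x = (\<integral>h. ker J x h * I1 h \<partial>lborel) + (\<integral>h. ker J x h * I2 h \<partial>lborel) + (\<integral>h. ker J x h * I3 h \<partial>lborel)" .
  let ?X = "4 ^ k * \<rho> ^ k"
  have X: "?X = (2 powr (a1 / 2 + 1)) ^ k"
  proof -
    have "2 powr (a1 / 2 + 1) = 4 * \<rho>"
      using powr_add[of 2 "a1 / 2 - 1" 2] by (simp add: \<rho>_def add.commute mult.commute)
    then show ?thesis by (simp add: power_mult_distrib)
  qed
  have ax: "0 < \<alpha> x" "\<alpha> x \<le> a1" "a1 < 2" using \<alpha>_pos \<alpha>_le a1 by auto
  have l_powr: "l powr - e = (2 powr e) ^ k" for e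
  proof -
    have "l powr - e = ((1/2) powr - e) ^ k" unfolding l_def by (rule power_powr) simp
    also have "(1/2::real) powr - e = 2 powr e" by (simp add: powr_divide powr_minus)
    finally show ?thesis .
  qed
  have T1: "\<bar>f' J k g t x - (\<integral>h. ker J x h * I1 h \<partial>lborel)\<bar> \<le> CE * 4 ^ k * \<Omega> k * norm g"
  proof -
    have int: "integrable (lborel \<Otimes>\<^sub>M lborel) (\<lambda>(h, z). ker J x h * (?w z * (v z (x + h) - v z x)))"
    proof (rule Bochner_Integration.integrable_bound)
      show "integrable (lborel \<Otimes>\<^sub>M lborel) (\<lambda>p. 2 * norm g * (case p of (h, z) \<Rightarrow> ker J x h * ?w z))"
        by (intro integrable_mult_right integrable_pair_mult integrable_ker iw)
      show "(\<lambda>(h, z). ker J x h * (?w z * (v z (x + h) - v z x))) \<in> borel_measurable (lborel \<Otimes>\<^sub>M lborel)"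
        by (simp add: split_beta)
      show "AE p in lborel \<Otimes>\<^sub>M lborel. norm (case p of (h, z) \<Rightarrow> ker J x h * (?w z * (v z (x + h) - v z x)))
          \<le> norm (2 * norm g * (case p of (h, z) \<Rightarrow> ker J x h * ?w z))"
      proof (rule AE_I2, clarify)
        fix h z
        show "norm (ker J x h * (?w z * (v z (x + h) - v z x))) \<le> norm (2 * norm g * (ker J x h * ?w z))"
          using mult_left_mono[OF nv2[of z "x + h" x], of "ker J x h * ?w z"] bump_nonneg[OF l(1), of "x - z"]
          by (simp add: abs_mult mult_ac)
      qed
    qed
    have "(\<integral>h. ker J x h * I1 h \<partial>lborel) = (\<integral>h. \<integral>z. ker J x h * (?w z * (v z (x + h) - v z x)) \<partial>lborel \<partial>lborel)"
      by (simp add: I1_def)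
    also have "\<dots> = (\<integral>z. \<integral>h. ker J x h * (?w z * (v z (x + h) - v z x)) \<partial>lborel \<partial>lborel)"
      by (rule lborel_pair.Fubini_integral[symmetric, OF int])
    also have "\<dots> = (\<integral>z. ?w z * (B J x \<bullet>\<^sub>o v z) x \<partial>lborel)"
    proof (rule Bochner_Integration.integral_cong[OF refl])
      fix z
      have "(\<integral>h. ker J x h * (?w z * (v z (x + h) - v z x)) \<partial>lborel) = (\<integral>h. ?w z * ((v z (x + h) - v z x) * ker J x h) \<partial>lborel)"
        by (rule Bochner_Integration.integral_cong) (simp_all add: mult_ac)
      also have "\<dots> = ?w z * (B J x \<bullet>\<^sub>o v z) x"
        unfolding B_def gen_apply[OF integrable_ker] by (rule integral_mult_right_zero)
      finally show "(\<integral>h. ker J x h * (?w z * (v z (x + h) - v z x)) \<partial>lborel) = ?w z * (B J x \<bullet>\<^sub>o v z) x" .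
    qed
    finally have e1: "(\<integral>h. ker J x h * I1 h \<partial>lborel) = (\<integral>z. ?w z * (B J x \<bullet>\<^sub>o v z) x \<partial>lborel)" .
    have cB: "continuous_on UNIV (\<lambda>z. B J x \<bullet>\<^sub>o v z)"
      by (intro cop_apply.continuous_on continuous_on_const cv)
    have cB': "continuous_on UNIV (\<lambda>z. B J z \<bullet>\<^sub>o v z)"
      by (intro cop_apply.continuous_on continuous_B cv)
    have nB: "\<bar>(B J y \<bullet>\<^sub>o v z) x\<bar> \<le> LB J * norm g" for y z
      unfolding v_def by (rule order_trans[OF abs_bcontfun_le order_trans[OF norm_cop_apply]]) (intro mult_mono norm_B norm_u[OF t0] LB_nonneg norm_ge_zero)
    have mB: "(\<lambda>z. (B J x \<bullet>\<^sub>o v z) x) \<in> borel_measurable borel" "(\<lambda>z. (B J z \<bullet>\<^sub>o v z) x) \<in> borel_measurable borel"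
      by (rule measurable_bcontfun2[OF cB] measurable_bcontfun2[OF cB']; simp)+
    have iB: "integrable lborel (\<lambda>z. ?w z * (B J x \<bullet>\<^sub>o v z) x)" "integrable lborel (\<lambda>z. ?w z * (B J z \<bullet>\<^sub>o v z) x)"
      by (rule integrable_weighted[OF iw mB(1) nB] integrable_weighted[OF iw mB(2) nB])+
    have "f' J k g t x = (\<integral>z. ?w z * (B J z \<bullet>\<^sub>o v z) x \<partial>lborel)"
      by (simp add: f'_apply[OF t0] Bu_def v_def l_def)
    then have "f' J k g t x - (\<integral>h. ker J x h * I1 h \<partial>lborel) = (\<integral>z. ?w z * ((B J z \<bullet>\<^sub>o v z) x - (B J x \<bullet>\<^sub>o v z) x) \<partial>lborel)"
      using iB by (simp add: e1 right_diff_distrib)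
    moreover have "\<bar>(\<integral>z. ?w z * ((B J z \<bullet>\<^sub>o v z) x - (B J x \<bullet>\<^sub>o v z) x) \<partial>lborel)\<bar> \<le> CE * 4 ^ k * \<Omega> k * norm g * (\<integral>z. \<bar>?w z\<bar> \<partial>lborel)"
    proof (rule abs_integral_weighted_le[OF iw])
      show "(\<lambda>z. (B J z \<bullet>\<^sub>o v z) x - (B J x \<bullet>\<^sub>o v z) x) \<in> borel_measurable borel" using mB by measurable
      fix z assume "?w z \<noteq> 0"
      then have "norm (x - z) < l" using bump_eq_0[OF l(1), of "x - z"] by force
      then have xz: "norm (x - z) \<le> 2 * (1/2) ^ k" unfolding l_def by (rule half_power_le)
      have "(B J z \<bullet>\<^sub>o v z) x - (B J x \<bullet>\<^sub>o v z) x = - (((B J x - B J z) * (P J z t * moll2 J)) \<bullet>\<^sub>o g) x"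
        by (simp add: v_def u_def cop_apply_simps)
      then have "\<bar>(B J z \<bullet>\<^sub>o v z) x - (B J x \<bullet>\<^sub>o v z) x\<bar> \<le> norm ((B J x - B J z) * (P J z t * moll2 J)) * norm g"
        using order_trans[OF abs_bcontfun_le norm_cop_apply] by (simp del: cop_simps)
      also have "\<dots> \<le> CE * 4 ^ k * \<Omega> k * norm g"
        by (intro mult_right_mono norm_B_diff_P t(1) t1 t2 xz) auto
      finally show "\<bar>(B J z \<bullet>\<^sub>o v z) x - (B J x \<bullet>\<^sub>o v z) x\<bar> \<le> CE * 4 ^ k * \<Omega> k * norm g" .
    qed
    ultimately show ?thesis by (simp add: int_w)
  qed
  \<comment> \<open>The factor \<open>v z x\<close> does not depend on \<open>h\<close>, so
    reflecting \<open>h\<close> makes a second difference of the weight. A first difference could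
    not be bounded uniformly in \<open>J\<close> for indices of 1 and above.\<close>
  have T2: "\<bar>\<integral>h. ker J x h * I2 h \<partial>lborel\<bar> \<le> \<kappa>2 * Ck * (4 + bump_const TYPE('a)) * ?X * norm g"
  proof -
    have i2: "integrable lborel (\<lambda>h. ker J x h * I2 h)" "integrable lborel (\<lambda>h. ker J x h * I2 (- h))"
      by (rule ik[OF _ b2]; measurable)+
    have I22: "\<bar>I2 h + I2 (- h)\<bar> \<le> norm g * ((4 + bump_const TYPE('a)) * min 1 ((norm h / l)\<^sup>2))" for h
    proof -
      have iv: "integrable lborel (\<lambda>z. bump l (y - z) * v z x)" for y
        by (rule integrable_weighted[OF iw mv nv])
      have "I2 h + I2 (- h) = (\<integral>z. (bump l (x + h - z) + bump l (x - h - z) - 2 * bump l (x - z)) * v z x \<partial>lborel)"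
        using iv by (simp add: I2_def left_diff_distrib distrib_right mult.assoc)
      also have "\<bar>\<dots>\<bar> \<le> norm g * (\<integral>z. \<bar>bump l (x + h - z) + bump l (x - h - z) - 2 * bump l (x - z)\<bar> \<partial>lborel)"
        using iw by (intro abs_integral_weighted_le mv nv) auto
      also have "\<dots> \<le> norm g * ((4 + bump_const TYPE('a)) * min 1 ((norm h / l)\<^sup>2))"
        by (intro mult_left_mono integral_bump_Dw_le(3) l(1)) auto
      finally show ?thesis .
    qed
    have "(\<integral>h. ker J x h * I2 h \<partial>lborel) = (\<integral>h. ker J x h * I2 (- h) \<partial>lborel)"
      using integral_lborel_reflect_shift[of "\<lambda>h. ker J x h * I2 h" "-1" 0] by simp
    then have "2 * (\<integral>h. ker J x h * I2 h \<partial>lborel) = (\<integral>h. ker J x h * (I2 h + I2 (- h)) \<partial>lborel)"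
      using i2 by (simp add: distrib_left)
    also have "\<bar>\<dots>\<bar> \<le> (\<integral>h. \<bar>ker J x h * (I2 h + I2 (- h))\<bar> \<partial>lborel)" by (rule integral_abs_bound)
    also have "\<dots> \<le> (\<integral>h. norm g * (4 + bump_const TYPE('a)) * (min 1 ((norm h / l)\<^sup>2) * ker J x h) \<partial>lborel)"
    proof (rule integral_mono)
      show "integrable lborel (\<lambda>h. \<bar>ker J x h * (I2 h + I2 (- h))\<bar>)" using i2 by (simp add: distrib_left)
      show "integrable lborel (\<lambda>h. norm g * (4 + bump_const TYPE('a)) * (min 1 ((norm h / l)\<^sup>2) * ker J x h))"
        by (intro integrable_mult_right integrable_min_ker l(1))
      show "\<bar>ker J x h * (I2 h + I2 (- h))\<bar> \<le> norm g * (4 + bump_const TYPE('a)) * (min 1 ((norm h / l)\<^sup>2) * ker J x h)" for h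
        using mult_left_mono[OF I22[of h] ker_nonneg[of J x h]] by (simp add: abs_mult mult_ac)
    qed
    also have "\<dots> = norm g * (4 + bump_const TYPE('a)) * (\<integral>h. min 1 ((norm h / l)\<^sup>2) * ker J x h \<partial>lborel)"
      by (rule integral_mult_right_zero)
    also have "\<dots> \<le> norm g * (4 + bump_const TYPE('a)) * (\<kappa>2 * Ck * l powr - \<alpha> x)"
      using bump_const_pos[where 'a='a] by (intro mult_left_mono integral_min_ker_le l(1)) auto
    also have "\<dots> \<le> norm g * (4 + bump_const TYPE('a)) * (\<kappa>2 * Ck * ?X)"
    proof -
      have "l powr - \<alpha> x \<le> ?X" unfolding l_powr X using ax by (intro power_mono powr_mono) auto
      then show ?thesis using bump_const_pos[where 'a='a] \<kappa>2 Ck_nonneg by (intro mult_left_mono) auto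
    qed
    finally have "2 * \<bar>\<integral>h. ker J x h * I2 h \<partial>lborel\<bar> \<le> \<kappa>2 * Ck * (4 + bump_const TYPE('a)) * ?X * norm g"
      by (simp add: abs_mult mult_ac)
    then show ?thesis by linarith
  qed
  have T3: "\<bar>\<integral>h. ker J x h * I3 h \<partial>lborel\<bar> \<le> \<kappa>2 * Ck * (8 * (4 + bump_const TYPE('a) * D2)) * ?X * norm g"
  proof -
    define \<tau> where "\<tau> = (t / 2) powr (1 / \<alpha> x)"
    \<comment> \<open>The product of an increment at scale \<open>l\<close> and one at scale \<open>\<tau>\<close> behaves like a second difference at
      their geometric mean.\<close>
    define s where "s = sqrt (l * \<tau>)"
    have \<tau>: "0 < \<tau>" using t by (simp add: \<tau>_def)
    have s: "0 < s" "s\<^sup>2 = l * \<tau>" using l \<tau> by (simp_all add: s_def)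
    \<comment> \<open>Here \<open>\<alpha> x < 2\<close> and \<open>t <= (1/4) ^ k\<close> put the
      smoothing scale below the radius of the weight. Then \<open>norm h < s\<close> forces
      \<open>norm h < l\<close>, and every \<open>z\<close> involved lies within
      \<open>2 * l\<close> of \<open>x\<close>: this is what the factor 2 in the oscillation bounds
      is for.\<close>
    have \<tau>l: "\<tau> \<le> l"
    proof -
      have "1 / 2 \<le> 1 / \<alpha> x" using ax by (intro divide_left_mono) auto
      then have "\<tau> \<le> (t / 2) powr (1 / 2)"
        unfolding \<tau>_def using t t1 by (intro powr_mono') auto
      also have "\<dots> \<le> ((1/4) ^ k) powr (1/2)" using t by (intro powr_mono2) auto
      also have "\<dots> = ((1/4) powr (1/2)) ^ k" by (rule power_powr) simp
      also have "(1/4::real) powr (1/2) = 1/2"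
        by (simp add: powr_half_sqrt real_sqrt_divide)
      finally show ?thesis by (simp add: l_def)
    qed
    have bcD: "0 \<le> bump_const TYPE('a) * D2" using D2_pos bump_const_pos[where 'a='a] by simp
    have I33: "\<bar>I3 h\<bar> \<le> 2 * (4 + bump_const TYPE('a) * D2) * min 1 ((norm h / s)\<^sup>2) * norm g" for h
    proof (cases "1 \<le> (norm h / s)\<^sup>2")
      case True
      have "\<bar>I3 h\<bar> \<le> 4 * norm g" using b3[of h] by simp
      also have "\<dots> \<le> 2 * (4 + bump_const TYPE('a) * D2) * norm g" using bcD by (intro mult_right_mono) auto
      finally show ?thesis using True by simp
    next
      case False
      then have "(norm h)\<^sup>2 < s\<^sup>2"
        using s mult_pos_pos[OF l(1) \<tau>] by (simp add: power_divide not_le divide_less_eq)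
      also have "s\<^sup>2 \<le> l\<^sup>2" using s \<tau>l l by (simp add: power2_eq_square)
      finally have hl: "norm h < l" using l by (simp add: power2_less_imp_less)
      have D: "\<bar>v z (x + h) - v z x\<bar> \<le> 2 * (norm h * D2 / \<tau>) * norm g" if "?D h z \<noteq> 0" for z
      proof -
        have "norm (x - z) < l \<or> norm (x + h - z) < l"
          using that bump_eq_0[OF l(1), of "x - z"] bump_eq_0[OF l(1), of "x + h - z"] by force
        moreover have "norm (x - z) \<le> norm (x + h - z) + norm h"
          using norm_triangle_ineq4[of "x + h - z" h] by (simp add: algebra_simps)
        ultimately have xz: "norm (x - z) \<le> 2 * (1/2) ^ k" unfolding l_def[symmetric] using hl l by linarith
        have "1 / \<delta> z t \<le> D2 * (2 / t) powr (1 / \<alpha> x)" by (rule inverse_\<delta>_le[OF t(1) t1 t2 xz])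
        also have "\<dots> = D2 / \<tau>" using t by (simp add: \<tau>_def powr_divide)
        finally have "norm h * (1 / \<delta> z t) \<le> norm h * (D2 / \<tau>)" by (intro mult_left_mono) auto
        then have "2 * min 1 (norm h / \<delta> z t) * norm g \<le> 2 * (norm h * D2 / \<tau>) * norm g"
          by (intro mult_right_mono) (auto simp: min_def)
        with u_shift_le[OF t(1) t1, of J g z x h] show ?thesis unfolding v_def by linarith
      qed
      have "\<bar>I3 h\<bar> \<le> 2 * (norm h * D2 / \<tau>) * norm g * (\<integral>z. \<bar>?D h z\<bar> \<partial>lborel)"
        unfolding I3_def by (rule abs_integral_weighted_le[OF iD _ D]) measurable
      also have "\<dots> \<le> 2 * (norm h * D2 / \<tau>) * norm g * (bump_const TYPE('a) * norm h / l)"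
        using \<tau> D2_pos by (intro mult_left_mono integral_bump_Dw_le(1) l(1)) auto
      also have "\<dots> = 2 * (bump_const TYPE('a) * D2) * (norm h / s)\<^sup>2 * norm g"
        unfolding power_divide s(2) by (simp add: power2_eq_square mult_ac)
      also have "\<dots> \<le> 2 * (4 + bump_const TYPE('a) * D2) * (norm h / s)\<^sup>2 * norm g"
        by (intro mult_right_mono) auto
      finally show ?thesis using False by simp
    qed
    have "\<bar>\<integral>h. ker J x h * I3 h \<partial>lborel\<bar> \<le> (\<integral>h. \<bar>ker J x h * I3 h\<bar> \<partial>lborel)" by (rule integral_abs_bound)
    also have "\<dots> \<le> (\<integral>h. 2 * (4 + bump_const TYPE('a) * D2) * norm g * (min 1 ((norm h / s)\<^sup>2) * ker J x h) \<partial>lborel)"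
    proof (rule integral_mono)
      show "integrable lborel (\<lambda>h. \<bar>ker J x h * I3 h\<bar>)" using ik[OF m(3) b3] by simp
      show "integrable lborel (\<lambda>h. 2 * (4 + bump_const TYPE('a) * D2) * norm g * (min 1 ((norm h / s)\<^sup>2) * ker J x h))"
        by (intro integrable_mult_right integrable_min_ker s(1))
      show "\<bar>ker J x h * I3 h\<bar> \<le> 2 * (4 + bump_const TYPE('a) * D2) * norm g * (min 1 ((norm h / s)\<^sup>2) * ker J x h)" for h
        using mult_left_mono[OF I33[of h] ker_nonneg[of J x h]] by (simp add: abs_mult mult_ac)
    qed
    also have "\<dots> = 2 * (4 + bump_const TYPE('a) * D2) * norm g * (\<integral>h. min 1 ((norm h / s)\<^sup>2) * ker J x h \<partial>lborel)"
      by (rule integral_mult_right_zero)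
    also have "\<dots> \<le> 2 * (4 + bump_const TYPE('a) * D2) * norm g * (\<kappa>2 * Ck * s powr - \<alpha> x)"
      using bcD by (intro mult_left_mono integral_min_ker_le s(1)) auto
    also have "\<dots> \<le> 2 * (4 + bump_const TYPE('a) * D2) * norm g * (\<kappa>2 * Ck * (4 * ?X))"
    proof -
      \<comment> \<open>Half of the index falls on \<open>\<tau>\<close> and cancels there, leaving
        the square root of \<open>2 / t\<close>, of order \<open>2 ^ k\<close>. Only the half that
        falls on \<open>l\<close> still sees the index, which produces
        \<open>a1 / 2 + 1\<close>.\<close>
      have "s powr - \<alpha> x = (l * \<tau>) powr - (\<alpha> x / 2)"
        unfolding s_def using l \<tau> by (simp add: powr_half_sqrt[symmetric] powr_powr)
      also have "\<dots> = l powr - (\<alpha> x / 2) * \<tau> powr - (\<alpha> x / 2)" by (rule powr_mult)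
      also have "\<tau> powr - (\<alpha> x / 2) = (t / 2) powr - (1 / 2)"
        unfolding \<tau>_def powr_powr using ax by simp
      also have "\<dots> = (2 / t) powr (1 / 2)"
        using t by (simp add: powr_divide powr_minus field_simps)
      also have "\<dots> \<le> (4 ^ (k + 2)) powr (1/2)"
      proof (rule powr_mono2)
        have "2 / t \<le> 2 / (1/4) ^ (k + 1)" using t by (intro divide_left_mono) auto
        also have "\<dots> \<le> 4 ^ (k + 2)" by (simp add: power_one_over)
        finally show "2 / t \<le> 4 ^ (k + 2)" .
      qed (use t in auto)
      also have "(4 ^ (k + 2)) powr (1/2) = ((4::real) powr (1/2)) ^ (k + 2)" by (rule power_powr) simp
      also have "(4::real) powr (1/2) = 2" by (simp add: powr_half_sqrt)
      finally have "s powr - \<alpha> x \<le> l powr - (\<alpha> x / 2) * 2 ^ (k + 2)" by (simp add: mult_left_mono)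
      also have "\<dots> = 4 * (2 powr (\<alpha> x / 2 + 1)) ^ k"
        unfolding l_powr by (simp add: powr_add power_mult_distrib)
      also have "\<dots> \<le> 4 * ?X" unfolding X using ax by (intro mult_left_mono power_mono powr_mono) auto
      finally show ?thesis using bcD \<kappa>2 Ck_nonneg by (intro mult_left_mono) auto
    qed
    also have "\<dots> = \<kappa>2 * Ck * (8 * (4 + bump_const TYPE('a) * D2)) * ?X * norm g"
      by (simp add: algebra_simps)
    finally show ?thesis .
  qed
  have "\<bar>f' J k g t x - (B J x \<bullet>\<^sub>o F) x\<bar> \<le> CE * 4 ^ k * \<Omega> k * norm g + \<kappa>2 * Ck * (4 + bump_const TYPE('a)) * ?X * norm g
      + \<kappa>2 * Ck * (8 * (4 + bump_const TYPE('a) * D2)) * ?X * norm g"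
    using T1 T2 T3 unfolding BF by linarith
  also have "\<dots> = (CE * 4 ^ k * \<Omega> k + CC * ?X) * norm g" by (simp add: CC_def algebra_simps)
  finally show ?thesis by (simp add: F_def)
qed

end

context stable_like begin

section \<open>The resolvent equation for functions with bounded second differences\<close>

definition kernel :: "'a \<Rightarrow> 'a \<Rightarrow> real" where "kernel x h = n x h * stable_kernel (\<alpha> x) h"

text \<open>The operator in symmetrised form. It makes sense without derivatives, provided that
  second differences are quadratically small.\<close>

definition A2 :: "('a \<Rightarrow>\<^sub>C real) \<Rightarrow> 'a \<Rightarrow> real"
  where "A2 v x = (\<integral>h. (diff2 h \<bullet>\<^sub>o v) x * kernel x h \<partial>lborel) / 2"

text \<open>A substitute for bounded functions with Lipschitz gradient. The constant survives every
  contraction that commutes with translations, in particular mollifiers and frozen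
  semigroups.\<close>

definition C11 :: "real \<Rightarrow> ('a \<Rightarrow>\<^sub>C real) \<Rightarrow> bool"
  where "C11 K v \<longleftrightarrow> (\<forall>h. norm (diff2 h \<bullet>\<^sub>o v) \<le> K * min 1 ((norm h)\<^sup>2))"

lemma kernel_nonneg [simp]: "0 \<le> kernel x h" using n_pos[of x h] by (simp add: kernel_def)

lemma kernel_minus: "kernel x (- h) = kernel x h" by (simp add: kernel_def n_even stable_kernel_def)

lemma kernel_eq: "kernel x h = n x h / norm h powr (real DIM('a) + \<alpha> x)"
  unfolding kernel_def stable_kernel_def powr_minus_divide by simp

lemma measurable_kernel [measurable]: "kernel x \<in> borel_measurable borel"
  unfolding kernel_def[abs_def] by measurable

lemma kernel_le: "kernel x h \<le> \<kappa>2 * stable_kernel (\<alpha> x) h"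
  unfolding kernel_def by (intro mult_right_mono n_le) simp

lemma
  assumes "0 < d"
  shows integrable_min_kernel: "integrable lborel (\<lambda>h. min 1 ((norm h / d)\<^sup>2) * kernel x h)"
    and integral_min_kernel_le: "(\<integral>h. min 1 ((norm h / d)\<^sup>2) * kernel x h \<partial>lborel) \<le> \<kappa>2 * Ck * d powr - \<alpha> x"
proof -
  have i: "integrable lborel (\<lambda>h::'a. \<kappa>2 * (min 1 ((norm h / d)\<^sup>2) * stable_kernel (\<alpha> x) h))"
    by (intro integrable_mult_right integrable_stable_kernel[OF \<alpha>_ge \<alpha>_le a0 a1 assms])
  have le: "min 1 ((norm h / d)\<^sup>2) * kernel x h \<le> \<kappa>2 * (min 1 ((norm h / d)\<^sup>2) * stable_kernel (\<alpha> x) h)" for h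
    using mult_left_mono[OF kernel_le[of x h], of "min 1 ((norm h / d)\<^sup>2)"] by (simp add: mult_ac)
  show i': "integrable lborel (\<lambda>h. min 1 ((norm h / d)\<^sup>2) * kernel x h)"
    by (rule Bochner_Integration.integrable_bound[OF i]) (auto intro!: AE_I2 intro: order_trans[OF le abs_ge_self])
  have "(\<integral>h. min 1 ((norm h / d)\<^sup>2) * kernel x h \<partial>lborel)
      \<le> (\<integral>h. \<kappa>2 * (min 1 ((norm h / d)\<^sup>2) * stable_kernel (\<alpha> x) (h::'a)) \<partial>lborel)"
    by (rule integral_mono[OF i' i le])
  also have "\<dots> \<le> \<kappa>2 * (Ck * d powr - \<alpha> x)"
    using integral_stable_kernel_le[OF \<alpha>_ge \<alpha>_le a0 a1 assms, where 'a='a] \<kappa>2 by (simp add: Ck_def mult.assoc)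
  finally show "(\<integral>h. min 1 ((norm h / d)\<^sup>2) * kernel x h \<partial>lborel) \<le> \<kappa>2 * Ck * d powr - \<alpha> x" by simp
qed

lemmas integrable_min_kernel1 = integrable_min_kernel[of 1, simplified]
lemmas integral_min_kernel1_le = integral_min_kernel_le[of 1, simplified]

text \<open>The gradient term is odd in \<open>h\<close> and the kernel even, so adding the
  reflected integrand cancels it. The Taylor bound provides the integrability that this
  needs.\<close>

lemma stable_like_operator_eq:
  fixes F :: "'a \<Rightarrow> real"
  assumes F [measurable]: "F \<in> borel_measurable borel" and b: "\<And>y. \<bar>F y\<bar> \<le> b" and C: "0 \<le> C"
    and taylor: "\<And>h. \<bar>F (x + h) - F x - h \<bullet> gradient F x\<bar> \<le> C * (norm h)\<^sup>2"
  shows "stable_like_operator n \<alpha> F x = (\<integral>h. (F (x + h) + F (x - h) - 2 * F x) * kernel x h \<partial>lborel) / 2"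
proof -
  let ?G = "\<lambda>h. F (x + h) - F x - indicator {h. norm h \<le> 1} h * (h \<bullet> gradient F x)"
  have b0: "0 \<le> b" using b[of 0] by linarith
  have G: "\<bar>?G h\<bar> \<le> (C + 2 * b) * min 1 ((norm h)\<^sup>2)" for h
  proof (cases "norm h \<le> 1")
    case True
    then have "(norm h)\<^sup>2 \<le> 1" by (simp add: power_le_one)
    moreover have "C * (norm h)\<^sup>2 \<le> (C + 2 * b) * (norm h)\<^sup>2" using b0 by (intro mult_right_mono) auto
    ultimately show ?thesis using taylor[of h] True by (simp add: min_def)
  next
    case False
    then have "1 \<le> (norm h)\<^sup>2" by (intro one_le_power) simp
    moreover have "\<bar>F (x + h) - F x\<bar> \<le> 2 * b" using b[of "x + h"] b[of x] by linarith
    ultimately show ?thesis using False C by simp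
  qed
  have m: "(\<lambda>h. ?G h * kernel x h) \<in> borel_measurable borel" by measurable
  have i: "integrable lborel (\<lambda>h. ?G h * kernel x h)"
  proof (rule Bochner_Integration.integrable_bound)
    show "integrable lborel (\<lambda>h. (C + 2 * b) * (min 1 ((norm h)\<^sup>2) * kernel x h))"
      by (intro integrable_mult_right integrable_min_kernel1)
    show "AE h in lborel. norm (?G h * kernel x h) \<le> norm ((C + 2 * b) * (min 1 ((norm h)\<^sup>2) * kernel x h))"
    proof (rule AE_I2)
      fix h
      show "norm (?G h * kernel x h) \<le> norm ((C + 2 * b) * (min 1 ((norm h)\<^sup>2) * kernel x h))"
        using mult_right_mono[OF G[of h] kernel_nonneg[of x h]] C b0
        by (simp add: abs_mult mult.assoc)
    qed
  qed (use m in simp)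
  have "stable_like_operator n \<alpha> F x = (\<integral>h. ?G h * kernel x h \<partial>lborel)"
    unfolding stable_like_operator_def set_lebesgue_integral_def
    by (rule Bochner_Integration.integral_cong[OF refl])
      (auto simp: kernel_eq indicator_def)
  moreover have "(\<integral>h. ?G h * kernel x h \<partial>lborel) = (\<integral>h. ?G (- h) * kernel x h \<partial>lborel)"
    using integral_lborel_reflect_shift[OF m, of "-1" 0] by (simp add: kernel_minus)
  moreover have "integrable lborel (\<lambda>h. ?G (- h) * kernel x h)"
    using integrable_lborel_reflect_shift[OF m, of "-1" 0] i by (simp add: kernel_minus)
  ultimately have "2 * stable_like_operator n \<alpha> F x = (\<integral>h. ?G h * kernel x h + ?G (- h) * kernel x h \<partial>lborel)"
    using i by simp
  also have "\<dots> = (\<integral>h. (F (x + h) + F (x - h) - 2 * F x) * kernel x h \<partial>lborel)"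
    by (rule Bochner_Integration.integral_cong) (auto simp: algebra_simps indicator_def)
  finally show ?thesis by simp
qed

lemma stable_like_operator_conv_bump:
  assumes s: "0 < s"
  shows "stable_like_operator n \<alpha> (apply_bcontfun (conv (bump s) \<bullet>\<^sub>o v)) x = A2 (conv (bump s) \<bullet>\<^sub>o v) x"
proof -
  obtain C where "0 \<le> C" "\<And>x h. \<bar>(conv (bump s) \<bullet>\<^sub>o v) (x + h) - (conv (bump s) \<bullet>\<^sub>o v) x
      - h \<bullet> gradient (apply_bcontfun (conv (bump s) \<bullet>\<^sub>o v)) x\<bar> \<le> C * (norm h)\<^sup>2"
    using conv_bump_taylor[OF s] by blast
  then show ?thesis
    unfolding A2_def diff2_apply
    by (intro stable_like_operator_eq[where C=C and b="norm (conv (bump s) \<bullet>\<^sub>o v)"] abs_bcontfun_le) auto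
qed

lemma C11_nonneg: "C11 K v \<Longrightarrow> 0 \<le> K"
proof -
  obtain b :: 'a where b: "b \<in> Basis" using nonempty_Basis by blast
  assume "C11 K v"
  then have "norm (diff2 b \<bullet>\<^sub>o v) \<le> K * min 1 ((norm b)\<^sup>2)" unfolding C11_def by (rule spec)
  also have "\<dots> = K" using b by simp
  finally show "0 \<le> K" using norm_ge_zero order_trans by blast
qed

lemma abs_diff2_kernel_le:
  assumes "C11 K v"
  shows "\<bar>(diff2 h \<bullet>\<^sub>o v) x * kernel x h\<bar> \<le> K * (min 1 ((norm h)\<^sup>2) * kernel x h)"
  using mult_right_mono[OF order_trans[OF abs_bcontfun_le[of "diff2 h \<bullet>\<^sub>o v" x]] kernel_nonneg[of x h], of "K * min 1 ((norm h)\<^sup>2)"] assms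
  by (simp add: C11_def abs_mult mult.assoc)

lemma measurable_diff2 [measurable]: "(\<lambda>h. (diff2 h \<bullet>\<^sub>o v) x) \<in> borel_measurable borel"
  unfolding diff2_apply by measurable

lemma integrable_diff2_kernel:
  assumes "C11 K v"
  shows "integrable lborel (\<lambda>h. (diff2 h \<bullet>\<^sub>o v) x * kernel x h)"
proof (rule Bochner_Integration.integrable_bound)
  show "integrable lborel (\<lambda>h. K * (min 1 ((norm h)\<^sup>2) * kernel x h))"
    by (intro integrable_mult_right integrable_min_kernel1)
  show "AE h in lborel. norm ((diff2 h \<bullet>\<^sub>o v) x * kernel x h) \<le> norm (K * (min 1 ((norm h)\<^sup>2) * kernel x h))"
    unfolding real_norm_def by (intro AE_I2 order_trans[OF abs_diff2_kernel_le[OF assms] abs_ge_self])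
qed measurable

lemma abs_A2_le:
  assumes "C11 K v"
  shows "\<bar>A2 v x\<bar> \<le> K * (\<kappa>2 * Ck)"
proof -
  have "\<bar>\<integral>h. (diff2 h \<bullet>\<^sub>o v) x * kernel x h \<partial>lborel\<bar> \<le> (\<integral>h. \<bar>(diff2 h \<bullet>\<^sub>o v) x * kernel x h\<bar> \<partial>lborel)"
    by (rule integral_abs_bound)
  also have "\<dots> \<le> (\<integral>h. K * (min 1 ((norm h)\<^sup>2) * kernel x h) \<partial>lborel)"
    by (intro integral_mono integrable_abs integrable_diff2_kernel[OF assms] integrable_mult_right integrable_min_kernel1 abs_diff2_kernel_le[OF assms])
  also have "\<dots> \<le> K * (\<kappa>2 * Ck)"
    using mult_left_mono[OF integral_min_kernel1_le C11_nonneg[OF assms]] by simp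
  finally show ?thesis using C11_nonneg[OF assms] \<kappa>2 Ck_nonneg by (simp add: A2_def)
qed

lemma measurable_A2: "A2 v \<in> borel_measurable borel"
proof -
  have [measurable]: "(\<lambda>p. n (fst p) (snd p)) \<in> borel_measurable (borel \<Otimes>\<^sub>M lborel)"
    using n_meas by (simp add: split_beta cong: measurable_cong_sets)
  have "(\<lambda>p. (v (fst p + snd p) + v (fst p - snd p) - 2 * v (fst p)) * kernel (fst p) (snd p)) \<in> borel_measurable (borel \<Otimes>\<^sub>M lborel)"
    unfolding kernel_def stable_kernel_def by measurable
  then have "(\<lambda>x. \<integral>h. (v (x + h) + v (x - h) - 2 * v x) * kernel x h \<partial>lborel) \<in> borel_measurable borel"
    by (intro lborel.borel_measurable_lebesgue_integral) (simp add: split_beta)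
  then show ?thesis unfolding A2_def[abs_def] diff2_apply by simp
qed

text \<open>The operator \<open>conv (bump s) - 1\<close> is itself the generator of a symmetric
  jump process with jumps shorter than \<open>s\<close>, so the general bound for generators
  applies.\<close>

lemma norm_conv_bump_diff_le:
  assumes K: "C11 K v" and s: "0 < s"
  shows "norm (conv (bump s) \<bullet>\<^sub>o v - v) \<le> K * s\<^sup>2"
proof -
  have i: "integrable lborel (\<lambda>h::'a. (K * (norm h)\<^sup>2) * bump s h)"
  proof (rule Bochner_Integration.integrable_bound)
    show "integrable lborel (\<lambda>h::'a. (K * s\<^sup>2) * bump s h)" by (intro integrable_mult_right integrable_bump s)
    show "AE h in lborel. norm (K * (norm h)\<^sup>2 * bump s (h::'a)) \<le> norm (K * s\<^sup>2 * bump s h)"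
    proof (rule AE_I2)
      fix h :: 'a
      show "norm (K * (norm h)\<^sup>2 * bump s h) \<le> norm (K * s\<^sup>2 * bump s h)"
        using bump_eq_0[OF s, of h] bump_nonneg[OF s, of h] C11_nonneg[OF K]
        by (cases "s \<le> norm h") (auto simp: abs_mult intro!: mult_mono power_mono)
    qed
  qed simp
  have "norm (gen (bump s) \<bullet>\<^sub>o v) \<le> (\<integral>h. (K * (norm h)\<^sup>2) * bump s (h::'a) \<partial>lborel) / 2"
  proof (rule norm_gen_apply_le[OF integrable_bump[OF s] bump_minus _ i])
    show "norm (diff2 h \<bullet>\<^sub>o v) \<le> K * (norm h)\<^sup>2" for h
      using K C11_nonneg[OF K] mult_left_mono[of "min 1 ((norm h)\<^sup>2)" "(norm h)\<^sup>2" K]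
      unfolding C11_def by (meson min.cobounded2 order_trans)
  qed (simp add: bump_nonneg[OF s])
  also have "(\<integral>h. (K * (norm h)\<^sup>2) * bump s (h::'a) \<partial>lborel) \<le> (\<integral>h. (K * s\<^sup>2) * bump s (h::'a) \<partial>lborel)"
  proof (rule integral_mono[OF i])
    show "integrable lborel (\<lambda>h::'a. (K * s\<^sup>2) * bump s h)" by (intro integrable_mult_right integrable_bump s)
    show "K * (norm h)\<^sup>2 * bump s h \<le> K * s\<^sup>2 * bump s h" for h :: 'a
      using bump_eq_0[OF s, of h] bump_nonneg[OF s, of h] C11_nonneg[OF K]
      by (cases "s \<le> norm h") (auto intro!: mult_mono power_mono)
  qed
  also have "\<dots> = K * s\<^sup>2" by (simp add: integral_bump[OF s])
  finally have "norm (gen (bump s) \<bullet>\<^sub>o v) \<le> K * s\<^sup>2 / 2" by simp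
  also have "\<dots> \<le> K * s\<^sup>2" using C11_nonneg[OF K] by simp
  finally show ?thesis by (simp add: gen_bump[OF s] cop_apply.diff_left)
qed

lemma C11_apply:
  assumes K: "C11 K v" and A: "norm A \<le> 1" "\<And>h. A * shift h = shift h * A"
  shows "C11 K (A \<bullet>\<^sub>o v)"
  unfolding C11_def
proof
  fix h
  have "diff2 h * A = A * diff2 h" by (simp add: diff2_def algebra_simps A(2))
  then have "diff2 h \<bullet>\<^sub>o A \<bullet>\<^sub>o v = A \<bullet>\<^sub>o diff2 h \<bullet>\<^sub>o v" by (metis cop_simps(1))
  then have "norm (diff2 h \<bullet>\<^sub>o A \<bullet>\<^sub>o v) \<le> norm A * norm (diff2 h \<bullet>\<^sub>o v)" by (simp add: norm_cop_apply)
  also have "\<dots> \<le> 1 * norm (diff2 h \<bullet>\<^sub>o v)" by (intro mult_right_mono A) simp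
  also have "\<dots> \<le> K * min 1 ((norm h)\<^sup>2)" using K by (simp add: C11_def)
  finally show "norm (diff2 h \<bullet>\<^sub>o A \<bullet>\<^sub>o v) \<le> K * min 1 ((norm h)\<^sup>2)" .
qed

lemma C11_conv_bump: "C11 K v \<Longrightarrow> 0 < s \<Longrightarrow> C11 K (conv (bump s) \<bullet>\<^sub>o v)"
  by (intro C11_apply norm_conv_bump conv_shift_commute integrable_bump)

text \<open>Truncation alters the kernel only for \<open>norm h < (1/2) ^ J\<close>, where second
  differences are at most \<open>K * (norm h)^2\<close>. The integral over these small jumps
  vanishes with \<open>J\<close> because \<open>a1 < 2\<close>.\<close>

lemma abs_A2_B_le:
  assumes K: "C11 K v"
  shows "\<bar>A2 v x - (B J x \<bullet>\<^sub>o v) x\<bar> \<le> K * (\<kappa>2 * Ck * ((1/2) ^ J) powr (2 - a1))"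
proof -
  let ?e = "(1/2) ^ J :: real"
  have e: "0 < ?e" "?e \<le> 1" by (simp_all add: power_le_one)
  note K0 = C11_nonneg[OF K]
  have iB: "integrable lborel (\<lambda>h. (diff2 h \<bullet>\<^sub>o v) x * ker J x h)"
  proof (rule Bochner_Integration.integrable_bound)
    show "integrable lborel (\<lambda>h. K * ker J x h)" by (intro integrable_mult_right integrable_ker)
    have "\<bar>(diff2 h \<bullet>\<^sub>o v) x\<bar> \<le> K" for h
    proof -
      have "\<bar>(diff2 h \<bullet>\<^sub>o v) x\<bar> \<le> K * min 1 ((norm h)\<^sup>2)"
        using order_trans[OF abs_bcontfun_le, of "diff2 h \<bullet>\<^sub>o v"] K by (simp add: C11_def)
      also have "\<dots> \<le> K * 1" using K0 by (intro mult_left_mono) auto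
      finally show ?thesis by simp
    qed
    then show "AE h in lborel. norm ((diff2 h \<bullet>\<^sub>o v) x * ker J x h) \<le> norm (K * ker J x h)"
      using K0 by (auto intro!: AE_I2 mult_right_mono simp: abs_mult)
  qed measurable
  have le: "\<bar>(diff2 h \<bullet>\<^sub>o v) x * kernel x h - (diff2 h \<bullet>\<^sub>o v) x * ker J x h\<bar>
      \<le> K * ?e\<^sup>2 * (\<kappa>2 * (min 1 ((norm h / ?e)\<^sup>2) * stable_kernel (\<alpha> x) h))" for h
  proof (cases "norm h < ?e \<and> h \<noteq> 0")
    case True
    have d: "\<bar>kernel x h - ker J x h\<bar> \<le> \<kappa>2 * stable_kernel (\<alpha> x) h"
    proof -
      have "ker J x h \<le> kernel x h"
        unfolding ker_def kernel_def using True n_pos[of x h] by (intro mult_left_mono regk_le_stable_kernel \<alpha>_pos) auto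
      then show ?thesis using kernel_le[of x h] ker_nonneg[of J x h] by linarith
    qed
    have h2: "(norm h)\<^sup>2 = ?e\<^sup>2 * min 1 ((norm h / ?e)\<^sup>2)"
    proof -
      have "norm h / ?e < 1" using True e by (simp add: divide_less_eq)
      then have "(norm h / ?e)\<^sup>2 \<le> 1" by (intro power_le_one) auto
      then show ?thesis using e by (simp add: power_divide power_mult_distrib)
    qed
    have "\<bar>(diff2 h \<bullet>\<^sub>o v) x\<bar> \<le> K * (norm h)\<^sup>2"
      using order_trans[OF abs_bcontfun_le, of "diff2 h \<bullet>\<^sub>o v"] K mult_left_mono[of "min 1 ((norm h)\<^sup>2)" "(norm h)\<^sup>2" K] K0
      unfolding C11_def by (meson min.cobounded2 order_trans)
    then have "\<bar>(diff2 h \<bullet>\<^sub>o v) x\<bar> * \<bar>kernel x h - ker J x h\<bar> \<le> K * (norm h)\<^sup>2 * (\<kappa>2 * stable_kernel (\<alpha> x) h)"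
      using d K0 by (intro mult_mono) auto
    moreover have "\<bar>(diff2 h \<bullet>\<^sub>o v) x * kernel x h - (diff2 h \<bullet>\<^sub>o v) x * ker J x h\<bar> = \<bar>(diff2 h \<bullet>\<^sub>o v) x\<bar> * \<bar>kernel x h - ker J x h\<bar>"
      unfolding right_diff_distrib[symmetric] abs_mult ..
    ultimately show ?thesis unfolding h2 by (simp only: mult_ac)
  next
    case False
    then have "kernel x h = ker J x h \<or> h = 0"
      by (auto simp: kernel_def ker_def stable_kernel_def regk_def max_def not_less)
    moreover have "(diff2 0 \<bullet>\<^sub>o v) x = 0" by (simp add: diff2_apply)
    ultimately show ?thesis using K0 \<kappa>2 by auto
  qed
  have i: "integrable lborel (\<lambda>h::'a. K * ?e\<^sup>2 * (\<kappa>2 * (min 1 ((norm h / ?e)\<^sup>2) * stable_kernel (\<alpha> x) h)))"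
    by (intro integrable_mult_right integrable_stable_kernel[OF \<alpha>_ge \<alpha>_le a0 a1 e(1)])
  define p where "p h = (diff2 h \<bullet>\<^sub>o v) x * kernel x h" for h
  define q where "q h = (diff2 h \<bullet>\<^sub>o v) x * ker J x h" for h
  have pq: "integrable lborel p" "integrable lborel q"
    using integrable_diff2_kernel[OF K, of x] iB unfolding p_def[abs_def] q_def[abs_def] .
  have eq: "A2 v x - (B J x \<bullet>\<^sub>o v) x = (\<integral>h. p h - q h \<partial>lborel) / 2"
    unfolding Bochner_Integration.integral_diff[OF pq] diff_divide_distrib
    by (simp add: p_def[abs_def] q_def[abs_def] A2_def B_def gen_apply_diff2[OF integrable_ker ker_minus])
  have "\<bar>A2 v x - (B J x \<bullet>\<^sub>o v) x\<bar> \<le> (\<integral>h. \<bar>p h - q h\<bar> \<partial>lborel)"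
    using integral_abs_bound[of lborel "\<lambda>h. p h - q h"] unfolding eq abs_divide by linarith
  also have "\<dots> \<le> (\<integral>h. K * ?e\<^sup>2 * (\<kappa>2 * (min 1 ((norm h / ?e)\<^sup>2) * stable_kernel (\<alpha> x) (h::'a))) \<partial>lborel)"
  proof (rule integral_mono)
    show "integrable lborel (\<lambda>h. \<bar>p h - q h\<bar>)"
      using pq by (intro integrable_abs Bochner_Integration.integrable_diff)
  qed (use i le in \<open>auto simp: p_def q_def\<close>)
  also have "\<dots> = K * ?e\<^sup>2 * \<kappa>2 * (\<integral>h. min 1 ((norm h / ?e)\<^sup>2) * stable_kernel (\<alpha> x) (h::'a) \<partial>lborel)" by simp
  also have "\<dots> \<le> K * ?e\<^sup>2 * \<kappa>2 * (Ck * ?e powr - \<alpha> x)"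
    using integral_stable_kernel_le[OF \<alpha>_ge \<alpha>_le a0 a1 e(1), where 'a='a] K0 \<kappa>2
    by (intro mult_left_mono) (auto simp: Ck_def)
  also have "\<dots> = K * (\<kappa>2 * Ck * (?e\<^sup>2 * ?e powr - \<alpha> x))" by simp
  also have "?e\<^sup>2 * ?e powr - \<alpha> x = ?e powr (2 - \<alpha> x)"
    using powr_add[of ?e 2 "- \<alpha> x"] e by simp
  also have "K * (\<kappa>2 * Ck * ?e powr (2 - \<alpha> x)) \<le> K * (\<kappa>2 * Ck * ?e powr (2 - a1))"
    using K0 \<kappa>2 Ck_nonneg e \<alpha>_le[of x] by (intro mult_left_mono powr_mono') auto
  finally show ?thesis .
qed

end

section \<open>Regularity and initial values of the averages\<close>

context stable_like begin

text \<open>Provides enough initial functions. The constant is of no importance: it only multiplies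
  quantities that tend to 0 for a fixed initial function.\<close>

lemma C11_conv_bump_any:
  fixes v :: "'a \<Rightarrow>\<^sub>C real"
  assumes s: "0 < s"
  shows "\<exists>K. C11 K (conv (bump s) \<bullet>\<^sub>o v)"
proof
  let ?c = "4 + bump_const TYPE('a)"
  show "C11 (?c * (1 + 1 / s\<^sup>2) * norm v) (conv (bump s) \<bullet>\<^sub>o v)"
    unfolding C11_def
  proof (intro allI norm_bound)
    fix h x
    have m: "(\<lambda>z. v z) \<in> borel_measurable borel" by measurable
    have iv: "integrable lborel (\<lambda>z. bump s (y - z) * v z)" for y
      by (rule integrable_weighted[OF integrable_bump_reflect[OF s] m abs_bcontfun_le])
    have eq: "(conv (bump s) \<bullet>\<^sub>o v) y = (\<integral>z. bump s (y - z) * v z \<partial>lborel)" for y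
      using integral_lborel_reflect_shift[of "\<lambda>h. v (y + h) * bump s h" 1 "- y"]
      by (simp add: conv_apply[OF integrable_bump[OF s]] mult.commute bump_minus[of s "y - _", symmetric])
    have "(diff2 h \<bullet>\<^sub>o conv (bump s) \<bullet>\<^sub>o v) x = (\<integral>z. (bump s (x + h - z) + bump s (x - h - z) - 2 * bump s (x - z)) * v z \<partial>lborel)"
      using iv by (simp add: diff2_apply eq left_diff_distrib distrib_right mult.assoc)
    also have "\<bar>\<dots>\<bar> \<le> norm v * (\<integral>z. \<bar>bump s (x + h - z) + bump s (x - h - z) - 2 * bump s (x - z)\<bar> \<partial>lborel)"
      by (intro abs_integral_weighted_le m abs_bcontfun_le Bochner_Integration.integrable_diff
        Bochner_Integration.integrable_add integrable_mult_right integrable_bump_reflect[OF s])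
    also have "\<dots> \<le> norm v * (?c * min 1 ((norm h / s)\<^sup>2))"
      by (intro mult_left_mono integral_bump_Dw_le(3) s) auto
    also have "\<dots> \<le> norm v * (?c * ((1 + 1 / s\<^sup>2) * min 1 ((norm h)\<^sup>2)))"
    proof -
      have "min 1 ((norm h / s)\<^sup>2) \<le> (1 + 1 / s\<^sup>2) * min 1 ((norm h)\<^sup>2)"
      proof (cases "1 \<le> (norm h)\<^sup>2")
        case True
        then show ?thesis by (simp add: min.coboundedI1)
      next
        case False
        have "(norm h / s)\<^sup>2 \<le> (1 + 1 / s\<^sup>2) * (norm h)\<^sup>2"
          by (simp add: power_divide distrib_right)
        then show ?thesis using False by (simp add: min.coboundedI2)
      qed
      then show ?thesis using bump_const_pos[where 'a='a] by (intro mult_left_mono) auto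
    qed
    finally show "norm ((diff2 h \<bullet>\<^sub>o conv (bump s) \<bullet>\<^sub>o v) x) \<le> ?c * (1 + 1 / s\<^sup>2) * norm v * min 1 ((norm h)\<^sup>2)"
      by (simp add: mult_ac)
  qed
qed

text \<open>The order of quantifiers is the point: \<open>K\<close> depends on lower bounds for time
  and radius but not on \<open>J\<close>. For a fixed number of blocks, \<open>K\<close> times the
  truncation error therefore tends to 0.\<close>

lemma C11_f:
  fixes \<tau> l0 :: real
  assumes \<tau>: "0 < \<tau>" "\<tau> \<le> 1" and l0: "0 < l0"
  obtains K where "0 \<le> K" "\<And>J k t g. l0 \<le> (1/2) ^ k \<Longrightarrow> \<tau> \<le> t \<Longrightarrow> t \<le> 1 \<Longrightarrow> C11 (K * norm g) (f J k g t)"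
proof -
  define b where "b = bump_const TYPE('a)"
  define E where "E = C_sm * (2 / \<tau>) powr (1 / a0)"
  define K where "K = 4 + 4 * b * E / l0 + (4 + b) / l0\<^sup>2 + 4 * E\<^sup>2"
  have b: "0 < b" using bump_const_pos by (simp add: b_def)
  have E: "0 < E" using C_sm \<tau> by (simp add: E_def)
  have K0: "4 \<le> K" using b E l0 by (simp add: K_def)
  have "C11 (K * norm g) (f J k g t)" if k: "l0 \<le> (1/2) ^ k" and t: "\<tau> \<le> t" "t \<le> 1" for J k t g
    unfolding C11_def
  proof (intro allI norm_bound)
    fix h x
    define l :: real where "l = (1/2) ^ k"
    have l: "0 < l" "l0 \<le> l" using k by (simp_all add: l_def)
    have t0: "0 < t" "0 \<le> t" using \<tau> t by auto
    define v where "v = u J t g"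
    have dl: "1 / \<delta> z t \<le> E" for z
    proof -
      have "(2 / t) powr (1 / \<alpha> z) \<le> (2 / \<tau>) powr (1 / \<alpha> z)"
        using \<tau> t \<alpha>_pos[of z] by (intro powr_mono2 divide_left_mono) auto
      also have "\<dots> \<le> (2 / \<tau>) powr (1 / a0)"
        using \<tau> \<alpha>_ge[of z] a0 by (intro powr_mono divide_left_mono) auto
      finally have "C_sm * (2 / t) powr (1 / \<alpha> z) \<le> E"
        using C_sm unfolding E_def by (intro mult_left_mono) auto
      then show ?thesis using t0 by (simp add: \<delta>_def powr_divide mult.commute)
    qed
    have d0: "0 < \<delta> z t" for z by (rule \<delta>_pos[OF t0(1)])
    have v1: "\<bar>v z (y + h) - v z y\<bar> \<le> 2 * (E * norm h) * norm g" for z y h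
    proof -
      have "min 1 (norm h / \<delta> z t) \<le> E * norm h"
        using mult_right_mono[OF dl[of z], of "norm h"] by (simp add: min_le_iff_disj)
      then have "2 * min 1 (norm h / \<delta> z t) * norm g \<le> 2 * (E * norm h) * norm g"
        by (intro mult_right_mono) auto
      with u_shift_le[OF t0(1) t(2), of J g z y h] show ?thesis unfolding v_def by linarith
    qed
    have v2: "\<bar>(diff2 h \<bullet>\<^sub>o v z) x\<bar> \<le> 4 * (E\<^sup>2 * (norm h)\<^sup>2) * norm g" for z
    proof -
      have "(1 / \<delta> z t * norm h)\<^sup>2 \<le> (E * norm h)\<^sup>2"
        using d0[of z] by (intro power_mono mult_right_mono dl) auto
      then have "min 1 ((norm h / \<delta> z t)\<^sup>2) \<le> E\<^sup>2 * (norm h)\<^sup>2"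
        by (simp add: min_le_iff_disj power_mult_distrib)
      then have "4 * min 1 ((norm h / \<delta> z t)\<^sup>2) * norm g \<le> 4 * (E\<^sup>2 * (norm h)\<^sup>2) * norm g"
        by (intro mult_right_mono) auto
      with u_diff2_le[OF t0(1) t(2), of h J g z x] show ?thesis unfolding v_def by linarith
    qed
    have cv: "continuous_on UNIV v" unfolding v_def by (rule continuous_u[OF t0(2)])
    have nv: "\<bar>v z y\<bar> \<le> norm g" for z y
      unfolding v_def by (rule order_trans[OF abs_bcontfun_le norm_u[OF t0(2)]])
    have nv2: "\<bar>v z y - v z y'\<bar> \<le> 2 * norm g" for z y y'
      using nv[of z y] nv[of z y'] by linarith
    have mv [measurable]: "(\<lambda>z. v z y) \<in> borel_measurable borel" for y
      by (rule measurable_bcontfun2[OF cv]) auto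
    let ?w = "\<lambda>y z. bump l (y - z)"
    have iw: "integrable lborel (?w y)" for y :: 'a by (rule integrable_bump_reflect[OF l(1)])
    have iwv: "integrable lborel (\<lambda>z. ?w y z * v z y')" for y y' by (rule integrable_weighted[OF iw mv nv])
    have Fa: "f J k g t y = (\<integral>z. ?w y z * v z y \<partial>lborel)" for y
      by (simp add: f_apply[OF t0(2)] v_def l_def)
    \<comment> \<open>Discrete product rule for a second difference: two mixed terms with a first
      difference on each factor, and two terms in which one factor carries the whole second
      difference.\<close>
    let ?D1 = "\<lambda>z. (?w (x + h) z - ?w x z) * (v z (x + h) - v z x)"
    let ?D2 = "\<lambda>z. (?w (x - h) z - ?w x z) * (v z (x - h) - v z x)"
    let ?D3 = "\<lambda>z. (?w (x + h) z + ?w (x - h) z - 2 * ?w x z) * v z x"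
    let ?D4 = "\<lambda>z. ?w x z * (diff2 h \<bullet>\<^sub>o v z) x"
    have md: "(\<lambda>z. (diff2 h \<bullet>\<^sub>o v z) x) \<in> borel_measurable borel" unfolding diff2_apply by measurable
    have i: "integrable lborel ?D1" "integrable lborel ?D2" "integrable lborel ?D3" "integrable lborel ?D4"
      using iw by (auto intro!: integrable_weighted[OF _ _ nv2] integrable_weighted[OF _ _ nv] integrable_weighted[OF _ md v2])
    have "(diff2 h \<bullet>\<^sub>o f J k g t) x = (\<integral>z. ?w (x + h) z * v z (x + h) + ?w (x - h) z * v z (x - h) - 2 * (?w x z * v z x) \<partial>lborel)"
      using iwv by (simp add: diff2_apply Fa)
    also have "\<dots> = (\<integral>z. ?D1 z + ?D2 z + ?D3 z + ?D4 z \<partial>lborel)"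
      by (rule Bochner_Integration.integral_cong) (simp_all add: diff2_apply algebra_simps)
    also have "\<dots> = (\<integral>z. ?D1 z \<partial>lborel) + (\<integral>z. ?D2 z \<partial>lborel) + (\<integral>z. ?D3 z \<partial>lborel) + (\<integral>z. ?D4 z \<partial>lborel)"
      using i by simp
    finally have eq: "(diff2 h \<bullet>\<^sub>o f J k g t) x = \<dots>" .
    have B1: "\<bar>\<integral>z. (?w (x + h) z - ?w x z) * (v z (x + h) - v z x) \<partial>lborel\<bar> \<le> 2 * b * E / l0 * (norm h)\<^sup>2 * norm g" for h
    proof -
      have "\<bar>\<integral>z. (?w (x + h) z - ?w x z) * (v z (x + h) - v z x) \<partial>lborel\<bar>
          \<le> 2 * (E * norm h) * norm g * (\<integral>z. \<bar>?w (x + h) z - ?w x z\<bar> \<partial>lborel)"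
        using iw v1 by (intro abs_integral_weighted_le) auto
      also have "\<dots> \<le> 2 * (E * norm h) * norm g * (b * norm h / l0)"
      proof (rule mult_left_mono)
        have "b * norm h / l \<le> b * norm h / l0" using b l l0 by (intro divide_left_mono) auto
        then show "(\<integral>z. \<bar>?w (x + h) z - ?w x z\<bar> \<partial>lborel) \<le> b * norm h / l0"
          using integral_bump_Dw_le(1)[OF l(1), of x h] by (simp add: b_def)
      qed (use E in auto)
      finally show ?thesis by (simp add: power2_eq_square mult_ac)
    qed
    have B3: "\<bar>\<integral>z. ?D3 z \<partial>lborel\<bar> \<le> (4 + b) / l0\<^sup>2 * (norm h)\<^sup>2 * norm g"
    proof -
      have "\<bar>\<integral>z. ?D3 z \<partial>lborel\<bar> \<le> norm g * (\<integral>z. \<bar>?w (x + h) z + ?w (x - h) z - 2 * ?w x z\<bar> \<partial>lborel)"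
        using iw nv by (intro abs_integral_weighted_le) auto
      also have "\<dots> \<le> norm g * ((4 + b) * (norm h / l0)\<^sup>2)"
      proof (rule mult_left_mono)
        have "min 1 ((norm h / l)\<^sup>2) \<le> (norm h / l0)\<^sup>2"
          using l l0 by (intro min.coboundedI2 power_mono divide_left_mono) auto
        then have "(4 + b) * min 1 ((norm h / l)\<^sup>2) \<le> (4 + b) * (norm h / l0)\<^sup>2" using b by (intro mult_left_mono) auto
        then show "(\<integral>z. \<bar>?w (x + h) z + ?w (x - h) z - 2 * ?w x z\<bar> \<partial>lborel) \<le> (4 + b) * (norm h / l0)\<^sup>2"
          using integral_bump_Dw_le(3)[OF l(1), of x h] by (simp add: b_def)
      qed auto
      finally show ?thesis by (simp add: power_divide mult_ac)
    qed
    have B4: "\<bar>\<integral>z. ?D4 z \<partial>lborel\<bar> \<le> 4 * E\<^sup>2 * (norm h)\<^sup>2 * norm g"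
      using abs_integral_weighted_le[OF iw md v2, of x]
      by (simp add: bump_nonneg[OF l(1)] integral_bump_reflect[OF l(1)] mult_ac)
    have "\<bar>(diff2 h \<bullet>\<^sub>o f J k g t) x\<bar> \<le> 2 * b * E / l0 * (norm h)\<^sup>2 * norm g + 2 * b * E / l0 * (norm h)\<^sup>2 * norm g
        + (4 + b) / l0\<^sup>2 * (norm h)\<^sup>2 * norm g + 4 * E\<^sup>2 * (norm h)\<^sup>2 * norm g"
      unfolding eq by (intro order_trans[OF abs_triangle_ineq] add_mono B1 B3 B4
        B1[of "- h", unfolded norm_minus_cancel diff_conv_add_uminus[symmetric]])
    also have "\<dots> = (K - 4) * ((norm h)\<^sup>2 * norm g)" by (simp add: K_def algebra_simps)
    also have "\<dots> \<le> K * ((norm h)\<^sup>2 * norm g)" by (intro mult_right_mono) auto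
    finally have 1: "\<bar>(diff2 h \<bullet>\<^sub>o f J k g t) x\<bar> \<le> K * norm g * (norm h)\<^sup>2" by (simp add: mult_ac)
    have "\<bar>(diff2 h \<bullet>\<^sub>o f J k g t) x\<bar> \<le> norm (diff2 h :: 'a cop) * norm (f J k g t)"
      by (rule order_trans[OF abs_bcontfun_le norm_cop_apply])
    also have "\<dots> \<le> 4 * norm g" by (intro mult_mono norm_diff2 norm_f t0) auto
    also have "\<dots> \<le> K * norm g" using K0 by (intro mult_right_mono) auto
    finally have 2: "\<bar>(diff2 h \<bullet>\<^sub>o f J k g t) x\<bar> \<le> K * norm g" .
    show "norm ((diff2 h \<bullet>\<^sub>o f J k g t) x) \<le> K * norm g * min 1 ((norm h)\<^sup>2)"
      using 1 2 by (simp add: min_def)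
  qed
  then show thesis using that[of K] K0 by simp
qed

lemma norm_P_apply_diff_le:
  assumes t: "0 \<le> t"
  shows "norm (P J z t \<bullet>\<^sub>o w - w) \<le> t * norm (B J z \<bullet>\<^sub>o w)"
proof (cases "t = 0")
  case False
  let ?\<phi> = "\<lambda>s. P J z s \<bullet>\<^sub>o w"
  have bl: "bounded_linear (\<lambda>A. A \<bullet>\<^sub>o w)" by (rule cop_apply.bounded_linear_left)
  have d: "(?\<phi> has_vector_derivative P J z s \<bullet>\<^sub>o B J z \<bullet>\<^sub>o w) (at s)" for s
    using bounded_linear.has_vector_derivative[OF bl exp_scaleR_has_vector_derivative_right[of "B J z" s UNIV]]
    by (simp add: P_def)
  have "norm (?\<phi> t - ?\<phi> 0) \<le> norm (B J z \<bullet>\<^sub>o w) * t - norm (B J z \<bullet>\<^sub>o w) * 0"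
  proof (rule differentiable_bound_general[where \<phi>'="\<lambda>_. norm (B J z \<bullet>\<^sub>o w)", OF _ _ _ d])
    show "continuous_on {0..t} ?\<phi>"
      by (intro continuous_at_imp_continuous_on ballI has_vector_derivative_continuous[OF d])
    show "((*) (norm (B J z \<bullet>\<^sub>o w)) has_vector_derivative norm (B J z \<bullet>\<^sub>o w)) (at s)" for s
      by (auto intro!: derivative_eq_intros simp flip: has_real_derivative_iff_has_vector_derivative)
    show "norm (P J z s \<bullet>\<^sub>o B J z \<bullet>\<^sub>o w) \<le> norm (B J z \<bullet>\<^sub>o w)" if "0 < s" for s
      using order_trans[OF norm_cop_apply mult_right_mono[OF norm_P[of s J z]]] that by simp
  qed (use False t in \<open>auto intro!: continuous_intros\<close>)
  then show ?thesis by (simp add: P_def mult.commute)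
qed (simp add: P_def)

lemma norm_B_C11:
  assumes K: "C11 K v"
  shows "norm (B J z \<bullet>\<^sub>o v) \<le> K * (\<kappa>2 * Ck)"
proof -
  have i: "integrable lborel (\<lambda>h. min 1 ((norm h)\<^sup>2) * ker J z h)"
    using integrable_min_ker[of 1 J z] by simp
  have "norm (B J z \<bullet>\<^sub>o v) \<le> (\<integral>h. K * min 1 ((norm h)\<^sup>2) * ker J z h \<partial>lborel) / 2"
    unfolding B_def
  proof (rule norm_gen_apply_le[OF integrable_ker ker_minus])
    show "integrable lborel (\<lambda>h. K * min 1 ((norm h)\<^sup>2) * ker J z h)"
      using integrable_mult_right[OF i, of K] by (simp add: mult.assoc)
  qed (use K in \<open>auto simp: C11_def\<close>)
  also have "(\<integral>h. K * min 1 ((norm h)\<^sup>2) * ker J z h \<partial>lborel) = K * (\<integral>h. min 1 ((norm h)\<^sup>2) * ker J z h \<partial>lborel)"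
    by (simp add: mult.assoc)
  also have "\<dots> \<le> K * (\<kappa>2 * Ck)"
    using integral_min_ker_le[of 1 J z] C11_nonneg[OF K] by (intro mult_left_mono) auto
  also have "K * (\<kappa>2 * Ck) / 2 \<le> K * (\<kappa>2 * Ck)"
    using C11_nonneg[OF K] \<kappa>2 Ck_nonneg by simp
  finally show ?thesis by simp
qed

lemma C11_moll: "C11 K v \<Longrightarrow> C11 K (moll J \<bullet>\<^sub>o v)"
  unfolding moll_def by (rule C11_conv_bump) auto

text \<open>The first summand is the cost of the two mollifiers, the second that of running the
  semigroup for time \<open>t\<close>. Regularity of \<open>g\<close> is what makes both
  small.\<close>

lemma norm_f_init:
  assumes K: "C11 K g" and t: "0 \<le> t"
  shows "norm (f J k g t - g) \<le> 2 * K * (1/4) ^ J + t * (K * (\<kappa>2 * Ck))"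
proof (rule norm_bound)
  fix x
  have e: "((1/2) ^ J)\<^sup>2 = (1/4 :: real) ^ J"
    by (simp add: power2_eq_square flip: power_mult_distrib)
  have m1: "norm (moll J \<bullet>\<^sub>o g - g) \<le> K * (1/4) ^ J"
    using norm_conv_bump_diff_le[OF K, of "(1/2) ^ J"] by (simp add: moll_def e)
  have m2: "norm (moll J \<bullet>\<^sub>o moll J \<bullet>\<^sub>o g - moll J \<bullet>\<^sub>o g) \<le> K * (1/4) ^ J"
    using norm_conv_bump_diff_le[OF C11_moll[OF K], of "(1/2) ^ J" J] by (simp add: moll_def e)
  have m: "norm (moll2 J \<bullet>\<^sub>o g - g) \<le> 2 * K * (1/4) ^ J"
    using norm_triangle_ineq[of "moll J \<bullet>\<^sub>o moll J \<bullet>\<^sub>o g - moll J \<bullet>\<^sub>o g" "moll J \<bullet>\<^sub>o g - g"] m1 m2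
    by (simp add: moll2_def)
  have c: "C11 K (moll2 J \<bullet>\<^sub>o g)" unfolding moll2_def cop_simps by (intro C11_moll K)
  have "\<bar>u J t g z x - g x\<bar> \<le> 2 * K * (1/4) ^ J + t * (K * (\<kappa>2 * Ck))" for z
  proof -
    have "norm (P J z t \<bullet>\<^sub>o moll2 J \<bullet>\<^sub>o g - moll2 J \<bullet>\<^sub>o g) \<le> t * (K * (\<kappa>2 * Ck))"
      by (rule order_trans[OF norm_P_apply_diff_le[OF t] mult_left_mono[OF norm_B_C11[OF c] t]])
    then have "norm (u J t g z - g) \<le> 2 * K * (1/4) ^ J + t * (K * (\<kappa>2 * Ck))"
      using norm_triangle_ineq[of "P J z t \<bullet>\<^sub>o moll2 J \<bullet>\<^sub>o g - moll2 J \<bullet>\<^sub>o g" "moll2 J \<bullet>\<^sub>o g - g"] m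
      by (simp add: u_def)
    then show ?thesis using order_trans[OF abs_bcontfun_le[of "u J t g z - g" x]] by simp
  qed
  then have "\<bar>f J k g t x - g x\<bar> \<le> 2 * K * (1/4) ^ J + t * (K * (\<kappa>2 * Ck))"
    unfolding f_def by (intro abs_avg_diff_le[OF continuous_u[OF t] norm_u[OF t]]) auto
  then show "norm ((f J k g t - g) x) \<le> 2 * K * (1/4) ^ J + t * (K * (\<kappa>2 * Ck))" by simp
qed

text \<open>The truncated counterpart of \<open>A2\<close>, as an element of the space of bounded
  continuous functions.\<close>

definition Bdiag :: "nat \<Rightarrow> ('a \<Rightarrow>\<^sub>C real) \<Rightarrow> ('a \<Rightarrow>\<^sub>C real)"
  where "Bdiag J v = Bcontfun (\<lambda>x. (B J x \<bullet>\<^sub>o v) x)"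

lemma Bdiag_apply: "Bdiag J v x = (B J x \<bullet>\<^sub>o v) x"
proof -
  have "(\<lambda>x. (B J x \<bullet>\<^sub>o v) x) \<in> bcontfun"
  proof (rule bcontfun_normI)
    show "continuous_on UNIV (\<lambda>x. (B J x \<bullet>\<^sub>o v) x)"
      by (intro continuous_on_bcontfun2[of "\<lambda>x. B J x \<bullet>\<^sub>o v"] cop_apply.continuous_on continuous_B continuous_intros)
    show "norm ((B J x \<bullet>\<^sub>o v) x) \<le> LB J * norm v" for x
      using order_trans[OF abs_bcontfun_le order_trans[OF norm_cop_apply mult_right_mono[OF norm_B]]] by simp
  qed
  then show ?thesis by (simp add: Bdiag_def Bcontfun_inverse)
qed

text \<open>The error of one block relative to \<open>norm g\<close>: the rate
  \<open>4 ^ k * Om k\<close> acts for a time of at most \<open>4^-k\<close>.\<close>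

definition Om :: "nat \<Rightarrow> real" where "Om k = CE * \<Omega> k + CC * \<rho> ^ k"

lemma summable_Om: "summable Om"
  unfolding Om_def[abs_def] using \<rho>
  by (intro summable_add summable_mult summable_\<Omega> summable_geometric) simp

lemma CE_\<Omega>_le_Om: "CE * \<Omega> k \<le> Om k"
  using CC_nonneg \<rho> by (simp add: Om_def)

lemma norm_f'_Bdiag_le:
  assumes "0 < t" "t \<le> (1/4) ^ k" "(1/4) ^ (k + 1) \<le> t"
  shows "norm (f' J k g t - Bdiag J (f J k g t)) \<le> 4 ^ k * Om k * norm g"
proof (rule norm_bound)
  fix x
  show "norm ((f' J k g t - Bdiag J (f J k g t)) x) \<le> 4 ^ k * Om k * norm g"
    using commutator[OF assms, of J g x] by (simp add: Bdiag_apply Om_def algebra_simps)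
qed

end

section \<open>Uniqueness for the resolvent equation\<close>

lemma abs_conv_bump_diff_le:
  fixes v :: "'a::euclidean_space \<Rightarrow>\<^sub>C real"
  assumes s: "0 < s" and e: "\<And>h. norm h < s \<Longrightarrow> \<bar>v (x + h) - v x\<bar> \<le> e"
  shows "\<bar>(conv (bump s) \<bullet>\<^sub>o v) x - v x\<bar> \<le> e"
proof -
  have i: "integrable lborel (\<lambda>h::'a. bump s h)" using integrable_bump[OF s] by simp
  have m: "(\<lambda>h. v (x + h)) \<in> borel_measurable borel" by measurable
  have iv: "integrable lborel (\<lambda>h. bump s h * v (x + h))"
    by (rule integrable_weighted[OF i m abs_bcontfun_le])
  have "(conv (bump s) \<bullet>\<^sub>o v) x - v x = (\<integral>h. bump s h * (v (x + h) - v x) \<partial>lborel)"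
    using i iv by (simp add: conv_apply[OF integrable_bump[OF s]] right_diff_distrib integral_bump[OF s] mult.commute)
  also have "\<bar>\<dots>\<bar> \<le> e * (\<integral>h. \<bar>bump s h\<bar> \<partial>(lborel :: 'a measure))"
  proof (rule abs_integral_weighted_le[OF i])
    show "\<bar>v (x + h) - v x\<bar> \<le> e" if "bump s h \<noteq> 0" for h
      using that bump_eq_0[OF s, of h] e[of h] by force
  qed measurable
  finally show ?thesis by (simp add: bump_nonneg[OF s] integral_bump[OF s])
qed

lemma conv_bump_tendsto:
  fixes v :: "'a::euclidean_space \<Rightarrow>\<^sub>C real"
  assumes s: "\<And>i. 0 < s i" "s \<longlonglongrightarrow> 0"
  shows "(\<lambda>i. (conv (bump (s i)) \<bullet>\<^sub>o v) x) \<longlonglongrightarrow> v x"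
proof (rule tendstoI)
  fix e :: real assume e: "0 < e"
  have "isCont v x" unfolding isCont_def by (intro tendsto_bcontfun tendsto_ident_at)
  then obtain d where d: "0 < d" "\<And>y. dist y x < d \<Longrightarrow> dist (v y) (v x) < e / 2"
    using e unfolding continuous_at_eps_delta by (meson half_gt_zero)
  show "\<forall>\<^sub>F i in sequentially. dist ((conv (bump (s i)) \<bullet>\<^sub>o v) x) (v x) < e"
    using order_tendstoD(2)[OF s(2) d(1)]
  proof eventually_elim
    case (elim i)
    have "\<bar>(conv (bump (s i)) \<bullet>\<^sub>o v) x - v x\<bar> \<le> e / 2"
    proof (rule abs_conv_bump_diff_le[OF s(1)])
      fix h :: 'a assume "norm h < s i"
      then show "\<bar>v (x + h) - v x\<bar> \<le> e / 2"
        using d(2)[of "x + h"] elim by (simp add: dist_norm)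
    qed
    then show ?case using e by (simp add: dist_norm)
  qed
qed

lemma norm_conv_bump_apply: "0 < s \<Longrightarrow> norm (conv (bump s) \<bullet>\<^sub>o v) \<le> norm v"
  using order_trans[OF norm_cop_apply mult_right_mono[OF norm_conv_bump norm_ge_zero]] by simp

lemma integrable_bcontfun:
  fixes v :: "'b::euclidean_space \<Rightarrow>\<^sub>C real"
  assumes "finite_measure M" "sets M = sets borel"
  shows "integrable M (apply_bcontfun v)"
proof -
  interpret finite_measure M by fact
  show ?thesis
    by (rule integrable_const_bound[of _ "norm v"])
      (auto intro!: AE_I2 simp: abs_bcontfun_le measurable_cong_sets[OF assms(2) refl])
qed

lemma (in finite_measure) abs_integral_le_const:
  fixes g :: "'a \<Rightarrow> real"
  assumes g: "g \<in> borel_measurable M" and C: "\<And>x. \<bar>g x\<bar> \<le> C"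
  shows "\<bar>\<integral>x. g x \<partial>M\<bar> \<le> measure M (space M) * C"
proof -
  have i: "integrable M g" by (rule integrable_const_bound[OF _ g]) (use C in auto)
  have "\<bar>\<integral>x. g x \<partial>M\<bar> \<le> (\<integral>x. \<bar>g x\<bar> \<partial>M)" by (rule integral_abs_bound)
  also have "\<dots> \<le> (\<integral>x. C \<partial>M)" using i C by (intro integral_mono) auto
  finally show ?thesis by simp
qed

lemma sum_affine:
  fixes r c :: real
  shows "(\<Sum>k=i..<j. r * F k + c) = r * sum F {i..<j} + real (j - i) * c"
  by (simp add: sum.distrib sum_distrib_left)

context stable_like begin

lemma diff2_conv_bump_tendsto:
  assumes s: "\<And>i. 0 < s i" "s \<longlonglongrightarrow> 0"
  shows "(\<lambda>i. (diff2 h \<bullet>\<^sub>o conv (bump (s i)) \<bullet>\<^sub>o v) x) \<longlonglongrightarrow> (diff2 h \<bullet>\<^sub>o v) x"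
  unfolding diff2_apply by (intro tendsto_intros conv_bump_tendsto s)

lemma A2_conv_bump_tendsto:
  assumes K: "C11 K v" and s: "\<And>i. 0 < s i" "s \<longlonglongrightarrow> 0"
  shows "(\<lambda>i. A2 (conv (bump (s i)) \<bullet>\<^sub>o v) x) \<longlonglongrightarrow> A2 v x"
  unfolding A2_def
proof (intro tendsto_divide integral_dominated_convergence[where w="\<lambda>h. K * (min 1 ((norm h)\<^sup>2) * kernel x h)"] tendsto_const)
  show "integrable lborel (\<lambda>h. K * (min 1 ((norm h)\<^sup>2) * kernel x h))"
    by (intro integrable_mult_right integrable_min_kernel1)
  show "AE h in lborel. (\<lambda>i. (diff2 h \<bullet>\<^sub>o conv (bump (s i)) \<bullet>\<^sub>o v) x * kernel x h) \<longlonglongrightarrow> (diff2 h \<bullet>\<^sub>o v) x * kernel x h"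
    by (intro AE_I2 tendsto_intros diff2_conv_bump_tendsto s)
  show "AE h in lborel. norm ((diff2 h \<bullet>\<^sub>o conv (bump (s i)) \<bullet>\<^sub>o v) x * kernel x h) \<le> K * (min 1 ((norm h)\<^sup>2) * kernel x h)" for i
    unfolding real_norm_def by (intro AE_I2 abs_diff2_kernel_le C11_conv_bump K s)
  show "(\<lambda>h. (diff2 h \<bullet>\<^sub>o v) x * kernel x h) \<in> borel_measurable lborel" by measurable
  show "(\<lambda>h. (diff2 h \<bullet>\<^sub>o conv (bump (s i)) \<bullet>\<^sub>o v) x * kernel x h) \<in> borel_measurable lborel" for i by measurable
qed simp

lemma f_has_vector_derivative:
  assumes t: "0 < t"
  shows "(f J k g has_vector_derivative f' J k g t) (at t)"
proof -
  let ?C = "(LB J)\<^sup>2 * norm g"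
  have "((\<lambda>s. norm (f J k g s - f J k g t - (s - t) *\<^sub>R f' J k g t) / norm (s - t)) \<longlongrightarrow> 0) (at t)"
  proof (rule Lim_null_comparison)
    show "((\<lambda>s. ?C * \<bar>s - t\<bar>) \<longlongrightarrow> 0) (at t)" by (auto intro!: tendsto_eq_intros)
    have "\<forall>\<^sub>F s in at t. 0 < s" using order_tendstoD(1)[OF tendsto_ident_at t] .
    then show "\<forall>\<^sub>F s in at t. norm (norm (f J k g s - f J k g t - (s - t) *\<^sub>R f' J k g t) / norm (s - t)) \<le> ?C * \<bar>s - t\<bar>"
    proof eventually_elim
      case (elim s)
      have e: "(s - t)\<^sup>2 = \<bar>s - t\<bar> * \<bar>s - t\<bar>" by (simp add: power2_eq_square)
      have "norm (f J k g s - f J k g t - (s - t) *\<^sub>R f' J k g t) \<le> ?C * \<bar>s - t\<bar> * \<bar>s - t\<bar>"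
        using norm_f_taylor[of t s J k g] t elim unfolding e by (simp add: mult.assoc)
      then show ?case by (cases "s = t") (simp_all add: divide_le_eq)
    qed
  qed
  then show ?thesis
    unfolding has_vector_derivative_def has_derivative_iff_norm by (simp add: bounded_linear_scaleR_left)
qed

end

text \<open>Two measures that agree on the range of \<open>lam - A\<close> over admissible test
  functions. Restricting to bounded measurable images keeps the equation within what the martingale
  problem delivers, and mollified functions satisfy it.\<close>

locale resolvent_pair = stable_like n \<alpha> \<kappa>1 \<kappa>2 a0 a1 \<psi> \<beta> + M1: finite_measure \<mu>1 + M2: finite_measure \<mu>2
  for n :: "'a::euclidean_space \<Rightarrow> 'a \<Rightarrow> real" and \<alpha> \<kappa>1 \<kappa>2 a0 a1 \<psi> \<beta> and \<mu>1 \<mu>2 :: "'a measure" +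
  fixes lam :: real
  assumes sets_\<mu>1: "sets \<mu>1 = sets borel" and sets_\<mu>2: "sets \<mu>2 = sets borel" and lam: "0 < lam"
    and resolvent: "Cb 2 F \<Longrightarrow> stable_like_operator n \<alpha> F \<in> borel_measurable borel \<Longrightarrow>
      bounded (range (stable_like_operator n \<alpha> F)) \<Longrightarrow>
      (\<integral>x. lam * F x - stable_like_operator n \<alpha> F x \<partial>\<mu>1) = (\<integral>x. lam * F x - stable_like_operator n \<alpha> F x \<partial>\<mu>2)"
begin

definition L :: "('a \<Rightarrow>\<^sub>C real) \<Rightarrow> real" where "L v = (\<integral>x. v x \<partial>\<mu>1) - (\<integral>x. v x \<partial>\<mu>2)"

definition mass :: real where "mass = measure \<mu>1 (space \<mu>1) + measure \<mu>2 (space \<mu>2)"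

lemma mass_nonneg: "0 \<le> mass" by (simp add: mass_def)

lemma measurable_\<mu>: "g \<in> borel_measurable borel \<Longrightarrow> g \<in> borel_measurable \<mu>1"
  "g \<in> borel_measurable borel \<Longrightarrow> g \<in> borel_measurable \<mu>2"
  by (simp_all add: measurable_cong_sets[OF sets_\<mu>1 refl] measurable_cong_sets[OF sets_\<mu>2 refl])

lemma abs_integral_diff_le:
  assumes g: "g \<in> borel_measurable borel" and C: "\<And>x. \<bar>g x\<bar> \<le> C"
  shows "\<bar>(\<integral>x. g x \<partial>\<mu>1) - (\<integral>x. g x \<partial>\<mu>2)\<bar> \<le> mass * C"
  using M1.abs_integral_le_const[OF measurable_\<mu>(1)[OF g] C] M2.abs_integral_le_const[OF measurable_\<mu>(2)[OF g] C]
  by (simp add: mass_def distrib_right)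

lemma bounded_linear_L: "bounded_linear L"
proof (rule bounded_linear_intro[where K=mass])
  note i = integrable_bcontfun[OF M1.finite_measure_axioms sets_\<mu>1] integrable_bcontfun[OF M2.finite_measure_axioms sets_\<mu>2]
  show "L (v + w) = L v + L w" for v w using i by (simp add: L_def plus_bcontfun.rep_eq)
  show "L (r *\<^sub>R v) = r *\<^sub>R L v" for r v by (simp add: L_def scaleR_bcontfun.rep_eq right_diff_distrib)
  show "norm (L v) \<le> norm v * mass" for v
    using abs_integral_diff_le[of "apply_bcontfun v" "norm v"] by (simp add: L_def abs_bcontfun_le mult.commute)
qed

interpretation L: bounded_linear L by (rule bounded_linear_L)

text \<open>The optimal constant rather than \<open>mass\<close>: only for it does the bound by one
  half yield \<open>NL <= NL / 2\<close> and so \<open>NL = 0\<close>.\<close>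

definition NL :: real where "NL = onorm L"

lemma NL_nonneg: "0 \<le> NL" unfolding NL_def by (rule onorm_pos_le[OF bounded_linear_L])

lemma abs_L_le: "\<bar>L v\<bar> \<le> NL * norm v"
  using onorm[OF bounded_linear_L, of v] by (simp add: NL_def)

lemma L_conv_bump_tendsto: "(\<lambda>i. L (conv (bump (1 / real (Suc i))) \<bullet>\<^sub>o v)) \<longlonglongrightarrow> L v"
proof -
  have s: "(\<lambda>i. 1 / real (Suc i)) \<longlonglongrightarrow> 0" using LIMSEQ_inverse_real_of_nat by (simp add: inverse_eq_divide)
  have *: "(\<lambda>i. \<integral>x. (conv (bump (1 / real (Suc i))) \<bullet>\<^sub>o v) x \<partial>M) \<longlonglongrightarrow> (\<integral>x. v x \<partial>M)"
    if "finite_measure M" and M: "sets M = sets borel" for M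
  proof (rule integral_dominated_convergence[where w="\<lambda>_. norm v"])
    interpret finite_measure M by fact
    show "AE x in M. (\<lambda>i. (conv (bump (1 / real (Suc i))) \<bullet>\<^sub>o v) x) \<longlonglongrightarrow> v x"
      by (intro AE_I2 conv_bump_tendsto s) simp
    show "AE x in M. norm ((conv (bump (1 / real (Suc i))) \<bullet>\<^sub>o v) x) \<le> norm v" for i
      by (intro AE_I2 order_trans[OF norm_bounded] norm_conv_bump_apply) simp
    show "integrable M (\<lambda>_. norm v)" by simp
  qed (simp_all add: measurable_cong_sets[OF M refl])
  show ?thesis unfolding L_def by (intro tendsto_diff * sets_\<mu>1 sets_\<mu>2) unfold_locales
qed

text \<open>The averages are known to have controlled second differences, so the equation is needed
  for this class. Mollification preserves \<open>K\<close>, which makes the images under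
  \<open>A2\<close> converge boundedly.\<close>

lemma resolvent_C11:
  assumes K: "C11 K v"
  shows "lam * L v = (\<integral>x. A2 v x \<partial>\<mu>1) - (\<integral>x. A2 v x \<partial>\<mu>2)"
proof -
  define w where "w i = conv (bump (1 / real (Suc i))) \<bullet>\<^sub>o v" for i
  have s: "(\<lambda>i. 1 / real (Suc i)) \<longlonglongrightarrow> 0" using LIMSEQ_inverse_real_of_nat by (simp add: inverse_eq_divide)
  have Kw: "C11 K (w i)" for i unfolding w_def by (rule C11_conv_bump[OF K]) simp
  have A: "stable_like_operator n \<alpha> (apply_bcontfun (w i)) = A2 (w i)" for i
    unfolding w_def by (rule ext, rule stable_like_operator_conv_bump) simp
  have int: "integrable \<mu>1 (A2 u)" "integrable \<mu>2 (A2 u)" if "C11 K u" for u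
    using abs_A2_le[OF that] measurable_\<mu>[OF measurable_A2]
    by (auto intro!: M1.integrable_const_bound[where B="K * (\<kappa>2 * Ck)"] M2.integrable_const_bound[where B="K * (\<kappa>2 * Ck)"])
  have eq: "lam * L (w i) = (\<integral>x. A2 (w i) x \<partial>\<mu>1) - (\<integral>x. A2 (w i) x \<partial>\<mu>2)" for i
  proof -
    have "bounded (range (A2 (w i)))"
      unfolding bounded_iff using abs_A2_le[OF Kw] by auto
    then have "(\<integral>x. lam * w i x - A2 (w i) x \<partial>\<mu>1) = (\<integral>x. lam * w i x - A2 (w i) x \<partial>\<mu>2)"
      using resolvent[of "apply_bcontfun (w i)"] by (simp add: A measurable_A2) (simp add: w_def Cb_2_conv_bump)
    then show ?thesis
      using int[OF Kw] integrable_bcontfun[OF M1.finite_measure_axioms sets_\<mu>1] integrable_bcontfun[OF M2.finite_measure_axioms sets_\<mu>2]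
      by (simp add: L_def right_diff_distrib)
  qed
  have lim: "(\<lambda>i. \<integral>x. A2 (w i) x \<partial>M) \<longlonglongrightarrow> (\<integral>x. A2 v x \<partial>M)"
    if "finite_measure M" and M: "sets M = sets borel" for M
  proof (rule integral_dominated_convergence[where w="\<lambda>_. K * (\<kappa>2 * Ck)"])
    interpret finite_measure M by fact
    show "AE x in M. (\<lambda>i. A2 (w i) x) \<longlonglongrightarrow> A2 v x"
      unfolding w_def by (intro AE_I2 A2_conv_bump_tendsto[OF K] s) simp
    show "AE x in M. norm (A2 (w i) x) \<le> K * (\<kappa>2 * Ck)" for i
      using abs_A2_le[OF Kw] by simp
    show "integrable M (\<lambda>_. K * (\<kappa>2 * Ck))" by simp
  qed (simp_all add: measurable_cong_sets[OF M refl] measurable_A2)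
  have "(\<lambda>i. lam * L (w i)) \<longlonglongrightarrow> lam * L v"
    unfolding w_def by (intro tendsto_mult_left L_conv_bump_tendsto)
  moreover have "(\<lambda>i. lam * L (w i)) \<longlonglongrightarrow> (\<integral>x. A2 v x \<partial>\<mu>1) - (\<integral>x. A2 v x \<partial>\<mu>2)"
    unfolding eq by (intro tendsto_diff lim sets_\<mu>1 sets_\<mu>2) unfold_locales
  ultimately show ?thesis by (rule LIMSEQ_unique)
qed

definition err :: "nat \<Rightarrow> real" where "err J = mass * (\<kappa>2 * Ck * ((1/2) ^ J) powr (2 - a1))"

lemma err_nonneg: "0 \<le> err J"
  using mass_nonneg \<kappa>2 Ck_nonneg by (simp add: err_def)

lemma err_tendsto_0: "err \<longlonglongrightarrow> 0"
proof -
  have "(\<lambda>J. ((1/2) ^ J :: real) powr (2 - a1)) \<longlonglongrightarrow> 0 powr (2 - a1)"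
    using a1 by (intro tendsto_powr' tendsto_const LIMSEQ_realpow_zero) auto
  then show ?thesis unfolding err_def[abs_def] using a1 by (auto intro!: tendsto_eq_intros)
qed

lemma resolvent_Bdiag:
  assumes K: "C11 K v"
  shows "\<bar>L (Bdiag J v) - lam * L v\<bar> \<le> K * err J"
proof -
  have int: "integrable \<mu>1 (A2 v)" "integrable \<mu>2 (A2 v)"
    using abs_A2_le[OF K] measurable_\<mu>[OF measurable_A2]
    by (auto intro!: M1.integrable_const_bound[where B="K * (\<kappa>2 * Ck)"] M2.integrable_const_bound[where B="K * (\<kappa>2 * Ck)"])
  have "lam * L v - L (Bdiag J v) = (\<integral>x. A2 v x - Bdiag J v x \<partial>\<mu>1) - (\<integral>x. A2 v x - Bdiag J v x \<partial>\<mu>2)"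
    unfolding resolvent_C11[OF K] using int integrable_bcontfun[OF M1.finite_measure_axioms sets_\<mu>1] integrable_bcontfun[OF M2.finite_measure_axioms sets_\<mu>2]
    by (simp add: L_def)
  also have "\<bar>\<dots>\<bar> \<le> mass * (K * (\<kappa>2 * Ck * ((1/2) ^ J) powr (2 - a1)))"
  proof (rule abs_integral_diff_le)
    show "(\<lambda>x. A2 v x - Bdiag J v x) \<in> borel_measurable borel" using measurable_A2[of v] by simp
    show "\<bar>A2 v x - Bdiag J v x\<bar> \<le> K * (\<kappa>2 * Ck * ((1/2) ^ J) powr (2 - a1))" for x
      unfolding Bdiag_apply by (rule abs_A2_B_le[OF K])
  qed
  finally show ?thesis by (simp add: err_def abs_minus_commute mult_ac)
qed

text \<open>Sampled at the largest time of block \<open>k\<close>; larger \<open>k\<close> means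
  earlier times.\<close>

definition a :: "nat \<Rightarrow> ('a \<Rightarrow>\<^sub>C real) \<Rightarrow> nat \<Rightarrow> real"
  where "a J g k = exp (- lam * (1/4) ^ k) * L (f J k g ((1/4) ^ k))"

lemma abs_a_diff_le:
  assumes C: "\<And>t. (1/4) ^ (k + 1) \<le> t \<Longrightarrow> t \<le> (1/4) ^ k \<Longrightarrow> C11 K (f J k g t)"
  shows "\<bar>a J g k - a J g (Suc k)\<bar> \<le> 2 * NL * norm g * Om k + K * err J"
proof -
  define G where "G t = exp (- lam * t) * L (f J k g t)" for t
  define t0 t1 :: real where "t0 = (1/4) ^ (k + 1)" and "t1 = (1/4) ^ k"
  have t: "0 < t0" "t0 < t1" "t1 - t0 \<le> (1/4) ^ k" "t1 \<le> 1" by (simp_all add: t0_def t1_def power_le_one)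
  have K0: "0 \<le> K" using C11_nonneg[OF C[of "(1/4) ^ k"]] by simp
  have "\<exists>z. t0 < z \<and> z < t1 \<and> G t1 - G t0 = (t1 - t0) * (exp (- lam * z) * (L (f' J k g z) - lam * L (f J k g z)))"
  proof (rule MVT2[OF t(2)])
    fix s assume s: "t0 \<le> s" "s \<le> t1"
    have "((\<lambda>t. L (f J k g t)) has_real_derivative L (f' J k g s)) (at s)"
      using L.has_vector_derivative[OF f_has_vector_derivative[of s J k g]] s t
      by (simp add: has_real_derivative_iff_has_vector_derivative)
    then show "(G has_real_derivative exp (- lam * s) * (L (f' J k g s) - lam * L (f J k g s))) (at s)"
      unfolding G_def[abs_def] by (auto intro!: derivative_eq_intros simp: algebra_simps)
  qed
  then obtain z where z: "t0 < z" "z < t1"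
    and Gz: "G t1 - G t0 = (t1 - t0) * (exp (- lam * z) * (L (f' J k g z) - lam * L (f J k g z)))" by blast
  have z0: "0 < z" using z t by simp
  have e: "exp (- lam * z) \<le> 1" using z0 lam by simp
  \<comment> \<open>The derivative of \<open>G\<close> is small for two reasons: \<open>f'\<close>
    is \<open>Bdiag\<close> of \<open>f\<close> up to the error of the block, and \<open>L\<close>
    sends that to \<open>lam * L f\<close> up to the truncation error.\<close>
  have "\<bar>L (f' J k g z) - lam * L (f J k g z)\<bar> \<le> \<bar>L (f' J k g z - Bdiag J (f J k g z))\<bar> + \<bar>L (Bdiag J (f J k g z)) - lam * L (f J k g z)\<bar>"
    unfolding L.diff by linarith
  also have "\<dots> \<le> NL * (4 ^ k * Om k * norm g) + K * err J"
  proof (rule add_mono)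
    show "\<bar>L (f' J k g z - Bdiag J (f J k g z))\<bar> \<le> NL * (4 ^ k * Om k * norm g)"
      using z z0 NL_nonneg unfolding t0_def t1_def
      by (intro order_trans[OF abs_L_le] mult_left_mono norm_f'_Bdiag_le) auto
    show "\<bar>L (Bdiag J (f J k g z)) - lam * L (f J k g z)\<bar> \<le> K * err J"
      using z unfolding t0_def t1_def by (intro resolvent_Bdiag C) auto
  qed
  finally have R: "\<bar>L (f' J k g z) - lam * L (f J k g z)\<bar> \<le> NL * (4 ^ k * Om k * norm g) + K * err J" .
  have "\<bar>G t1 - G t0\<bar> = (t1 - t0) * (exp (- lam * z) * \<bar>L (f' J k g z) - lam * L (f J k g z)\<bar>)"
    unfolding Gz using t by (simp add: abs_mult)
  also have "\<dots> \<le> (1/4) ^ k * (1 * (NL * (4 ^ k * Om k * norm g) + K * err J))"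
    using t e R by (intro mult_mono) auto
  also have "\<dots> = NL * norm g * Om k * ((1/4) ^ k * 4 ^ k) + (1/4) ^ k * (K * err J)"
    by (simp add: algebra_simps)
  also have "(1/4) ^ k * 4 ^ k = (1 :: real)" by (simp flip: power_mult_distrib)
  also have "NL * norm g * Om k * 1 + (1/4) ^ k * (K * err J) \<le> NL * norm g * Om k + K * err J"
    using K0 err_nonneg[of J] t(4) mult_right_mono[OF t(4), of "K * err J"] by (simp add: t1_def)
  finally have 1: "\<bar>G t1 - G t0\<bar> \<le> NL * norm g * Om k + K * err J" .
  \<comment> \<open>At the common time \<open>t0\<close> of the two blocks the radius changes; this
    accounts for the second \<open>Om k\<close>.\<close>
  have "\<bar>exp (- lam * t0) * L (f J k g t0 - f J (Suc k) g t0)\<bar> \<le> 1 * (NL * (Om k * norm g))"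
    unfolding abs_mult
  proof (rule mult_mono)
    show "\<bar>exp (- lam * t0)\<bar> \<le> 1" using t lam by simp
    have "norm (f J k g t0 - f J (Suc k) g t0) \<le> Om k * norm g"
      unfolding t0_def by (rule order_trans[OF norm_f_switch mult_right_mono[OF CE_\<Omega>_le_Om]]) simp
    then show "\<bar>L (f J k g t0 - f J (Suc k) g t0)\<bar> \<le> NL * (Om k * norm g)"
      using NL_nonneg by (intro order_trans[OF abs_L_le] mult_left_mono)
  qed auto
  moreover have "a J g k - a J g (Suc k) = (G t1 - G t0) + exp (- lam * t0) * L (f J k g t0 - f J (Suc k) g t0)"
    by (simp add: a_def G_def t0_def t1_def L.diff right_diff_distrib)
  ultimately show ?thesis using 1 by (simp add: mult_ac)
qed

text \<open>Start of the chain: at block \<open>k0\<close> the exponential factor leaves 1/4. The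
  blocks from there to \<open>N\<close> add twice 1/8, and at block \<open>N\<close> the average is
  close to \<open>g\<close>. First \<open>J\<close> tends to infinity, with \<open>N\<close> fixed
  because \<open>K\<close> depends on \<open>N\<close>; then \<open>N\<close> does.\<close>

lemma abs_L_le_half_C11:
  assumes g: "C11 Kg g" and k0: "exp (- lam * (1/4) ^ k0) \<le> 1 / 4"
    and Om: "\<And>N. (\<Sum>k=k0..<N. Om k) \<le> 1 / 8"
  shows "\<bar>L g\<bar> \<le> NL / 2 * norm g"
proof -
  have step: "\<bar>L g\<bar> \<le> exp (lam * (1/4) ^ N) * (NL / 2 * norm g) + NL * ((1/4) ^ N * (Kg * (\<kappa>2 * Ck)))"
    if N: "k0 \<le> N" for N
  proof -
    define tN :: real where "tN = (1/4) ^ N"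
    have tN: "0 < tN" "tN \<le> 1" by (simp_all add: tN_def power_le_one)
    obtain K where K: "0 \<le> K"
      "\<And>J k t g. (1/2) ^ N \<le> ((1/2) ^ k :: real) \<Longrightarrow> tN \<le> t \<Longrightarrow> t \<le> 1 \<Longrightarrow> C11 (K * norm g) (f J k g t)"
      using C11_f[OF tN, of "(1/2) ^ N"] by auto
    define e where "e J = real N * (K * norm g * err J)" for J
    have "\<bar>L g\<bar> \<le> exp (lam * tN) * (NL / 2 * norm g + e J) + NL * (2 * Kg * (1/4) ^ J + tN * (Kg * (\<kappa>2 * Ck)))" for J
    proof -
      have tel: "a J g k0 - a J g N = (\<Sum>k=k0..<N. a J g k - a J g (Suc k))"
        using arg_cong[OF sum_Suc_diff'[OF N, of "a J g"], of uminus] unfolding sum_negf[symmetric] minus_diff_eq by (rule sym)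
      have "\<bar>a J g k0 - a J g N\<bar> \<le> (\<Sum>k=k0..<N. 2 * NL * norm g * Om k + K * norm g * err J)"
        unfolding tel
      proof (rule order_trans[OF sum_abs sum_mono])
        fix k assume k: "k \<in> {k0..<N}"
        have p: "(1/2) ^ N \<le> ((1/2) ^ k :: real)" "tN \<le> (1/4) ^ (k + 1)"
          unfolding tN_def by (rule power_decreasing; use k in simp)+
        have "(1/4) ^ k \<le> (1 :: real)" by (simp add: power_le_one)
        then show "\<bar>a J g k - a J g (Suc k)\<bar> \<le> 2 * NL * norm g * Om k + K * norm g * err J"
          using p by (intro abs_a_diff_le K) auto
      qed
      also have "\<dots> = 2 * NL * norm g * (\<Sum>k=k0..<N. Om k) + real (N - k0) * (K * norm g * err J)"
        by (rule sum_affine[of "2 * NL * norm g" Om "K * norm g * err J" k0 N])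
      also have "\<dots> \<le> 2 * NL * norm g * (1 / 8) + e J"
        unfolding e_def
      proof (rule add_mono)
        show "2 * NL * norm g * (\<Sum>k=k0..<N. Om k) \<le> 2 * NL * norm g * (1 / 8)"
          by (rule mult_left_mono[OF Om]) (use NL_nonneg in simp)
        show "real (N - k0) * (K * norm g * err J) \<le> real N * (K * norm g * err J)"
          by (rule mult_right_mono) (use K(1) err_nonneg[of J] in simp_all)
      qed
      finally have 1: "\<bar>a J g k0 - a J g N\<bar> \<le> 2 * NL * norm g * (1 / 8) + e J" .
      have "\<bar>a J g k0\<bar> = exp (- lam * (1/4) ^ k0) * \<bar>L (f J k0 g ((1/4) ^ k0))\<bar>" by (simp add: a_def abs_mult)
      also have "\<dots> \<le> 1 / 4 * (NL * norm g)"
        using k0 NL_nonneg by (intro mult_mono order_trans[OF abs_L_le] mult_left_mono norm_f) auto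
      finally have "\<bar>a J g N\<bar> \<le> NL / 2 * norm g + e J"
        using 1 abs_triangle_ineq4[of "a J g k0" "a J g k0 - a J g N"] by (simp add: mult_ac)
      moreover have "\<bar>a J g N\<bar> = exp (- lam * tN) * \<bar>L (f J N g tN)\<bar>" by (simp add: a_def tN_def abs_mult)
      ultimately have "exp (- lam * tN) * \<bar>L (f J N g tN)\<bar> \<le> NL / 2 * norm g + e J" by simp
      then have "exp (lam * tN) * (exp (- lam * tN) * \<bar>L (f J N g tN)\<bar>) \<le> exp (lam * tN) * (NL / 2 * norm g + e J)"
        by (rule mult_left_mono) simp
      also have "exp (lam * tN) * (exp (- lam * tN) * \<bar>L (f J N g tN)\<bar>) = \<bar>L (f J N g tN)\<bar>"
        by (simp add: exp_minus)
      finally have 2: "\<bar>L (f J N g tN)\<bar> \<le> exp (lam * tN) * (NL / 2 * norm g + e J)" .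
      have "\<bar>L (f J N g tN - g)\<bar> \<le> NL * (2 * Kg * (1/4) ^ J + tN * (Kg * (\<kappa>2 * Ck)))"
        using tN NL_nonneg by (intro order_trans[OF abs_L_le] mult_left_mono norm_f_init[OF g]) auto
      then show ?thesis using 2 unfolding L.diff by linarith
    qed
    moreover have "(\<lambda>J. exp (lam * tN) * (NL / 2 * norm g + e J) + NL * (2 * Kg * (1/4) ^ J + tN * (Kg * (\<kappa>2 * Ck))))
        \<longlonglongrightarrow> exp (lam * tN) * (NL / 2 * norm g + real N * (K * norm g * 0)) + NL * (2 * Kg * 0 + tN * (Kg * (\<kappa>2 * Ck)))"
      unfolding e_def by (intro tendsto_add tendsto_mult tendsto_const err_tendsto_0 LIMSEQ_realpow_zero) simp_all
    ultimately have "\<bar>L g\<bar> \<le> exp (lam * tN) * (NL / 2 * norm g + real N * (K * norm g * 0)) + NL * (2 * Kg * 0 + tN * (Kg * (\<kappa>2 * Ck)))"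
      using LIMSEQ_le_const by blast
    then show ?thesis by (simp add: tN_def)
  qed
  have "(\<lambda>N. exp (lam * (1/4) ^ N) * (NL / 2 * norm g) + NL * ((1/4) ^ N * (Kg * (\<kappa>2 * Ck)))) \<longlonglongrightarrow>
      exp (lam * 0) * (NL / 2 * norm g) + NL * (0 * (Kg * (\<kappa>2 * Ck)))"
    by (intro tendsto_add tendsto_mult tendsto_const tendsto_exp LIMSEQ_realpow_zero) simp_all
  then have "\<bar>L g\<bar> \<le> exp (lam * 0) * (NL / 2 * norm g) + NL * (0 * (Kg * (\<kappa>2 * Ck)))"
    using step by (intro LIMSEQ_le_const) blast+
  then show ?thesis by simp
qed

text \<open>Mollification does not increase the norm, and \<open>L\<close> converges along it, so
  the bound extends to all bounded continuous functions.\<close>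

lemma L_eq_0:
  assumes k0: "exp (- lam * (1/4) ^ k0) \<le> 1 / 4" "\<And>N. (\<Sum>k=k0..<N. Om k) \<le> 1 / 8"
  shows "L v = 0"
proof -
  have "\<bar>L v\<bar> \<le> NL / 2 * norm v" for v
  proof (rule LIMSEQ_le_const2)
    show "(\<lambda>i. \<bar>L (conv (bump (1 / real (Suc i))) \<bullet>\<^sub>o v)\<bar>) \<longlonglongrightarrow> \<bar>L v\<bar>"
      by (intro tendsto_rabs L_conv_bump_tendsto)
    have "\<bar>L (conv (bump (1 / real (Suc i))) \<bullet>\<^sub>o v)\<bar> \<le> NL / 2 * norm v" for i
    proof -
      obtain K where "C11 K (conv (bump (1 / real (Suc i))) \<bullet>\<^sub>o v)"
        using C11_conv_bump_any[of "1 / real (Suc i)" v] by auto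
      from abs_L_le_half_C11[OF this k0] show ?thesis
        using mult_left_mono[OF norm_conv_bump_apply[of "1 / real (Suc i)" v], of "NL / 2"] NL_nonneg by simp
    qed
    then show "\<exists>N. \<forall>i\<ge>N. \<bar>L (conv (bump (1 / real (Suc i))) \<bullet>\<^sub>o v)\<bar> \<le> NL / 2 * norm v" by blast
  qed
  then have "NL \<le> NL / 2"
    unfolding NL_def using NL_nonneg by (intro onorm_bound) (auto simp: NL_def)
  then have "NL = 0" using NL_nonneg by simp
  then show ?thesis using abs_L_le[of v] by simp
qed

end

lemma (in stable_like) resolvent_unique:
  "\<exists>lam0>0. \<forall>lam\<ge>lam0. \<forall>\<mu>1 \<mu>2. resolvent_pair n \<alpha> \<kappa>1 \<kappa>2 a0 a1 \<psi> \<beta> \<mu>1 \<mu>2 lam \<longrightarrow>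
    (\<forall>v :: 'a \<Rightarrow>\<^sub>C real. (\<integral>x. v x \<partial>\<mu>1) = (\<integral>x. v x \<partial>\<mu>2))"
proof -
  obtain k0 where k0: "\<And>i j. k0 \<le> i \<Longrightarrow> norm (\<Sum>k=i..<j. Om k) < 1 / 8"
    using summable_Om unfolding summable_Cauchy by (metis zero_less_divide_1_iff zero_less_numeral)
  show ?thesis
  \<comment> \<open>\<open>k0\<close> depends only on the tail of the series of \<open>Om\<close>,
    so this threshold is common to all pairs of measures. It is the value at which
    \<open>exp (- lam * (1/4) ^ k0)\<close> drops to 1/4.\<close>
  proof (intro exI[of _ "4 ^ k0 * ln 4 :: real"] conjI allI impI)
    show "0 < (4 ^ k0 * ln 4 :: real)" by simp
    fix lam and \<mu>1 \<mu>2 :: "'a measure" and v :: "'a \<Rightarrow>\<^sub>C real"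
    assume ge: "4 ^ k0 * ln 4 \<le> lam" and "resolvent_pair n \<alpha> \<kappa>1 \<kappa>2 a0 a1 \<psi> \<beta> \<mu>1 \<mu>2 lam"
    then interpret resolvent_pair n \<alpha> \<kappa>1 \<kappa>2 a0 a1 \<psi> \<beta> \<mu>1 \<mu>2 lam by simp
    have "ln (4 :: real) = 4 ^ k0 * ln 4 * (1/4) ^ k0" by (simp add: power_one_over)
    also have "\<dots> \<le> lam * (1/4) ^ k0" using ge by (intro mult_right_mono) auto
    finally have "exp (- lam * (1/4) ^ k0) \<le> exp (- ln 4)" by simp
    also have "\<dots> = 1 / (4 :: real)" by (simp add: exp_minus inverse_eq_divide)
    finally have k1: "exp (- lam * (1/4) ^ k0) \<le> 1 / 4" .
    have "(\<Sum>k=k0..<N. Om k) \<le> 1 / 8" for N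
      using k0[OF order_refl, of N] by (simp add: abs_less_iff)
    then have "L v = 0" by (rule L_eq_0[OF k1])
    then show "(\<integral>x. v x \<partial>\<mu>1) = (\<integral>x. v x \<partial>\<mu>2)" by (simp add: L_def)
  qed
qed

section \<open>Path space\<close>

lemma space_coord_algebra [simp]: "space (coord_algebra T) = cadlag_paths"
  unfolding coord_algebra_def by (rule space_measure_of) auto

lemma sets_coord_algebra: "sets (coord_algebra T) = sigma_sets cadlag_paths
    (\<Union>r\<in>T. {(\<lambda>\<omega>. \<omega> r) -` B \<inter> cadlag_paths |B. B \<in> sets borel})"
  unfolding coord_algebra_def by (rule sets_measure_of) auto

lemma measurable_coord: "r \<in> T \<Longrightarrow> (\<lambda>\<omega>. \<omega> r) \<in> borel_measurable (coord_algebra T)"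
  by (rule measurableI) (auto simp: sets_coord_algebra intro!: sigma_sets.Basic)

lemma dyadic_right:
  fixes r :: real
  defines "q \<equiv> \<lambda>k. (of_int \<lfloor>2 ^ k * r\<rfloor> + 1) / 2 ^ k"
  shows "r < q k" and "q \<longlonglongrightarrow> r"
proof -
  have 1: "r < q k" and 2: "q k \<le> r + (1/2) ^ k" for k
  proof -
    have "2 ^ k * r < of_int \<lfloor>2 ^ k * r\<rfloor> + 1" "of_int \<lfloor>2 ^ k * r\<rfloor> \<le> 2 ^ k * r" by linarith+
    then show "r < q k" "q k \<le> r + (1/2) ^ k" by (simp_all add: q_def field_simps power_one_over)
  qed
  show "r < q k" by (rule 1)
  have "(\<lambda>k. r + (1/2) ^ k) \<longlonglongrightarrow> r + 0" by (intro tendsto_add tendsto_const LIMSEQ_realpow_zero) simp_all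
  then show "q \<longlonglongrightarrow> r"
    by (intro tendsto_sandwich[of "\<lambda>_. r" q sequentially "\<lambda>k. r + (1/2) ^ k"] always_eventually allI less_imp_le[OF 1] 2) simp_all
qed

lemma cadlag_paths_right: "\<omega> \<in> cadlag_paths \<Longrightarrow> 0 \<le> t \<Longrightarrow> (\<omega> \<longlongrightarrow> \<omega> t) (at_right t)"
  by (simp add: cadlag_paths_def)

text \<open>A right-continuous path is the limit of its values at dyadic times to the right, and for
  each mesh size only countably many times occur. The points have to lie strictly to the right
  because paths may jump. \<open>max 0\<close> makes the evaluation total.\<close>

lemma measurable_path:
  "(\<lambda>p. fst p (max 0 (snd p))) \<in> borel_measurable ((path_algebra :: (real \<Rightarrow> 'a::euclidean_space) measure) \<Otimes>\<^sub>M borel)"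
proof -
  define q where "q k r = (of_int \<lfloor>2 ^ k * max 0 r\<rfloor> + 1) / (2 ^ k :: real)" for k :: nat and r :: real
  have q: "max 0 r < q k r" "(\<lambda>k. q k r) \<longlonglongrightarrow> max 0 r" for k r
    using dyadic_right[of "max 0 r"] unfolding q_def by auto
  show ?thesis
  proof (rule borel_measurable_LIMSEQ_metric)
    fix k :: nat
    have "(\<lambda>p. fst p (max 0 ((of_int \<lfloor>2 ^ k * max 0 (snd p) :: real\<rfloor> + 1) / 2 ^ k)))
        \<in> borel_measurable ((path_algebra :: (real \<Rightarrow> 'a) measure) \<Otimes>\<^sub>M borel)"
    proof (rule measurable_compose_countable[where f="\<lambda>i p. fst p (max 0 ((of_int i + 1) / 2 ^ k))"
          and g="\<lambda>p. \<lfloor>2 ^ k * max 0 (snd p) :: real\<rfloor>"])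
      show "(\<lambda>p. fst p (max 0 ((of_int i + 1) / 2 ^ k))) \<in> borel_measurable ((path_algebra :: (real \<Rightarrow> 'a) measure) \<Otimes>\<^sub>M borel)"
        for i :: int
        unfolding path_algebra_def by (rule measurable_compose[OF measurable_fst measurable_coord]) simp
    qed measurable
    moreover have "max 0 (q k r) = q k r" for r using q(1)[of r k] by simp
    ultimately show "(\<lambda>p. fst p (q k (snd p))) \<in> borel_measurable ((path_algebra :: (real \<Rightarrow> 'a) measure) \<Otimes>\<^sub>M borel)"
      unfolding q_def by simp
  next
    fix p :: "(real \<Rightarrow> 'a) \<times> real" assume "p \<in> space ((path_algebra :: (real \<Rightarrow> 'a) measure) \<Otimes>\<^sub>M borel)"
    then have p: "fst p \<in> cadlag_paths" by (auto simp: space_pair_measure path_algebra_def)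
    have "filterlim (\<lambda>k. q k (snd p)) (at_right (max 0 (snd p))) sequentially"
      using q unfolding filterlim_at by (auto intro!: always_eventually less_imp_neq[symmetric])
    then show "(\<lambda>k. fst p (q k (snd p))) \<longlonglongrightarrow> fst p (max 0 (snd p))"
      by (rule filterlim_compose[OF cadlag_paths_right[OF p max.cobounded1]])
  qed
qed

locale path_measure = prob_space P for P :: "(real \<Rightarrow> 'a::euclidean_space) measure" +
  assumes sets_P: "sets P = sets path_algebra"
begin

lemma space_P: "space P = cadlag_paths"
  using sets_eq_imp_space_eq[OF sets_P] by (simp add: path_algebra_def)

lemma measurable_joint:
  assumes [measurable]: "f \<in> borel_measurable N" "g \<in> measurable N P"
  shows "(\<lambda>p. g p (max 0 (f p))) \<in> borel_measurable N"
proof -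
  have [measurable]: "g \<in> measurable N path_algebra"
    using assms(2) by (simp add: measurable_cong_sets[OF refl sets_P])
  have "(\<lambda>p. (g p, f p)) \<in> measurable N (path_algebra \<Otimes>\<^sub>M borel)" by measurable
  from measurable_compose[OF this measurable_path] show ?thesis by simp
qed

lemma measurable_eval: "0 \<le> t \<Longrightarrow> (\<lambda>\<omega>. \<omega> t) \<in> borel_measurable P"
  using measurable_joint[of "\<lambda>_. t" P "\<lambda>\<omega>. \<omega>"] by (simp add: max_def)

lemma integrable_bounded:
  fixes f :: "_ \<Rightarrow> real"
  assumes "f \<in> borel_measurable P" "\<And>\<omega>. \<omega> \<in> space P \<Longrightarrow> \<bar>f \<omega>\<bar> \<le> C"
  shows "integrable P f"
  by (rule integrable_const_bound[of _ C]) (use assms in auto)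

lemma abs_expectation_le:
  fixes f :: "_ \<Rightarrow> real"
  assumes f: "f \<in> borel_measurable P" and C: "\<And>\<omega>. \<omega> \<in> space P \<Longrightarrow> \<bar>f \<omega>\<bar> \<le> C"
  shows "\<bar>expectation f\<bar> \<le> C"
proof -
  have "\<bar>expectation f\<bar> \<le> expectation (\<lambda>\<omega>. \<bar>f \<omega>\<bar>)" by (rule integral_abs_bound)
  also have "\<dots> \<le> expectation (\<lambda>_. C)" using integrable_bounded[OF f C] C by (intro integral_mono) auto
  finally show ?thesis by (simp add: prob_space)
qed

end

text \<open>Conditioning on the past is replaced by a bounded nonnegative weight; in the application
  \<open>Z\<close> is a product of functions of the path at times up to \<open>s\<close>.\<close>

locale weighted_path_measure = path_measure P for P :: "(real \<Rightarrow> 'a::euclidean_space) measure" +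
  fixes Z :: "(real \<Rightarrow> 'a) \<Rightarrow> real" and CZ s :: real
  assumes measurable_Z [measurable]: "Z \<in> borel_measurable P"
    and Z_nonneg: "0 \<le> Z \<omega>" and Z_le: "Z \<omega> \<le> CZ" and s_nonneg: "0 \<le> s"
begin

definition wexp :: "('a \<Rightarrow> real) \<Rightarrow> real \<Rightarrow> real"
  where "wexp h u = expectation (\<lambda>\<omega>. Z \<omega> * h (\<omega> (s + max 0 u)))"

lemma max_s: "max 0 (s + max 0 u) = s + max 0 u" using s_nonneg by simp

lemma measurable_shifted:
  assumes [measurable]: "f \<in> borel_measurable N" "g \<in> measurable N P"
  shows "(\<lambda>p. g p (s + max 0 (f p))) \<in> borel_measurable N"
  using measurable_joint[of "\<lambda>p. s + max 0 (f p)" N g] by (simp add: max_s)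

context
  fixes h :: "'a \<Rightarrow> real" and C :: real
  assumes h [measurable]: "h \<in> borel_measurable borel" and C: "\<And>y. \<bar>h y\<bar> \<le> C"
begin

lemma abs_Zh_le: "\<bar>Z \<omega> * h y\<bar> \<le> CZ * C"
  using mult_mono[OF Z_le[of \<omega>] C[of y]] Z_nonneg[of \<omega>] Z_le[of \<omega>] by (simp add: abs_mult)

lemma measurable_Zh:
  assumes [measurable]: "f \<in> borel_measurable N" "g \<in> measurable N P"
  shows "(\<lambda>p. Z (g p) * h (g p (s + max 0 (f p)))) \<in> borel_measurable N"
  using measurable_compose[OF measurable_shifted[OF assms] h] by measurable

lemma measurable_Zh1: "(\<lambda>\<omega>. Z \<omega> * h (\<omega> (s + max 0 u))) \<in> borel_measurable P"
  by (rule measurable_Zh) simp_all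

lemma integrable_Zh: "integrable P (\<lambda>\<omega>. Z \<omega> * h (\<omega> (s + max 0 u)))"
  by (rule integrable_bounded[OF measurable_Zh1 abs_Zh_le])

lemma abs_wexp_le: "\<bar>wexp h u\<bar> \<le> CZ * C"
  unfolding wexp_def by (rule abs_expectation_le[OF measurable_Zh1 abs_Zh_le])

lemma measurable_wexp [measurable]: "wexp h \<in> borel_measurable borel"
  unfolding wexp_def[abs_def]
  by (rule borel_measurable_lebesgue_integral)
    (use measurable_Zh[of fst "borel \<Otimes>\<^sub>M P" snd] in \<open>simp add: split_beta\<close>)

lemma wexp_right_continuous:
  assumes h: "continuous_on UNIV h" and u: "0 \<le> u"
  shows "(wexp h \<longlongrightarrow> wexp h u) (at_right u)"
proof (rule tendsto_at_right_sequentially[of u "u + 1"])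
  fix S :: "nat \<Rightarrow> real" assume S: "\<And>k. u < S k" "decseq S" "S \<longlonglongrightarrow> u"
  show "(\<lambda>k. wexp h (S k)) \<longlonglongrightarrow> wexp h u"
    unfolding wexp_def
  proof (rule integral_dominated_convergence[where w="\<lambda>_. CZ * C"])
    show "AE \<omega> in P. (\<lambda>k. Z \<omega> * h (\<omega> (s + max 0 (S k)))) \<longlonglongrightarrow> Z \<omega> * h (\<omega> (s + max 0 u))"
    proof (rule AE_I2)
      fix \<omega> assume "\<omega> \<in> space P"
      then have \<omega>: "\<omega> \<in> cadlag_paths" by (simp add: space_P)
      have "(\<lambda>k. s + max 0 (S k)) \<longlonglongrightarrow> s + max 0 u" by (intro tendsto_intros S)
      moreover have "s + max 0 u < s + max 0 (S k)" for k using S(1)[of k] u by auto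
      ultimately have "filterlim (\<lambda>k. s + max 0 (S k)) (at_right (s + max 0 u)) sequentially"
        unfolding filterlim_at by (auto intro!: always_eventually less_imp_neq[symmetric])
      then have "(\<lambda>k. \<omega> (s + max 0 (S k))) \<longlonglongrightarrow> \<omega> (s + max 0 u)"
        using s_nonneg by (intro filterlim_compose[OF cadlag_paths_right[OF \<omega>]]) auto
      then have "(\<lambda>k. h (\<omega> (s + max 0 (S k)))) \<longlonglongrightarrow> h (\<omega> (s + max 0 u))"
        by (rule continuous_on_tendsto_compose[OF h]) auto
      then show "(\<lambda>k. Z \<omega> * h (\<omega> (s + max 0 (S k)))) \<longlonglongrightarrow> Z \<omega> * h (\<omega> (s + max 0 u))"
        by (rule tendsto_mult_left)
    qed
  qed (simp_all add: abs_Zh_le measurable_Zh1)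
qed simp

end

end


section \<open>Exponential weights and injectivity of the Laplace transform\<close>

lemma has_bochner_integral_exp_atLeast:
  fixes lam c :: real
  assumes "0 < lam"
  shows "has_bochner_integral lborel (\<lambda>u. indicator {c..} u * (lam * exp (- lam * u))) (exp (- lam * c))"
proof (rule has_bochner_integral_nn_integral)
  have "(\<integral>\<^sup>+u. ennreal (lam * exp (- lam * u)) * indicator {c..} u \<partial>lborel) = ennreal (0 - - exp (- lam * c))"
  proof (rule nn_integral_FTC_atLeast)
    show "((\<lambda>u. - exp (- lam * u)) has_real_derivative lam * exp (- lam * x)) (at x)" for x
      by (auto intro!: derivative_eq_intros)
    have "filterlim (\<lambda>u. - lam * u) at_bot at_top"
      using assms by (intro filterlim_tendsto_neg_mult_at_bot[OF tendsto_const _ filterlim_ident]) simp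
    then show "((\<lambda>u. - exp (- lam * u)) \<longlongrightarrow> 0) at_top"
      using filterlim_compose[OF exp_at_bot] tendsto_minus by fastforce
  qed (use assms in auto)
  then show "(\<integral>\<^sup>+u. ennreal (indicator {c..} u * (lam * exp (- lam * u))) \<partial>lborel) = ennreal (exp (- lam * c))"
    by (simp add: indicator_mult_ennreal mult.commute)
qed (use assms in auto)

lemma integrable_exp_atLeast:
  fixes lam c :: real
  assumes "0 < lam"
  shows "integrable lborel (\<lambda>u. indicator {c..} u * exp (- lam * u))"
  using integrable_mult_left[OF integrable.intros[OF has_bochner_integral_exp_atLeast[OF assms, of c]], of "1 / lam"] assms
  by simp

text \<open>With \<open>x = exp (- u)\<close> the transform at \<open>lam0 + k\<close> becomes the
  \<open>k\<close>th moment of a weight on the unit interval. Vanishing moments mean, by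
  Weierstrass, that the weight annihilates all continuous functions of \<open>x\<close>. A nonzero
  value of \<open>D\<close> would by right continuity keep its sign on an interval, which a test
  function detects.\<close>

lemma laplace_unique:
  fixes D :: "real \<Rightarrow> real"
  assumes D [measurable]: "D \<in> borel_measurable borel" and C: "\<And>u. \<bar>D u\<bar> \<le> C"
    and right: "\<And>u. 0 \<le> u \<Longrightarrow> (D \<longlongrightarrow> D u) (at_right u)"
    and lam0: "0 < lam0" and zero: "\<And>lam. lam0 \<le> lam \<Longrightarrow> (\<integral>u. (indicator {0..} u * exp (- lam * u)) * D u \<partial>lborel) = 0"
    and u: "0 \<le> u"
  shows "D u = 0"
proof -
  define w where "w u = (indicator {0..} u * exp (- lam0 * u)) * D u" for u
  have w: "integrable lborel w"
    unfolding w_def[abs_def] by (rule integrable_weighted[OF integrable_exp_atLeast[OF lam0] D C])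
  have wm [measurable]: "w \<in> borel_measurable borel" unfolding w_def[abs_def] by measurable
  \<comment> \<open>The minimum keeps the argument in the unit interval also for negative
    \<open>u\<close>, where \<open>w\<close> vanishes.\<close>
  have e01: "min 1 (exp (- u)) \<in> {0..1}" for u :: real by simp
  have mono: "integrable lborel (\<lambda>u. w u * (exp (- u)) ^ k) \<and> (\<integral>u. w u * (exp (- u)) ^ k \<partial>lborel) = 0" for k
  proof -
    have eq: "w u * exp (- u) ^ k = (indicator {0..} u * exp (- (lam0 + real k) * u)) * D u" for u
      unfolding w_def exp_of_nat_mult[symmetric] by (simp add: algebra_simps exp_add[symmetric] indicator_def)
    show ?thesis
      unfolding eq using lam0 by (intro conjI integrable_weighted[OF integrable_exp_atLeast D C] zero) auto
  qed
  have cont: "(\<integral>u. w u * q (min 1 (exp (- u))) \<partial>lborel) = 0" if q: "continuous_on {0..1} q" for q :: "real \<Rightarrow> real"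
  proof -
    have qm: "(\<lambda>u. q (min 1 (exp (- u)))) \<in> borel_measurable borel"
      by (intro borel_measurable_continuous_onI continuous_on_compose2[OF q]) (auto intro!: continuous_intros)
    have "bounded (q ` {0..1})" by (rule compact_imp_bounded[OF compact_continuous_image[OF q]]) simp
    then obtain Cq where "\<And>x. x \<in> {0..1} \<Longrightarrow> norm (q x) \<le> Cq" unfolding bounded_iff by blast
    then have Cq: "\<bar>q (min 1 (exp (- u)))\<bar> \<le> Cq" for u using e01[of u] by auto
    have iq: "integrable lborel (\<lambda>u. w u * q (min 1 (exp (- u))))"
      by (rule integrable_weighted[OF w qm Cq])
    have "\<bar>\<integral>u. w u * q (min 1 (exp (- u))) \<partial>lborel\<bar> \<le> (\<integral>u. \<bar>w u\<bar> \<partial>lborel) * e" if e: "0 < e" for e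
    proof -
      obtain p where p: "real_polynomial_function p" "\<And>x. x \<in> {0..1} \<Longrightarrow> \<bar>q x - p x\<bar> < e"
        using Stone_Weierstrass_real_polynomial_function[OF _ q e] by auto
      obtain a n where pa: "p = (\<lambda>x. \<Sum>i\<le>n. a i * x ^ i)" using p(1) real_polynomial_function_iff_sum by auto
      have wp: "w u * p (min 1 (exp (- u))) = (\<Sum>i\<le>n. a i * (w u * exp (- u) ^ i))" for u
        by (cases "0 \<le> u") (simp_all add: pa w_def sum_distrib_left mult_ac)
      have ip: "integrable lborel (\<lambda>u. w u * p (min 1 (exp (- u))))"
        unfolding wp using mono by (intro Bochner_Integration.integrable_sum integrable_mult_right) blast
      have p0: "(\<integral>u. w u * p (min 1 (exp (- u))) \<partial>lborel) = 0"
        unfolding wp using mono by (subst Bochner_Integration.integral_sum) auto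
      have "(\<integral>u. w u * q (min 1 (exp (- u))) \<partial>lborel) = (\<integral>u. w u * q (min 1 (exp (- u))) - w u * p (min 1 (exp (- u))) \<partial>lborel)"
        using iq ip p0 by simp
      moreover have "\<bar>\<dots>\<bar> \<le> (\<integral>u. \<bar>w u * q (min 1 (exp (- u))) - w u * p (min 1 (exp (- u)))\<bar> \<partial>lborel)"
        by (rule integral_abs_bound)
      moreover have "\<dots> \<le> (\<integral>u. \<bar>w u\<bar> * e \<partial>lborel)"
      proof (rule integral_mono)
        show "integrable lborel (\<lambda>u. \<bar>w u * q (min 1 (exp (- u))) - w u * p (min 1 (exp (- u)))\<bar>)"
          using iq ip by (intro integrable_abs Bochner_Integration.integrable_diff)
        show "integrable lborel (\<lambda>u. \<bar>w u\<bar> * e)" using w by simp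
        show "\<bar>w u * q (min 1 (exp (- u))) - w u * p (min 1 (exp (- u)))\<bar> \<le> \<bar>w u\<bar> * e" for u
          unfolding right_diff_distrib[symmetric] abs_mult using p(2)[OF e01, of u] by (intro mult_left_mono) auto
      qed
      moreover have "(\<integral>u. \<bar>w u\<bar> * e \<partial>lborel) = (\<integral>u. \<bar>w u\<bar> \<partial>lborel) * e" by simp
      ultimately show ?thesis by linarith
    qed
    then have "\<bar>\<integral>u. w u * q (min 1 (exp (- u))) \<partial>lborel\<bar> \<le> (\<integral>u. \<bar>w u\<bar> \<partial>lborel) * 0"
      by (intro tendsto_lowerbound[of "\<lambda>e. (\<integral>u. \<bar>w u\<bar> \<partial>lborel) * e" _ "at_right 0"] tendsto_intros)
        (auto simp: eventually_at_right_field intro!: exI[of _ 1])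
    then show ?thesis by simp
  qed
  have sgn: "\<not> 0 < c * D u" for c
  proof
    assume pos: "0 < c * D u"
    have "((\<lambda>v. c * D v) \<longlongrightarrow> c * D u) (at_right u)" by (intro tendsto_intros right u)
    then have "\<forall>\<^sub>F v in at_right u. 0 < c * D v" using order_tendstoD(1) pos by blast
    then obtain b where b: "u < b" "\<And>v. u < v \<Longrightarrow> v < b \<Longrightarrow> 0 < c * D v"
      by (auto simp: eventually_at_right_field)
    \<comment> \<open>The maximum is positive exactly for \<open>x\<close> between
      \<open>exp (- b)\<close> and \<open>exp (- u)\<close>, that is for \<open>v\<close> between
      \<open>u\<close> and \<open>b\<close>; the factor \<open>c\<close> matches the sign of
      \<open>D\<close> there.\<close>
    define q where "q x = c * max 0 ((x - exp (- b)) * (exp (- u) - x))" for x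
    have "continuous_on {0..1} q" unfolding q_def by (intro continuous_intros)
    from cont[OF this] have 0: "(\<integral>v. w v * q (min 1 (exp (- v))) \<partial>lborel) = 0" .
    have out: "q (min 1 (exp (- v))) = 0" if v: "0 \<le> v" "v \<notin> {u<..<b}" for v
    proof -
      have "(exp (- v) - exp (- b)) * (exp (- u) - exp (- v)) \<le> 0"
        using v b by (cases "v \<le> u") (auto simp: mult_le_0_iff)
      then show ?thesis using v by (simp add: q_def)
    qed
    have ins: "0 < w v * q (min 1 (exp (- v)))" if v: "v \<in> {u<..<b}" for v
    proof -
      have "0 < (exp (- v) - exp (- b)) * (exp (- u) - exp (- v))" using v by (intro mult_pos_pos) auto
      moreover have "0 < exp (- lam0 * v) * (c * D v)" using v by (intro mult_pos_pos[OF exp_gt_zero b(2)]) auto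
      ultimately have "0 < (exp (- lam0 * v) * (c * D v)) * ((exp (- v) - exp (- b)) * (exp (- u) - exp (- v)))"
        by (simp only: mult_pos_pos)
      then show ?thesis using v u \<open>0 < (exp (- v) - exp (- b)) * (exp (- u) - exp (- v))\<close>
        by (simp add: q_def w_def max_def mult_ac)
    qed
    have nonneg: "0 \<le> w v * q (min 1 (exp (- v)))" for v
      using out[of v] ins[of v] by (cases "v \<in> {u<..<b}"; cases "0 \<le> v") (auto simp: w_def)
    have qm: "(\<lambda>v. q (min 1 (exp (- v)))) \<in> borel_measurable borel" unfolding q_def by measurable
    have "\<bar>q (min 1 (exp (- v)))\<bar> \<le> \<bar>c\<bar>" for v
    proof -
      have "0 \<le> min 1 (exp (- v))" "min 1 (exp (- v)) \<le> 1" "0 \<le> exp (- b)" "exp (- b) \<le> 1" "0 \<le> exp (- u)" "exp (- u) \<le> 1"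
        using u b by simp_all
      then have "\<bar>min 1 (exp (- v)) - exp (- b)\<bar> \<le> 1" "\<bar>exp (- u) - min 1 (exp (- v))\<bar> \<le> 1"
        by linarith+
      then have "\<bar>(min 1 (exp (- v)) - exp (- b)) * (exp (- u) - min 1 (exp (- v)))\<bar> \<le> 1"
        unfolding abs_mult by (intro mult_le_one) auto
      then have "max 0 ((min 1 (exp (- v)) - exp (- b)) * (exp (- u) - min 1 (exp (- v)))) \<le> 1" by simp
      then show ?thesis unfolding q_def abs_mult by (simp add: mult_left_le)
    qed
    then have iq: "integrable lborel (\<lambda>v. w v * q (min 1 (exp (- v))))" by (rule integrable_weighted[OF w qm])
    have "AE v in lborel. w v * q (min 1 (exp (- v))) = 0"
      using 0 integral_nonneg_eq_0_iff_AE[OF iq] nonneg by simp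
    then have "AE v in lborel. v \<notin> {u<..<b}"
    proof eventually_elim
      case (elim v)
      then show ?case using ins[of v] by (metis less_irrefl)
    qed
    then have "emeasure lborel {u<..<b} = 0" by (subst (asm) AE_iff_measurable[where N="{u<..<b}"]) auto
    then show False using b by simp
  qed
  from sgn[of 1] sgn[of "-1"] show ?thesis by simp
qed

section \<open>From the martingale problem to the resolvent equation\<close>

lemma integrable_pair_weight:
  fixes w :: "real \<Rightarrow> real" and f :: "_ \<Rightarrow> real"
  assumes P: "prob_space P" and w: "integrable lborel w"
    and f: "f \<in> borel_measurable (P \<Otimes>\<^sub>M lborel)" and C: "\<And>p. \<bar>f p\<bar> \<le> C * \<bar>w (snd p)\<bar>"
  shows "integrable (P \<Otimes>\<^sub>M lborel) f"
proof -
  interpret prob_space P by fact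
  interpret PL: pair_sigma_finite P lborel ..
  have [measurable]: "w \<in> borel_measurable borel" using borel_measurable_integrable[OF w] by simp
  show ?thesis
  proof (rule Bochner_Integration.integrable_bound[OF _ f])
    show "integrable (P \<Otimes>\<^sub>M lborel) (\<lambda>p. C * \<bar>w (snd p)\<bar>)"
    proof (rule PL.Fubini_integrable)
      show "AE x in P. integrable lborel (\<lambda>y. C * \<bar>w (snd (x, y))\<bar>)" using w by simp
    qed simp_all
    show "AE p in P \<Otimes>\<^sub>M lborel. norm (f p) \<le> norm (C * \<bar>w (snd p)\<bar>)"
      using C by (intro AE_I2) (auto intro: order_trans[OF C abs_ge_self])
  qed
qed

context weighted_path_measure
begin

lemma integral_pair_eq:
  fixes w :: "real \<Rightarrow> real"
  assumes h: "h \<in> borel_measurable borel" and C: "\<And>y. \<bar>h y\<bar> \<le> C" and w: "integrable lborel w"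
  shows "integrable (P \<Otimes>\<^sub>M lborel) (\<lambda>p. w (snd p) * (Z (fst p) * h (fst p (s + max 0 (snd p)))))" (is "integrable _ ?f")
    and "(\<integral>p. w (snd p) * (Z (fst p) * h (fst p (s + max 0 (snd p)))) \<partial>(P \<Otimes>\<^sub>M lborel)) = (\<integral>u. w u * wexp h u \<partial>lborel)"
    and "(\<integral>\<omega>. Z \<omega> * (\<integral>u. w u * h (\<omega> (s + max 0 u)) \<partial>lborel) \<partial>P) = (\<integral>u. w u * wexp h u \<partial>lborel)"
proof -
  interpret PL: pair_sigma_finite P lborel ..
  have [measurable]: "w \<in> borel_measurable borel" using borel_measurable_integrable[OF w] by simp
  have m: "?f \<in> borel_measurable (P \<Otimes>\<^sub>M lborel)"
    using measurable_Zh[OF h C, of snd "P \<Otimes>\<^sub>M lborel" fst] by measurable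
  show i: "integrable (P \<Otimes>\<^sub>M lborel) ?f"
  proof (rule integrable_pair_weight[OF prob_space_axioms w m])
    show "\<bar>?f p\<bar> \<le> CZ * C * \<bar>w (snd p)\<bar>" for p
      unfolding abs_mult[of "w (snd p)"] mult.commute[of "CZ * C"] by (intro mult_left_mono abs_Zh_le[OF h C]) simp
  qed
  have f_eq: "case_prod (\<lambda>\<omega> u. ?f (\<omega>, u)) = ?f" by (simp add: fun_eq_iff)
  have "(\<integral>p. ?f p \<partial>(P \<Otimes>\<^sub>M lborel)) = (\<integral>u. \<integral>\<omega>. ?f (\<omega>, u) \<partial>P \<partial>lborel)"
    using PL.integral_snd[of "\<lambda>\<omega> u. ?f (\<omega>, u)", unfolded f_eq, OF i] by simp
  also have "\<dots> = (\<integral>u. w u * wexp h u \<partial>lborel)" by (simp add: wexp_def)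
  finally show 2: "(\<integral>p. ?f p \<partial>(P \<Otimes>\<^sub>M lborel)) = (\<integral>u. w u * wexp h u \<partial>lborel)" .
  have "(\<integral>p. ?f p \<partial>(P \<Otimes>\<^sub>M lborel)) = (\<integral>\<omega>. \<integral>u. ?f (\<omega>, u) \<partial>lborel \<partial>P)"
    using PL.integral_fst'[OF i] by simp
  also have "\<dots> = (\<integral>\<omega>. Z \<omega> * (\<integral>u. w u * h (\<omega> (s + max 0 u)) \<partial>lborel) \<partial>P)"
    by (simp add: mult.left_commute)
  finally show "(\<integral>\<omega>. Z \<omega> * (\<integral>u. w u * h (\<omega> (s + max 0 u)) \<partial>lborel) \<partial>P) = (\<integral>u. w u * wexp h u \<partial>lborel)"
    using 2 by simp
qed

text \<open>Up to the factor \<open>lam\<close>, the law, weighted by \<open>Z\<close>, of the path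
  at time \<open>s\<close> plus an independent exponential time.\<close>

definition occ :: "real \<Rightarrow> 'a measure" where
  "occ lam = distr (density (P \<Otimes>\<^sub>M lborel) (\<lambda>p. ennreal (indicator {0..} (snd p) * exp (- lam * snd p) * Z (fst p)))) borel
     (\<lambda>p. fst p (s + max 0 (snd p)))"

lemma
  assumes lam: "0 < lam"
  shows finite_measure_occ: "finite_measure (occ lam)" and sets_occ: "sets (occ lam) = sets borel"
    and integral_occ: "h \<in> borel_measurable borel \<Longrightarrow> (\<And>y. \<bar>h y\<bar> \<le> C) \<Longrightarrow>
      (\<integral>y. h y \<partial>occ lam) = (\<integral>u. (indicator {0..} u * exp (- lam * u)) * wexp h u \<partial>lborel)"
proof -
  define w :: "real \<Rightarrow> real" where "w u = indicator {0..} u * exp (- lam * u)" for u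
  have w: "integrable lborel w" unfolding w_def[abs_def] by (rule integrable_exp_atLeast[OF lam])
  have [measurable]: "w \<in> borel_measurable borel" using borel_measurable_integrable[OF w] by simp
  have w0: "0 \<le> w u" for u by (simp add: w_def)
  have occ_eq: "occ lam = distr (density (P \<Otimes>\<^sub>M lborel) (\<lambda>p. ennreal (w (snd p) * Z (fst p)))) borel (\<lambda>p. fst p (s + max 0 (snd p)))"
    by (simp add: occ_def w_def)
  have wZ [measurable]: "(\<lambda>p. w (snd p) * Z (fst p)) \<in> borel_measurable (P \<Otimes>\<^sub>M lborel)" by measurable
  have g: "(\<lambda>p. fst p (s + max 0 (snd p))) \<in> borel_measurable (P \<Otimes>\<^sub>M lborel)"
    by (rule measurable_shifted) measurable
  show "sets (occ lam) = sets borel" by (simp add: occ_eq)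
  have i: "integrable (P \<Otimes>\<^sub>M lborel) (\<lambda>p. w (snd p) * Z (fst p))"
    using integral_pair_eq(1)[OF _ _ w, of "\<lambda>_. 1" 1] by simp
  have "emeasure (density (P \<Otimes>\<^sub>M lborel) (\<lambda>p. ennreal (w (snd p) * Z (fst p)))) (space (P \<Otimes>\<^sub>M lborel))
      = (\<integral>\<^sup>+p. ennreal (w (snd p) * Z (fst p)) \<partial>(P \<Otimes>\<^sub>M lborel))"
    by (subst emeasure_density[OF _ sets.top]) (auto intro!: nn_integral_cong)
  also have "\<dots> < \<infinity>" using integrableD(2)[OF i] w0 Z_nonneg by (simp add: less_top)
  finally show "finite_measure (occ lam)"
    unfolding occ_eq by (intro finite_measure.finite_measure_distr finite_measureI) (simp_all add: g)
  show "(\<integral>y. h y \<partial>occ lam) = (\<integral>u. (indicator {0..} u * exp (- lam * u)) * wexp h u \<partial>lborel)"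
    if h: "h \<in> borel_measurable borel" and C: "\<And>y. \<bar>h y\<bar> \<le> C"
  proof -
    have hm: "(\<lambda>p. h (fst p (s + max 0 (snd p)))) \<in> borel_measurable (P \<Otimes>\<^sub>M lborel)"
      by (rule measurable_compose[OF g h])
    have "(\<integral>y. h y \<partial>occ lam) = (\<integral>p. (w (snd p) * Z (fst p)) *\<^sub>R h (fst p (s + max 0 (snd p))) \<partial>(P \<Otimes>\<^sub>M lborel))"
      unfolding occ_eq using g h hm w0 Z_nonneg
      by (subst integral_distr) (simp_all add: integral_density)
    also have "\<dots> = (\<integral>u. w u * wexp h u \<partial>lborel)"
      using integral_pair_eq(2)[OF h C w] by (simp add: mult.assoc)
    finally show ?thesis by (simp add: w_def)
  qed
qed

context
  fixes F g :: "'a \<Rightarrow> real" and CF C :: real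
  assumes F: "F \<in> borel_measurable borel" "\<And>y. \<bar>F y\<bar> \<le> CF"
    and g: "g \<in> borel_measurable borel" "\<And>y. \<bar>g y\<bar> \<le> C"
    and mart: "martingale P path_filtration (\<lambda>t \<omega>. F (\<omega> t) - (LINT r:{0..t}|lborel. g (\<omega> r)))"
    and Zs: "Z \<in> borel_measurable (path_filtration s)"
begin

text \<open>Dynkin's formula for weighted expectations: \<open>Z\<close> is known at time
  \<open>s\<close>, so the increment of the martingale after \<open>s\<close> has weighted mean
  0.\<close>

lemma wexp_dynkin:
  assumes u: "0 \<le> u"
  shows "wexp F u = wexp F 0 + (\<integral>v. indicator {0..u} v * wexp g v \<partial>lborel)"
proof -
  define M :: "real \<Rightarrow> (real \<Rightarrow> 'a) \<Rightarrow> real" where "M t \<omega> = F (\<omega> t) - (LINT r:{0..t}|lborel. g (\<omega> r))" for t \<omega>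
  have M: "subalgebra P (path_filtration t)" "integrable P (M t)" if "0 \<le> t" for t
    using mart that unfolding martingale_def M_def by auto
  have cond: "AE \<omega> in P. real_cond_exp P (path_filtration s) (M (s + u)) \<omega> = M s \<omega>"
    using mart s_nonneg u unfolding martingale_def M_def by auto
  have ZM: "integrable P (\<lambda>\<omega>. Z \<omega> * M t \<omega>)" if t: "0 \<le> t" for t
  proof (rule Bochner_Integration.integrable_bound)
    show "integrable P (\<lambda>\<omega>. CZ * M t \<omega>)" using M(2)[OF t] by simp
    show "(\<lambda>\<omega>. Z \<omega> * M t \<omega>) \<in> borel_measurable P" using borel_measurable_integrable[OF M(2)[OF t]] by measurable
    show "AE \<omega> in P. norm (Z \<omega> * M t \<omega>) \<le> norm (CZ * M t \<omega>)"
      by (rule AE_I2) (use Z_le Z_nonneg order_trans[OF Z_nonneg Z_le] in \<open>auto simp: abs_mult intro!: mult_right_mono\<close>)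
  qed
  interpret sub: finite_measure_subalgebra P "path_filtration s"
    by unfold_locales (rule M(1)[OF s_nonneg])
  have su: "0 \<le> s + u" using s_nonneg u by simp
  have mM: "M (s + u) \<in> borel_measurable P" by (rule borel_measurable_integrable[OF M(2)[OF su]])
  have "(\<integral>\<omega>. Z \<omega> * M (s + u) \<omega> \<partial>P) = (\<integral>\<omega>. Z \<omega> * real_cond_exp P (path_filtration s) (M (s + u)) \<omega> \<partial>P)"
    using sub.real_cond_exp_intg(2)[OF ZM[OF su] Zs mM] by simp
  also have "\<dots> = (\<integral>\<omega>. Z \<omega> * M s \<omega> \<partial>P)"
  proof (rule integral_cong_AE)
    show "(\<lambda>\<omega>. Z \<omega> * M s \<omega>) \<in> borel_measurable P" by (rule borel_measurable_integrable[OF ZM[OF s_nonneg]])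
    show "AE \<omega> in P. Z \<omega> * real_cond_exp P (path_filtration s) (M (s + u)) \<omega> = Z \<omega> * M s \<omega>"
      using cond by eventually_elim simp
  qed (intro borel_measurable_times measurable_Z borel_measurable_cond_exp2)
  finally have "0 = (\<integral>\<omega>. Z \<omega> * M (s + u) \<omega> - Z \<omega> * M s \<omega> \<partial>P)"
    using ZM[OF su] ZM[OF s_nonneg] by simp
  also have "\<dots> = (\<integral>\<omega>. Z \<omega> * F (\<omega> (s + max 0 u)) - Z \<omega> * F (\<omega> (s + max 0 0))
      - Z \<omega> * (\<integral>v. indicator {0..u} v * g (\<omega> (s + max 0 v)) \<partial>lborel) \<partial>P)"
  proof (rule Bochner_Integration.integral_cong[OF refl])
    fix \<omega> assume \<omega>: "\<omega> \<in> space P"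
    \<comment> \<open>An extension to the whole line that is measurable there and agrees with the
      integrand at all times that matter.\<close>
    define k where "k r = g (\<omega> (max 0 r))" for r
    have k [measurable]: "k \<in> borel_measurable borel"
      unfolding k_def[abs_def] by (rule measurable_compose[OF measurable_joint[of "\<lambda>r. r" borel "\<lambda>_. \<omega>"] g(1)]) (use \<omega> in auto)
    have ki: "integrable lborel (\<lambda>r. indicator {a..b} r * k r)" for a b :: real
      by (rule integrable_weighted[OF _ k]) (use g(2) in \<open>auto simp: k_def emeasure_lborel_Icc_eq\<close>)
    have I: "(LINT r:{0..t}|lborel. g (\<omega> r)) = (\<integral>r. indicator {0..t} r * k r \<partial>lborel)" for t
      unfolding set_lebesgue_integral_def by (rule Bochner_Integration.integral_cong) (auto simp: k_def indicator_def)
    have "(\<integral>r. indicator {0..s + u} r * k r \<partial>lborel) - (\<integral>r. indicator {0..s} r * k r \<partial>lborel)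
        = (\<integral>r. indicator {0..s + u} r * k r - indicator {0..s} r * k r \<partial>lborel)"
      using ki by simp
    also have "\<dots> = (\<integral>r. indicator {s..s + u} r * k r \<partial>lborel)"
    proof (rule integral_cong_AE)
      \<comment> \<open>The two sides differ only at the common endpoint \<open>s\<close>.\<close>
      show "AE r in lborel. indicator {0..s + u} r * k r - indicator {0..s} r * k r = indicator {s..s + u} r * k r"
        using AE_lborel_singleton[of s] by eventually_elim (use s_nonneg u in \<open>auto simp: indicator_def\<close>)
    qed measurable
    also have "\<dots> = (\<integral>v. indicator {s..s + u} (s + 1 * v) * k (s + 1 * v) \<partial>lborel)"
      by (subst lborel_integral_real_affine[of 1 _ s]) simp_all
    also have "\<dots> = (\<integral>v. indicator {0..u} v * g (\<omega> (s + max 0 v)) \<partial>lborel)"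
      using s_nonneg by (intro Bochner_Integration.integral_cong) (auto simp: k_def indicator_def max_def)
    finally show "Z \<omega> * M (s + u) \<omega> - Z \<omega> * M s \<omega> = Z \<omega> * F (\<omega> (s + max 0 u)) - Z \<omega> * F (\<omega> (s + max 0 0))
      - Z \<omega> * (\<integral>v. indicator {0..u} v * g (\<omega> (s + max 0 v)) \<partial>lborel)"
      using u unfolding M_def I by (simp add: right_diff_distrib[symmetric])
  qed
  also have "\<dots> = wexp F u - wexp F 0 - (\<integral>\<omega>. Z \<omega> * (\<integral>v. indicator {0..u} v * g (\<omega> (s + max 0 v)) \<partial>lborel) \<partial>P)"
  proof -
    have "(\<lambda>\<omega>. \<integral>v. indicator {0..u} v * g (\<omega> (s + max 0 v)) \<partial>lborel) \<in> borel_measurable P"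
    proof (rule lborel.borel_measurable_lebesgue_integral)
      have "(\<lambda>p. g (fst p (s + max 0 (snd p)))) \<in> borel_measurable (P \<Otimes>\<^sub>M lborel)"
        by (rule measurable_compose[OF measurable_shifted g(1)]) measurable
      then show "(\<lambda>(\<omega>, v). indicator {0..u} v * g (\<omega> (s + max 0 v))) \<in> borel_measurable (P \<Otimes>\<^sub>M lborel)"
        unfolding split_beta by measurable
    qed
    moreover have "\<bar>\<integral>v. indicator {0..u} v * g (\<omega> (s + max 0 v)) \<partial>lborel\<bar> \<le> u * C" if \<omega>: "\<omega> \<in> space P" for \<omega>
    proof -
      have gm: "(\<lambda>v. g (\<omega> (s + max 0 v))) \<in> borel_measurable borel"
        by (rule measurable_compose[OF measurable_shifted[of "\<lambda>r. r" borel "\<lambda>_. \<omega>"] g(1)]) (use \<omega> in auto)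
      have i: "integrable lborel (\<lambda>v. indicator {0..u} v * g (\<omega> (s + max 0 v)))"
        by (rule integrable_weighted[OF _ gm g(2)]) (simp add: emeasure_lborel_Icc_eq)
      have "\<bar>\<integral>v. indicator {0..u} v * g (\<omega> (s + max 0 v)) \<partial>lborel\<bar> \<le> (\<integral>v. \<bar>indicator {0..u} v * g (\<omega> (s + max 0 v))\<bar> \<partial>lborel)"
        by (rule integral_abs_bound)
      also have "\<dots> \<le> (\<integral>v. indicator {0..u} v * C \<partial>lborel)"
      proof (rule integral_mono)
        show "integrable lborel (\<lambda>v. \<bar>indicator {0..u} v * g (\<omega> (s + max 0 v))\<bar>)" by (rule integrable_abs[OF i])
        show "integrable lborel (\<lambda>v. indicator {0..u} v * C)" by (simp add: emeasure_lborel_Icc_eq)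
        show "\<bar>indicator {0..u} v * g (\<omega> (s + max 0 v))\<bar> \<le> indicator {0..u} v * C" for v
          using g(2) by (simp add: indicator_def)
      qed
      finally show ?thesis using u by simp
    qed
    ultimately have "integrable P (\<lambda>\<omega>. Z \<omega> * (\<integral>v. indicator {0..u} v * g (\<omega> (s + max 0 v)) \<partial>lborel))"
      using Z_nonneg Z_le g(2)[of 0]
      by (intro integrable_bounded[of _ "CZ * (u * C)"]) (auto simp: abs_mult intro!: mult_mono order_trans[OF Z_nonneg Z_le])
    then show ?thesis
      unfolding wexp_def using integrable_Zh[OF F, of u] integrable_Zh[OF F, of 0]
      by (simp only: Bochner_Integration.integral_diff Bochner_Integration.integrable_diff)
  qed
  finally show ?thesis
    using integral_pair_eq(3)[OF g, of "indicator {0..u}"] by (simp add: emeasure_lborel_Icc_eq)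
qed

text \<open>The right-hand side depends only on the weighted law at time \<open>s\<close> itself,
  for which two solutions already agree by induction. Hence their occupation measures satisfy the
  same resolvent equation.\<close>

lemma resolvent_occ:
  assumes lam: "0 < lam"
  shows "(\<integral>y. lam * F y - g y \<partial>occ lam) = wexp F 0"
proof -
  note [measurable] = measurable_wexp[OF F] measurable_wexp[OF g]
  define w :: "real \<Rightarrow> real" where "w u = indicator {0..} u * exp (- lam * u)" for u
  \<comment> \<open>Fubini in place of integration by parts: integrating over \<open>u\<close>
    leaves the transform of \<open>wexp g\<close>, integrating over \<open>v\<close> leaves the
    integral in Dynkin's formula.\<close>
  define f :: "real \<Rightarrow> real \<Rightarrow> real" where "f v u = (indicator {0..} v * wexp g v) * (indicator {v..} u * (lam * exp (- lam * u)))" for v u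
  have w: "integrable lborel w" unfolding w_def[abs_def] by (rule integrable_exp_atLeast[OF lam])
  note e = has_bochner_integral_exp_atLeast[OF lam]
  have fv: "has_bochner_integral lborel (f v) (w v * wexp g v)" for v
    using has_bochner_integral_mult_right[OF e[of v], of "indicator {0..} v * wexp g v"]
    by (simp add: f_def[abs_def] w_def mult_ac)
  have "case_prod f = (\<lambda>p. if 0 \<le> fst p \<and> fst p \<le> snd p then wexp g (fst p) * (lam * exp (- lam * snd p)) else 0)"
    by (auto simp: fun_eq_iff f_def indicator_def)
  then have fm: "case_prod f \<in> borel_measurable (lborel \<Otimes>\<^sub>M lborel)" by simp
  have wi: "integrable lborel (\<lambda>v. w v * wexp g v)"
    by (rule integrable_weighted[OF w measurable_wexp[OF g] abs_wexp_le[OF g]])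
  have fi: "integrable (lborel \<Otimes>\<^sub>M lborel) (case_prod f)"
  proof (rule lborel_pair.Fubini_integrable[OF fm])
    have "(\<integral>u. norm (case_prod f (v, u)) \<partial>lborel) = \<bar>w v * wexp g v\<bar>" for v
    proof -
      have "norm (f v u) = \<bar>indicator {0..} v * wexp g v\<bar> * (indicator {v..} u * (lam * exp (- lam * u)))" for u
        unfolding f_def using lam by (simp add: abs_mult)
      then show ?thesis
        using has_bochner_integral_integral_eq[OF has_bochner_integral_mult_right[OF e[of v], of "\<bar>indicator {0..} v * wexp g v\<bar>"]]
        by (simp add: w_def abs_mult mult_ac)
    qed
    then show "integrable lborel (\<lambda>v. \<integral>u. norm (case_prod f (v, u)) \<partial>lborel)" using wi by simp
    show "AE v in lborel. integrable lborel (\<lambda>u. case_prod f (v, u))" using integrable.intros[OF fv] by simp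
  qed
  have fu: "(\<integral>v. f v u \<partial>lborel) = lam * w u * wexp F u - lam * w u * wexp F 0" for u
  proof (cases "0 \<le> u")
    case True
    have "(\<integral>v. f v u \<partial>lborel) = (\<integral>v. (lam * exp (- lam * u)) * (indicator {0..u} v * wexp g v) \<partial>lborel)"
      by (rule Bochner_Integration.integral_cong) (auto simp: f_def indicator_def)
    also have "\<dots> = (lam * exp (- lam * u)) * (wexp F u - wexp F 0)"
      using wexp_dynkin[OF True] by simp
    finally show ?thesis using True by (simp add: w_def right_diff_distrib)
  next
    case False
    then have "f v u = 0" for v by (simp add: f_def indicator_def)
    then show ?thesis using False by (simp add: w_def)
  qed
  have wF: "integrable lborel (\<lambda>u. w u * wexp F u)"
    by (rule integrable_weighted[OF w measurable_wexp[OF F] abs_wexp_le[OF F]])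
  have "lam * (\<integral>u. w u \<partial>lborel) = 1"
    using has_bochner_integral_integral_eq[OF e[of 0]] unfolding w_def by (simp add: mult.left_commute)
  moreover have "(\<integral>v. w v * wexp g v \<partial>lborel) = (\<integral>u. lam * w u * wexp F u - lam * w u * wexp F 0 \<partial>lborel)"
    using lborel_pair.Fubini_integral[OF fi] has_bochner_integral_integral_eq[OF fv] by (simp add: fu)
  ultimately have eq: "(\<integral>v. w v * wexp g v \<partial>lborel) = lam * (\<integral>u. w u * wexp F u \<partial>lborel) - wexp F 0"
    using w wF by (simp add: mult.assoc)
  have "(\<integral>y. lam * F y - g y \<partial>occ lam) = (\<integral>u. w u * wexp (\<lambda>y. lam * F y - g y) u \<partial>lborel)"
    unfolding w_def
  proof (rule integral_occ[OF lam])
    show "\<bar>lam * F y - g y\<bar> \<le> lam * CF + C" for y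
    proof -
      have "\<bar>lam * F y\<bar> \<le> lam * CF" using mult_left_mono[OF F(2)[of y], of lam] lam by (simp add: abs_mult)
      then show ?thesis using g(2)[of y] by linarith
    qed
  qed (use F g in measurable)
  also have "\<dots> = (\<integral>u. lam * (w u * wexp F u) - w u * wexp g u \<partial>lborel)"
    using integrable_Zh[OF F] integrable_Zh[OF g]
    by (intro Bochner_Integration.integral_cong) (simp_all add: wexp_def right_diff_distrib mult.left_commute)
  also have "\<dots> = lam * (\<integral>u. w u * wexp F u \<partial>lborel) - (\<integral>u. w u * wexp g u \<partial>lborel)"
    using wF wi by simp
  finally show ?thesis using eq by simp
qed

end

end

section \<open>Finite-dimensional distributions\<close>

lemma Cb_imp_Cb_0: "Cb k f \<Longrightarrow> Cb 0 f"
  by (cases k) auto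

lemma Cb_0_measurable: "Cb 0 f \<Longrightarrow> f \<in> borel_measurable borel"
  by (simp add: borel_measurable_continuous_onI)

lemma Cb_0_bound: "Cb 0 f \<Longrightarrow> \<exists>c. \<forall>y. \<bar>f y\<bar> \<le> c"
  by (auto simp: bounded_iff)

lemma Cb_0I: "continuous_on UNIV f \<Longrightarrow> (\<And>y. \<bar>f y\<bar> \<le> c) \<Longrightarrow> Cb 0 f"
  by (auto simp: bounded_iff)

definition path_prod :: "real set \<Rightarrow> (real \<Rightarrow> 'a \<Rightarrow> real) \<Rightarrow> (real \<Rightarrow> 'a) \<Rightarrow> real"
  where "path_prod I h \<omega> = (\<Prod>i\<in>I. h i (\<omega> i))"

lemma measurable_path_prod:
  assumes "I \<subseteq> T" "\<And>i. h i \<in> borel_measurable borel"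
  shows "path_prod I h \<in> borel_measurable (coord_algebra T)"
  unfolding path_prod_def[abs_def]
  using assms by (intro borel_measurable_prod measurable_compose[OF measurable_coord]) auto

lemma (in path_measure) measurable_path_prod:
  "I \<subseteq> {0..} \<Longrightarrow> (\<And>i. h i \<in> borel_measurable borel) \<Longrightarrow> path_prod I h \<in> borel_measurable P"
  using measurable_path_prod[of I "{0..}" h] by (simp add: measurable_cong_sets[OF sets_P refl] path_algebra_def)

text \<open>Nonnegativity makes products of these functions weights, so that \<open>occ\<close> is a
  genuine measure; factors of either sign are reached by adding a constant.\<close>

definition test_family :: "(real \<Rightarrow> 'a::euclidean_space \<Rightarrow> real) \<Rightarrow> bool"
  where "test_family h \<longleftrightarrow> (\<forall>i. Cb 0 (h i)) \<and> (\<forall>i y. 0 \<le> h i y)"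

text \<open>The interface between analysis and probability: all that is used of the operator is
  that, for every large \<open>lam\<close>, the range of \<open>lam - A\<close> separates finite
  measures.\<close>

locale resolvent_determining =
  fixes A :: "('a::euclidean_space \<Rightarrow> real) \<Rightarrow> 'a \<Rightarrow> real" and lam0 :: real
  assumes lam0: "0 < lam0"
    and determining: "\<And>lam \<mu>1 \<mu>2 v. lam0 \<le> lam \<Longrightarrow> finite_measure \<mu>1 \<Longrightarrow> finite_measure \<mu>2 \<Longrightarrow>
      sets \<mu>1 = sets borel \<Longrightarrow> sets \<mu>2 = sets borel \<Longrightarrow>
      (\<And>F. Cb 2 F \<Longrightarrow> A F \<in> borel_measurable borel \<Longrightarrow> bounded (range (A F)) \<Longrightarrow>
        (\<integral>x. lam * F x - A F x \<partial>\<mu>1) = (\<integral>x. lam * F x - A F x \<partial>\<mu>2)) \<Longrightarrow>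
      Cb 0 v \<Longrightarrow> (\<integral>x. v x \<partial>\<mu>1) = (\<integral>x. v x \<partial>\<mu>2)"

locale two_solutions = resolvent_determining A lam0 for A :: "('a::euclidean_space \<Rightarrow> real) \<Rightarrow> 'a \<Rightarrow> real" and lam0 +
  fixes x :: 'a and P Q :: "(real \<Rightarrow> 'a) measure"
  assumes solves_P: "solves_martingale_problem A x P" and solves_Q: "solves_martingale_problem A x Q"
begin

sublocale P: path_measure P
  using solves_P by (intro path_measure.intro path_measure_axioms.intro) (auto simp: solves_martingale_problem_def)

sublocale Q: path_measure Q
  using solves_Q by (intro path_measure.intro path_measure_axioms.intro) (auto simp: solves_martingale_problem_def)

lemma expectation_step:
  assumes I: "finite I" "I \<subseteq> {0..s}" "s \<in> I" and u: "0 \<le> u"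
    and IH: "\<And>h. test_family h \<Longrightarrow> P.expectation (path_prod I h) = Q.expectation (path_prod I h)"
    and h: "test_family h" and v: "Cb 0 v"
  shows "P.expectation (\<lambda>\<omega>. path_prod I h \<omega> * v (\<omega> (s + u))) = Q.expectation (\<lambda>\<omega>. path_prod I h \<omega> * v (\<omega> (s + u)))"
proof -
  have I0: "I \<subseteq> {0..}" and s: "0 \<le> s" using I by auto
  have hm: "h i \<in> borel_measurable borel" for i using h by (intro Cb_0_measurable) (simp add: test_family_def)
  have h0: "0 \<le> h i y" for i y using h by (simp add: test_family_def)
  have "\<forall>i. \<exists>c. \<forall>y. \<bar>h i y\<bar> \<le> c" using h by (intro allI Cb_0_bound) (simp add: test_family_def)
  then obtain c where c: "\<And>i y. \<bar>h i y\<bar> \<le> c i" by metis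
  define Z where "Z = path_prod I h"
  have Z0: "0 \<le> Z \<omega>" for \<omega> unfolding Z_def path_prod_def by (intro prod_nonneg h0)
  have Zc: "Z \<omega> \<le> (\<Prod>i\<in>I. c i)" for \<omega>
    unfolding Z_def path_prod_def using c h0 by (intro prod_mono) (auto intro: order_trans[OF abs_ge_self])
  interpret WP: weighted_path_measure P Z "\<Prod>i\<in>I. c i" s
    by unfold_locales (use Z0 Zc s P.measurable_path_prod[OF I0 hm] in \<open>auto simp: Z_def\<close>)
  interpret WQ: weighted_path_measure Q Z "\<Prod>i\<in>I. c i" s
    by unfold_locales (use Z0 Zc s Q.measurable_path_prod[OF I0 hm] in \<open>auto simp: Z_def\<close>)
  have Zs: "Z \<in> borel_measurable (path_filtration s)"
    unfolding Z_def path_filtration_def by (rule measurable_path_prod[OF I(2) hm])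
  have init: "WP.wexp F 0 = WQ.wexp F 0" if F: "Cb 0 F" for F
  proof -
    obtain CF where CF: "\<And>y. \<bar>F y\<bar> \<le> CF" using Cb_0_bound[OF F] by blast
    \<comment> \<open>Adding \<open>CF\<close> makes the new factor nonnegative. It is merged with
      the factor at time \<open>s\<close>, which is why \<open>s\<close> has to belong to
      \<open>I\<close>; the contribution of the constant is removed by the hypothesis for
      \<open>h\<close> itself.\<close>
    define h' where "h' = h(s := \<lambda>y. h s y * (F y + CF))"
    have F': "0 \<le> F y + CF" for y using CF[of y] by linarith
    have "Cb 0 (\<lambda>y. h s y * (F y + CF))"
    proof (rule Cb_0I)
      show "continuous_on UNIV (\<lambda>y. h s y * (F y + CF))"
        using h F by (intro continuous_intros) (auto simp: test_family_def)
      show "\<bar>h s y * (F y + CF)\<bar> \<le> c s * (2 * CF)" for y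
        unfolding abs_mult using CF[of y] F'[of y] order_trans[OF abs_ge_zero c[of s y]]
        by (intro mult_mono c) auto
    qed
    then have h': "test_family h'" using h h0 F' by (simp add: test_family_def h'_def)
    have "path_prod I h' \<omega> = Z \<omega> * F (\<omega> (s + max 0 0)) + CF * Z \<omega>" for \<omega>
    proof -
      have "(\<Prod>i\<in>I - {s}. h' i (\<omega> i)) = (\<Prod>i\<in>I - {s}. h i (\<omega> i))" by (rule prod.cong) (auto simp: h'_def)
      then show ?thesis
        unfolding path_prod_def Z_def using I by (simp add: prod.remove[of I s] h'_def algebra_simps)
    qed
    then have E: "path_prod I h' = (\<lambda>\<omega>. Z \<omega> * F (\<omega> (s + max 0 0)) + CF * Z \<omega>)" by (rule ext)
    have "P.expectation (path_prod I h') = WP.wexp F 0 + CF * P.expectation Z"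
      unfolding E WP.wexp_def using WP.integrable_Zh[OF Cb_0_measurable[OF F] CF, of 0] WP.integrable_Zh[of "\<lambda>_. 1" 1]
      by simp
    moreover have "Q.expectation (path_prod I h') = WQ.wexp F 0 + CF * Q.expectation Z"
      unfolding E WQ.wexp_def using WQ.integrable_Zh[OF Cb_0_measurable[OF F] CF, of 0] WQ.integrable_Zh[of "\<lambda>_. 1" 1]
      by simp
    ultimately show ?thesis using IH[OF h'] IH[OF h] by (simp add: Z_def)
  qed
  obtain Cv where Cv: "\<And>y. \<bar>v y\<bar> \<le> Cv" using Cb_0_bound[OF v] by blast
  have vm: "v \<in> borel_measurable borel" by (rule Cb_0_measurable[OF v])
  define D where "D u = WP.wexp v u - WQ.wexp v u" for u
  have "D u = 0"
  proof (rule laplace_unique[OF _ _ _ lam0 _ u])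
    note [measurable] = WP.measurable_wexp[OF vm Cv] WQ.measurable_wexp[OF vm Cv]
    show "D \<in> borel_measurable borel" unfolding D_def[abs_def] by measurable
    show "\<bar>D u\<bar> \<le> 2 * ((\<Prod>i\<in>I. c i) * Cv)" for u
      using WP.abs_wexp_le[OF vm Cv, of u] WQ.abs_wexp_le[OF vm Cv, of u] unfolding D_def by linarith
    show "(D \<longlongrightarrow> D u) (at_right u)" if "0 \<le> u" for u
      unfolding D_def[abs_def] using v that
      by (intro tendsto_diff WP.wexp_right_continuous[OF vm Cv] WQ.wexp_right_continuous[OF vm Cv]) auto
    fix lam assume "lam0 \<le> lam"
    then have lam: "0 < lam" using lam0 by simp
    have "(\<integral>y. v y \<partial>WP.occ lam) = (\<integral>y. v y \<partial>WQ.occ lam)"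
    proof (rule determining[OF \<open>lam0 \<le> lam\<close> WP.finite_measure_occ[OF lam] WQ.finite_measure_occ[OF lam]
          WP.sets_occ[OF lam] WQ.sets_occ[OF lam] _ v])
      fix F assume F: "Cb 2 F" and m: "A F \<in> borel_measurable borel" and b: "bounded (range (A F))"
      note F0 = Cb_imp_Cb_0[OF F]
      obtain CF where CF: "\<And>y. \<bar>F y\<bar> \<le> CF" using Cb_0_bound[OF F0] by blast
      obtain CA where CA: "\<And>y. \<bar>A F y\<bar> \<le> CA" using b by (auto simp: bounded_iff)
      have "martingale P path_filtration (\<lambda>t \<omega>. F (\<omega> t) - (LINT r:{0..t}|lborel. A F (\<omega> r)))"
        "martingale Q path_filtration (\<lambda>t \<omega>. F (\<omega> t) - (LINT r:{0..t}|lborel. A F (\<omega> r)))"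
        using solves_P solves_Q F by (auto simp: solves_martingale_problem_def)
      then show "(\<integral>x. lam * F x - A F x \<partial>WP.occ lam) = (\<integral>x. lam * F x - A F x \<partial>WQ.occ lam)"
        using WP.resolvent_occ[OF Cb_0_measurable[OF F0] CF m CA _ Zs lam]
          WQ.resolvent_occ[OF Cb_0_measurable[OF F0] CF m CA _ Zs lam] init[OF F0] by simp
    qed
    then have eq: "(\<integral>u. (indicator {0..} u * exp (- lam * u)) * WP.wexp v u \<partial>lborel)
        = (\<integral>u. (indicator {0..} u * exp (- lam * u)) * WQ.wexp v u \<partial>lborel)"
      by (simp only: WP.integral_occ[OF lam vm Cv] WQ.integral_occ[OF lam vm Cv])
    have "integrable lborel (\<lambda>u. (indicator {0..} u * exp (- lam * u)) * WP.wexp v u)"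
      "integrable lborel (\<lambda>u. (indicator {0..} u * exp (- lam * u)) * WQ.wexp v u)"
      by (rule integrable_weighted[OF integrable_exp_atLeast[OF lam] WP.measurable_wexp[OF vm Cv] WP.abs_wexp_le[OF vm Cv]],
          rule integrable_weighted[OF integrable_exp_atLeast[OF lam] WQ.measurable_wexp[OF vm Cv] WQ.abs_wexp_le[OF vm Cv]])
    then show "(\<integral>u. (indicator {0..} u * exp (- lam * u)) * D u \<partial>lborel) = 0"
      unfolding D_def right_diff_distrib using eq by simp
  qed
  then show ?thesis unfolding Z_def[symmetric] using u by (simp add: D_def WP.wexp_def WQ.wexp_def)
qed

text \<open>Keeping time 0 in the set guarantees a last earlier time from which to step, and the
  prescribed starting point settles the base case.\<close>

lemma expectation_path_prod_insert_0:
  assumes "finite I" "I \<subseteq> {0<..}" "test_family h"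
  shows "P.expectation (path_prod (insert 0 I) h) = Q.expectation (path_prod (insert 0 I) h)"
  using assms
proof (induction I arbitrary: h rule: finite_linorder_max_induct)
  case empty
  have hm: "h i \<in> borel_measurable borel" for i
    using empty by (intro Cb_0_measurable) (simp add: test_family_def)
  have *: "integral\<^sup>L R (path_prod {0} h) = h 0 x" if R: "path_measure R" and start: "measure R {\<omega> \<in> space R. \<omega> 0 = x} = 1" for R
  proof -
    interpret path_measure R by fact
    have [measurable]: "(\<lambda>\<omega>. \<omega> 0) \<in> borel_measurable R" by (rule measurable_eval) simp
    have "AE \<omega> in R. \<omega> 0 = x" using start by (subst prob_Collect_eq_1[symmetric]) measurable
    then have "integral\<^sup>L R (path_prod {0} h) = (\<integral>\<omega>. h 0 x \<partial>R)"
      using measurable_path_prod[of "{0}" h] hm by (intro integral_cong_AE) (auto simp: path_prod_def)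
    then show ?thesis by (simp add: prob_space)
  qed
  show ?case
    using *[OF P.path_measure_axioms] *[OF Q.path_measure_axioms] solves_P solves_Q
    by (simp add: solves_martingale_problem_def)
next
  case (insert b I)
  define J where "J = insert 0 I"
  have J: "finite J" "J \<noteq> {}" using insert by (auto simp: J_def)
  define s where "s = Max J"
  have s: "s \<in> J" "J \<subseteq> {0..s}" "0 \<le> s"
    using J insert Max_in[OF J] by (auto simp: s_def J_def subset_iff intro!: Max_ge)
  have b: "s < b" "b \<notin> J" using s insert by (auto simp: J_def)
  have "path_prod (insert 0 (insert b I)) h = (\<lambda>\<omega>. path_prod J h \<omega> * h b (\<omega> (s + (b - s))))"
    using b J by (simp add: fun_eq_iff path_prod_def insert_commute[of 0] J_def[symmetric] mult.commute)
  moreover have "P.expectation (\<lambda>\<omega>. path_prod J h \<omega> * h b (\<omega> (s + (b - s)))) = Q.expectation (\<lambda>\<omega>. path_prod J h \<omega> * h b (\<omega> (s + (b - s))))"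
    using insert b unfolding J_def[symmetric]
    by (intro expectation_step[OF J(1) s(2,1)]) (auto simp: test_family_def)
  ultimately show ?case by simp
qed

lemma expectation_path_prod:
  assumes I: "finite I" "I \<subseteq> {0..}" and h: "test_family h"
  shows "P.expectation (path_prod I h) = Q.expectation (path_prod I h)"
proof -
  define h' where "h' = (if 0 \<in> I then h else h(0 := \<lambda>_. 1))"
  have h': "test_family h'"
    using h Cb_0I[of "\<lambda>_. 1" 1] by (auto simp: h'_def test_family_def)
  have "path_prod I h = path_prod (insert 0 (I - {0})) h'"
  proof (cases "0 \<in> I")
    case True
    then show ?thesis by (simp add: h'_def insert_absorb)
  next
    case False
    then have "(\<Prod>i\<in>I. h' i (\<omega> i)) = (\<Prod>i\<in>I. h i (\<omega> i))" for \<omega>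
      by (intro prod.cong) (auto simp: h'_def)
    then show ?thesis using False I by (simp add: path_prod_def fun_eq_iff) (simp add: h'_def)
  qed
  moreover have "I - {0} \<subseteq> {0<..}" using I by force
  ultimately show ?thesis using expectation_path_prod_insert_0[of "I - {0}" h'] I h' by simp
qed

lemma measure_closed_cylinder:
  assumes I: "finite I" "I \<subseteq> {0..}" and C: "\<And>i. closed (C i)"
  shows "measure P {\<omega> \<in> cadlag_paths. \<forall>i\<in>I. \<omega> i \<in> C i} = measure Q {\<omega> \<in> cadlag_paths. \<forall>i\<in>I. \<omega> i \<in> C i}"
proof -
  \<comment> \<open>Continuous functions that decrease to the indicator of a closed set. The
    distance to the empty set is 0 by convention, hence the separate case.\<close>
  define h where "h k i y = (if C i = {} then 0 else max 0 (1 - real k * infdist y (C i)))" for k i y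
  have h01: "0 \<le> h k i y" "h k i y \<le> 1" for k i y by (auto simp: h_def infdist_nonneg)
  have h: "test_family (h k)" for k
  proof -
    have "continuous_on UNIV (h k i)" for i
      unfolding h_def by (cases "C i = {}") (auto intro!: continuous_intros)
    then have "Cb 0 (h k i)" for i
      using h01 by (intro Cb_0I[of _ 1]) auto
    then show ?thesis using h01 by (simp add: test_family_def)
  qed
  have lim: "(\<lambda>k. h k i y) \<longlonglongrightarrow> indicator (C i) y" for i y
  proof (cases "y \<in> C i \<or> C i = {}")
    case True
    then show ?thesis by (cases "C i = {}") (auto simp: h_def indicator_def)
  next
    case False
    then have "infdist y (C i) \<noteq> 0" using C in_closed_iff_infdist_zero by blast
    then have d: "0 < infdist y (C i)" using infdist_nonneg[of y "C i"] by simp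
    obtain N :: nat where N: "1 / infdist y (C i) \<le> real N" using real_arch_simple by blast
    have "h k i y = 0" if k: "N \<le> k" for k
    proof -
      have "1 \<le> real N * infdist y (C i)" using N d by (simp add: field_simps)
      also have "\<dots> \<le> real k * infdist y (C i)" using k d by (intro mult_right_mono) auto
      finally show ?thesis by (simp add: h_def)
    qed
    then show ?thesis using False by (intro tendsto_eventually) (auto simp: eventually_sequentially)
  qed
  have E: "(\<lambda>k. integral\<^sup>L R (path_prod I (h k))) \<longlonglongrightarrow> measure R {\<omega> \<in> cadlag_paths. \<forall>i\<in>I. \<omega> i \<in> C i}"
    if R: "path_measure R" for R
  proof -
    interpret path_measure R by fact
    have m: "path_prod I (\<lambda>i. indicator (C i)) \<in> borel_measurable R"
      using C by (intro measurable_path_prod[OF I(2)] borel_measurable_indicator) auto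
    have eq: "path_prod I (\<lambda>i. indicator (C i)) \<omega> = indicator {\<omega>. \<forall>i\<in>I. \<omega> i \<in> C i} \<omega>" for \<omega>
      using I(1) by (auto simp: path_prod_def indicator_def prod_eq_1_iff)
    have "{\<omega> \<in> space R. path_prod I (\<lambda>i. indicator (C i)) \<omega> = (1::real)} \<in> sets R" using m by measurable
    moreover have "{\<omega> \<in> space R. path_prod I (\<lambda>i. indicator (C i)) \<omega> = (1::real)} = {\<omega> \<in> cadlag_paths. \<forall>i\<in>I. \<omega> i \<in> C i}"
      by (auto simp: eq space_P indicator_def split: if_splits)
    ultimately have S: "{\<omega> \<in> cadlag_paths. \<forall>i\<in>I. \<omega> i \<in> C i} \<in> sets R" by simp
    have "(\<lambda>k. integral\<^sup>L R (path_prod I (h k))) \<longlonglongrightarrow> integral\<^sup>L R (path_prod I (\<lambda>i. indicator (C i)))"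
    proof (rule integral_dominated_convergence[where w="\<lambda>_. 1"])
      show "path_prod I (h k) \<in> borel_measurable R" for k
        using h by (intro measurable_path_prod[OF I(2)] Cb_0_measurable) (simp add: test_family_def)
      show "AE \<omega> in R. (\<lambda>k. path_prod I (h k) \<omega>) \<longlonglongrightarrow> path_prod I (\<lambda>i. indicator (C i)) \<omega>"
        unfolding path_prod_def by (intro AE_I2 tendsto_prod lim)
      show "AE \<omega> in R. norm (path_prod I (h k) \<omega>) \<le> 1" for k
        unfolding path_prod_def real_norm_def abs_prod using h01 by (intro AE_I2 prod_le_1) auto
    qed (use m in auto)
    also have "integral\<^sup>L R (path_prod I (\<lambda>i. indicator (C i))) = integral\<^sup>L R (indicator {\<omega> \<in> cadlag_paths. \<forall>i\<in>I. \<omega> i \<in> C i})"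
      by (rule Bochner_Integration.integral_cong) (auto simp: eq space_P indicator_def)
    also have "\<dots> = measure R {\<omega> \<in> cadlag_paths. \<forall>i\<in>I. \<omega> i \<in> C i}"
      using S by simp
    finally show ?thesis .
  qed
  show ?thesis
    using E[OF P.path_measure_axioms] E[OF Q.path_measure_axioms]
    unfolding expectation_path_prod[OF I h] by (rule LIMSEQ_unique)
qed

text \<open>Closed cylinders are stable under intersection and generate the path algebra, and the
  cylinder over no times is the whole space, so agreement on them suffices.\<close>

theorem solution_unique: "P = Q"
proof -
  define cyl where "cyl I C = {\<omega> \<in> cadlag_paths. \<forall>i\<in>I. \<omega> i \<in> (C i :: 'a set)}" for I and C :: "real \<Rightarrow> 'a set"
  define E where "E = {cyl I C |I C. finite I \<and> I \<subseteq> {0..} \<and> (\<forall>i. closed (C i))}"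
  have E_sub: "E \<subseteq> Pow cadlag_paths" by (auto simp: E_def cyl_def)
  have "cyl I C \<in> sets path_algebra" if "finite I" "I \<subseteq> {0..}" "\<forall>i. closed (C i)" for I C
  proof -
    have "{\<omega> \<in> space path_algebra. \<forall>i\<in>I. \<omega> i \<in> C i} \<in> sets path_algebra"
    proof (rule sets.sets_Collect_finite_All[OF _ that(1)])
      fix i assume "i \<in> I"
      then have "(\<lambda>\<omega>. \<omega> i) \<in> borel_measurable path_algebra"
        unfolding path_algebra_def using that by (intro measurable_coord) auto
      from measurable_sets[OF this, of "C i"] that(3)
      show "{\<omega> \<in> space path_algebra. \<omega> i \<in> C i} \<in> sets path_algebra"
        by (simp add: vimage_def Int_def conj_commute)
    qed
    then show ?thesis by (simp add: cyl_def path_algebra_def)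
  qed
  then have E_sets: "E \<subseteq> sets path_algebra" by (auto simp: E_def)
  have "sets path_algebra \<subseteq> sigma_sets cadlag_paths E"
    unfolding path_algebra_def sets_coord_algebra
  proof (rule sigma_sets_mono, rule subsetI)
    fix X :: "(real \<Rightarrow> 'a) set"
    assume "X \<in> (\<Union>r\<in>{0..}. {(\<lambda>\<omega>. \<omega> r) -` B \<inter> cadlag_paths |B. B \<in> sets borel})"
    then obtain r :: real and B :: "'a set"
      where r: "r \<in> {0..}" and B: "B \<in> sets borel" and X: "X = (\<lambda>\<omega>. \<omega> r) -` B \<inter> cadlag_paths" by blast
    have "(\<lambda>\<omega>. \<omega> r) \<in> measurable (sigma cadlag_paths E) (sigma UNIV (Collect closed))"
    proof (rule measurable_measure_of)
      fix S :: "'a set" assume "S \<in> Collect closed"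
      then have "cyl {r} (\<lambda>_. S) \<in> E" using r by (auto simp: E_def)
      moreover have "(\<lambda>\<omega>. \<omega> r) -` S \<inter> space (sigma cadlag_paths E) = cyl {r} (\<lambda>_. S)"
        using E_sub by (auto simp: cyl_def)
      ultimately show "(\<lambda>\<omega>. \<omega> r) -` S \<inter> space (sigma cadlag_paths E) \<in> sets (sigma cadlag_paths E)"
        using E_sub by (simp add: sets_measure_of sigma_sets.Basic)
    qed auto
    then have "(\<lambda>\<omega>. \<omega> r) \<in> borel_measurable (sigma cadlag_paths E)" by (simp add: borel_eq_closed)
    from measurable_sets[OF this B] show "X \<in> sigma_sets cadlag_paths E"
      unfolding X using E_sub by (simp add: sets_measure_of space_measure_of)
  qed
  moreover have "sigma_sets cadlag_paths E \<subseteq> sets path_algebra"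
    using sets.sigma_sets_subset[OF E_sets] by (simp add: path_algebra_def)
  ultimately have sets_E: "sets path_algebra = sigma_sets cadlag_paths E" by auto
  show ?thesis
  proof (rule measure_eqI_generator_eq)
    show "Int_stable E"
    proof (rule Int_stableI)
      fix a b assume "a \<in> E" "b \<in> E"
      then obtain I J C D where ab: "a = cyl I C" "b = cyl J D" "finite I" "finite J" "I \<subseteq> {0..}" "J \<subseteq> {0..}"
        "\<forall>i. closed (C i)" "\<forall>i. closed (D i)" by (auto simp: E_def)
      \<comment> \<open>Cylinders over different time sets are brought to the union by imposing no
        condition at the missing times.\<close>
      have "a \<inter> b = cyl (I \<union> J) (\<lambda>i. (if i \<in> I then C i else UNIV) \<inter> (if i \<in> J then D i else UNIV))"
        unfolding ab cyl_def by auto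
      moreover have "\<dots> \<in> E"
        unfolding E_def using ab
        by (intro CollectI exI[of _ "I \<union> J"] exI[of _ "\<lambda>i. (if i \<in> I then C i else UNIV) \<inter> (if i \<in> J then D i else UNIV)"]) auto
      ultimately show "a \<inter> b \<in> E" by simp
    qed
    show "emeasure P X = emeasure Q X" if "X \<in> E" for X
      using that measure_closed_cylinder
      by (auto simp: E_def cyl_def P.emeasure_eq_measure Q.emeasure_eq_measure)
    show "range (\<lambda>_ :: nat. cadlag_paths) \<subseteq> E"
    proof -
      have "cadlag_paths = cyl {} (\<lambda>_. UNIV)" by (simp add: cyl_def)
      then have "cadlag_paths \<in> E" unfolding E_def by blast
      then show ?thesis by auto
    qed
  qed (use E_sub sets_E P.sets_P Q.sets_P in auto)
qed

end

section \<open>The Dini conditions\<close>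

text \<open>Comparing with a step function from below avoids any measurability of \<open>\<omega>\<close>.\<close>

lemma dini_summable:
  fixes \<omega> g :: "real \<Rightarrow> real"
  assumes mono: "\<And>r r'. 0 \<le> r \<Longrightarrow> r \<le> r' \<Longrightarrow> \<omega> r \<le> \<omega> r'" and nonneg: "\<And>r. 0 \<le> r \<Longrightarrow> 0 \<le> \<omega> r"
    and c: "\<And>j. 0 \<le> c j" "\<And>j r. (1/2) ^ Suc j < r \<Longrightarrow> r \<le> (1/2) ^ j \<Longrightarrow> c j \<le> g r"
    and fin: "(\<integral>\<^sup>+ r\<in>{0<..1}. ennreal (g r * \<omega> r / r) \<partial>lborel) < \<infinity>"
  shows "summable (\<lambda>j. c j * \<omega> ((1/2) ^ Suc j))"
proof -
  define I :: "nat \<Rightarrow> real set" where "I j = {(1/2) ^ Suc j<..(1/2) ^ j}" for j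
  define a where "a j = c j * \<omega> ((1/2) ^ Suc j)" for j
  have a: "0 \<le> a j" for j unfolding a_def by (intro mult_nonneg_nonneg c nonneg) simp
  have disj: "disjoint_family I"
  proof -
    have "I i \<inter> I j = {}" if "i < j" for i j
    proof -
      have "(1/2) ^ j \<le> ((1/2) ^ Suc i :: real)" using that by (intro power_decreasing) auto
      then show ?thesis by (auto simp: I_def)
    qed
    then show ?thesis unfolding disjoint_family_on_def by (metis Int_commute linorder_neqE_nat)
  qed
  have le: "(\<Sum>j. ennreal (a j * 2 ^ j) * indicator (I j) r) \<le> ennreal (g r * \<omega> r / r) * indicator {0<..1} r" for r
  proof (cases "\<exists>j. r \<in> I j")
    case True
    then obtain j where j: "r \<in> I j" by blast
    then have r: "(1/2) ^ Suc j < r" "r \<le> (1/2) ^ j" by (auto simp: I_def)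
    have r0: "0 < r" using r(1) zero_less_power[of "1/2 :: real" "Suc j"] by linarith
    have r1: "r \<le> 1" using r(2) power_le_one[of "1/2 :: real" j] by linarith
    have "2 ^ j \<le> 1 / r" using r(2) r0 by (simp add: field_simps power_one_over)
    moreover have "a j \<le> g r * \<omega> r"
      unfolding a_def using r r0 order_trans[OF c(1) c(2)[OF r]]
      by (intro mult_mono c mono nonneg) auto
    ultimately have "a j * 2 ^ j \<le> g r * \<omega> r * (1 / r)"
      using a[of j] r0 by (intro mult_mono) (auto intro: order_trans)
    then show ?thesis
      using suminf_cmult_indicator[OF disj j, of "\<lambda>j. ennreal (a j * 2 ^ j)"] r0 r1 by (simp add: ennreal_leI)
  next
    case False
    then have "(\<lambda>j. ennreal (a j * 2 ^ j) * indicator (I j) r) = (\<lambda>j. 0)" by (auto simp: fun_eq_iff indicator_def)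
    then show ?thesis by simp
  qed
  have "(\<Sum>j. ennreal (a j / 2)) = (\<Sum>j. \<integral>\<^sup>+r. ennreal (a j * 2 ^ j) * indicator (I j) r \<partial>lborel)"
  proof (rule suminf_cong)
    fix j
    have "emeasure lborel (I j) = ennreal ((1/2) ^ Suc j)" unfolding I_def by (subst emeasure_lborel_Ioc) auto
    then show "ennreal (a j / 2) = (\<integral>\<^sup>+r. ennreal (a j * 2 ^ j) * indicator (I j) r \<partial>lborel)"
      using a[of j] by (subst nn_integral_cmult_indicator) (auto simp: I_def ennreal_mult[symmetric] power_one_over)
  qed
  also have "\<dots> = (\<integral>\<^sup>+r. (\<Sum>j. ennreal (a j * 2 ^ j) * indicator (I j) r) \<partial>lborel)"
    by (rule nn_integral_suminf[symmetric]) (auto simp: I_def)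
  also have "\<dots> \<le> (\<integral>\<^sup>+ r\<in>{0<..1}. ennreal (g r * \<omega> r / r) \<partial>lborel)"
    by (rule nn_integral_mono) (rule le)
  finally have "(\<Sum>j. ennreal (a j / 2)) \<noteq> top" using fin by (auto simp: top_unique)
  then have "summable (\<lambda>j. a j / 2)" using a by (intro summable_suminf_not_top) auto
  from summable_mult[OF this, of 2] show ?thesis by (simp add: a_def)
qed

lemma dini_log_summable:
  fixes \<omega> :: "real \<Rightarrow> real"
  assumes mono: "\<And>r r'. 0 \<le> r \<Longrightarrow> r \<le> r' \<Longrightarrow> \<omega> r \<le> \<omega> r'" and nonneg: "\<And>r. 0 \<le> r \<Longrightarrow> 0 \<le> \<omega> r"
    and fin: "(\<integral>\<^sup>+ r\<in>{0<..1}. ennreal (\<bar>ln r\<bar> * \<omega> r / r) \<partial>lborel) < \<infinity>"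
  shows "summable (\<lambda>k. (1 + real k) * \<omega> (2 * (1/2) ^ k))"
proof -
  have s: "summable (\<lambda>j. (real j * ln 2) * \<omega> ((1/2) ^ Suc j))"
  proof (rule dini_summable[OF mono nonneg _ _ fin])
    fix j and r :: real assume r: "(1/2) ^ Suc j < r" "r \<le> (1/2) ^ j"
    then have r0: "0 < r" using zero_less_power[of "1/2 :: real" "Suc j"] by linarith
    have "ln r \<le> ln ((1/2) ^ j)" using r r0 by simp
    also have "\<dots> = - (real j * ln 2)" by (simp add: ln_realpow ln_div)
    finally show "real j * ln 2 \<le> \<bar>ln r\<bar>" by linarith
  qed auto
  \<comment> \<open>A shift by two, because \<open>2 * (1/2) ^ (j + 2)\<close> is the left endpoint
    of the \<open>j\<close>th dyadic interval; \<open>1 + (j + 2)\<close> is at most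
    \<open>4 * j\<close> from \<open>j = 1\<close> on.\<close>
  have "summable (\<lambda>j. (1 + real (j + 2)) * \<omega> (2 * (1/2) ^ (j + 2)))"
  proof (rule summable_comparison_test'[OF summable_mult[OF s, of "4 / ln 2"], of 1])
    fix j :: nat assume j: "1 \<le> j"
    have "(1 + real (j + 2)) * \<omega> ((1/2) ^ Suc j) \<le> 4 * real j * \<omega> ((1/2) ^ Suc j)"
      using j by (intro mult_right_mono nonneg) auto
    moreover have "0 \<le> \<omega> ((1/2) ^ Suc j)" by (intro nonneg) simp
    ultimately show "norm ((1 + real (j + 2)) * \<omega> (2 * (1/2) ^ (j + 2))) \<le> 4 / ln 2 * ((real j * ln 2) * \<omega> ((1/2) ^ Suc j))"
      by (simp add: abs_mult)
  qed
  then show ?thesis by (subst (asm) summable_iff_shift)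
qed

lemma dini_summable_1:
  fixes \<omega> :: "real \<Rightarrow> real"
  assumes mono: "\<And>r r'. 0 \<le> r \<Longrightarrow> r \<le> r' \<Longrightarrow> \<omega> r \<le> \<omega> r'" and nonneg: "\<And>r. 0 \<le> r \<Longrightarrow> 0 \<le> \<omega> r"
    and fin: "(\<integral>\<^sup>+ r\<in>{0<..1}. ennreal (\<omega> r / r) \<partial>lborel) < \<infinity>"
  shows "summable (\<lambda>k. \<omega> (2 * (1/2) ^ k))"
proof -
  have "summable (\<lambda>j. 1 * \<omega> ((1/2) ^ Suc j))"
    by (rule dini_summable[where g="\<lambda>_. 1", OF mono nonneg]) (use fin in simp_all)
  then have "summable (\<lambda>j. \<omega> (2 * (1/2) ^ (j + 2)))" by simp
  then show ?thesis by (subst (asm) summable_iff_shift)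
qed

text \<open>The suprema are taken in \<open>real\<close>, so each of these facts rests on an upper
  bound; values between 0 and \<open>K\<close> differ by at most \<open>K\<close>.\<close>

lemma
  fixes n :: "'a::euclidean_space \<Rightarrow> 'a \<Rightarrow> real"
  assumes n: "\<And>x h. 0 \<le> n x h \<and> n x h \<le> K"
  shows le_modulus_kernel: "norm (x - y) \<le> r \<Longrightarrow> \<bar>n x h - n y h\<bar> \<le> modulus_kernel n r"
    and modulus_kernel_mono: "0 \<le> r \<Longrightarrow> r \<le> r' \<Longrightarrow> modulus_kernel n r \<le> modulus_kernel n r'"
    and modulus_kernel_nonneg: "0 \<le> r \<Longrightarrow> 0 \<le> modulus_kernel n r"
proof -
  have bdd: "bdd_above ((\<lambda>(x, y, h). \<bar>n x h - n y h\<bar>) ` S)" for S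
  proof (rule bdd_aboveI[of _ K])
    fix t assume "t \<in> (\<lambda>(x, y, h). \<bar>n x h - n y h\<bar>) ` S"
    then obtain x y h where "t = \<bar>n x h - n y h\<bar>" by auto
    then show "t \<le> K" using n[of x h] n[of y h] by linarith
  qed
  show le: "\<bar>n x h - n y h\<bar> \<le> modulus_kernel n r" if "norm (x - y) \<le> r" for x y h r
    unfolding modulus_kernel_def
    using cSUP_upper[OF _ bdd, of "(x, y, h)" "{(x, y, h). norm (x - y) \<le> r}"] that by simp
  show "0 \<le> modulus_kernel n r" if "0 \<le> r" using le[of 0 0 r 0] that by simp
  show "modulus_kernel n r \<le> modulus_kernel n r'" if "0 \<le> r" "r \<le> r'"
    unfolding modulus_kernel_def
  proof (rule cSUP_subset_mono[OF _ bdd])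
    have "(0, 0, 0) \<in> {(x, y, h :: 'a). norm (x - y :: 'a) \<le> r}" using that by simp
    then show "{(x, y, h :: 'a). norm (x - y :: 'a) \<le> r} \<noteq> {}" by blast
  qed (use that in auto)
qed

lemma
  fixes \<alpha> :: "'a::euclidean_space \<Rightarrow> real"
  assumes \<alpha>: "\<And>x. 0 \<le> \<alpha> x \<and> \<alpha> x \<le> K"
  shows le_modulus_index: "norm (x - y) \<le> r \<Longrightarrow> \<bar>\<alpha> x - \<alpha> y\<bar> \<le> modulus_index \<alpha> r"
    and modulus_index_mono: "0 \<le> r \<Longrightarrow> r \<le> r' \<Longrightarrow> modulus_index \<alpha> r \<le> modulus_index \<alpha> r'"
    and modulus_index_nonneg: "0 \<le> r \<Longrightarrow> 0 \<le> modulus_index \<alpha> r"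
proof -
  \<comment> \<open>The index is treated as a kernel that does not depend on the jump.\<close>
  have eq: "modulus_index \<alpha> r = modulus_kernel (\<lambda>x _. \<alpha> x) r" for r
  proof -
    have "(\<lambda>(x, y, h). \<bar>\<alpha> x - \<alpha> y\<bar>) ` {(x, y, h :: 'a). norm (x - y) \<le> r} = (\<lambda>(x, y). \<bar>\<alpha> x - \<alpha> y\<bar>) ` {(x, y). norm (x - y) \<le> r}"
      by (auto simp: image_iff) force
    then show ?thesis by (simp add: modulus_index_def modulus_kernel_def)
  qed
  show "norm (x - y) \<le> r \<Longrightarrow> \<bar>\<alpha> x - \<alpha> y\<bar> \<le> modulus_index \<alpha> r"
    unfolding eq by (rule le_modulus_kernel[OF \<alpha>])
  show "0 \<le> r \<Longrightarrow> r \<le> r' \<Longrightarrow> modulus_index \<alpha> r \<le> modulus_index \<alpha> r'"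
    unfolding eq by (rule modulus_kernel_mono[OF \<alpha>])
  show "0 \<le> r \<Longrightarrow> 0 \<le> modulus_index \<alpha> r"
    unfolding eq by (rule modulus_kernel_nonneg[OF \<alpha>])
qed

section \<open>Assembly of the uniqueness theorem\<close>

lemma (in stable_like) resolvent_determining:
  obtains lam0 where "resolvent_determining (stable_like_operator n \<alpha>) lam0"
proof -
  obtain lam0 where lam0: "0 < lam0"
    and unique: "\<And>lam \<mu>1 \<mu>2 v. lam0 \<le> lam \<Longrightarrow> resolvent_pair n \<alpha> \<kappa>1 \<kappa>2 a0 a1 \<psi> \<beta> \<mu>1 \<mu>2 lam \<Longrightarrow>
      (\<integral>x. apply_bcontfun (v :: 'a \<Rightarrow>\<^sub>C real) x \<partial>\<mu>1) = (\<integral>x. v x \<partial>\<mu>2)"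
    using resolvent_unique by blast
  have "resolvent_determining (stable_like_operator n \<alpha>) lam0"
  proof
    fix lam \<mu>1 \<mu>2 and v :: "'a \<Rightarrow> real"
    assume lam: "lam0 \<le> lam" and fin: "finite_measure \<mu>1" "finite_measure \<mu>2"
      and sets: "sets \<mu>1 = sets borel" "sets \<mu>2 = sets borel"
      and res: "\<And>F. Cb 2 F \<Longrightarrow> stable_like_operator n \<alpha> F \<in> borel_measurable borel \<Longrightarrow> bounded (range (stable_like_operator n \<alpha> F)) \<Longrightarrow>
        (\<integral>x. lam * F x - stable_like_operator n \<alpha> F x \<partial>\<mu>1) = (\<integral>x. lam * F x - stable_like_operator n \<alpha> F x \<partial>\<mu>2)"
      and v: "Cb 0 v"
    have "resolvent_pair n \<alpha> \<kappa>1 \<kappa>2 a0 a1 \<psi> \<beta> \<mu>1 \<mu>2 lam"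
      using lam lam0 sets res
      by (intro resolvent_pair.intro resolvent_pair_axioms.intro stable_like_axioms fin) auto
    moreover have "apply_bcontfun (Bcontfun v) = v"
      using v by (intro Bcontfun_inverse) (auto simp: bcontfun_def)
    ultimately show "(\<integral>x. v x \<partial>\<mu>1) = (\<integral>x. v x \<partial>\<mu>2)" using unique[OF lam, of \<mu>1 \<mu>2 "Bcontfun v"] by simp
  qed (rule lam0)
  then show thesis by (rule that)
qed

theorem theorem1p3:
  fixes n :: "real ^ 'd \<Rightarrow> real ^ 'd \<Rightarrow> real"
    and \<alpha> :: "real ^ 'd \<Rightarrow> real"
    and \<kappa>1 \<kappa>2 \<alpha>_lower \<alpha>_upper :: real
  assumes n_measurable: "(\<lambda>(x, h). n x h) \<in> borel_measurable (borel \<Otimes>\<^sub>M borel)"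
    and n_pos: "\<forall>x h. 0 < n x h"
    and \<alpha>_range: "\<forall>x. 0 < \<alpha> x \<and> \<alpha> x < 2"
    and n_symmetric: "\<forall>x h. n x h = n x (- h)"
    and n_bounds: "0 < \<kappa>1" "\<forall>x h. \<kappa>1 \<le> n x h \<and> n x h \<le> \<kappa>2"
    and n_dini: "(\<integral>\<^sup>+ r\<in>{0<..1}. ennreal (modulus_kernel n r / r) \<partial>lborel) < \<infinity>"
    and \<alpha>_bounds: "0 < \<alpha>_lower" "\<alpha>_upper < 2" "\<forall>x. \<alpha>_lower \<le> \<alpha> x \<and> \<alpha> x \<le> \<alpha>_upper"
    and \<alpha>_small: "modulus_index \<alpha> \<in> o[at_right 0](\<lambda>r. 1 / \<bar>ln r\<bar>)"
    and \<alpha>_dini: "(\<integral>\<^sup>+ r\<in>{0<..1}. ennreal (\<bar>ln r\<bar> * modulus_index \<alpha> r / r) \<partial>lborel) < \<infinity>"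
  shows "\<forall>x P Q. solves_martingale_problem (stable_like_operator n \<alpha>) x P \<and>
           solves_martingale_problem (stable_like_operator n \<alpha>) x Q \<longrightarrow> P = Q"
proof (intro allI impI, elim conjE)
  fix x :: "real ^ 'd" and P Q
  assume PQ: "solves_martingale_problem (stable_like_operator n \<alpha>) x P" "solves_martingale_problem (stable_like_operator n \<alpha>) x Q"
  have n: "0 \<le> n x h \<and> n x h \<le> \<kappa>2" for x h using n_pos n_bounds by (simp add: less_imp_le)
  have \<alpha>: "0 \<le> \<alpha> x \<and> \<alpha> x \<le> \<alpha>_upper" for x using \<alpha>_range \<alpha>_bounds by (simp add: less_imp_le)
  \<comment> \<open>The moduli at the dyadic distances \<open>2 * (1/2) ^ k\<close> provide the two
    sequences, and the integral conditions become their summability.\<close>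
  have "stable_like n \<alpha> \<kappa>1 \<kappa>2 \<alpha>_lower \<alpha>_upper (\<lambda>k. modulus_kernel n (2 * (1/2) ^ k)) (\<lambda>k. modulus_index \<alpha> (2 * (1/2) ^ k))"
  proof
    show "summable (\<lambda>k. modulus_kernel n (2 * (1/2) ^ k))"
      by (rule dini_summable_1[OF modulus_kernel_mono[OF n] modulus_kernel_nonneg[OF n] n_dini])
    show "summable (\<lambda>k. (1 + real k) * modulus_index \<alpha> (2 * (1/2) ^ k))"
      by (rule dini_log_summable[OF modulus_index_mono[OF \<alpha>] modulus_index_nonneg[OF \<alpha>] \<alpha>_dini])
  qed (use n_measurable n_symmetric n_bounds \<alpha>_bounds le_modulus_kernel[OF n] le_modulus_index[OF \<alpha>] in auto)
  then obtain lam0 where "resolvent_determining (stable_like_operator n \<alpha>) lam0"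
    by (rule stable_like.resolvent_determining)
  then have "two_solutions (stable_like_operator n \<alpha>) lam0 x P Q"
    by (intro two_solutions.intro two_solutions_axioms.intro PQ)
  then show "P = Q" by (rule two_solutions.solution_unique)
qed

end
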